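(* Let $n\ge m\ge1$ be integers and put $$a=\frac{m-1}{2}+\frac{n-m}{4},\qquad b=\frac12+\frac{n-m}{4},\qquad c=\frac12-\frac{n-m}{4}.$$ The Hilbert space $\mathscr{H}_1^L$ is isometrically isomorphic to the Hilbert space $L^2(\Sigma,\mu)$, where $$\Sigma=(0,\infty)\cup\left\{i\left(\tfrac12-\tfrac{n-m}{4}+k\right): k\in\mathbb{N},\ \tfrac12-\tfrac{n-m}{4}+k<0\right\}$$ and $\mu$ is the measure defined by $$\int_\Sigma f\,d\mu=\frac1{2\pi}\int_0^\infty\left|\frac{\Gamma(a+ix)\Gamma(b+ix)\Gamma(c+ix)}{\Gamma(2ix)}\right|^2f(x)\,dx+\frac{\Gamma(a+c)\Gamma(c+b)\Gamma(b-c)\Gamma(a-c)}{\Gamma(-2c)}\sum_{j\in\mathbb{N},\,c+j<0}\frac{(2c)_j(c+1)_j(c+b)_j(c+a)_j}{(c)_j(c-b+1)_j(c-a+1)_j}(-1)^jf(i(c+j))$$ (the discrete part being absent when $c\ge0$). Under the isomorphism, the operator $\mathcal{L}^1$ corresponds to the multiplication operator $f\mapsto-(a^2+x^2)f$.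
   Context: $\mathbb{N}=\{0,1,2,\dots\}$ and $(t)_0=1$, $(t)_j=t(t+1)\cdots(t+j-1)$. $\mathscr{D}=\{z\in M_{nm}(\mathbb{C}): I_n-zz^*>0\}$ and $\mathscr{H}_1$ is the Hilbert space of holomorphic functions on $\mathscr{D}$ with reproducing kernel $\det(I_n-zw^* )^{-1}$. $L=S(O(n)\times O(m))$ acts by $(A,D)\cdot z=AzD^{-1}$, and $\mathscr{H}_1^L$ is the subspace of $f\in\mathscr{H}_1$ with $f(l^{-1}z)=f(z)$ for all $l\in L$. An $L$-invariant function in $\mathscr{H}_1$ is determined by its restriction to the real "diagonal" matrices with $(i,i)$ entries $x_i\in\mathbb R$ ($1\le i\le m$) and all other entries zero; we write $f(x_1,\dots,x_m)$ for this restriction. $\mathscr{H}_1^L$ has the orthogonal basis $\psi_k$ ($k\in\mathbb{N}$) of polynomials with restrictions $\psi_k(x)=\sum_{\beta\in\mathbb{N}^m,|\beta|=k}\binom k\beta^2(2\beta)!\,x^{2\beta}$, where $\binom k\beta=k!/\prod_i\beta_i!$ and $(2\beta)!=\prod_i(2\beta_i)!$. $\mathcal{L}^1$ is the operator (expressing the action of the Casimir element of $\mathfrak{so}(n,m)$ on $\mathscr{H}_1^L$) given in the coordinates $x_i$ by $$4\mathcal{L}^1=\sum_{i=1}^m\Big(-(1-x_i^2)-x_i^2-2x_i(1-x_i^2)\partial_i+(1-x_i^2)^2\partial_i^2\Big)+\sum_{i=1}^m\Big(2x_i^2-2x_i(1-x_i^2)\partial_i\Big)+(n-m)\sum_{i=1}^m\Big(-1-x_i\partial_i+\tfrac1{x_i}\partial_i\Big)+2\sum_{m\ge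 i>j\ge1}\Big(-1+\tfrac{(1-x_i^2)(1-x_j^2)}{x_i^2-x_j^2}(x_i\partial_i-x_j\partial_j)\Big),$$ with $\partial_i=\partial/\partial x_i$. On $L^2(\Sigma,\mu)$, $x$ denotes the coordinate on $\Sigma\subset\mathbb{C}$, so $x^2=-(c+j)^2$ at the point $x=i(c+j)$.
   Formalization: For n=m=1, L acts trivially, so the literal space of L-invariants is the whole Hardy space, the ψ_k are not a basis and the claim about L^1 fails (double spectrum); there the space is replaced by its even functions, the closed span of the ψ_k. All other cases are as stated. *)

theory Defs
  imports "HOL-Analysis.Analysis"
begin

section \<open>Matrices, the domain and the group\<close>

definition conj_transpose :: "complex^'m^'n \<Rightarrow> complex^'n^'m" where
  "conj_transpose A = (\<chi> i j. cnj (A $ j $ i))"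

definition pos_def :: "complex^'n^'n \<Rightarrow> bool" where
  "pos_def A \<longleftrightarrow> conj_transpose A = A \<and>
     (\<forall>v. v \<noteq> 0 \<longrightarrow> 0 < Re (\<Sum>i\<in>UNIV. \<Sum>j\<in>UNIV. cnj (v $ i) * A $ i $ j * v $ j))"

text \<open>A matrix with \<open>n\<close> rows and \<open>m\<close> columns has type \<open>complex^'m^'n\<close>.\<close>

definition domD :: "(complex^'m^'n) set" where
  "domD = {z. pos_def (mat 1 - z ** conj_transpose z)}"

definition cmat :: "real^'m^'n \<Rightarrow> complex^'m^'n" where
  "cmat A = (\<chi> i j. complex_of_real (A $ i $ j))"

definition grpL :: "((real^'n^'n) \<times> (real^'m^'m)) set" where
  "grpL = {(A, B). orthogonal_matrix A \<and> orthogonal_matrix B \<and> det A * det B = 1}"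

definition act :: "(real^'n^'n) \<times> (real^'m^'m) \<Rightarrow> complex^'m^'n \<Rightarrow> complex^'m^'n" where
  "act l z = cmat (fst l) ** z ** cmat (matrix_inv (snd l))"

definition inv_pair :: "(real^'n^'n) \<times> (real^'m^'m) \<Rightarrow> (real^'n^'n) \<times> (real^'m^'m)" where
  "inv_pair l = (matrix_inv (fst l), matrix_inv (snd l))"

text \<open>Complex Frechet differentiability: the real derivative exists and is complex-linear.\<close>

definition holo_on :: "(complex^'m^'n \<Rightarrow> complex) \<Rightarrow> (complex^'m^'n) set \<Rightarrow> bool" where
  "holo_on f S \<longleftrightarrow> (\<forall>z\<in>S. \<exists>f'. (f has_derivative f') (at z) \<and>
     (\<forall>c v. f' (\<chi> i j. c * v $ i $ j) = c * f' v))"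


section \<open>Hilbert spaces of functions\<close>

text \<open>A complex Hilbert space of functions is given by its set \<open>H\<close> of elements and its inner
  product \<open>ip\<close>, linear in the first argument.\<close>

definition fun_hilbert_space ::
  "('z \<Rightarrow> complex) set \<Rightarrow> (('z \<Rightarrow> complex) \<Rightarrow> ('z \<Rightarrow> complex) \<Rightarrow> complex) \<Rightarrow> bool" where
  "fun_hilbert_space H ip \<longleftrightarrow>
     (\<lambda>z. 0) \<in> H \<and>
     (\<forall>f\<in>H. \<forall>g\<in>H. (\<lambda>z. f z + g z) \<in> H) \<and>
     (\<forall>c. \<forall>f\<in>H. (\<lambda>z. c * f z) \<in> H) \<and>
     (\<forall>f\<in>H. \<forall>g\<in>H. \<forall>h\<in>H. ip (\<lambda>z. f z + g z) h = ip f h + ip g h) \<and>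
     (\<forall>c. \<forall>f\<in>H. \<forall>h\<in>H. ip (\<lambda>z. c * f z) h = c * ip f h) \<and>
     (\<forall>f\<in>H. \<forall>g\<in>H. ip g f = cnj (ip f g)) \<and>
     (\<forall>f\<in>H. f \<noteq> (\<lambda>z. 0) \<longrightarrow> 0 < Re (ip f f)) \<and>
     (\<forall>F :: nat \<Rightarrow> 'z \<Rightarrow> complex. (\<forall>k. F k \<in> H) \<longrightarrow>
        (\<forall>e>0. \<exists>N. \<forall>k\<ge>N. \<forall>l\<ge>N.
           Re (ip (\<lambda>z. F k z - F l z) (\<lambda>z. F k z - F l z)) < e) \<longrightarrow>
        (\<exists>f\<in>H. (\<lambda>k. Re (ip (\<lambda>z. F k z - f z) (\<lambda>z. F k z - f z))) \<longlonglongrightarrow> 0))"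

text \<open>Functions on \<open>S\<close> are total functions vanishing off \<open>S\<close>, so that equality of elements
  of \<open>H\<close> is equality on \<open>S\<close>. By the Moore-Aronszajn theorem \<open>H\<close> and the values of \<open>ip\<close> on
  \<open>H\<close> are determined by \<open>S\<close> and \<open>K\<close>.\<close>

definition rkhs :: "'z set \<Rightarrow> ('z \<Rightarrow> 'z \<Rightarrow> complex) \<Rightarrow> ('z \<Rightarrow> complex) set \<Rightarrow>
    (('z \<Rightarrow> complex) \<Rightarrow> ('z \<Rightarrow> complex) \<Rightarrow> complex) \<Rightarrow> bool" where
  "rkhs S K H ip \<longleftrightarrow>
     fun_hilbert_space H ip \<and>
     (\<forall>f\<in>H. \<forall>z. z \<notin> S \<longrightarrow> f z = 0) \<and>
     (\<forall>w\<in>S. (\<lambda>z. if z \<in> S then K z w else 0) \<in> H \<and>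
        (\<forall>f\<in>H. f w = ip f (\<lambda>z. if z \<in> S then K z w else 0)))"

definition ker1 :: "complex^'m^'n \<Rightarrow> complex^'m^'n \<Rightarrow> complex" where
  "ker1 z w = inverse (det (mat 1 - z ** conj_transpose w))"

definition is_H1 :: "(complex^'m^'n \<Rightarrow> complex) set \<Rightarrow>
    ((complex^'m^'n \<Rightarrow> complex) \<Rightarrow> (complex^'m^'n \<Rightarrow> complex) \<Rightarrow> complex) \<Rightarrow> bool" where
  "is_H1 H ip \<longleftrightarrow> rkhs domD ker1 H ip \<and> (\<forall>f\<in>H. holo_on f domD)"

text \<open>For \<open>n \<ge> 2\<close> this is the space of \<open>L\<close>-invariants and the last condition is void. For
  \<open>n = m = 1\<close> the group \<open>L\<close> acts trivially, so the invariants are the whole Hardy space, in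
  which the polynomials \<open>\<psi>\<^sub>k = (2k)! z^(2k)\<close> are not complete. The last condition then
  selects their closed span, the even functions.\<close>

definition L_invariants :: "(complex^'m^'n \<Rightarrow> complex) set \<Rightarrow> (complex^'m^'n \<Rightarrow> complex) set" where
  "L_invariants H = {f \<in> H. (\<forall>l\<in>grpL. \<forall>z\<in>domD. f (act (inv_pair l) z) = f z) \<and>
     (CARD('n) = 1 \<longrightarrow> (\<forall>z\<in>domD. f (- z) = f z))}"


definition L2 :: "'x measure \<Rightarrow> ('x \<Rightarrow> complex) set" where
  "L2 M = {\<phi> \<in> borel_measurable M. integrable M (\<lambda>x. (cmod (\<phi> x))\<^sup>2)}"

text \<open>\<open>U\<close> is a linear isometry of \<open>(H, ip)\<close> onto the Hilbert space of almost-everywhere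
  classes of \<open>L2 M\<close>, acting through representatives.\<close>

definition isometric_iso_L2 :: "('z \<Rightarrow> complex) set \<Rightarrow>
    (('z \<Rightarrow> complex) \<Rightarrow> ('z \<Rightarrow> complex) \<Rightarrow> complex) \<Rightarrow>
    'x measure \<Rightarrow> (('z \<Rightarrow> complex) \<Rightarrow> 'x \<Rightarrow> complex) \<Rightarrow> bool" where
  "isometric_iso_L2 H ip M U \<longleftrightarrow>
     (\<forall>f\<in>H. U f \<in> L2 M) \<and>
     (\<forall>f\<in>H. \<forall>g\<in>H. AE x in M. U (\<lambda>z. f z + g z) x = U f x + U g x) \<and>
     (\<forall>c. \<forall>f\<in>H. AE x in M. U (\<lambda>z. c * f z) x = c * U f x) \<and>
     (\<forall>f\<in>H. \<forall>g\<in>H. (\<integral>x. U f x * cnj (U g x) \<partial>M) = ip f g) \<and>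
     (\<forall>\<phi>\<in>L2 M. \<exists>f\<in>H. AE x in M. U f x = \<phi> x)"


section \<open>The operator\<close>

text \<open>Rows and columns are numbered through the linear orders on the index types, and
  \<open>pos i\<close> is the number, counted from 0, of \<open>i\<close>.\<close>

definition pos :: "'i::{finite,linorder} \<Rightarrow> nat" where
  "pos i = card {j. j < i}"

definition diag_mat :: "real^'m::{finite,linorder} \<Rightarrow> complex^'m::{finite,linorder}^'n::{finite,linorder}" where
  "diag_mat x = (\<chi> r s. if pos r = pos s then complex_of_real (x $ s) else 0)"

definition pd :: "'m::{finite,linorder} \<Rightarrow> (real^'m::{finite,linorder} \<Rightarrow> complex) \<Rightarrow> real^'m::{finite,linorder} \<Rightarrow> complex" where
  "pd i F x = vector_derivative (\<lambda>t. F (\<chi> k. if k = i then t else x $ k)) (at (x $ i))"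

definition four_L1 ::
  "nat \<Rightarrow> nat \<Rightarrow> (real^'m::{finite,linorder} \<Rightarrow> complex) \<Rightarrow> real^'m::{finite,linorder} \<Rightarrow> complex" where
  "four_L1 n m F x =
     (\<Sum>i\<in>UNIV. (- (1 - (x$i)\<^sup>2) - (x$i)\<^sup>2) *\<^sub>R F x
        - (2 * x$i * (1 - (x$i)\<^sup>2)) *\<^sub>R pd i F x
        + ((1 - (x$i)\<^sup>2)\<^sup>2) *\<^sub>R pd i (pd i F) x)
   + (\<Sum>i\<in>UNIV. (2 * (x$i)\<^sup>2) *\<^sub>R F x - (2 * x$i * (1 - (x$i)\<^sup>2)) *\<^sub>R pd i F x)
   + (real n - real m) *\<^sub>R
       (\<Sum>i\<in>UNIV. - F x - (x$i) *\<^sub>R pd i F x + (1 / x$i) *\<^sub>R pd i F x)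
   + 2 *\<^sub>R (\<Sum>(i,j)\<in>{(i,j). j < i}. - F x +
       ((1 - (x$i)\<^sup>2) * (1 - (x$j)\<^sup>2) / ((x$i)\<^sup>2 - (x$j)\<^sup>2)) *\<^sub>R
         ((x$i) *\<^sub>R pd i F x - (x$j) *\<^sub>R pd j F x))"

text \<open>\<open>L1_rel f g\<close> says that \<open>L1 f = g\<close>. The formula is imposed where its denominators do not
  vanish; this is a dense set of diagonal points of the domain and so determines an
  \<open>L\<close>-invariant \<open>g\<close>.\<close>

definition L1_rel :: "(complex^'m::{finite,linorder}^'n::{finite,linorder} \<Rightarrow> complex) \<Rightarrow>
    (complex^'m::{finite,linorder}^'n::{finite,linorder} \<Rightarrow> complex) \<Rightarrow> bool" where
  "L1_rel f g \<longleftrightarrow>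
     (\<forall>x :: real^'m::{finite,linorder}. (diag_mat x :: complex^'m::{finite,linorder}^'n::{finite,linorder}) \<in> domD \<longrightarrow> (\<forall>i. x$i \<noteq> 0) \<longrightarrow>
        (\<forall>i j. i \<noteq> j \<longrightarrow> (x$i)\<^sup>2 \<noteq> (x$j)\<^sup>2) \<longrightarrow>
        4 * g (diag_mat x) = four_L1 CARD('n) CARD('m) (\<lambda>y. f (diag_mat y)) x)"


section \<open>The measure\<close>

definition par_a :: "nat \<Rightarrow> nat \<Rightarrow> real" where
  "par_a n m = (real m - 1) / 2 + (real n - real m) / 4"

definition par_b :: "nat \<Rightarrow> nat \<Rightarrow> real" where
  "par_b n m = 1 / 2 + (real n - real m) / 4"

definition par_c :: "nat \<Rightarrow> nat \<Rightarrow> real" where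
  "par_c n m = 1 / 2 - (real n - real m) / 4"

definition disc_pt :: "nat \<Rightarrow> nat \<Rightarrow> nat \<Rightarrow> complex" where
  "disc_pt n m j = \<i> * complex_of_real (par_c n m + real j)"

definition disc_ind :: "nat \<Rightarrow> nat \<Rightarrow> nat set" where
  "disc_ind n m = {j. par_c n m + real j < 0}"

definition spec_set :: "nat \<Rightarrow> nat \<Rightarrow> complex set" where
  "spec_set n m = complex_of_real ` {0<..} \<union> disc_pt n m ` disc_ind n m"

definition cont_wt :: "nat \<Rightarrow> nat \<Rightarrow> real \<Rightarrow> real" where
  "cont_wt n m x = 1 / (2 * pi) *
     (cmod (Gamma (of_real (par_a n m) + \<i> * of_real x) *
            Gamma (of_real (par_b n m) + \<i> * of_real x) *
            Gamma (of_real (par_c n m) + \<i> * of_real x) /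
            Gamma (2 * \<i> * of_real x)))\<^sup>2"

definition disc_wt :: "nat \<Rightarrow> nat \<Rightarrow> nat \<Rightarrow> real" where
  "disc_wt n m j = (let a = par_a n m; b = par_b n m; c = par_c n m in
     Gamma (a + c) * Gamma (c + b) * Gamma (b - c) * Gamma (a - c) / Gamma (- 2 * c) *
     (pochhammer (2 * c) j * pochhammer (c + 1) j * pochhammer (c + b) j * pochhammer (c + a) j /
      (pochhammer c j * pochhammer (c - b + 1) j * pochhammer (c - a + 1) j)) * (- 1) ^ j)"

definition mu :: "nat \<Rightarrow> nat \<Rightarrow> complex measure" where
  "mu n m = measure_of (spec_set n m) (sets (restrict_space borel (spec_set n m)))
     (\<lambda>A. (\<integral>\<^sup>+x\<in>{0<..}. ennreal (cont_wt n m x) * indicator A (complex_of_real x) \<partial>lborel)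
        + (\<Sum>j\<in>disc_ind n m. ennreal (disc_wt n m j) * indicator A (disc_pt n m j)))"

lemma finite_disc_ind: "finite (disc_ind n m)"
proof -
  have "disc_ind n m \<subseteq> {..nat \<lceil>- par_c n m\<rceil>}"
    unfolding disc_ind_def by (auto simp: le_nat_iff) linarith
  then show ?thesis by (rule finite_subset) simp
qed


lemma restrict_sets_Pow:
  "sets (restrict_space borel (spec_set n m)) \<subseteq> Pow (spec_set n m)"
  by (auto simp: sets_restrict_space)

lemma sets_mu: "sets (mu n m) = sets (restrict_space borel (spec_set n m))"
  using sets.sigma_sets_eq[of "restrict_space borel (spec_set n m)"]
  by (simp add: mu_def sets_measure_of[OF restrict_sets_Pow] space_restrict_space)

lemma space_mu [simp]: "space (mu n m) = spec_set n m"
  using sets_eq_imp_space_eq[OF sets_mu] by (simp add: space_restrict_space)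

lemma spec_set_borel: "spec_set n m \<in> sets borel"
proof -
  have "complex_of_real ` {0<..} = {z. Im z = 0 \<and> 0 < Re z}"
    by (auto simp: image_iff complex_eq_iff)
  also have "\<dots> \<in> sets borel" by measurable
  finally have 1: "complex_of_real ` {0<..} \<in> sets borel" .
  have "closed (disc_pt n m ` disc_ind n m)"
    by (intro finite_imp_closed finite_imageI finite_disc_ind)
  then have "disc_pt n m ` disc_ind n m \<in> sets borel" by (rule borel_closed)
  with 1 show ?thesis unfolding spec_set_def by (rule sets.Un)
qed

lemma cont_wt_measurable [measurable]:
  "(\<lambda>x. indicator {0<..} x * cont_wt n m x) \<in> borel_measurable borel"
proof -
  have nz: "complex_of_real p + \<i> * complex_of_real x \<notin> \<int>\<^sub>\<le>\<^sub>0" if "x > 0" for p x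
    using that by (auto elim!: nonpos_Ints_cases simp: complex_eq_iff)
  have nz2: "2 * \<i> * complex_of_real x \<notin> \<int>\<^sub>\<le>\<^sub>0" if "x > 0" for x
    using that by (auto elim!: nonpos_Ints_cases simp: complex_eq_iff)
  have 1: "continuous_on {0<..} (\<lambda>x. Gamma (complex_of_real p + \<i> * complex_of_real x))" for p
    by (rule continuous_on_compose2[OF continuous_on_Gamma[of "- \<int>\<^sub>\<le>\<^sub>0"]])
       (auto intro!: continuous_intros simp: nz)
  have 2: "continuous_on {0<..} (\<lambda>x. Gamma (2 * \<i> * complex_of_real x))"
    by (rule continuous_on_compose2[OF continuous_on_Gamma[of "- \<int>\<^sub>\<le>\<^sub>0"]])
       (auto intro!: continuous_intros simp: nz2)
  have "continuous_on {0<..} (cont_wt n m)"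
    unfolding cont_wt_def
    by (intro continuous_on_mult continuous_on_power continuous_on_norm continuous_on_divide
          continuous_on_const 1 2) (simp add: Gamma_eq_zero_iff nz2)
  then have "(\<lambda>x. indicator {0<..} x *\<^sub>R cont_wt n m x) \<in> borel_measurable borel"
    by (intro borel_measurable_continuous_on_indicator) simp_all
  then show ?thesis by simp
qed

lemma emeasure_mu:
  assumes "A \<in> sets (mu n m)"
  shows "emeasure (mu n m) A =
     (\<integral>\<^sup>+x\<in>{0<..}. ennreal (cont_wt n m x) * indicator A (complex_of_real x) \<partial>lborel)
        + (\<Sum>j\<in>disc_ind n m. ennreal (disc_wt n m j) * indicator A (disc_pt n m j))"
proof (rule emeasure_measure_of[OF mu_def restrict_sets_Pow _ _ assms])
  show "positive (sets (mu n m)) (\<lambda>A.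
     (\<integral>\<^sup>+x\<in>{0<..}. ennreal (cont_wt n m x) * indicator A (complex_of_real x) \<partial>lborel)
        + (\<Sum>j\<in>disc_ind n m. ennreal (disc_wt n m j) * indicator A (disc_pt n m j)))"
    by (simp add: positive_def)
  show "countably_additive (sets (mu n m)) (\<lambda>A.
     (\<integral>\<^sup>+x\<in>{0<..}. ennreal (cont_wt n m x) * indicator A (complex_of_real x) \<partial>lborel)
        + (\<Sum>j\<in>disc_ind n m. ennreal (disc_wt n m j) * indicator A (disc_pt n m j)))"
  proof (rule countably_additiveI)
    fix A :: "nat \<Rightarrow> complex set"
    assume A: "range A \<subseteq> sets (mu n m)" and disj: "disjoint_family A"
    have Ab [measurable]: "A i \<in> sets borel" for i
    proof -
      have "A i \<in> sets (restrict_space borel (spec_set n m))"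
        using A by (auto simp: sets_mu)
      then show ?thesis
        using spec_set_borel[of n m] by (simp add: sets_restrict_space_iff)
    qed
    have ind: "(\<Sum>i. indicator (A i) z) = (indicator (\<Union>i. A i) z :: ennreal)" for z
      by (rule suminf_indicator[OF disj])
    have [measurable]: "(\<lambda>x. ennreal (cont_wt n m x) * indicator (A i) (complex_of_real x) *
        indicator {0<..} x) \<in> borel_measurable lborel" for i
    proof -
      have "(\<lambda>x. ennreal (indicator {0<..} x * cont_wt n m x) * indicator (A i) (complex_of_real x))
          \<in> borel_measurable borel"
        by measurable
      also have "(\<lambda>x. ennreal (indicator {0<..} x * cont_wt n m x) * indicator (A i) (complex_of_real x))
        = (\<lambda>x. ennreal (cont_wt n m x) * indicator (A i) (complex_of_real x) * indicator {0<..} x)"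
        by (auto simp: indicator_def)
      finally show ?thesis by simp
    qed
    have "(\<integral>\<^sup>+ x. ennreal (cont_wt n m x) * indicator (\<Union>i. A i) (complex_of_real x) *
           indicator {0<..} x \<partial>lborel)
        = (\<integral>\<^sup>+ x. (\<Sum>i. ennreal (cont_wt n m x) * indicator (A i) (complex_of_real x) *
           indicator {0<..} x) \<partial>lborel)"
      by (simp flip: ind)
    also have "\<dots> = (\<Sum>i. \<integral>\<^sup>+ x. ennreal (cont_wt n m x) * indicator (A i) (complex_of_real x) *
           indicator {0<..} x \<partial>lborel)"
      by (rule nn_integral_suminf) measurable
    finally have 1: "(\<Sum>i. \<integral>\<^sup>+ x. ennreal (cont_wt n m x) * indicator (A i) (complex_of_real x) *
           indicator {0<..} x \<partial>lborel) = (\<integral>\<^sup>+ x. ennreal (cont_wt n m x) *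
           indicator (\<Union>i. A i) (complex_of_real x) * indicator {0<..} x \<partial>lborel)" by simp
    have 2: "(\<Sum>i. \<Sum>j\<in>disc_ind n m. ennreal (disc_wt n m j) * indicator (A i) (disc_pt n m j))
        = (\<Sum>j\<in>disc_ind n m. ennreal (disc_wt n m j) * indicator (\<Union>i. A i) (disc_pt n m j))"
      by (subst suminf_sum) (auto simp flip: ind)
    show "(\<Sum>i. (\<integral>\<^sup>+ x. ennreal (cont_wt n m x) * indicator (A i) (complex_of_real x) *
           indicator {0<..} x \<partial>lborel)
        + (\<Sum>j\<in>disc_ind n m. ennreal (disc_wt n m j) * indicator (A i) (disc_pt n m j)))
      = (\<integral>\<^sup>+ x. ennreal (cont_wt n m x) * indicator (\<Union>i. A i) (complex_of_real x) *
           indicator {0<..} x \<partial>lborel)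
        + (\<Sum>j\<in>disc_ind n m. ennreal (disc_wt n m j) * indicator (\<Union>i. A i) (disc_pt n m j))"
      by (subst suminf_add[symmetric]) (simp_all only: 1 2 summableI)
  qed
qed

end

(* The coefficient functional of f in H1 along a real rank-one matrix a b^T has a representing vector,
   read off from the expansion of the inverse of det (1 - z (conj_transpose w)), namely the power of a^T z b. Hence the L-invariant
   form psi_k, an average of such powers over Gaussian a and b, pairs with an invariant f to a single Taylor
   coefficient of f, and the psi_k are orthogonal and total with explicit norms. Generating functions show
   that the operator acts on their restrictions by a three-term recurrence. The same recurrence is satisfied
   by continuous dual Hahn polynomials in -x^2; their orthogonality follows from moment relations obtained by
   shifting a line of integration and collecting residues, their completeness from the exponential decay of
   the weight. Matching the two orthogonal systems gives the isometry, and matching coefficients identifies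
   the operator with the multiplication. *)
theory Submission
  imports Defs "HOL-Probability.Probability" "HOL-Complex_Analysis.Complex_Analysis"
begin

text \<open>Gaussian averages are finite sums here: signed weights on the grid 0..N with the moments
  of a normal variable up to order N integrate the polynomials that occur exactly, so an average of
  members of H is a finite linear combination of them. The spectral side works with the basis
  \<open>phi k\<close>, the product of (a + i)^2 - x over i < k: multiplying the weight by it
  replaces a by a + k, and one first-order difference equation, solved by \<open>Tfun\<close>,
  yields all the moments. The line integral contributes the residue at one pole of a tangent, the
  atoms telescope down to a zero of \<open>Tfun\<close>, and the two cancel. Multiplication
  operators in L2 are unitarily equivalent for mutually absolutely continuous measures; the
  polynomials are made orthogonal for the density \<open>wd\<close> and the masses \<open>ms\<close>
  that this calculation produces, and the factor \<open>sw\<close> carries them to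
  \<open>mu\<close>. The operator is unbounded, so it and the multiplication are compared as graphs:
  g is the image of f exactly when its coefficients satisfy the recurrence. For m = n = 1 the gamma
  factor has a pole on the line, which needs a separate argument.\<close>

no_notation fps_nth (infixl "$" 75)

abbreviation (input) sum_UNIV (binder "\<Oplus>" 10) where "sum_UNIV f \<equiv> sum f UNIV"
abbreviation (input) br :: "real \<Rightarrow> real" where "br y \<equiv> 1 + \<bar>y\<bar>"
abbreviation (input) ep :: "real \<Rightarrow> real" where "ep y \<equiv> exp (- (pi * \<bar>y\<bar>))"
abbreviation (input) cr :: "real \<Rightarrow> complex" where "cr \<equiv> of_real"
abbreviation (input) cv :: "('i \<Rightarrow> real) \<Rightarrow> 'i \<Rightarrow> complex" where "cv f \<equiv> \<lambda>i. of_real (f i)"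
abbreviation (input) uv :: "'i \<Rightarrow> 'i \<Rightarrow> complex" where "uv i0 \<equiv> \<lambda>i. if i = i0 then 1 else 0"
abbreviation (input) bmeas :: "('a::topological_space \<Rightarrow> 'b::topological_space) set" where "bmeas \<equiv> borel_measurable borel"

lemma cmod_square_mult_cnj: "(cr (cmod z))\<^sup>2 = z * cnj z"
 by (metis complex_norm_square of_real_power)

section \<open>Hilbert spaces of functions and orthogonal systems in them\<close>

locale hilbert_fun =
 fixes H :: "('z => complex) set" and ip :: "('z => complex) => ('z => complex) => complex"
 assumes fhs: "fun_hilbert_space H ip"
begin

definition nsq :: "('z => complex) => real" where "nsq f = Re (ip f f)"

lemma zero_mem: "(%z. 0) \<in> H"
 and add_mem: "f \<in> H ==> g \<in> H ==> (%z. f z + g z) \<in> H"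
 and scale_mem: "f \<in> H ==> (%z. c * f z) \<in> H"
 and ip_add_left: "f \<in> H ==> g \<in> H ==> h \<in> H ==> ip (%z. f z + g z) h = ip f h + ip g h"
 and ip_scale_left: "f \<in> H ==> h \<in> H ==> ip (%z. c * f z) h = c * ip f h"
 and ip_cnj: "f \<in> H ==> g \<in> H ==> ip g f = cnj (ip f g)"
 and nsq_pos: "f \<in> H ==> f ~= (%z. 0) ==> 0 < nsq f"
 using fhs unfolding fun_hilbert_space_def nsq_def by (blast, blast, blast, blast, blast, blast, blast)

lemma complete:
 assumes "!!k::nat. F k \<in> H"
 and "!!e. e > 0 ==> \<exists>N. \<forall>k\<ge>N. \<forall>l\<ge>N. nsq (%z. F k z - F l z) < e"
 shows "\<exists>f\<in>H. (%k. nsq (%z. F k z - f z)) \<longlonglongrightarrow> 0"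
 using fhs assms unfolding fun_hilbert_space_def nsq_def by blast

lemma diff_mem: "f \<in> H ==> g \<in> H ==> (%z. f z - g z) \<in> H"
 using add_mem[of f "%z. -1 * g z"] scale_mem[of g "-1"] by simp

lemma sum_mem: "(!!i. i \<in> I ==> F i \<in> H) ==> (%z. \<Sum>i\<in>I. F i z) \<in> H"
 by (induction I rule: infinite_finite_induct) (auto intro: zero_mem add_mem)

lemma ip_zero_left: "h \<in> H ==> ip (%z. 0) h = 0"
 using ip_scale_left[OF zero_mem, of h 0] by simp

lemma ip_diff_left:
 assumes "f \<in> H" "g \<in> H" "h \<in> H" shows "ip (%z. f z - g z) h = ip f h - ip g h"
proof -
 have "ip (%z. f z + - 1 * g z) h = ip f h + - 1 * ip g h"
 using assms by (simp only: ip_add_left scale_mem ip_scale_left)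
 then show ?thesis by simp
qed

lemma ip_sum_left:
 "(!!i. i \<in> I ==> F i \<in> H) ==> h \<in> H ==> ip (%z. \<Sum>i\<in>I. F i z) h = (\<Sum>i\<in>I. ip (F i) h)"
proof (induction I rule: infinite_finite_induct)
 case (insert x I)
 have "ip (%z. F x z + (\<Sum>i\<in>I. F i z)) h = ip (F x) h + ip (%z. \<Sum>i\<in>I. F i z) h"
 using insert by (intro ip_add_left sum_mem) auto
 then show ?case using insert by simp
qed (auto simp: ip_zero_left)

lemma ip_add_right:
 assumes "f \<in> H" "g \<in> H" "h \<in> H" shows "ip h (%z. f z + g z) = ip h f + ip h g"
 using assms ip_cnj[OF add_mem[OF assms(1,2)] assms(3)] ip_cnj[OF assms(1,3)] ip_cnj[OF assms(2,3)]
 by (simp add: ip_add_left)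

lemma ip_diff_right:
 assumes "f \<in> H" "g \<in> H" "h \<in> H" shows "ip h (%z. f z - g z) = ip h f - ip h g"
 using assms ip_cnj[OF diff_mem[OF assms(1,2)] assms(3)] ip_cnj[OF assms(1,3)] ip_cnj[OF assms(2,3)]
 by (simp add: ip_diff_left)

lemma ip_scale_right:
 assumes "f \<in> H" "h \<in> H" shows "ip h (%z. c * f z) = cnj c * ip h f"
 using assms ip_cnj[OF scale_mem[OF assms(1)] assms(2), of c] ip_cnj[OF assms]
 by (simp add: ip_scale_left)

lemma ip_sum_right:
 assumes "!!i. i \<in> I ==> F i \<in> H" "h \<in> H"
 shows "ip h (%z. \<Sum>i\<in>I. F i z) = (\<Sum>i\<in>I. ip h (F i))"
proof -
 have "ip h (%z. \<Sum>i\<in>I. F i z) = cnj (\<Sum>i\<in>I. ip (F i) h)"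
 using ip_cnj[OF sum_mem[OF assms(1)] assms(2), of I] ip_sum_left[OF assms(1) assms(2), of I] by simp
 also have "... = (\<Sum>i\<in>I. ip h (F i))"
 unfolding cnj_sum by (rule sum.cong[OF refl ip_cnj[OF assms(1) assms(2), symmetric]])
 finally show ?thesis .
qed

lemma ip_self: "f \<in> H ==> ip f f = of_real (nsq f)"
 using ip_cnj[of f f] by (auto simp: complex_eq_iff nsq_def)

lemma nsq_nonneg: "f \<in> H ==> 0 <= nsq f"
 using nsq_pos[of f] ip_zero_left[OF zero_mem] by (cases "f = (%z. 0)") (auto simp: nsq_def)

lemma nsq_add:
 assumes "f \<in> H" "g \<in> H" shows "nsq (%z. f z + g z) = nsq f + nsq g + 2 * Re (ip f g)"
 using assms ip_cnj[OF assms] by (simp add: nsq_def ip_add_left ip_add_right add_mem)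

lemma nsq_diff:
 assumes "f \<in> H" "g \<in> H" shows "nsq (%z. f z - g z) = nsq f + nsq g - 2 * Re (ip f g)"
 using assms ip_cnj[OF assms] by (simp add: nsq_def ip_diff_left ip_diff_right diff_mem)

lemma nsq_scale: "f \<in> H ==> nsq (%z. c * f z) = (cmod c)\<^sup>2 * nsq f"
proof -
 assume f: "f \<in> H"
 then have "ip (%z. c * f z) (%z. c * f z) = (c * cnj c) * of_real (nsq f)"
 by (simp add: ip_scale_left ip_scale_right scale_mem ip_self mult.assoc)
 then show ?thesis by (simp add: nsq_def flip: complex_norm_square of_real_power)
qed

lemma cauchy_schwarz:
 assumes "f \<in> H" "g \<in> H" shows "(cmod (ip f g))\<^sup>2 <= nsq f * nsq g"
proof (cases "nsq g = 0")
 case True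
 then have "g = (%z. 0)" using nsq_pos[OF assms(2)] by fastforce
 then have "ip f g = 0" using ip_cnj[OF zero_mem assms(1)] ip_zero_left[OF assms(1)] by simp
 then show ?thesis using True by simp
next
 case False
 then have g: "nsq g > 0" using nsq_nonneg[OF assms(2)] by simp
 define c where "c = ip f g / of_real (nsq g)"
 have "0 <= nsq (%z. f z - c * g z)" by (intro nsq_nonneg diff_mem scale_mem assms)
 also have "... = nsq f + (cmod c)\<^sup>2 * nsq g - 2 * Re (cnj c * ip f g)"
 using assms by (simp add: nsq_diff scale_mem nsq_scale ip_scale_right)
 also have "cnj c * ip f g = of_real ((cmod (ip f g))\<^sup>2 / nsq g)"
 unfolding c_def by (simp add: cmod_square_mult_cnj mult.commute)
 also have "(cmod c)\<^sup>2 * nsq g = (cmod (ip f g))\<^sup>2 / nsq g"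
 using g by (simp add: c_def norm_divide power_divide power2_eq_square)
 finally have "(cmod (ip f g))\<^sup>2 / nsq g <= nsq f" by simp
 then show ?thesis using g by (simp add: field_simps)
qed

lemma cauchy_schwarz_sqrt:
 assumes "f \<in> H" "g \<in> H" shows "cmod (ip f g) <= sqrt (nsq f) * sqrt (nsq g)"
 using real_le_rsqrt[OF cauchy_schwarz[OF assms]] by (simp add: real_sqrt_mult)

lemma ip_tendsto_left:
 assumes F: "!!k::nat. F k \<in> H" and f: "f \<in> H" and g: "g \<in> H"
 and lim: "(%k. nsq (%z. F k z - f z)) \<longlonglongrightarrow> 0"
 shows "(%k. ip (F k) g) \<longlonglongrightarrow> ip f g"
proof -
 have "(%k. ip (F k) g - ip f g) \<longlonglongrightarrow> 0"
 proof (rule Lim_null_comparison)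
 show "\<forall>\<^sub>F k in sequentially. norm (ip (F k) g - ip f g) <= sqrt (nsq (%z. F k z - f z)) * sqrt (nsq g)"
  using cauchy_schwarz_sqrt[OF diff_mem[OF F f] g] by (simp add: ip_diff_left F f g)
 show "(%k. sqrt (nsq (%z. F k z - f z)) * sqrt (nsq g)) \<longlonglongrightarrow> 0"
  using tendsto_mult_right[OF tendsto_real_sqrt[OF lim], of "sqrt (nsq g)"] by simp
 qed
 then show ?thesis by (simp add: LIM_zero_iff)
qed

lemma nsq_tendsto:
 assumes F: "!!k::nat. F k \<in> H" and f: "f \<in> H"
 and lim: "(%k. nsq (%z. F k z - f z)) \<longlonglongrightarrow> 0"
 shows "(%k. nsq (F k)) \<longlonglongrightarrow> nsq f"
proof -
 have "nsq (F k) = nsq (%z. F k z - f z) + 2 * Re (ip (F k) f) - nsq f" for k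
 by (simp add: nsq_diff F f)
 moreover have "(%k. nsq (%z. F k z - f z) + 2 * Re (ip (F k) f) - nsq f) \<longlonglongrightarrow> 0 + 2 * Re (ip f f) - nsq f"
 by (intro tendsto_intros lim ip_tendsto_left F f)
 ultimately show ?thesis by (simp add: nsq_def)
qed

text \<open>Minimises J f = |f|^2 - 2 Re (\<phi> f), which the bound on \<phi> keeps above - C^2.
  The parallelogram law, in the form \<open>half\<close>, makes a minimising sequence Cauchy,
  completeness supplies the minimiser r, and the first variation of J at r gives Re (\<phi> g) = Re
  (ip g r).\<close>

lemma riesz_representation:
 assumes \<phi>_add: "!!f g. f \<in> H ==> g \<in> H ==> \<phi> (%z. f z + g z) = \<phi> f + \<phi> g"
 and \<phi>_scale: "!!c f. f \<in> H ==> \<phi> (%z. c * f z) = c * \<phi> f"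
 and \<phi>_bound: "!!f. f \<in> H ==> cmod (\<phi> f) <= C * sqrt (nsq f)"
 shows "\<exists>r\<in>H. \<forall>f\<in>H. \<phi> f = ip f r"
proof -
 define J where "J f = nsq f - 2 * Re (\<phi> f)" for f
 define d where "d = Inf (J ` H)"
 have J_lower: "- C\<^sup>2 <= J f" if "f \<in> H" for f
 proof -
 have "Re (\<phi> f) <= C * sqrt (nsq f)" using \<phi>_bound[OF that] complex_Re_le_cmod order_trans by blast
 moreover have "0 <= (sqrt (nsq f) - C)\<^sup>2" by simp
 then have "0 <= nsq f - 2 * (C * sqrt (nsq f)) + C\<^sup>2" using nsq_nonneg[OF that] by (simp add: power2_diff mult.commute mult.left_commute)
 ultimately show ?thesis unfolding J_def by linarith
 qed
 have bdd: "bdd_below (J ` H)" using J_lower by (intro bdd_belowI2[of _ "- C\<^sup>2"])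
 have J_ge: "d <= J f" if "f \<in> H" for f unfolding d_def by (rule cINF_lower[OF bdd that])
 have "\<exists>f\<in>H. J f < d + 1 / real (Suc k)" for k
 using cInf_lessD[of "J ` H" "d + 1 / real (Suc k)"] zero_mem unfolding d_def by auto
 then obtain F where F: "!!k. F k \<in> H" and FJ: "!!k. J (F k) < d + 1 / real (Suc k)" by metis
 have half: "J (%z. (1/2) * (f z + g z)) = (J f + J g) / 2 - nsq (%z. f z - g z) / 4"
 if "f \<in> H" "g \<in> H" for f g
 proof -
 have 1: "nsq (%z. (1/2) * (f z + g z)) = (nsq f + nsq g + 2 * Re (ip f g)) / 4"
  using that by (subst nsq_scale) (auto simp: add_mem nsq_add power2_eq_square)
 have 2: "\<phi> (%z. (1/2) * (f z + g z)) = (\<phi> f + \<phi> g) / 2"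
  using that by (subst \<phi>_scale) (auto simp: add_mem \<phi>_add)
 show ?thesis unfolding J_def 1 2 nsq_diff[OF that] by (simp add: field_simps)
 qed
 have cau: "nsq (%z. F k z - F l z) <= 2 / real (Suc k) + 2 / real (Suc l)" for k l
 proof -
 have "d <= (J (F k) + J (F l)) / 2 - nsq (%z. F k z - F l z) / 4"
  using J_ge[OF scale_mem[OF add_mem[OF F F]], of "1/2" k l] unfolding half[OF F F] .
 moreover have e: "2 / real (Suc i) = 2 * (1 / real (Suc i))" for i by simp
 ultimately show ?thesis unfolding e using FJ[of k] FJ[of l] by argo
 qed
 obtain r where r: "r \<in> H" and lim: "(%k. nsq (%z. F k z - r z)) \<longlonglongrightarrow> 0"
 proof -
 have "\<exists>N. \<forall>k\<ge>N. \<forall>l\<ge>N. nsq (%z. F k z - F l z) < e" if "e > 0" for e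
 proof -
  obtain N where N: "4 / e < real N" using reals_Archimedean2 by blast
  have "2 / real (Suc k) < e / 2" if "k \<ge> N" for k
  proof -
  have "4 / e < real (Suc k)" using N that by simp
  then show ?thesis using \<open>e > 0\<close> by (simp add: field_simps)
  qed
  then have "2 / real (Suc k) + 2 / real (Suc l) < e" if "k \<ge> N" "l \<ge> N" for k l
  using that by (smt (verit, del_insts) field_sum_of_halves)
  then show ?thesis using cau by (meson le_less_trans)
 qed
 then show ?thesis using complete[of F] F that by blast
 qed
 have "(%k. \<phi> (F k) - \<phi> r) \<longlonglongrightarrow> 0"
 proof (rule Lim_null_comparison)
 have "\<phi> (F k) - \<phi> r = \<phi> (%z. F k z - r z)" for k
  using \<phi>_add[OF F scale_mem[OF r], of k "-1"] \<phi>_scale[OF r, of "-1"] by simp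
 then show "\<forall>\<^sub>F k in sequentially. norm (\<phi> (F k) - \<phi> r) <= C * sqrt (nsq (%z. F k z - r z))"
  using \<phi>_bound[OF diff_mem[OF F r]] by simp
 show "(%k. C * sqrt (nsq (%z. F k z - r z))) \<longlonglongrightarrow> 0"
  using tendsto_mult_left[OF tendsto_real_sqrt[OF lim], of C] by simp
 qed
 then have "(%k. J (F k)) \<longlonglongrightarrow> J r"
 unfolding J_def LIM_zero_iff by (intro tendsto_intros nsq_tendsto F r lim)
 moreover have "(%k. d + 1 / real (Suc k)) \<longlonglongrightarrow> d + 0"
 by (intro tendsto_intros) (use LIMSEQ_inverse_real_of_nat in \<open>simp add: inverse_eq_divide\<close>)
 ultimately have Jr: "J r <= d"
 using LIMSEQ_le[of "%k. J (F k)" "J r" "%k. d + 1 / real (Suc k)" "d + 0"] FJ less_imp_le by auto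
 have re: "Re (\<phi> g) = Re (ip g r)" if g: "g \<in> H" for g
 proof -
 define b where "b = Re (ip g r) - Re (\<phi> g)"
 have q: "0 <= t\<^sup>2 * nsq g + 2 * t * b" for t :: real
 proof -
  have "J r <= J (%z. of_real t * g z + r z)" using Jr J_ge[OF add_mem[OF scale_mem[OF g] r], of "of_real t"] by simp
  also have "... = t\<^sup>2 * nsq g + nsq r + 2 * t * Re (ip g r) - 2 * (t * Re (\<phi> g) + Re (\<phi> r))"
  unfolding J_def using g r by (simp add: nsq_add scale_mem nsq_scale ip_scale_left \<phi>_add \<phi>_scale)
  finally show ?thesis by (simp add: J_def b_def algebra_simps)
 qed
 have "b = 0"
 proof (rule ccontr)
  assume b: "b ~= 0"
  \<comment> \<open>The quadratic t^2 * nsq g + 2 * t * b is negative at t = - b / N; the added 1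
    also covers nsq g = 0.\<close>
  define N where "N = nsq g + 1"
  have N: "N > 0" "nsq g < N" using nsq_nonneg[OF g] by (auto simp: N_def)
  have "0 <= (- b / N)\<^sup>2 * nsq g + 2 * (- b / N) * b" by (rule q)
  also have "... = b\<^sup>2 * (nsq g / N - 2) / N" using N by (simp add: field_simps power2_eq_square)
  also have "... < 0" using N b by (intro divide_neg_pos mult_pos_neg) (auto simp: field_simps)
  finally show False by simp
 qed
 then show ?thesis by (simp add: b_def)
 qed
 have "\<phi> g = ip g r" if g: "g \<in> H" for g
 proof (rule complex_eqI)
 show "Re (\<phi> g) = Re (ip g r)" by (rule re[OF g])
 \<comment> \<open>Multiplication by - i turns imaginary parts into real parts.\<close>
 have "Re (\<phi> (%z. - \<i> * g z)) = Re (ip (%z. - \<i> * g z) r)" by (rule re[OF scale_mem[OF g]])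
 then show "Im (\<phi> g) = Im (ip g r)" using g r by (simp only: \<phi>_scale ip_scale_left) simp
 qed
 then show ?thesis using r by blast
qed

end

locale hilbert_orthogonal = hilbert_fun +
 fixes e :: "nat => 'a => complex" and N :: "nat => real"
 assumes e_mem: "!!k. e k \<in> H" and N_pos: "!!k. N k > 0"
 and ip_e: "!!j k. ip (e j) (e k) = (if j = k then of_real (N k) else 0)"
begin

lemma partial_mem: "(%z. \<Sum>k\<in>I. c k * e k z) \<in> H"
 by (intro sum_mem scale_mem e_mem)

lemma ip_partial:
 assumes "finite I" "f \<in> H"
 shows "ip (%z. \<Sum>k\<in>I. c k * e k z) f = (\<Sum>k\<in>I. c k * ip (e k) f)"
 by (subst ip_sum_left) (auto simp: scale_mem e_mem assms ip_scale_left)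

lemma ip_partial_e:
 assumes "finite I"
 shows "ip (%z. \<Sum>k\<in>I. c k * e k z) (e j) = (if j \<in> I then c j * of_real (N j) else 0)"
 using assms by (simp add: ip_partial e_mem ip_e if_distrib[of "%x. _ * x"] sum.delta' cong: if_cong)

lemma nsq_partial:
 assumes "finite I" shows "nsq (%z. \<Sum>k\<in>I. c k * e k z) = (\<Sum>k\<in>I. (cmod (c k))\<^sup>2 * N k)"
proof -
 have "ip (%z. \<Sum>k\<in>I. c k * e k z) (%z. \<Sum>k\<in>I. c k * e k z)
  = (\<Sum>k\<in>I. cnj (c k) * ip (%z. \<Sum>k\<in>I. c k * e k z) (e k))"
 by (subst ip_sum_right) (auto simp: scale_mem e_mem partial_mem ip_scale_right)
 also have "... = (\<Sum>k\<in>I. of_real ((cmod (c k))\<^sup>2 * N k))"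
 by (intro sum.cong refl) (simp add: ip_partial_e assms cmod_square_mult_cnj mult_ac)
 finally show ?thesis by (simp add: nsq_def)
qed

definition coef :: "('a => complex) => nat => complex" where "coef f k = ip f (e k) / of_real (N k)"

lemma nsq_remainder:
 assumes f: "f \<in> H"
 shows "nsq (%z. (\<Sum>k<K. coef f k * e k z) - f z) = nsq f - (\<Sum>k<K. (cmod (coef f k))\<^sup>2 * N k)"
proof -
 have *: "coef f k * ip (e k) f = of_real ((cmod (coef f k))\<^sup>2 * N k)" for k
 proof -
 have "ip (e k) f = cnj (coef f k) * of_real (N k)"
  using ip_cnj[OF f e_mem, of k] N_pos[of k] by (simp add: coef_def)
 then show ?thesis by (simp add: cmod_square_mult_cnj mult_ac)
 qed
 show ?thesis using f by (simp add: nsq_diff partial_mem nsq_partial ip_partial * flip: of_real_sum)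
qed

lemma bessel_summable:
 assumes f: "f \<in> H" shows "summable (%k. (cmod (coef f k))\<^sup>2 * N k)"
proof (rule summableI_nonneg_bounded[of _ "nsq f"])
 show "0 <= (cmod (coef f k))\<^sup>2 * N k" for k using N_pos[of k] by simp
 show "(\<Sum>k<K. (cmod (coef f k))\<^sup>2 * N k) <= nsq f" for K
 using nsq_remainder[OF f, of K] nsq_nonneg[OF diff_mem[OF partial_mem f], of "coef f" "{..<K}"] by linarith
qed

text \<open>Riesz-Fischer: the square norm of a difference of partial sums is a difference of
  partial sums of the given summable series, so the partial sums are Cauchy in H. Each of their
  coefficients is eventually constant, which fixes those of the limit.\<close>

lemma series_exists:
 assumes "summable (%k. (cmod (c k))\<^sup>2 * N k)"
 shows "\<exists>f\<in>H. (%K. nsq (%z. (\<Sum>k<K. c k * e k z) - f z)) \<longlonglongrightarrow> 0 \<and> (\<forall>k. coef f k = c k)"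
proof -
 have diff: "nsq (%z. (\<Sum>k<K. c k * e k z) - (\<Sum>k<L. c k * e k z)) = \<bar>(\<Sum>k<K. (cmod (c k))\<^sup>2 * N k) - (\<Sum>k<L. (cmod (c k))\<^sup>2 * N k)\<bar>" for K L
 proof -
 have 1: "nsq (%z. (\<Sum>k<K. c k * e k z) - (\<Sum>k<L. c k * e k z)) = \<bar>(\<Sum>k<K. (cmod (c k))\<^sup>2 * N k) - (\<Sum>k<L. (cmod (c k))\<^sup>2 * N k)\<bar>"
  if "L <= K" for K L
 proof -
  have s: "sum h {..<K} - sum h {..<L} = sum h {L..<K}" for h :: "nat => 'c::ab_group_add"
  using that by (simp add: lessThan_atLeast0 sum_diff_nat_ivl)
  have "0 <= (\<Sum>k\<in>{L..<K}. (cmod (c k))\<^sup>2 * N k)" by (intro sum_nonneg mult_nonneg_nonneg) (auto intro: less_imp_le N_pos)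
  then show ?thesis by (simp add: s nsq_partial)
 qed
 have 2: "nsq (%z. f z - g z) = nsq (%z. g z - f z)" if "f \<in> H" "g \<in> H" for f g
  using that ip_cnj[OF that] by (simp add: nsq_diff)
 show ?thesis
  by (cases "L <= K") (use 1[of L K] 1[of K L] 2[OF partial_mem partial_mem, of c "{..<K}" c "{..<L}"] in \<open>auto simp: abs_minus_commute\<close>)
 qed
 have "Cauchy (%K. \<Sum>k<K. (cmod (c k))\<^sup>2 * N k)"
 using assms by (simp add: summable_iff_convergent Cauchy_convergent_iff)
 then have "\<exists>M. \<forall>K\<ge>M. \<forall>L\<ge>M. nsq (%z. (\<Sum>k<K. c k * e k z) - (\<Sum>k<L. c k * e k z)) < \<epsilon>" if "\<epsilon> > 0" for \<epsilon>
 unfolding diff using that CauchyD[of "%K. \<Sum>k<K. (cmod (c k))\<^sup>2 * N k" \<epsilon>] by auto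
 then obtain f where f: "f \<in> H" and lim: "(%K. nsq (%z. (\<Sum>k<K. c k * e k z) - f z)) \<longlonglongrightarrow> 0"
 using complete[of "%K z. \<Sum>k<K. c k * e k z"] partial_mem by blast
 have "coef f j = c j" for j
 proof -
 have "(%K. ip (%z. \<Sum>k<K. c k * e k z) (e j)) \<longlonglongrightarrow> ip f (e j)"
  by (rule ip_tendsto_left[OF partial_mem f e_mem lim])
 moreover have "(%K. ip (%z. \<Sum>k<K. c k * e k z) (e j)) \<longlonglongrightarrow> c j * of_real (N j)"
  by (rule tendsto_eventually) (use eventually_gt_at_top[of j] in eventually_elim, simp add: ip_partial_e)
 ultimately have "ip f (e j) = c j * of_real (N j)" by (rule LIMSEQ_unique)
 then show ?thesis using N_pos[of j] by (simp add: coef_def)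
 qed
 then show ?thesis using f lim by blast
qed

end

section \<open>Power series of the reciprocal of det (1 - t A)\<close>

primrec mpow :: "complex^'n^'n => nat => complex^'n^'n" where
 "mpow A 0 = mat 1"
| "mpow A (Suc k) = A ** mpow A k"

definition mtr :: "complex^'n^'n => complex" where "mtr A = (\<Oplus>i. A $ i $ i)"

definition csm :: "complex => complex^'m^'n => complex^'m^'n" where
 "csm t A = (\<chi> i j. t * A $ i $ j)"

lemma csm_nth [simp]: "csm t A $ i $ j = t * A $ i $ j"
 by (simp add: csm_def)

lemma mpow_Suc_right: "mpow A (Suc k) = mpow A k ** A"
 by (induction k) (simp_all add: matrix_mul_assoc)

lemma mpow_bound:
 fixes A :: "complex^'n^'n"
 assumes B: "!!i j. cmod (A $ i $ j) <= B"
 shows "cmod (mpow A k $ i $ j) <= (real CARD('n) * B) ^ k"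
proof (induction k arbitrary: i j)
 case 0 show ?case by (simp add: mat_def)
next
 case (Suc k)
 have B0: "0 <= B" using B[of i j] norm_ge_zero order_trans by blast
 have "cmod (mpow A (Suc k) $ i $ j) <= (\<Oplus>l. cmod (A $ i $ l) * cmod (mpow A k $ l $ j))"
 by (simp add: matrix_matrix_mult_def norm_mult sum_norm_le)
 also have "... <= (\<Sum>l\<in>(UNIV::'n set). B * (real CARD('n) * B) ^ k)"
 by (intro sum_mono mult_mono B Suc.IH B0) auto
 finally show ?case by (simp add: mult_ac)
qed

lemma has_field_derivative_det:
 fixes M :: "complex => complex^'n^'n"
 assumes M: "!!i j. ((%t. M t $ i $ j) has_field_derivative M' $ i $ j) (at t)"
 shows "((%t. det (M t)) has_field_derivative
   (\<Oplus>k. det (\<chi> i. if i = k then M' $ i else M t $ i))) (at t)"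
proof -
 have *: "((%t. \<Prod>i\<in>UNIV. M t $ i $ p i) has_field_derivative
  (\<Oplus>k. \<Prod>i\<in>UNIV. (if i = k then M' $ i else M t $ i) $ p i)) (at t)" for p
 proof -
 have "((%t. \<Prod>i\<in>UNIV. M t $ i $ p i) has_field_derivative
  (\<Oplus>k. M' $ k $ p k * (\<Prod>i\<in>UNIV - {k}. M t $ i $ p i))) (at t)"
  by (rule has_field_derivative_prod) (rule M)
 also have "(\<Oplus>k. M' $ k $ p k * (\<Prod>i\<in>UNIV - {k}. M t $ i $ p i))
  = (\<Oplus>k. \<Prod>i\<in>UNIV. (if i = k then M' $ i else M t $ i) $ p i)"
 proof (rule sum.cong[OF refl])
  fix k
  show "M' $ k $ p k * (\<Prod>i\<in>UNIV - {k}. M t $ i $ p i) = (\<Prod>i\<in>UNIV. (if i = k then M' $ i else M t $ i) $ p i)"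
  by (subst prod.remove[of UNIV k]) (auto intro!: prod.cong)
 qed
 finally show ?thesis .
 qed
 have "((%t. \<Sum>p | p permutes UNIV. of_int (sign p) * (\<Prod>i\<in>UNIV. M t $ i $ p i)) has_field_derivative
  (\<Sum>p | p permutes UNIV. of_int (sign p) * (\<Oplus>k. \<Prod>i\<in>UNIV. (if i = k then M' $ i else M t $ i) $ p i))) (at t)"
 by (intro derivative_intros DERIV_cmult *)
 also have "(\<Sum>p | p permutes UNIV. of_int (sign p) * (\<Oplus>k. \<Prod>i\<in>UNIV. (if i = k then M' $ i else M t $ i) $ p i))
  = (\<Oplus>k. det (\<chi> i. if i = k then M' $ i else M t $ i))"
 unfolding det_def sum_distrib_left by (subst sum.swap) simp
 finally show ?thesis by (simp add: det_def)
qed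

text \<open>The left factor of the product is the Neumann series of A (1 - t A)^{-1}. It is summed
  entry by entry, dominated by a geometric series through \<open>mpow_bound\<close>, and the
  identity is a shift of the index of summation.\<close>

lemma resolvent_series:
 fixes A :: "complex^'n^'n"
 assumes B: "!!i j. cmod (A $ i $ j) <= B" and t: "cmod t * (real CARD('n) * B) < 1"
 shows "summable (%l. t ^ l * mpow A (Suc l) $ i $ j)"
 and "(\<chi> i j. \<Sum>l. t ^ l * mpow A (Suc l) $ i $ j) ** (mat 1 - csm t A) = A"
proof -
 have B0: "0 <= B" using B[of undefined undefined] norm_ge_zero order_trans by blast
 have s: "summable (%l. t ^ l * mpow A (Suc l) $ i $ j)" for i j
 proof (rule summable_comparison_test')
 show "summable (%l. (real CARD('n) * B) * (cmod t * (real CARD('n) * B)) ^ l)"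
  using t B0 by (intro summable_mult summable_geometric) simp
 fix l :: nat
 have "norm (t ^ l * mpow A (Suc l) $ i $ j) <= cmod t ^ l * (real CARD('n) * B) ^ Suc l"
  unfolding norm_mult norm_power by (intro mult_left_mono mpow_bound B) simp
 then show "norm (t ^ l * mpow A (Suc l) $ i $ j) <= (real CARD('n) * B) * (cmod t * (real CARD('n) * B)) ^ l"
  by (simp add: power_mult_distrib mult_ac)
 qed
 show "summable (%l. t ^ l * mpow A (Suc l) $ i $ j)" by (rule s)
 define Y where "Y i j = (\<Sum>l. t ^ l * mpow A (Suc l) $ i $ j)" for i j
 have "Y i j - t * (\<Oplus>l. Y i l * A $ l $ j) = A $ i $ j" for i j
 proof -
 have "(\<Oplus>l. Y i l * A $ l $ j) = (\<Oplus>l. \<Sum>k. t ^ k * mpow A (Suc k) $ i $ l * A $ l $ j)"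
  unfolding Y_def by (intro sum.cong refl suminf_mult2 s)
 also have "... = (\<Sum>k. \<Oplus>l. t ^ k * mpow A (Suc k) $ i $ l * A $ l $ j)"
  by (rule suminf_sum[symmetric]) (intro summable_mult2 s)
 also have "... = (\<Sum>k. t ^ k * mpow A (Suc (Suc k)) $ i $ j)"
  by (intro suminf_cong) (subst mpow_Suc_right[of _ "Suc _"], simp only: matrix_matrix_mult_def vec_lambda_beta sum_distrib_left mult.assoc)
 finally have "t * (\<Oplus>l. Y i l * A $ l $ j) = (\<Sum>k. t ^ Suc k * mpow A (Suc (Suc k)) $ i $ j)"
  using suminf_mult[of "%k. t ^ k * mpow A (Suc (Suc k)) $ i $ j" t] s[of i j, THEN summable_Suc_iff[THEN iffD2]]
  by (cases "t = 0") (simp_all add: mult.assoc summable_mult_D)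
 moreover have "Y i j = (\<Sum>k. t ^ Suc k * mpow A (Suc (Suc k)) $ i $ j) + A $ i $ j"
  unfolding Y_def using suminf_split_head[OF s, of i j] by simp
 ultimately show ?thesis by simp
 qed
 then show "(\<chi> i j. \<Sum>l. t ^ l * mpow A (Suc l) $ i $ j) ** (mat 1 - csm t A) = A"
 unfolding Y_def[symmetric]
 by (simp add: vec_eq_iff matrix_matrix_mult_def mat_def right_diff_distrib sum_subtractf if_distrib[of "%x. _ * x"]
  sum.delta' sum.delta sum_distrib_left mult.left_commute cong: if_cong)
qed

text \<open>Jacobi's formula. Differentiating row k of 1 - t A gives minus row k of A, and A = Y (1
  - t A) for the resolvent series Y writes it as a combination of the rows of 1 - t A; Cramer's rule
  then leaves only the diagonal entry of - Y times the determinant.\<close>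

lemma deriv_det_one_minus:
 fixes A :: "complex^'n^'n"
 assumes B: "!!i j. cmod (A $ i $ j) <= B" and t: "cmod t * (real CARD('n) * B) < 1"
 shows "((%t. det (mat 1 - csm t A)) has_field_derivative
   - (\<Sum>l. t ^ l * mtr (mpow A (Suc l))) * det (mat 1 - csm t A)) (at t)"
 and "(%l. t ^ l * mtr (mpow A (Suc l))) sums (\<Sum>l. t ^ l * mtr (mpow A (Suc l)))"
proof -
 define M where "M = mat 1 - csm t A"
 define Y where "Y = (\<chi> i j. \<Sum>l. t ^ l * mpow A (Suc l) $ i $ j)"
 note s = resolvent_series(1)[OF B t]
 have YM: "Y ** M = A" unfolding Y_def M_def by (rule resolvent_series(2)[OF B t])
 have "((%t. det (mat 1 - csm t A)) has_field_derivative
  (\<Oplus>k. det (\<chi> i. if i = k then (- A) $ i else (mat 1 - csm t A) $ i))) (at t)"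
 by (rule has_field_derivative_det) (auto intro!: derivative_eq_intros simp: csm_def)
 also have "(\<Oplus>k. det (\<chi> i. if i = k then (- A) $ i else (mat 1 - csm t A) $ i))
  = (\<Oplus>k. (- Y $ k $ k) * det M)"
 proof (rule sum.cong[OF refl])
 fix k
 have row: "(- A) $ k = (\<Oplus>i. (- Y $ k $ i) *s row i M)"
  unfolding YM[symmetric] by (simp add: vec_eq_iff matrix_matrix_mult_def row_def sum_negf)
 have "det (\<chi> i. if i = k then (- A) $ i else M $ i) = det (\<chi> i. if i = k then (\<Oplus>i. (- Y $ k $ i) *s row i M) else row i M)"
  using row by (intro arg_cong[of _ _ det]) (simp add: vec_eq_iff row_def)
 also have "... = (- Y $ k $ k) * det M"
  using cramer_lemma_transpose[of k "\<chi> i. - Y $ k $ i" M] by (simp only: vec_lambda_beta)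
 finally show "det (\<chi> i. if i = k then (- A) $ i else (mat 1 - csm t A) $ i) = (- Y $ k $ k) * det M"
  unfolding M_def .
 qed
 finally have der: "((%t. det (mat 1 - csm t A)) has_field_derivative (\<Oplus>k. (- Y $ k $ k) * det M)) (at t)" .
 have sms: "(%l. t ^ l * mtr (mpow A (Suc l))) sums (\<Oplus>k. Y $ k $ k)"
 unfolding mtr_def sum_distrib_left Y_def vec_lambda_beta by (intro sums_sum summable_sums s)
 then show "(%l. t ^ l * mtr (mpow A (Suc l))) sums (\<Sum>l. t ^ l * mtr (mpow A (Suc l)))"
 by (simp add: sums_iff)
 have e: "(\<Sum>l. t ^ l * mtr (mpow A (Suc l))) = (\<Oplus>k. Y $ k $ k)" using sms by (simp add: sums_iff)
 show "((%t. det (mat 1 - csm t A)) has_field_derivative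
   - (\<Sum>l. t ^ l * mtr (mpow A (Suc l))) * det (mat 1 - csm t A)) (at t)"
 using der unfolding e M_def by (simp add: sum_negf sum_distrib_right)
qed

text \<open>The logarithmic derivative of 1 / det (1 - t A) is the generating series of the traces
  of the powers of A, so its coefficients obey Newton's recursion, which determines them from the
  value 1 at 0. The recursion for h is asked only below K because the moments of
  \<open>bil_moments_newton\<close> satisfy it only up to an order bounded by the grid.\<close>

lemma inverse_det_fps:
 fixes A :: "complex^'n^'n"
 assumes h0: "h 0 = 1"
 and rec: "!!k. k < K ==> of_nat (Suc k) * h (Suc k) = (\<Sum>j\<le>k. mtr (mpow A (Suc j)) * h (k - j))"
 shows "\<exists>\<Phi>. (%t. inverse (det (mat 1 - csm t A))) has_fps_expansion \<Phi> \<and> (\<forall>k\<le>K. fps_nth \<Phi> k = h k)"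
proof -
 define D where "D t = det (mat 1 - csm t A)" for t
 define B where "B = (\<Oplus>i. \<Oplus>j. cmod (A $ i $ j))"
 have B: "cmod (A $ i $ j) <= B" for i j
 proof -
 have "cmod (A $ i $ j) <= (\<Oplus>j. cmod (A $ i $ j))" by (rule member_le_sum) auto
 also have "... <= B" unfolding B_def by (rule member_le_sum[of i UNIV "%i. \<Oplus>j. cmod (A $ i $ j)"]) (auto intro: sum_nonneg)
 finally show ?thesis .
 qed
 have B0: "0 <= B" using B[of undefined undefined] norm_ge_zero order_trans by blast
 \<comment> \<open>For |t| < r the resolvent series converges; the added 1 covers B = 0.\<close>
 define r where "r = 1 / (real CARD('n) * B + 1)"
 have r: "r > 0" using B0 by (simp add: r_def add_nonneg_pos)
 have tr: "cmod t * (real CARD('n) * B) < 1" if "t \<in> ball 0 r" for t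
 proof -
 have "cmod t * (real CARD('n) * B + 1) < 1"
  using that B0 unfolding r_def by (simp add: pos_less_divide_eq add_nonneg_pos)
 moreover have "cmod t * (real CARD('n) * B) <= cmod t * (real CARD('n) * B + 1)" by (simp add: mult_left_mono)
 ultimately show ?thesis by linarith
 qed
 define \<tau> where "\<tau> t = (\<Sum>l. t ^ l * mtr (mpow A (Suc l)))" for t
 have D': "(D has_field_derivative - \<tau> t * D t) (at t)" if "t \<in> ball 0 r" for t
 using deriv_det_one_minus(1)[OF B tr[OF that]] by (simp add: D_def[abs_def] \<tau>_def)
 have holD: "D holomorphic_on ball 0 r"
 using D' holomorphic_on_open by blast
 have D0: "D 0 = 1" by (simp add: D_def csm_def) (simp add: vec_lambda_unique flip: zero_vec_def)
 have "continuous (at 0) D" using D'[of 0] r by (auto intro: DERIV_isCont)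
 then obtain s where s: "s > 0" "!!y. dist 0 y < s ==> D y ~= 0"
 using continuous_at_avoid[of 0 D 0] D0 by auto
 define q where "q = min r s"
 have q: "q > 0" using r s by (simp add: q_def)
 have hol: "(%t. inverse (D t)) holomorphic_on ball 0 q"
 by (intro holomorphic_intros holomorphic_on_subset[OF holD]) (use s q in \<open>auto simp: q_def\<close>)
 define \<Phi> where "\<Phi> = fps_expansion (%t. inverse (D t)) 0"
 have \<Phi>: "(%t. inverse (D t)) has_fps_expansion \<Phi>"
 unfolding \<Phi>_def by (rule has_fps_expansion_fps_expansion[OF _ _ hol]) (use q in auto)
 have T: "\<tau> has_fps_expansion Abs_fps (%l. mtr (mpow A (Suc l)))"
 proof (rule has_fps_expansionI)
 have "\<forall>\<^sub>F u in nhds 0. u \<in> ball 0 r" by (rule eventually_nhds_in_open) (use r in auto)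
 then show "\<forall>\<^sub>F u in nhds 0. (%n. fps_nth (Abs_fps (%l. mtr (mpow A (Suc l)))) n * u ^ n) sums \<tau> u"
  by eventually_elim (use deriv_det_one_minus(2)[OF B tr] in \<open>simp add: \<tau>_def mult.commute\<close>)
 qed
 have "(%t. \<tau> t * inverse (D t)) has_fps_expansion Abs_fps (%l. mtr (mpow A (Suc l))) * \<Phi>"
 by (rule has_fps_expansion_mult[OF T \<Phi>])
 moreover have "\<forall>\<^sub>F t in nhds 0. deriv (%t. inverse (D t)) t = \<tau> t * inverse (D t)"
 proof -
 have "\<forall>\<^sub>F u in nhds 0. u \<in> ball 0 q" by (rule eventually_nhds_in_open) (use q in auto)
 then show ?thesis
 proof eventually_elim
  case (elim t)
  have Dt: "D t ~= 0" and tr': "t \<in> ball 0 r" using elim s by (auto simp: q_def)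
  have "((%t. inverse (D t)) has_field_derivative - (inverse (D t) * (- \<tau> t * D t) * inverse (D t))) (at t)"
  by (rule DERIV_inverse'[OF D'[OF tr'] Dt])
  then show ?case using Dt by (intro DERIV_imp_deriv) (simp add: field_simps)
 qed
 qed
 ultimately have "deriv (%t. inverse (D t)) has_fps_expansion Abs_fps (%l. mtr (mpow A (Suc l))) * \<Phi>"
 using has_fps_expansion_cong by force
 then have de: "fps_deriv \<Phi> = Abs_fps (%l. mtr (mpow A (Suc l))) * \<Phi>"
 using has_fps_expansion_deriv[OF \<Phi>] fps_expansion_unique_complex by blast
 have "fps_nth \<Phi> k = h k" if "k <= K" for k
 using that
 proof (induction k rule: less_induct)
 case (less k)
 show ?case
 proof (cases k)
  case 0
  then show ?thesis using h0 D0 by (simp add: \<Phi>_def fps_expansion_def)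
 next
  case (Suc l)
  have "of_nat (Suc l) * fps_nth \<Phi> (Suc l) = fps_nth (fps_deriv \<Phi>) l" by (simp del: of_nat_Suc)
  also have "... = (\<Sum>j\<le>l. mtr (mpow A (Suc j)) * fps_nth \<Phi> (l - j))"
  unfolding de by (simp add: fps_mult_nth atMost_atLeast0)
  also have "... = (\<Sum>j\<le>l. mtr (mpow A (Suc j)) * h (l - j))"
  by (intro sum.cong refl) (use less Suc in auto)
  also have "... = of_nat (Suc l) * h (Suc l)" using rec[of l] less.prems Suc by simp
  finally show ?thesis using Suc by (metis mult_left_cancel of_nat_eq_0_iff nat.distinct(1))
 qed
 qed
 then show ?thesis using \<Phi> unfolding D_def by blast
qed

section \<open>Gaussian averages by finite sums with signed weights\<close>

text \<open>A Vandermonde system, solved one node at a time. A weight s is reserved for the new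
  node, the lower moments are corrected for it, and s is forced by integrating \<omega>, the monic
  polynomial that vanishes at all old nodes; this gives the moment of order N + 1.\<close>

lemma moment_weights:
 fixes c :: "nat => 'a::field_char_0"
 shows "\<exists>w. \<forall>a\<le>N. (\<Sum>j\<le>N. w j * of_nat j ^ a) = c a"
proof (induction N arbitrary: c)
 case 0
 show ?case by (intro exI[of _ "%_. c 0"]) simp
next
 case (Suc N)
 define \<omega> where "\<omega> = (\<Prod>j\<le>N. [:- of_nat j, 1 :: 'a:])"
 have deg: "degree \<omega> = Suc N" unfolding \<omega>_def
 by (subst degree_prod_eq_sum_degree) auto
 have "lead_coeff \<omega> = 1" unfolding \<omega>_def by (simp add: lead_coeff_prod)
 then have lc: "coeff \<omega> (Suc N) = 1" using deg by simp
 have van: "poly \<omega> (of_nat j) = 0" if "j <= N" for j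
 using that by (auto simp: \<omega>_def poly_prod)
 have nv: "poly \<omega> (of_nat (Suc N)) ~= 0"
 proof -
 have "(of_nat (Suc N) :: 'a) ~= of_nat j" if "j <= N" for j using that by (simp del: of_nat_Suc)
 then show ?thesis by (auto simp: \<omega>_def poly_prod simp del: of_nat_Suc)
 qed
 define s where "s = (c (Suc N) + (\<Sum>a\<le>N. coeff \<omega> a * c a)) / poly \<omega> (of_nat (Suc N))"
 obtain w where w: "!!a. a <= N ==> (\<Sum>j\<le>N. w j * of_nat j ^ a) = c a - s * of_nat (Suc N) ^ a"
 using Suc.IH[of "%a. c a - s * of_nat (Suc N) ^ a"] by blast
 define v where "v j = (if j <= N then w j else s)" for j
 have low: "(\<Sum>j\<le>Suc N. v j * of_nat j ^ a) = c a" if "a <= N" for a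
 proof -
 have "(\<Sum>j\<le>N. v j * of_nat j ^ a) = (\<Sum>j\<le>N. w j * of_nat j ^ a)" by (intro sum.cong) (auto simp: v_def)
 then show ?thesis using w[OF that] by (simp add: v_def del: of_nat_Suc)
 qed
 have "(\<Sum>j\<le>Suc N. v j * poly \<omega> (of_nat j)) = s * poly \<omega> (of_nat (Suc N))"
 using van by (simp add: v_def del: of_nat_Suc)
 also have "... = c (Suc N) + (\<Sum>a\<le>N. coeff \<omega> a * c a)" using nv by (simp add: s_def del: of_nat_Suc)
 finally have 1: "(\<Sum>j\<le>Suc N. v j * poly \<omega> (of_nat j)) = c (Suc N) + (\<Sum>a\<le>N. coeff \<omega> a * c a)" .
 have "(\<Sum>j\<le>Suc N. v j * poly \<omega> (of_nat j)) = (\<Sum>j\<le>Suc N. \<Sum>a\<le>Suc N. coeff \<omega> a * (v j * of_nat j ^ a))"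
 unfolding poly_altdef deg sum_distrib_left by (intro sum.cong refl) (simp add: mult_ac del: of_nat_Suc)
 also have "... = (\<Sum>a\<le>Suc N. coeff \<omega> a * (\<Sum>j\<le>Suc N. v j * of_nat j ^ a))"
 by (subst sum.swap) (simp only: sum_distrib_left)
 also have "... = (\<Sum>a\<le>N. coeff \<omega> a * c a) + (\<Sum>j\<le>Suc N. v j * of_nat j ^ Suc N)"
 using low lc by (simp del: of_nat_Suc power_Suc)
 finally have top: "(\<Sum>j\<le>Suc N. v j * of_nat j ^ Suc N) = c (Suc N)" using 1 by simp
 show ?case
 by (intro exI[of _ v] allI impI) (use low top in \<open>auto simp: le_Suc_eq\<close>)
qed

lemma fps_nth_prod_cong:
 fixes F G :: "'i => 'a::comm_ring_1 fps"
 assumes "finite I" "!!i j. i \<in> I ==> j <= k ==> fps_nth (F i) j = fps_nth (G i) j"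
 shows "fps_nth (\<Prod>i\<in>I. F i) k = fps_nth (\<Prod>i\<in>I. G i) k"
 using assms
proof (induction I arbitrary: k rule: finite_induct)
 case (insert x I)
 have "fps_nth (F x * prod F I) k = fps_nth (G x * prod G I) k"
 unfolding fps_mult_nth using insert.IH insert.prems by (intro sum.cong refl) auto
 then show ?case using insert.hyps by simp
qed simp

text \<open>u acts as a signed distribution on B and p as a vector of independent samples from
  it.\<close>

definition fexp :: "'b set => ('b => complex) => (('i::finite => 'b) => complex) => complex" where
 "fexp B u F = (\<Sum>p\<in>PiE UNIV (%_. B). (\<Prod>i\<in>UNIV. u (p i)) * F p)"

lemma fps_const_prod: "(\<Prod>i\<in>I. fps_const (c i)) = fps_const (\<Prod>i\<in>I. c i :: 'a::comm_ring_1)"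
 by (induction I rule: infinite_finite_induct) auto

lemma fexp_fps:
 fixes G :: "'i::finite => 'b => complex fps"
 assumes "finite B"
 shows "fexp B u (%p. fps_nth (\<Prod>i\<in>UNIV. G i (p i)) k)
  = fps_nth (\<Prod>i\<in>UNIV. \<Sum>b\<in>B. fps_const (u b) * G i b) k"
proof -
 have "(\<Prod>i\<in>UNIV. \<Sum>b\<in>B. fps_const (u b) * G i b)
  = (\<Sum>p\<in>PiE UNIV (%_. B). \<Prod>i\<in>UNIV. fps_const (u (p i)) * G i (p i))"
 using assms by (subst prod_sum_PiE) auto
 also have "... = (\<Sum>p\<in>PiE UNIV (%_. B). fps_const (\<Prod>i\<in>UNIV. u (p i)) * (\<Prod>i\<in>UNIV. G i (p i)))"
 by (simp add: prod.distrib fps_const_prod)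
 finally show ?thesis by (simp add: fexp_def fps_sum_nth)
qed

lemma fps_exp_sum: "finite I ==> (\<Prod>i\<in>I. fps_exp (x i :: complex)) = fps_exp (\<Sum>i\<in>I. x i)"
 by (induction I rule: finite_induct) (auto simp: fps_exp_add_mult)

text \<open>The exponential generating series of a sum of independent variables is the product of
  those of the summands; the k-th moment is k! times its k-th coefficient.\<close>

lemma fexp_sum_power:
 fixes X :: "'i::finite => 'b => complex"
 assumes "finite B"
 shows "fexp B u (%p. (\<Oplus>i. X i (p i)) ^ k)
 = fact k * fps_nth (\<Prod>i\<in>UNIV. Abs_fps (%j. (\<Sum>b\<in>B. u b * X i b ^ j) / fact j)) k"
proof -
 have "fexp B u (%p. (\<Oplus>i. X i (p i)) ^ k)
  = fact k * fexp B u (%p. fps_nth (\<Prod>i\<in>UNIV. fps_exp (X i (p i))) k)"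
 unfolding fexp_def by (simp add: fps_exp_sum sum_distrib_left mult_ac)
 also have "fexp B u (%p. fps_nth (\<Prod>i\<in>UNIV. fps_exp (X i (p i))) k)
  = fps_nth (\<Prod>i\<in>UNIV. \<Sum>b\<in>B. fps_const (u b) * fps_exp (X i b)) k"
 by (rule fexp_fps[OF assms])
 also have "(%i. \<Sum>b\<in>B. fps_const (u b) * fps_exp (X i b)) = (%i. Abs_fps (%j. (\<Sum>b\<in>B. u b * X i b ^ j) / fact j))"
 by (simp add: fps_eq_iff fun_eq_iff fps_sum_nth sum_divide_distrib)
 finally show ?thesis .
qed

text \<open>The moments of a standard normal variable.\<close>

definition gmom :: "nat => real" where
 "gmom j = (if even j then fact j / (2 ^ (j div 2) * fact (j div 2)) else 0)"

text \<open>Averages of polynomials of degree at most N under these weights agree with Gaussian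
  averages. Being finite sums, they do not leave a linear space of functions.\<close>

definition gwt :: "nat => nat => real" where
 "gwt N = (SOME w. \<forall>a\<le>N. (\<Sum>j\<le>N. w j * of_nat j ^ a) = gmom a)"

lemma gwt: "a <= N ==> (\<Sum>j\<le>N. gwt N j * of_nat j ^ a) = gmom a"
 using someI_ex[OF moment_weights[of N gmom]] unfolding gwt_def by blast

definition gexp :: "nat => (('i::finite => nat) => complex) => complex" where
 "gexp N F = fexp {..N} (%j. of_real (gwt N j)) F"

lemma gwt_complex:
 assumes "a <= N" shows "(\<Sum>j\<le>N. cr (gwt N j) * of_nat j ^ a) = of_real (gmom a)"
 using arg_cong[OF gwt[OF assms], of cr] by simp

text \<open>A linear form in independent standard normal variables is normal with variance the sum
  of the (x i)^2; here this is the multiplicativity of the series G c = exp (c X^2 / 2), which holds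
  for complex x as well.\<close>

lemma gexp_linear_power:
 fixes x :: "'i::finite => complex"
 assumes "2 * k <= N"
 shows "gexp N (%p. (\<Oplus>i. of_nat (p i) * x i) ^ (2 * k)) = of_real (gmom (2 * k)) * (\<Oplus>i. (x i)\<^sup>2) ^ k"
proof -
 define G where "G c = fps_exp (c / 2 :: complex) oo fps_X ^ 2" for c
 have Gn: "fps_nth (G c) j = (if even j then (c / 2) ^ (j div 2) / fact (j div 2) else 0)" for c j
 unfolding G_def by (subst fps_nth_compose_X_power) auto
 have Gadd: "G (c + d) = G c * G d" for c d
 unfolding G_def by (simp add: add_divide_distrib fps_exp_add_mult fps_compose_mult_distrib)
 have Gprod: "finite I ==> (\<Prod>i\<in>I. G (y i)) = G (\<Sum>i\<in>I. y i)" for I and y :: "'i => complex"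
 proof (induction I rule: finite_induct)
 case empty
 have "G 0 = 1" by (simp add: G_def)
 then show ?case by simp
 qed (simp add: Gadd)
 have "gexp N (%p. (\<Oplus>i. of_nat (p i) * x i) ^ (2 * k))
  = fact (2 * k) * fps_nth (\<Prod>i\<in>UNIV. Abs_fps (%j. (\<Sum>b\<le>N. of_real (gwt N b) * (of_nat b * x i) ^ j) / fact j)) (2 * k)"
 unfolding gexp_def by (rule fexp_sum_power) simp
 also have "fps_nth (\<Prod>i\<in>UNIV. Abs_fps (%j. (\<Sum>b\<le>N. of_real (gwt N b) * (of_nat b * x i) ^ j) / fact j)) (2 * k)
  = fps_nth (\<Prod>i\<in>UNIV. G ((x i)\<^sup>2)) (2 * k)"
 proof (rule fps_nth_prod_cong)
 fix i :: 'i and j assume j: "j <= 2 * k"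
 have "(\<Sum>b\<le>N. cr (gwt N b) * (of_nat b * x i) ^ j) = (\<Sum>b\<le>N. cr (gwt N b) * of_nat b ^ j) * x i ^ j"
  by (simp add: power_mult_distrib sum_distrib_right mult.assoc)
 also have "... = of_real (gmom j) * x i ^ j"
  using gwt_complex[of j N] j assms by simp
 also have "... / fact j = fps_nth (G ((x i)\<^sup>2)) j"
  by (auto simp: gmom_def Gn power_divide power_mult[symmetric] elim!: evenE)
 finally show "fps_nth (Abs_fps (%j. (\<Sum>b\<le>N. of_real (gwt N b) * (of_nat b * x i) ^ j) / fact j)) j = fps_nth (G ((x i)\<^sup>2)) j"
  by simp
 qed simp
 also have "fact (2 * k) * ... = of_real (gmom (2 * k)) * (\<Oplus>i. (x i)\<^sup>2) ^ k"
 by (simp add: Gprod Gn gmom_def power_divide)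
 finally show ?thesis .
qed

text \<open>The coefficient of X^j in (1 - X)^(-1/2), that is binomial (2 j) j / 4^j.\<close>

definition hb :: "nat => real" where "hb j = fact (2 * j) / (4 ^ j * (fact j)\<^sup>2)"

text \<open>Coefficients of \<open>\<Prod>i. (1 - y i * X) powr (-1/2)\<close>.\<close>
definition qfps :: "('i::finite => complex) => complex fps" where
 "qfps y = (\<Prod>i\<in>UNIV. Abs_fps (%j. of_real (hb j) * y i ^ j))"

text \<open>For y i = (x i)^2 this is psi_k(x) / (4^k (k!)^2), since (2 \<beta>)! / (\<beta>!)^2 is
  4^k times a product of values of \<open>hb\<close>.\<close>

definition qpoly :: "nat => ('i::finite => complex) => complex" where
 "qpoly k y = fps_nth (qfps y) k"

lemma fps_nth_prod_scale:
 fixes F G :: "'i => 'a::comm_ring_1 fps"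
 assumes "finite I" "!!i k. i \<in> I ==> fps_nth (F i) k = c ^ k * fps_nth (G i) k"
 shows "fps_nth (\<Prod>i\<in>I. F i) k = c ^ k * fps_nth (\<Prod>i\<in>I. G i) k"
 using assms
proof (induction I arbitrary: k rule: finite_induct)
 case (insert x I)
 have "fps_nth (F x * prod F I) k = (\<Sum>j=0..k. (c ^ j * fps_nth (G x) j) * (c ^ (k - j) * fps_nth (prod G I) (k - j)))"
 unfolding fps_mult_nth using insert.IH insert.prems by (intro sum.cong refl) auto
 also have "... = (\<Sum>j=0..k. c ^ k * (fps_nth (G x) j * fps_nth (prod G I) (k - j)))"
 proof (intro sum.cong refl)
 fix j assume "j \<in> {0..k}"
 then have "c ^ k = c ^ j * c ^ (k - j)" by (simp flip: power_add)
 then show "(c ^ j * fps_nth (G x) j) * (c ^ (k - j) * fps_nth (prod G I) (k - j)) = c ^ k * (fps_nth (G x) j * fps_nth (prod G I) (k - j))"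
  by (simp add: mult_ac)
 qed
 finally show ?case using insert.hyps by (simp add: fps_mult_nth sum_distrib_left)
qed (cases "k = 0"; simp)

lemma qpoly_scale: "qpoly k (%i. c * y i) = c ^ k * qpoly k y"
 unfolding qpoly_def qfps_def by (rule fps_nth_prod_scale) (auto simp: power_mult_distrib)

text \<open>The moment generating function of a weighted sum of squares of normal variables is the
  product of the (1 - 2 y i t)^(-1/2); the factor 2 gives 2^k by homogeneity.\<close>

lemma gexp_quadratic_power:
 fixes y :: "'i::finite => complex"
 assumes "2 * k <= N"
 shows "gexp N (%p. (\<Oplus>i. y i * of_nat (p i) ^ 2) ^ k) = fact k * 2 ^ k * qpoly k y"
proof -
 have "gexp N (%p. (\<Oplus>i. y i * of_nat (p i) ^ 2) ^ k)
  = fact k * fps_nth (\<Prod>i\<in>UNIV. Abs_fps (%j. (\<Sum>b\<le>N. of_real (gwt N b) * (y i * of_nat b ^ 2) ^ j) / fact j)) k"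
 unfolding gexp_def by (rule fexp_sum_power) simp
 also have "fps_nth (\<Prod>i\<in>UNIV. Abs_fps (%j. (\<Sum>b\<le>N. of_real (gwt N b) * (y i * of_nat b ^ 2) ^ j) / fact j)) k
  = fps_nth (\<Prod>i\<in>UNIV. Abs_fps (%j. of_real (hb j) * (2 * y i) ^ j)) k"
 proof (rule fps_nth_prod_cong)
 fix i :: 'i and j assume j: "j <= k"
 have "(\<Sum>b\<le>N. cr (gwt N b) * (y i * of_nat b ^ 2) ^ j) = (\<Sum>b\<le>N. cr (gwt N b) * of_nat b ^ (2 * j)) * y i ^ j"
 proof -
  have "(y i * of_nat b ^ 2) ^ j = of_nat b ^ (2 * j) * y i ^ j" for b
  by (simp add: power_mult_distrib power_mult)
  then show ?thesis by (simp add: sum_distrib_right mult.assoc)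
 qed
 also have "... = of_real (gmom (2 * j)) * y i ^ j"
  using gwt_complex[of "2 * j" N] j assms by simp
 also have "... / fact j = of_real (gmom (2 * j) / fact j) * y i ^ j"
  by simp
 also have "gmom (2 * j) / fact j = hb j * 2 ^ j"
 proof -
  have "(4::real) ^ j = 2 ^ j * 2 ^ j" by (simp flip: power_mult_distrib)
  then show ?thesis by (simp add: gmom_def hb_def power2_eq_square)
 qed
 also have "of_real (hb j * 2 ^ j) * y i ^ j = of_real (hb j) * (2 * y i) ^ j"
  by (simp add: power_mult_distrib)
 finally show "fps_nth (Abs_fps (%j. (\<Sum>b\<le>N. of_real (gwt N b) * (y i * of_nat b ^ 2) ^ j) / fact j)) j
  = fps_nth (Abs_fps (%j. of_real (hb j) * (2 * y i) ^ j)) j"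
  by simp
 qed simp
 also have "... = qpoly k (%i. 2 * y i)" by (simp add: qpoly_def qfps_def)
 finally show ?thesis by (simp add: qpoly_scale)
qed

lemma hb_0 [simp]: "hb 0 = 1" by (simp add: hb_def)

lemma hb_Suc: "real (Suc j) * hb (Suc j) = (real j + 1/2) * hb j"
 by (simp add: hb_def power2_eq_square divide_simps) (simp add: algebra_simps)

lemma pochhammer_div_fact_Suc:
 "real (Suc k) * (pochhammer c (Suc k) / fact (Suc k)) = (real k + c) * (pochhammer c k / fact k)"
 by (simp add: pochhammer_rec' field_simps del: of_nat_Suc)

lemma hb_pochhammer: "hb j = pochhammer (1/2) j / fact j"
proof (induction j)
 case (Suc j)
 have "real (Suc j) * hb (Suc j) = real (Suc j) * (pochhammer (1/2) (Suc j) / fact (Suc j))"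
 unfolding hb_Suc Suc pochhammer_div_fact_Suc ..
 then show ?case by (metis mult_left_cancel of_nat_eq_0_iff nat.distinct(1))
qed simp

text \<open>Here \<open>qfps\<close> is (1 - X)^(- p / 2) with p the number of variables; the
  coefficients follow from its differential equation (1 - X) P' = (p / 2) P.\<close>

lemma qpoly_one: "qpoly k (%_::'i::finite. 1) = of_real (pochhammer (real CARD('i) / 2) k / fact k)"
proof -
 define S where "S = Abs_fps (%j. cr (hb j))"
 have S: "(1 - fps_X) * fps_deriv S = fps_const (1/2) * S"
 proof (rule fps_ext)
 fix j
 have *: "of_nat (Suc j) * cr (hb (Suc j)) = (of_nat j + 1/2) * of_real (hb j)" for j
  using arg_cong[OF hb_Suc[of j], of cr] by auto
 show "fps_nth ((1 - fps_X) * fps_deriv S) j = fps_nth (fps_const (1/2) * S) j"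
  using *[of j] by (cases j) (simp_all add: S_def left_diff_distrib algebra_simps)
 qed
 define P where "P = S ^ CARD('i)"
 have P: "(1 - fps_X) * fps_deriv P = fps_const (of_nat CARD('i) / 2) * P"
 proof -
 have "(1 - fps_X) * fps_deriv P = fps_const (of_nat CARD('i)) * S ^ (CARD('i) - 1) * ((1 - fps_X) * fps_deriv S)"
  unfolding P_def fps_deriv_power by (simp add: mult_ac fps_of_nat)
 also have "... = fps_const (of_nat CARD('i)) * fps_const (1/2) * (S ^ (CARD('i) - 1) * S)"
  unfolding S by (simp only: mult_ac)
 also have "S ^ (CARD('i) - 1) * S = P" unfolding P_def using power_minus_mult zero_less_card_finite by blast
 finally show ?thesis by simp
 qed
 have "fps_nth P k = of_real (pochhammer (real CARD('i) / 2) k / fact k)" for k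
 proof (induction k)
 case 0 show ?case by (simp add: P_def S_def fps_nth_power_0)
 next
 case (Suc k)
 have "fps_nth ((1 - fps_X) * fps_deriv P) k = of_nat (Suc k) * fps_nth P (Suc k) - of_nat k * fps_nth P k"
  by (cases k) (simp_all add: left_diff_distrib)
 then have "of_nat (Suc k) * fps_nth P (Suc k) = (of_nat k + of_nat CARD('i) / 2) * fps_nth P k"
  unfolding P by (simp add: algebra_simps)
 also have "... = of_nat (Suc k) * of_real (pochhammer (real CARD('i) / 2) (Suc k) / fact (Suc k))"
  unfolding Suc using arg_cong[OF pochhammer_div_fact_Suc[of k "real CARD('i) / 2", symmetric], of cr] by (metis (mono_tags, opaque_lifting) of_nat_numeral of_real_add of_real_divide of_real_mult of_real_of_nat_eq)
 finally show ?case by (metis mult_left_cancel of_nat_eq_0_iff nat.distinct(1))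
 qed
 then show ?thesis by (simp add: qpoly_def qfps_def P_def S_def)
qed

section \<open>Complex Gaussian averages of bilinear forms\<close>

text \<open>Polynomials in two variables of bounded degree together with their derivative in the second.\<close>
inductive bipoly :: "nat => (complex => complex => complex) => (complex => complex => complex) => bool" for d where
 mono: "a <= d ==> b <= d ==> bipoly d (%x y. x ^ a * y ^ b) (%x y. x ^ a * (of_nat b * y ^ (b - 1)))"
| add: "bipoly d f f' ==> bipoly d g g' ==> bipoly d (%x y. f x y + g x y) (%x y. f' x y + g' x y)"
| scale: "bipoly d f f' ==> bipoly d (%x y. c * f x y) (%x y. c * f' x y)"

lemma bipoly_cong: "bipoly d f f' ==> (!!x y. g x y = f x y) ==> (!!x y. g' x y = f' x y) ==> bipoly d g g'"
proof -
 assume "bipoly d f f'" "!!x y. g x y = f x y" "!!x y. g' x y = f' x y"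
 moreover from this have "g = f" by blast
 moreover from calculation have "g' = f'" by blast
 ultimately show ?thesis by simp
qed

lemma bipoly_mono: "bipoly d f f' ==> d <= e ==> bipoly e f f'"
proof (induction rule: bipoly.induct)
 case (mono a b)
 then show ?case by (intro bipoly.mono) auto
qed (rule bipoly.add bipoly.scale; simp)+

lemma bipoly_const: "bipoly d (%x y. c) (%x y. 0)"
 by (rule bipoly_cong[OF bipoly.scale[OF bipoly.mono[of 0 d 0], of c]]) auto

lemma bipoly_mult_x: "bipoly d f f' ==> bipoly (Suc d) (%x y. x * f x y) (%x y. x * f' x y)"
proof (induction rule: bipoly.induct)
 case (mono a b)
 show ?case by (rule bipoly_cong[OF bipoly.mono[of "Suc a" "Suc d" b]]) (use mono in auto)
next
 case (add f f' g g')
 show ?case by (rule bipoly_cong[OF bipoly.add[OF add.IH]]) (auto simp: algebra_simps)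
next
 case (scale f f' c)
 show ?case by (rule bipoly_cong[OF bipoly.scale[OF scale.IH, of c]]) (auto simp: algebra_simps)
qed

lemma bipoly_mult_y: "bipoly d f f' ==> bipoly (Suc d) (%x y. y * f x y) (%x y. f x y + y * f' x y)"
proof (induction rule: bipoly.induct)
 case (mono a b)
 show ?case
 proof (rule bipoly_cong[OF bipoly.mono[of a "Suc d" "Suc b"]])
 show "x ^ a * y ^ b + y * (x ^ a * (of_nat b * y ^ (b - 1))) = x ^ a * (of_nat (Suc b) * y ^ (Suc b - 1))" for x y :: complex
  by (cases b) (simp_all add: algebra_simps)
 qed (use mono in auto)
next
 case (add f f' g g')
 show ?case by (rule bipoly_cong[OF bipoly.add[OF add.IH]]) (auto simp: algebra_simps)
next
 case (scale f f' c)
 show ?case by (rule bipoly_cong[OF bipoly.scale[OF scale.IH, of c]]) (auto simp: algebra_simps)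
qed

lemma bipoly_mult_bilinear:
 assumes "bipoly d f f'"
 shows "bipoly (Suc (Suc d)) (%x y. (\<alpha> + \<beta> * x + \<gamma> * y + \<delta> * x * y) * f x y)
  (%x y. (\<gamma> + \<delta> * x) * f x y + (\<alpha> + \<beta> * x + \<gamma> * y + \<delta> * x * y) * f' x y)"
proof -
 have 0: "bipoly (Suc (Suc d)) f f'" by (rule bipoly_mono[OF assms]) simp
 have 1: "bipoly (Suc (Suc d)) (%x y. x * f x y) (%x y. x * f' x y)"
 by (rule bipoly_mono[OF bipoly_mult_x[OF assms]]) simp
 have 2: "bipoly (Suc (Suc d)) (%x y. y * f x y) (%x y. f x y + y * f' x y)"
 by (rule bipoly_mono[OF bipoly_mult_y[OF assms]]) simp
 have 3: "bipoly (Suc (Suc d)) (%x y. x * (y * f x y)) (%x y. x * (f x y + y * f' x y))"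
 by (rule bipoly_mult_x[OF bipoly_mult_y[OF assms]])
 show ?thesis
 by (rule bipoly_cong[OF bipoly.add[OF bipoly.scale[OF 0, of \<alpha>] bipoly.add[OF bipoly.scale[OF 1, of \<beta>]
   bipoly.add[OF bipoly.scale[OF 2, of \<gamma>] bipoly.scale[OF 3, of \<delta>]]]]]) (auto simp: algebra_simps)
qed

lemma bipoly_power_bilinear:
 shows "bipoly (2 * k) (%x y. (\<alpha> + \<beta> * x + \<gamma> * y + \<delta> * x * y) ^ k)
  (%x y. of_nat k * (\<alpha> + \<beta> * x + \<gamma> * y + \<delta> * x * y) ^ (k - 1) * (\<gamma> + \<delta> * x))"
proof (induction k)
 case 0
 show ?case by (rule bipoly_cong[OF bipoly_const]) auto
next
 case (Suc k)
 have e: "Suc (Suc (2 * k)) = 2 * Suc k" by simp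
 show ?case
 proof (rule bipoly_cong[OF bipoly_mult_bilinear[OF Suc, of \<alpha> \<beta> \<gamma> \<delta>, unfolded e]])
 fix x y
 define q where "q = \<alpha> + \<beta> * x + \<gamma> * y + \<delta> * x * y"
 show "of_nat (Suc k) * (\<alpha> + \<beta> * x + \<gamma> * y + \<delta> * x * y) ^ (Suc k - 1) * (\<gamma> + \<delta> * x) =
  (\<gamma> + \<delta> * x) * (\<alpha> + \<beta> * x + \<gamma> * y + \<delta> * x * y) ^ k +
  (\<alpha> + \<beta> * x + \<gamma> * y + \<delta> * x * y) * (of_nat k * (\<alpha> + \<beta> * x + \<gamma> * y + \<delta> * x * y) ^ (k - 1) * (\<gamma> + \<delta> * x))"
  unfolding q_def[symmetric] by (cases k) (simp_all add: algebra_simps)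
 qed simp
qed

text \<open>Summation against \<open>cwt N d\<close> extracts the coefficient of order d of a
  polynomial of degree at most N.\<close>

definition cwt :: "nat => nat => nat => real" where
 "cwt N d = (SOME w. \<forall>a\<le>N. (\<Sum>j\<le>N. w j * of_nat j ^ a) = (if a = d then 1 else 0))"

lemma cwt: "a <= N ==> (\<Sum>j\<le>N. cwt N d j * of_nat j ^ a) = (if a = d then 1 else 0)"
 using someI_ex[OF moment_weights[of N "%a. if a = d then 1 else 0"]] unfolding cwt_def by blast

text \<open>Weights on a finite grid with the moments \<open>x ^ a * y ^ b \<mapsto> \<delta>\<^sub>a\<^sub>b a!\<close>, \<open>a, b <= N\<close>, of a
 standard complex Gaussian variable \<open>x\<close> and its conjugate \<open>y\<close>.\<close>
definition wwt :: "nat => nat \<times> nat => real" where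
 "wwt N = (%(j, l). \<Sum>d\<le>N. fact d * cwt N d j * cwt N d l)"

lemma wwt_moment:
 assumes "a <= N" "b <= N"
 shows "(\<Sum>q\<in>{..N}\<times>{..N}. cr (wwt N q) * (of_nat (fst q) ^ a * of_nat (snd q) ^ b)) = (if a = b then fact a else 0)"
proof -
 have "(\<Sum>q\<in>{..N}\<times>{..N}. wwt N q * (of_nat (fst q) ^ a * of_nat (snd q) ^ b))
  = (\<Sum>j\<le>N. \<Sum>l\<le>N. \<Sum>d\<le>N. fact d * (cwt N d j * of_nat j ^ a) * (cwt N d l * of_nat l ^ b))"
 unfolding sum.cartesian_product' wwt_def prod.case fst_conv snd_conv sum_distrib_right
 by (intro sum.cong refl) (simp add: mult_ac)
 also have "... = (\<Sum>j\<le>N. \<Sum>d\<le>N. \<Sum>l\<le>N. fact d * (cwt N d j * of_nat j ^ a) * (cwt N d l * of_nat l ^ b))"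
 by (intro sum.cong refl sum.swap)
 also have "... = (\<Sum>d\<le>N. \<Sum>j\<le>N. \<Sum>l\<le>N. fact d * (cwt N d j * of_nat j ^ a) * (cwt N d l * of_nat l ^ b))"
 by (rule sum.swap)
 also have "... = (\<Sum>d\<le>N. fact d * (\<Sum>j\<le>N. cwt N d j * of_nat j ^ a) * (\<Sum>l\<le>N. cwt N d l * of_nat l ^ b))"
 by (simp only: sum_distrib_left[symmetric] sum_distrib_right[symmetric])
 also have "... = (\<Sum>d\<le>N. if d = a then (if a = b then fact a else 0) else 0)"
 by (intro sum.cong refl) (use assms in \<open>auto simp: cwt\<close>)
 also have "... = (if a = b then fact a else 0)" using assms by simp
 finally have "(\<Sum>q\<in>{..N}\<times>{..N}. wwt N q * (of_nat (fst q) ^ a * of_nat (snd q) ^ b)) = (if a = b then fact a else 0)" .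
 from arg_cong[OF this, of cr] show ?thesis by (simp add: if_distrib cong: if_cong)
qed

text \<open>Gaussian integration by parts: multiplying by x amounts to differentiating in the
  conjugate variable y. For the monomial with exponents a and b both sides are b! when b = a + 1 and
  0 otherwise. The condition d < N leaves room for the extra factor x.\<close>

lemma wwt_ibp:
 assumes "bipoly d f f'" "d < N"
 shows "(\<Sum>q\<in>{..N}\<times>{..N}. cr (wwt N q) * (of_nat (fst q) * f (of_nat (fst q)) (of_nat (snd q))))
 = (\<Sum>q\<in>{..N}\<times>{..N}. cr (wwt N q) * f' (of_nat (fst q)) (of_nat (snd q)))"
 using assms(1)
proof (induction rule: bipoly.induct)
 case (mono a b)
 have "(\<Sum>q\<in>{..N}\<times>{..N}. cr (wwt N q) * (of_nat (fst q) * (of_nat (fst q) ^ a * of_nat (snd q) ^ b)))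
  = (if Suc a = b then fact b else 0)"
 using wwt_moment[of "Suc a" N b] mono assms(2) by (simp add: mult_ac)
 also have "... = of_nat b * (if a = b - 1 then fact a else 0)" by (cases b) (auto)
 also have "... = (\<Sum>q\<in>{..N}\<times>{..N}. cr (wwt N q) * (of_nat (fst q) ^ a * (of_nat b * of_nat (snd q) ^ (b - 1))))"
 proof -
 have "(\<Sum>q\<in>{..N}\<times>{..N}. cr (wwt N q) * (of_nat (fst q) ^ a * (of_nat b * of_nat (snd q) ^ (b - 1))))
  = of_nat b * (\<Sum>q\<in>{..N}\<times>{..N}. cr (wwt N q) * (of_nat (fst q) ^ a * of_nat (snd q) ^ (b - 1)))"
  by (simp add: sum_distrib_left mult_ac)
 also have "(\<Sum>q\<in>{..N}\<times>{..N}. cr (wwt N q) * (of_nat (fst q) ^ a * of_nat (snd q) ^ (b - 1)))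
  = (if a = b - 1 then fact a else 0)"
  by (rule wwt_moment) (use mono assms(2) in auto)
 finally show ?thesis ..
 qed
 finally show ?case .
next
 case (add f f' g g')
 then show ?case by (simp add: distrib_left sum.distrib)
next
 case (scale f f' c)
 then show ?case by (simp add: mult.left_commute[of _ c] flip: sum_distrib_left)
qed

text \<open>\<eta> is a vector of independent complex Gaussian variables and \<xi> plays its
  conjugate, each pair of coordinates being one sample of \<open>wwt N\<close>.\<close>

definition cexp :: "nat => (('i::finite => complex) => ('i => complex) => complex) => complex" where
 "cexp N F = fexp ({..N}\<times>{..N}) (%q. of_real (wwt N q)) (%p. F (%i. of_nat (fst (p i))) (%i. of_nat (snd (p i))))"

lemma fexp_split:
 fixes i :: "'i::finite"
 shows "fexp B u F = (\<Sum>p\<in>PiE (UNIV - {i}) (%_. B). (\<Prod>j\<in>UNIV-{i}. u (p j)) * (\<Sum>b\<in>B. u b * F (p(i := b))))"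
proof -
 have U: "UNIV = insert i (UNIV - {i})" by auto
 have "fexp B u F = (\<Sum>p\<in>(%(y, g). g(i := y)) ` (B \<times> PiE (UNIV - {i}) (%_. B)). (\<Prod>j\<in>UNIV. u (p j)) * F p)"
 unfolding fexp_def by (subst U, subst PiE_insert_eq) simp
 also have "... = (\<Sum>(b, p)\<in>B \<times> PiE (UNIV - {i}) (%_. B). (\<Prod>j\<in>UNIV. u ((p(i := b)) j)) * F (p(i := b)))"
 by (subst sum.reindex[OF inj_combinator[of i "UNIV - {i}" "%_. B"]]) (simp_all add: case_prod_unfold comp_def)
 also have "... = (\<Sum>(b, p)\<in>B \<times> PiE (UNIV - {i}) (%_. B). (\<Prod>j\<in>UNIV-{i}. u (p j)) * (u b * F (p(i := b))))"
 proof (rule sum.cong[OF refl], clarify)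
 fix b p
 have "(\<Prod>j\<in>UNIV. u ((p(i := b)) j)) = u b * (\<Prod>j\<in>UNIV-{i}. u (p j))"
  by (subst prod.remove[of UNIV i]) auto
 then show "(\<Prod>j\<in>UNIV. u ((p(i := b)) j)) * F (p(i := b)) = (\<Prod>j\<in>UNIV - {i}. u (p j)) * (u b * F (p(i := b)))"
  by simp
 qed
 also have "... = (\<Sum>p\<in>PiE (UNIV - {i}) (%_. B). \<Sum>b\<in>B. (\<Prod>j\<in>UNIV-{i}. u (p j)) * (u b * F (p(i := b))))"
 by (subst sum.cartesian_product[symmetric], subst sum.swap) simp
 finally show ?thesis by (simp add: sum_distrib_left)
qed

lemma cexp_ibp:
 fixes i :: "'i::finite"
 assumes P: "!!\<eta> \<xi>. bipoly d (%x y. P (\<eta>(i := x)) (\<xi>(i := y))) (%x y. D (\<eta>(i := x)) (\<xi>(i := y)))" and d: "d < N"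
 shows "cexp N (%\<eta> \<xi>. \<eta> i * P \<eta> \<xi>) = cexp N D"
proof -
 have *: "(%j. of_nat (fst ((p(i := b)) j))) = (%j. complex_of_nat (fst (p j)))(i := of_nat (fst b))"
   "(%j. of_nat (snd ((p(i := b)) j))) = (%j. complex_of_nat (snd (p j)))(i := of_nat (snd b))" for p b
 by auto
 show ?thesis
 unfolding cexp_def by (subst (1 2) fexp_split[of _ _ _ i]) (simp only: * fun_upd_same wwt_ibp[OF P d])
qed

lemma cexp_sum: "cexp N (%\<eta> \<xi>. \<Sum>i\<in>I. F i \<eta> \<xi>) = (\<Sum>i\<in>I. cexp N (F i))"
 unfolding cexp_def fexp_def sum_distrib_left by (rule sum.swap)

lemma cexp_add: "cexp N (%\<eta> \<xi>. F \<eta> \<xi> + G \<eta> \<xi>) = cexp N F + cexp N G"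
 by (simp add: cexp_def fexp_def distrib_left sum.distrib)

lemma cexp_scale: "cexp N (%\<eta> \<xi>. c * F \<eta> \<xi>) = c * cexp N F"
 by (simp add: cexp_def fexp_def sum_distrib_left mult_ac)

lemma cexp_one: "cexp N (%(\<eta> :: 'i::finite => complex) \<xi>. 1) = 1"
proof -
 have "(\<Sum>q\<in>{..N}\<times>{..N}. cr (wwt N q)) = 1" using wwt_moment[of 0 N 0] by simp
 moreover have "cexp N (%(\<eta> :: 'i => complex) \<xi>. 1) = (\<Prod>i\<in>(UNIV::'i set). \<Sum>q\<in>{..N}\<times>{..N}. cr (wwt N q))"
 unfolding cexp_def fexp_def by (subst prod_sum_PiE) auto
 ultimately show ?thesis by simp
qed

definition bil :: "complex^'n^'n => ('n => complex) => ('n => complex) => complex" where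
 "bil A \<eta> \<xi> = (\<Oplus>i. \<Oplus>j. \<eta> i * A $ i $ j * \<xi> j)"

lemma sum_upd:
 fixes g :: "'n::finite => complex"
 shows "(\<Oplus>j. g j * (\<xi>(i := y)) j) = (\<Sum>j\<in>UNIV-{i}. g j * \<xi> j) + g i * y"
 by (subst sum.remove[of UNIV i]) auto

lemma bil_upd:
 fixes A :: "complex^'n^'n"
 shows "bil A (\<eta>(i := x)) (\<xi>(i := y)) =
 (\<Sum>r\<in>UNIV-{i}. \<Sum>c\<in>UNIV-{i}. A $ r $ c * \<xi> c * \<eta> r) + (\<Sum>c\<in>UNIV-{i}. A $ i $ c * \<xi> c) * x
 + (\<Sum>r\<in>UNIV-{i}. A $ r $ i * \<eta> r) * y + A $ i $ i * x * y"
proof -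
 have "bil A (\<eta>(i := x)) (\<xi>(i := y)) = (\<Oplus>r. (\<Oplus>c. A $ r $ c * (\<xi>(i := y)) c) * (\<eta>(i := x)) r)"
 unfolding bil_def sum_distrib_right by (intro sum.cong refl) (simp only: mult_ac)
 also have "... = (\<Sum>r\<in>UNIV-{i}. ((\<Sum>c\<in>UNIV-{i}. A $ r $ c * \<xi> c) + A $ r $ i * y) * \<eta> r) + ((\<Sum>c\<in>UNIV-{i}. A $ i $ c * \<xi> c) + A $ i $ i * y) * x"
 unfolding sum_upd ..
 also have "(\<Sum>r\<in>UNIV-{i}. ((\<Sum>c\<in>UNIV-{i}. A $ r $ c * \<xi> c) + A $ r $ i * y) * \<eta> r)
  = (\<Sum>r\<in>UNIV-{i}. \<Sum>c\<in>UNIV-{i}. A $ r $ c * \<xi> c * \<eta> r) + (\<Sum>r\<in>UNIV-{i}. A $ r $ i * \<eta> r) * y"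
 proof -
 have "((\<Sum>c\<in>UNIV-{i}. A $ r $ c * \<xi> c) + A $ r $ i * y) * \<eta> r = (\<Sum>c\<in>UNIV-{i}. A $ r $ c * \<xi> c * \<eta> r) + A $ r $ i * \<eta> r * y" for r
  by (simp only: distrib_right sum_distrib_right mult.assoc mult.commute[of y])
 then show ?thesis by (simp only: sum.distrib sum_distrib_right[of _ _ y])
 qed
 finally show ?thesis by (simp only: distrib_right distrib_left mult_ac add_ac)
qed

text \<open>Integration by parts in each \<eta> i of the factor \<open>bil B\<close>.
  Differentiating the linear form of row i of B in \<xi> i produces the trace of B; differentiating
  the power of \<open>bil A\<close> produces the form of the product matrix.\<close>

lemma bil_power_rec:
 fixes A B :: "complex^'n^'n"
 assumes N: "2 * k + 2 < N"
 shows "cexp N (%\<eta> \<xi>. bil B \<eta> \<xi> * bil A \<eta> \<xi> ^ k)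
  = mtr B * cexp N (%\<eta> \<xi>. bil A \<eta> \<xi> ^ k) + of_nat k * cexp N (%\<eta> \<xi>. bil (A ** B) \<eta> \<xi> * bil A \<eta> \<xi> ^ (k - 1))"
proof -
 define P where "P i \<eta> \<xi> = (\<Oplus>j. B $ i $ j * \<xi> j) * bil A \<eta> \<xi> ^ k" for i \<eta> \<xi>
 define D where "D i \<eta> \<xi> = B $ i $ i * bil A \<eta> \<xi> ^ k
  + (\<Oplus>j. B $ i $ j * \<xi> j) * (of_nat k * bil A \<eta> \<xi> ^ (k - 1) * (\<Oplus>r. A $ r $ i * \<eta> r))" for i \<eta> \<xi>
 have bp: "bipoly (2 * k + 2) (%x y. P i (\<eta>(i := x)) (\<xi>(i := y))) (%x y. D i (\<eta>(i := x)) (\<xi>(i := y)))" for i \<eta> \<xi>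
 proof -
 define p1 where "p1 = (\<Sum>r\<in>UNIV-{i}. \<Sum>c\<in>UNIV-{i}. A $ r $ c * \<xi> c * \<eta> r)"
 define p2 where "p2 = (\<Sum>c\<in>UNIV-{i}. A $ i $ c * \<xi> c)"
 define p3 where "p3 = (\<Sum>r\<in>UNIV-{i}. A $ r $ i * \<eta> r)"
 define p4 where "p4 = (\<Sum>j\<in>UNIV-{i}. B $ i $ j * \<xi> j)"
 have b: "bil A (\<eta>(i := x)) (\<xi>(i := y)) = p1 + p2 * x + p3 * y + A $ i $ i * x * y" for x y
  unfolding bil_upd p1_def p2_def p3_def ..
 have l: "(\<Oplus>j. B $ i $ j * (\<xi>(i := y)) j) = p4 + B $ i $ i * y" for y
  unfolding p4_def by (rule sum_upd)
 have r: "(\<Oplus>r. A $ r $ i * (\<eta>(i := x)) r) = p3 + A $ i $ i * x" for x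
  unfolding p3_def by (rule sum_upd)
 have e: "Suc (Suc (2 * k)) = 2 * k + 2" by simp
 show ?thesis
  by (rule bipoly_cong[OF bipoly_mult_bilinear[OF bipoly_power_bilinear, of k p4 0 "B $ i $ i" 0 p1 p2 p3 "A $ i $ i", unfolded e]])
  (simp_all only: P_def D_def b l r mult_zero_left add_0_right mult.assoc mult_1_left)
 qed
 have "cexp N (%\<eta> \<xi>. bil B \<eta> \<xi> * bil A \<eta> \<xi> ^ k) = cexp N (%\<eta> \<xi>. \<Oplus>i. \<eta> i * P i \<eta> \<xi>)"
 unfolding P_def bil_def[of B] by (simp add: sum_distrib_left sum_distrib_right mult_ac)
 also have "... = (\<Oplus>i. cexp N (D i))"
 unfolding cexp_sum by (intro sum.cong refl cexp_ibp[OF bp N])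
 also have "... = cexp N (%\<eta> \<xi>. mtr B * bil A \<eta> \<xi> ^ k + of_nat k * (bil (A ** B) \<eta> \<xi> * bil A \<eta> \<xi> ^ (k - 1)))"
 proof -
 have "(\<Oplus>i. D i \<eta> \<xi>) = mtr B * bil A \<eta> \<xi> ^ k + of_nat k * (bil (A ** B) \<eta> \<xi> * bil A \<eta> \<xi> ^ (k - 1))" for \<eta> \<xi>
 proof -
  have "bil (A ** B) \<eta> \<xi> = (\<Oplus>r. \<Oplus>j. \<Oplus>i. B $ i $ j * \<xi> j * (A $ r $ i * \<eta> r))"
  unfolding bil_def matrix_matrix_mult_def by (simp add: sum_distrib_left sum_distrib_right mult_ac)
  also have "... = (\<Oplus>i. \<Oplus>j. \<Oplus>r. B $ i $ j * \<xi> j * (A $ r $ i * \<eta> r))"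
  by (subst sum.swap, subst (2) sum.swap, subst sum.swap) simp
  also have "... = (\<Oplus>i. (\<Oplus>j. B $ i $ j * \<xi> j) * (\<Oplus>r. A $ r $ i * \<eta> r))"
  by (simp add: sum_product)
  finally have b: "bil (A ** B) \<eta> \<xi> = (\<Oplus>i. (\<Oplus>j. B $ i $ j * \<xi> j) * (\<Oplus>r. A $ r $ i * \<eta> r))" .
  have "(\<Oplus>i. X i * (c * Y i)) = c * (\<Oplus>i. X i * Y i)" for X Y :: "'n => complex" and c
  by (simp add: sum_distrib_left mult.left_commute)
  then have "(\<Oplus>i. D i \<eta> \<xi>) = (\<Oplus>i. B $ i $ i * bil A \<eta> \<xi> ^ k) + (of_nat k * bil A \<eta> \<xi> ^ (k - 1)) *
   (\<Oplus>i. (\<Oplus>j. B $ i $ j * \<xi> j) * (\<Oplus>r. A $ r $ i * \<eta> r))"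
  by (simp only: D_def sum.distrib)
  then show ?thesis unfolding mtr_def b sum_distrib_right[of _ _ "bil A \<eta> \<xi> ^ k"] by (simp only: mult.assoc mult.commute[of "bil A \<eta> \<xi> ^ (k - 1)"])
 qed
 then show ?thesis by (simp flip: cexp_sum)
 qed
 finally show ?thesis by (simp add: cexp_add cexp_scale)
qed

text \<open>h k is the coefficient of t^k in the Gaussian average of exp (t * bil A), formally 1 /
  det (1 - t A). Iterating \<open>bil_power_rec\<close> from B = A peels off one trace of a power of
  A at each step, and this is Newton's recursion of \<open>inverse_det_fps\<close>.\<close>

lemma bil_moments_newton:
 fixes A :: "complex^'n^'n"
 assumes N: "2 * k + 2 < N"
 defines "h \<equiv> %k. cexp N (%\<eta> \<xi>. bil A \<eta> \<xi> ^ k) / fact k"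
 shows "of_nat (Suc k) * h (Suc k) = (\<Sum>j\<le>k. mtr (mpow A (Suc j)) * h (k - j))"
proof -
 \<comment> \<open>Generalised to a first factor A^(i + 1), because each integration by parts raises
   this power.\<close>
 have "cexp N (%\<eta> \<xi>. bil (mpow A (Suc i)) \<eta> \<xi> * bil A \<eta> \<xi> ^ l) / fact l = (\<Sum>j\<le>l. mtr (mpow A (Suc (i + j))) * h (l - j))" if "l <= k" for i l
 using that
 proof (induction l arbitrary: i)
 case 0
 then show ?case using bil_power_rec[of 0 N "mpow A (Suc i)" A] N by (simp add: h_def cexp_one)
 next
 case (Suc l)
 have N': "2 * Suc l + 2 < N" using Suc.prems N by simp
 have "cexp N (%\<eta> \<xi>. bil (mpow A (Suc i)) \<eta> \<xi> * bil A \<eta> \<xi> ^ Suc l) / fact (Suc l)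
  = mtr (mpow A (Suc i)) * h (Suc l) + of_nat (Suc l) * cexp N (%\<eta> \<xi>. bil (mpow A (Suc (Suc i))) \<eta> \<xi> * bil A \<eta> \<xi> ^ l) / fact (Suc l)"
  using bil_power_rec[OF N', of "mpow A (Suc i)" A] unfolding h_def by (simp add: add_divide_distrib del: of_nat_Suc fact_Suc)
 also have "of_nat (Suc l) * cexp N (%\<eta> \<xi>. bil (mpow A (Suc (Suc i))) \<eta> \<xi> * bil A \<eta> \<xi> ^ l) / fact (Suc l)
  = cexp N (%\<eta> \<xi>. bil (mpow A (Suc (Suc i))) \<eta> \<xi> * bil A \<eta> \<xi> ^ l) / fact l"
  by (simp add: fact_Suc del: of_nat_Suc mpow.simps)
 also have "... = (\<Sum>j\<le>l. mtr (mpow A (Suc (Suc i + j))) * h (l - j))" by (rule Suc.IH) (use Suc.prems in simp)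
 finally show ?case unfolding sum.atMost_Suc_shift[of _ l] by simp
 qed
 from this[of k 0]
 have "cexp N (%\<eta> \<xi>. bil A \<eta> \<xi> * bil A \<eta> \<xi> ^ k) / fact k = (\<Sum>j\<le>k. mtr (mpow A (Suc j)) * h (k - j))" by simp
 moreover have "of_nat (Suc k) * h (Suc k) = cexp N (%\<eta> \<xi>. bil A \<eta> \<xi> * bil A \<eta> \<xi> ^ k) / fact k"
 unfolding h_def by (simp add: fact_Suc del: of_nat_Suc)
 ultimately show ?thesis by simp
qed

section \<open>Growth of the gamma function and integrability\<close>

text \<open>|Gamma (x + i y)| / Gamma x is a limit of products of the factors (x + k) / |x + k + i
  y|, and each of these increases with x. This carries decay on a line far to the right back to all
  smaller positive x.\<close>

lemma Gamma_ratio_mono: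
 fixes x X y :: real
 assumes x: "0 < x" "x <= X"
 shows "cmod (Gamma (Complex x y)) / Gamma x <= cmod (Gamma (Complex X y)) / Gamma X"
proof -
 define r where "r x k = (x + real k) / cmod (Complex x y + of_nat k)" for x k
 have rmono: "0 <= r x k \<and> r x k <= r X k" for k
 proof -
 define u v where "u = x + real k" and "v = X + real k"
 have uv: "0 < u" "u <= v" using x by (auto simp: u_def v_def)
 have n: "cmod (Complex x y + of_nat k) = sqrt (u\<^sup>2 + y\<^sup>2)" "cmod (Complex X y + of_nat k) = sqrt (v\<^sup>2 + y\<^sup>2)"
  by (simp_all add: cmod_def u_def v_def)
 have p: "0 < sqrt (u\<^sup>2 + y\<^sup>2)" "0 < sqrt (v\<^sup>2 + y\<^sup>2)" using uv by (auto simp: add_pos_nonneg)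
 have "u * sqrt (v\<^sup>2 + y\<^sup>2) = sqrt (u\<^sup>2 * (v\<^sup>2 + y\<^sup>2))" using uv by (simp add: real_sqrt_mult)
 also have "... <= sqrt (v\<^sup>2 * (u\<^sup>2 + y\<^sup>2))"
 proof (rule real_sqrt_le_mono)
  have "u\<^sup>2 * y\<^sup>2 <= v\<^sup>2 * y\<^sup>2" using uv by (intro mult_right_mono power_mono) auto
  then show "u\<^sup>2 * (v\<^sup>2 + y\<^sup>2) <= v\<^sup>2 * (u\<^sup>2 + y\<^sup>2)" by (simp add: algebra_simps)
 qed
 also have "... = v * sqrt (u\<^sup>2 + y\<^sup>2)" using uv by (simp add: real_sqrt_mult)
 finally have "u / sqrt (u\<^sup>2 + y\<^sup>2) <= v / sqrt (v\<^sup>2 + y\<^sup>2)" using p by (simp add: field_simps)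
 then show ?thesis unfolding r_def n u_def[symmetric] v_def[symmetric] using uv p by auto
 qed
 have ser: "cmod (Gamma_series (Complex t y) n) / Gamma_series t n = (\<Prod>k<Suc n. r t k)" if t: "0 < t" and n: "n > 0" for t n
 proof -
 have 1: "cmod (pochhammer (Complex t y) (n + 1)) = (\<Prod>k<Suc n. cmod (Complex t y + of_nat k))"
  by (simp add: pochhammer_prod prod_norm atLeast0LessThan)
 have 2: "pochhammer t (n + 1) = (\<Prod>k<Suc n. t + real k)"
  by (simp add: pochhammer_prod atLeast0LessThan)
 have 3: "cmod (exp (Complex t y * of_real (ln (real n)))) = exp (t * ln (real n))" by simp
 have 4: "(\<Prod>k<Suc n. t + real k) > 0" using t by (intro prod_pos) auto
 have 5: "cmod (Gamma_series (Complex t y) n) = fact n * exp (t * ln (real n)) / (\<Prod>k<Suc n. cmod (Complex t y + of_nat k))"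
  unfolding Gamma_series_def norm_divide norm_mult 1 3 norm_fact ..
 have 6: "Gamma_series t n = fact n * exp (t * ln (real n)) / (\<Prod>k<Suc n. t + real k)"
  unfolding Gamma_series_def 2 by simp
 have "cmod (Gamma_series (Complex t y) n) / Gamma_series t n = (\<Prod>k<Suc n. t + real k) / (\<Prod>k<Suc n. cmod (Complex t y + of_nat k))"
  unfolding 5 6 using 4 by (simp del: prod.lessThan_Suc)
 then show ?thesis by (simp add: r_def prod_dividef del: prod.lessThan_Suc)
 qed
 have "(%n. cmod (Gamma_series (Complex t y) n) / Gamma_series t n) \<longlonglongrightarrow> cmod (Gamma (Complex t y)) / Gamma t" if "0 < t" for t
 using that by (intro tendsto_intros) (auto simp: Gamma_eq_zero_iff elim!: nonpos_Ints_cases)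
 note lim = this[OF x(1)] this[of X]
 have "\<exists>N. \<forall>n\<ge>N. cmod (Gamma_series (Complex x y) n) / Gamma_series x n <= cmod (Gamma_series (Complex X y) n) / Gamma_series X n"
 proof (intro exI[of _ 1] allI impI)
 fix n :: nat assume "1 <= n"
 then show "cmod (Gamma_series (Complex x y) n) / Gamma_series x n <= cmod (Gamma_series (Complex X y) n) / Gamma_series X n"
  using x rmono by (subst (1 2) ser) (auto intro!: prod_mono simp del: prod.lessThan_Suc)
 qed
 then show ?thesis using LIMSEQ_le[OF lim] x by auto
qed

lemma div_sinh_le:
 fixes u :: real
 assumes "u > 0" shows "u / sinh u <= (1 + 2 * u) * exp (- u)"
proof -
 have s: "sinh u > 0" using assms by simp
 have "(1 + 2 * u) * exp (- (2 * u)) <= exp (2 * u) * exp (- (2 * u))"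
 using exp_ge_add_one_self[of "2 * u"] by (intro mult_right_mono) auto
 then have "(1 + 2 * u) * exp (- (2 * u)) <= 1" by (simp flip: exp_add)
 then have "2 * u <= (1 + 2 * u) * (1 - exp (- (2 * u)))" by (simp add: algebra_simps)
 also have "... = 2 * ((1 + 2 * u) * exp (- u) * sinh u)"
 proof -
 have "exp (- u) * sinh u = (1 - exp (- (2 * u))) / 2"
  by (simp add: sinh_field_def right_diff_distrib flip: exp_add)
 then show ?thesis by (simp add: mult.assoc)
 qed
 finally show ?thesis using s by (simp add: field_simps)
qed

text \<open>The reflection formula gives |Gamma (1 + i y)|^2 = pi y / sinh (pi y) for y different
  from 0.\<close>

lemma Gamma_one_imag_bound: "(cmod (Gamma (Complex 1 y)))\<^sup>2 <= (1 + 2 * (pi * \<bar>y\<bar>)) * ep y"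
proof (cases "y = 0")
 case False
 have c: "cmod (Gamma (cnj z)) = cmod (Gamma z)" for z
 by (simp flip: cnj_Gamma)
 have eq: "(cmod (Gamma (Complex 1 y)))\<^sup>2 = pi * \<bar>y\<bar> / sinh (pi * \<bar>y\<bar>)"
 proof -
 define z where "z = Complex 0 y"
 have z: "z ~= 0" using False by (simp add: z_def complex_eq_iff)
 have "z \<notin> \<int>\<^sub>\<le>\<^sub>0" using False by (auto simp: z_def complex_eq_iff elim!: nonpos_Ints_cases)
 then have "Gamma (1 + z) = z * Gamma z" by (subst add.commute) (rule Gamma_plus1)
 then have "Gamma (1 + z) * Gamma (1 - z) = z * (of_real pi / sin (of_real pi * z))"
  using Gamma_reflection_complex[of z] by (simp add: mult.assoc)
 moreover have "1 + z = Complex 1 y" "1 - z = cnj (Complex 1 y)" by (simp_all add: z_def complex_eq_iff)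
 ultimately have "cmod (Gamma (Complex 1 y)) * cmod (Gamma (cnj (Complex 1 y))) = cmod z * (pi / cmod (sin (of_real pi * z)))"
  by (metis norm_divide norm_mult norm_of_real abs_of_pos pi_gt_zero)
 moreover have "cmod z = \<bar>y\<bar>" by (simp add: z_def cmod_def)
 moreover have "cmod (sin (of_real pi * z)) = sinh (pi * \<bar>y\<bar>)"
 proof -
  have "of_real pi * z = \<i> * of_real (pi * y)" by (simp add: z_def complex_eq_iff)
  then have "sin (of_real pi * z) = \<i> * sinh (of_real (pi * y))"
  by (simp add: sinh_conv_sin del: of_real_mult)
  also have "sinh (of_real (pi * y)) = cr (sinh (pi * y))"
  by (simp add: sinh_field_def exp_of_real flip: of_real_minus del: of_real_mult)
  finally show ?thesis by (cases "y \<ge> 0") (auto simp: norm_mult abs_if mult_less_0_iff)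
 qed
 ultimately show ?thesis by (simp add: c power2_eq_square)
 qed
 show ?thesis unfolding eq by (rule div_sinh_le) (use False in auto)
qed (simp add: complex_eq_iff flip: one_complex.code)

lemma Gamma_nat_imag_bound:
 "cmod (Gamma (Complex (real (Suc P)) y)) <= (real (Suc P) + \<bar>y\<bar>) ^ P * cmod (Gamma (Complex 1 y))"
proof (induction P)
 case (Suc P)
 have "Complex (real (Suc (Suc P))) y = Complex (real (Suc P)) y + 1" by (simp add: complex_eq_iff)
 moreover have "Gamma (Complex (real (Suc P)) y + 1) = Complex (real (Suc P)) y * Gamma (Complex (real (Suc P)) y)"
 by (rule Gamma_plus1) (auto simp: complex_eq_iff elim!: nonpos_Ints_cases)
 ultimately have "cmod (Gamma (Complex (real (Suc (Suc P))) y)) = cmod (Complex (real (Suc P)) y) * cmod (Gamma (Complex (real (Suc P)) y))"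
 by (simp add: norm_mult)
 also have "... <= (real (Suc (Suc P)) + \<bar>y\<bar>) * ((real (Suc (Suc P)) + \<bar>y\<bar>) ^ P * cmod (Gamma (Complex 1 y)))"
 proof (intro mult_mono)
 show "cmod (Complex (real (Suc P)) y) <= real (Suc (Suc P)) + \<bar>y\<bar>"
  using cmod_le[of "Complex (real (Suc P)) y"] by simp
 show "cmod (Gamma (Complex (real (Suc P)) y)) <= (real (Suc (Suc P)) + \<bar>y\<bar>) ^ P * cmod (Gamma (Complex 1 y))"
  by (rule order_trans[OF Suc]) (intro mult_right_mono power_mono; simp)
 qed auto
 finally show ?case by (simp add: mult.assoc)
qed simp

text \<open>\<open>Gamma_ratio_mono\<close> compares the strip with the line Re = Q at an integer Q
  beyond X; the functional equation leads from there to Re = 1, where the reflection formula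
  applies. The exponent pi |y| / 2 is half of that in \<open>Gamma_one_imag_bound\<close>, which
  bounds a square.\<close>

lemma Gamma_decay:
 fixes x0 X :: real
 assumes "0 < x0"
 shows "\<exists>C K. 0 <= C \<and> (\<forall>x y. x0 <= x --> x <= X --> cmod (Gamma (Complex x y)) <= C * (br y) ^ K * exp (- (pi * \<bar>y\<bar> / 2)))"
proof -
 obtain P where P: "X < real P" using reals_Archimedean2 by blast
 define Q where "Q = real (Suc P)"
 have "continuous_on {x0..X} (Gamma :: real => real)"
 by (rule continuous_on_Gamma) (use assms in \<open>auto elim!: nonpos_Ints_cases\<close>)
 then have "bounded ((Gamma :: real => real) ` {x0..X})"
 by (intro compact_imp_bounded compact_continuous_image) auto
 then obtain M where M: "!!x. x \<in> {x0..X} ==> \<bar>Gamma x :: real\<bar> <= M"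
 unfolding bounded_iff by force
 have GQ: "Gamma Q > 0" by (simp add: Q_def Gamma_real_pos)
 define C where "C = \<bar>M\<bar> / Gamma Q * (Q ^ P * (1 + 2 * pi))"
 have "cmod (Gamma (Complex x y)) <= C * (br y) ^ Suc P * exp (- (pi * \<bar>y\<bar> / 2))" if x: "x0 <= x" "x <= X" for x y
 proof -
 have x0: "x > 0" using x assms by simp
 have "cmod (Gamma (Complex x y)) / Gamma x <= cmod (Gamma (Complex Q y)) / Gamma Q"
  by (rule Gamma_ratio_mono) (use x0 x P in \<open>auto simp: Q_def\<close>)
 then have "cmod (Gamma (Complex x y)) <= Gamma x / Gamma Q * cmod (Gamma (Complex Q y))"
  using Gamma_real_pos[OF x0] by (simp add: field_simps)
 also have "... <= \<bar>M\<bar> / Gamma Q * cmod (Gamma (Complex Q y))"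
  using M[of x] x GQ by (intro mult_right_mono divide_right_mono) auto
 finally have A: "cmod (Gamma (Complex x y)) <= \<bar>M\<bar> / Gamma Q * cmod (Gamma (Complex Q y))" .
 have "cmod (Gamma (Complex Q y)) <= (Q + \<bar>y\<bar>) ^ P * cmod (Gamma (Complex 1 y))"
  unfolding Q_def by (rule Gamma_nat_imag_bound)
 also have "... <= (Q * (br y)) ^ P * ((1 + 2 * pi) * (br y) * exp (- (pi * \<bar>y\<bar> / 2)))"
 proof (intro mult_mono power_mono)
  show "Q + \<bar>y\<bar> <= Q * (br y)" by (simp add: Q_def algebra_simps)
  have "(cmod (Gamma (Complex 1 y)))\<^sup>2 <= ((1 + 2 * pi) * (br y)) * ep y"
  by (rule order_trans[OF Gamma_one_imag_bound]) (intro mult_right_mono, simp_all add: algebra_simps)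
  also have "... <= ((1 + 2 * pi) * (br y))\<^sup>2 * ep y"
  proof (intro mult_right_mono)
  have "1 * 1 <= (1 + 2 * pi) * (br y)" by (intro mult_mono) auto
  then show "(1 + 2 * pi) * (br y) <= ((1 + 2 * pi) * (br y))\<^sup>2" by (intro self_le_power) auto
  qed auto
  also have "... = ((1 + 2 * pi) * (br y) * exp (- (pi * \<bar>y\<bar> / 2)))\<^sup>2"
  by (simp add: power_mult_distrib flip: exp_double)
  finally show "cmod (Gamma (Complex 1 y)) <= (1 + 2 * pi) * (br y) * exp (- (pi * \<bar>y\<bar> / 2))"
  by (rule power2_le_imp_le) simp
 qed (auto simp: Q_def)
 finally have "\<bar>M\<bar> / Gamma Q * cmod (Gamma (Complex Q y)) <= \<bar>M\<bar> / Gamma Q * ((Q * (br y)) ^ P * ((1 + 2 * pi) * (br y) * exp (- (pi * \<bar>y\<bar> / 2))))"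
  using GQ by (intro mult_left_mono) auto
 also have "... = C * (br y) ^ Suc P * exp (- (pi * \<bar>y\<bar> / 2))"
  by (simp add: C_def power_mult_distrib)
 finally show ?thesis using A by linarith
 qed
 moreover have "C \<ge> 0" using GQ by (simp add: C_def Q_def)
 ultimately show ?thesis by blast
qed

lemma integrable_exp_abs:
 fixes c :: real assumes c: "c > 0"
 shows "integrable lborel (%y. exp (- (c * \<bar>y\<bar>)))"
proof -
 have 1: "set_integrable lborel {0..} (%y. exp (- (c * y)))"
 proof -
 have "(%y. exp (- (c * y))) absolutely_integrable_on {0..}"
  using integrable_on_exp_minus_to_infinity[OF c, of 0] by (intro nonnegative_absolutely_integrable_1) auto
 then show ?thesis unfolding set_integrable_def by (subst (asm) integrable_completion) auto
 qed
 then have 2: "integrable lborel (%y. indicator {0..} y * exp (- (c * y)))" by (simp add: set_integrable_def)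
 then have 3: "integrable lborel (%y. indicator {0..} (- y) * exp (- (c * (- y))))"
 using lborel_integrable_real_affine[OF 2, of "-1" 0] by simp
 show ?thesis
 by (rule Bochner_Integration.integrable_bound[OF Bochner_Integration.integrable_add[OF 2 3]])
  (auto simp: indicator_def abs_if)
qed

lemma poly_le_exp:
 fixes e :: real assumes e: "e > 0"
 shows "\<exists>C>0. \<forall>y. (br y) ^ K <= C * exp (e * \<bar>y\<bar>)"
proof -
 define d where "d = e / real (Suc K)"
 have d: "d > 0" using e by (simp add: d_def)
 define C where "C = (max 1 (1 / d)) ^ K"
 have "(br y) ^ K <= C * exp (e * \<bar>y\<bar>)" for y
 proof -
 have "1 + \<bar>y\<bar> <= max 1 (1 / d) * (1 + d * \<bar>y\<bar>)"
 proof -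
  have "1 <= max 1 (1 / d) * 1" by simp
  moreover have "1 * \<bar>y\<bar> <= (max 1 (1 / d) * d) * \<bar>y\<bar>"
  proof (rule mult_right_mono)
  have "1 = 1 / d * d" using d by simp
  also have "... <= max 1 (1 / d) * d" using d by (intro mult_right_mono) auto
  finally show "1 <= max 1 (1 / d) * d" .
  qed simp
  ultimately show ?thesis by (simp add: distrib_left mult.assoc)
 qed
 also have "... <= max 1 (1 / d) * exp (d * \<bar>y\<bar>)"
  using exp_ge_add_one_self[of "d * \<bar>y\<bar>"] by (intro mult_left_mono) auto
 finally have "(br y) ^ K <= (max 1 (1 / d) * exp (d * \<bar>y\<bar>)) ^ K" by (intro power_mono) auto
 also have "... = C * exp (real K * (d * \<bar>y\<bar>))" by (simp add: C_def power_mult_distrib exp_of_nat_mult)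
 also have "... <= C * exp (e * \<bar>y\<bar>)"
 proof -
  have "real K * d <= e" using e by (simp add: d_def field_simps)
  then have "real K * d * \<bar>y\<bar> <= e * \<bar>y\<bar>" by (intro mult_right_mono) auto
  then show ?thesis by (auto simp: C_def mult.assoc intro!: mult_left_mono)
 qed
 finally show ?thesis .
 qed
 moreover have "C > 0" by (simp add: C_def)
 ultimately show ?thesis by blast
qed

lemma integrable_exp_decay:
 fixes f :: "real => 'a::{banach, second_countable_topology}"
 assumes f: "f \<in> bmeas" and c: "c > 0"
 and b: "!!y. norm (f y) <= C * (br y) ^ K * exp (- (c * \<bar>y\<bar>))"
 shows "integrable lborel f"
proof -
 obtain D where D: "D > 0" "!!y. (br y) ^ K <= D * exp (c / 2 * \<bar>y\<bar>)" using poly_le_exp[of "c/2" K] c by auto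
 show ?thesis
 proof (rule Bochner_Integration.integrable_bound)
 show "integrable lborel (%y. \<bar>C\<bar> * D * exp (- (c / 2 * \<bar>y\<bar>)))"
  by (intro integrable_mult_right integrable_exp_abs) (use c in auto)
 show "f \<in> borel_measurable lborel" using f by simp
 have "norm (f y) <= \<bar>C\<bar> * D * exp (- (c / 2 * \<bar>y\<bar>))" for y
 proof -
  have "norm (f y) <= C * (br y) ^ K * exp (- (c * \<bar>y\<bar>))" by (rule b)
  also have "... <= \<bar>C\<bar> * (D * exp (c / 2 * \<bar>y\<bar>)) * exp (- (c * \<bar>y\<bar>))"
  using D by (intro mult_mono) auto
  also have "... = \<bar>C\<bar> * D * exp (- (c / 2 * \<bar>y\<bar>))" by (simp add: field_simps flip: exp_add)
  finally show ?thesis .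
 qed
 then show "AE y in lborel. norm (f y) <= norm (\<bar>C\<bar> * D * exp (- (c / 2 * \<bar>y\<bar>)))" using D by simp
 qed
qed

section \<open>The domain and the Taylor coefficients of functions in H1\<close>

text \<open>With z^H the conjugate transpose, the Hermitian form of 1 - z z^H at v is |v|^2 - |z^H
  v|^2, so the domain consists of the strict contractions.\<close>

lemma domD_iff:
 fixes z :: "complex^'m^'n"
 shows "z \<in> domD \<longleftrightarrow> (\<forall>v. v ~= 0 -->
  (\<Oplus>s. (cmod (\<Oplus>i. cnj (z $ i $ s) * v $ i))\<^sup>2) < (\<Oplus>i. (cmod (v $ i))\<^sup>2))"
proof -
 have herm: "conj_transpose (mat 1 - z ** conj_transpose z) = mat 1 - z ** conj_transpose z"
 by (auto simp: conj_transpose_def vec_eq_iff matrix_matrix_mult_def mat_def mult.commute)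
 have quad: "(\<Oplus>i. \<Oplus>j. cnj (v $ i) * (mat 1 - z ** conj_transpose z) $ i $ j * v $ j)
  = of_real ((\<Oplus>i. (cmod (v $ i))\<^sup>2) - (\<Oplus>s. (cmod (\<Oplus>i. cnj (z $ i $ s) * v $ i))\<^sup>2))" for v
 proof -
 have "(\<Oplus>i. \<Oplus>j. cnj (v $ i) * (mat 1 - z ** conj_transpose z) $ i $ j * v $ j)
  = (\<Oplus>i. \<Oplus>j. cnj (v $ i) * (if i = j then 1 else 0) * v $ j)
  - (\<Oplus>i. \<Oplus>j. \<Oplus>s. (cnj (v $ i) * z $ i $ s) * (cnj (z $ j $ s) * v $ j))"
  by (simp add: mat_def matrix_matrix_mult_def conj_transpose_def left_diff_distrib right_diff_distrib
   sum_subtractf sum_distrib_left sum_distrib_right mult.assoc)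
 also have "(\<Oplus>i. \<Oplus>j. cnj (v $ i) * (if i = j then 1 else 0) * v $ j) = (\<Oplus>i. cnj (v $ i) * v $ i)"
 proof (rule sum.cong[OF refl])
  fix i
  have "(\<Oplus>j. cnj (v $ i) * (if i = j then 1 else 0) * v $ j) = (\<Oplus>j. if i = j then cnj (v $ i) * v $ j else 0)"
  by (intro sum.cong) auto
  then show "(\<Oplus>j. cnj (v $ i) * (if i = j then 1 else 0) * v $ j) = cnj (v $ i) * v $ i" by simp
 qed
 also have "(\<Oplus>i. \<Oplus>j. \<Oplus>s. (cnj (v $ i) * z $ i $ s) * (cnj (z $ j $ s) * v $ j))
  = (\<Oplus>i. \<Oplus>s. \<Oplus>j. (cnj (v $ i) * z $ i $ s) * (cnj (z $ j $ s) * v $ j))"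
  by (intro sum.cong refl sum.swap)
 also have "... = (\<Oplus>s. \<Oplus>i. \<Oplus>j. (cnj (v $ i) * z $ i $ s) * (cnj (z $ j $ s) * v $ j))"
  by (rule sum.swap)
 also have "... = (\<Oplus>s. cnj (\<Oplus>i. cnj (z $ i $ s) * v $ i) * (\<Oplus>i. cnj (z $ i $ s) * v $ i))"
 proof (rule sum.cong[OF refl])
  fix s
  have "cnj (\<Oplus>i. cnj (z $ i $ s) * v $ i) = (\<Oplus>i. cnj (v $ i) * z $ i $ s)"
  by (simp add: mult.commute)
  then show "(\<Oplus>i. \<Oplus>j. (cnj (v $ i) * z $ i $ s) * (cnj (z $ j $ s) * v $ j))
  = cnj (\<Oplus>i. cnj (z $ i $ s) * v $ i) * (\<Oplus>i. cnj (z $ i $ s) * v $ i)"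
  by (simp only: sum_product)
 qed
 finally show ?thesis by (simp add: cmod_square_mult_cnj mult.commute)
 qed
 show ?thesis unfolding domD_def pos_def_def mem_Collect_eq quad using herm by simp
qed

lemma csm_domD:
 fixes z :: "complex^'m^'n"
 assumes "z \<in> domD" "cmod t <= 1" shows "csm t z \<in> domD"
 unfolding domD_iff
proof (intro allI impI)
 fix v :: "complex^'n" assume v: "v ~= 0"
 have e: "(\<Oplus>i. cnj (csm t z $ i $ s) * v $ i) = cnj t * (\<Oplus>i. cnj (z $ i $ s) * v $ i)" for s
 by (simp add: sum_distrib_left mult.assoc)
 have "(\<Oplus>s. (cmod (\<Oplus>i. cnj (csm t z $ i $ s) * v $ i))\<^sup>2)
  = (cmod t)\<^sup>2 * (\<Oplus>s. (cmod (\<Oplus>i. cnj (z $ i $ s) * v $ i))\<^sup>2)"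
 unfolding e norm_mult power_mult_distrib complex_mod_cnj sum_distrib_left[symmetric] ..
 also have "... <= 1 * (\<Oplus>s. (cmod (\<Oplus>i. cnj (z $ i $ s) * v $ i))\<^sup>2)"
 using assms(2) by (intro mult_right_mono sum_nonneg) (auto simp: power_le_one)
 also have "... < (\<Oplus>i. (cmod (v $ i))\<^sup>2)" using assms(1) v by (simp add: domD_iff)
 finally show "(\<Oplus>s. (cmod (\<Oplus>i. cnj (csm t z $ i $ s) * v $ i))\<^sup>2) < (\<Oplus>i. (cmod (v $ i))\<^sup>2)" .
qed

lemma sum_cmod_pos:
 fixes v :: "complex^'n"
 assumes "v ~= 0" shows "0 < (\<Oplus>i. (cmod (v $ i))\<^sup>2)"
proof -
 obtain i where "v $ i ~= 0" using assms by (auto simp: vec_eq_iff)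
 then have "0 < (cmod (v $ i))\<^sup>2" by simp
 also have "... <= (\<Oplus>i. (cmod (v $ i))\<^sup>2)" by (rule member_le_sum) auto
 finally show ?thesis .
qed

definition rk1 :: "('n => complex) => ('m => complex) => complex^'m^'n" where
 "rk1 a b = (\<chi> i j. a i * b j)"

lemma rk1_domD:
 fixes a :: "'n::finite => complex" and b :: "'m::finite => complex"
 assumes "(\<Oplus>i. (cmod (a i))\<^sup>2) * (\<Oplus>j. (cmod (b j))\<^sup>2) < 1"
 shows "rk1 a b \<in> domD"
 unfolding domD_iff
proof (intro allI impI)
 fix v :: "complex^'n" assume v: "v ~= 0"
 define A where "A = (\<Oplus>i. (cmod (a i))\<^sup>2)"
 define B where "B = (\<Oplus>j. (cmod (b j))\<^sup>2)"
 define V where "V = (\<Oplus>i. (cmod (v $ i))\<^sup>2)"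
 have V: "V > 0" unfolding V_def by (rule sum_cmod_pos[OF v])
 have "cmod (\<Oplus>i. cnj (a i) * v $ i) <= (\<Oplus>i. cmod (a i) * cmod (v $ i))"
 by (intro sum_norm_le) (simp add: norm_mult)
 then have "(cmod (\<Oplus>i. cnj (a i) * v $ i))\<^sup>2 <= (\<Oplus>i. cmod (a i) * cmod (v $ i))\<^sup>2"
 by (intro power_mono) auto
 also have "... <= A * V" unfolding A_def V_def by (rule Cauchy_Schwarz_ineq_sum)
 finally have cs: "(cmod (\<Oplus>i. cnj (a i) * v $ i))\<^sup>2 <= A * V" .
 have "(\<Oplus>i. cnj (rk1 a b $ i $ s) * v $ i) = cnj (b s) * (\<Oplus>i. cnj (a i) * v $ i)" for s
 by (simp add: rk1_def sum_distrib_left mult_ac)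
 then have "(\<Oplus>s. (cmod (\<Oplus>i. cnj (rk1 a b $ i $ s) * v $ i))\<^sup>2) = B * (cmod (\<Oplus>i. cnj (a i) * v $ i))\<^sup>2"
 by (simp add: norm_mult power_mult_distrib B_def sum_distrib_right)
 also have "... <= B * (A * V)" by (intro mult_left_mono cs) (simp add: B_def sum_nonneg)
 also have "... = (A * B) * V" by simp
 also have "... < 1 * V" using assms V unfolding A_def B_def by (intro mult_strict_right_mono) auto
 finally show "(\<Oplus>s. (cmod (\<Oplus>i. cnj (rk1 a b $ i $ s) * v $ i))\<^sup>2) < (\<Oplus>i. (cmod (v $ i))\<^sup>2)"
 by (simp add: V_def)
qed

lemma csm_rk1: "csm t (rk1 a b) = rk1 (%i. t * a i) b"
 by (simp add: csm_def rk1_def vec_eq_iff)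

lemma csm_csm: "csm s (csm t w) = csm (s * t) w"
 by (simp add: csm_def vec_eq_iff)

lemma csm_1 [simp]: "csm 1 w = w" by (simp add: csm_def vec_eq_iff)

text \<open>Cut off to 0 outside the domain, as membership in H requires.\<close>

definition tform :: "nat => ('n => complex) => ('m => complex) => complex^'m^'n => complex" where
 "tform k a b z = (if z \<in> domD then (\<Oplus>i. \<Oplus>j. a i * z $ i $ j * b j) ^ k else 0)"

text \<open>The homogeneous component of degree k of the Taylor series of f at 0, evaluated at w.
  Only t near 0 enters, so w may lie outside the domain.\<close>

definition cf :: "nat => (complex^'m^'n => complex) => complex^'m^'n => complex" where
 "cf k f w = (deriv ^^ k) (%t. f (csm t w)) 0 / fact k"

lemma has_derivative_matrix:
 fixes g :: "'a::real_normed_vector => complex^'m^'n"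
 assumes "!!i j. ((%t. g t $ i $ j) has_derivative (%h. D h $ i $ j)) (at t)"
 shows "(g has_derivative D) (at t)"
 unfolding has_derivative_componentwise_within[of g D t UNIV]
proof
 fix b :: "complex^'m^'n" assume "b \<in> Basis"
 then obtain i j u where b: "b = axis i (axis j u)" by (auto simp: Basis_vec_def)
 show "((%x. g x \<bullet> b) has_derivative (%x. D x \<bullet> b)) (at t)"
 unfolding b inner_axis by (rule has_derivative_inner_left[OF assms])
qed

locale H1_space =
 fixes H :: "(complex^'m^'n => complex) set" and ip
 assumes H1: "is_H1 H ip"
begin

sublocale hilbert_fun H ip
 using H1 unfolding is_H1_def rkhs_def by unfold_locales blast

definition kf :: "complex^'m^'n => complex^'m^'n => complex" where
 "kf w = (%z. if z \<in> domD then ker1 z w else 0)"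

lemma kf_mem: "w \<in> domD ==> kf w \<in> H"
 and reproducing: "w \<in> domD ==> f \<in> H ==> f w = ip f (kf w)"
 and off_domD: "f \<in> H ==> z \<notin> domD ==> f z = 0"
 and holo: "f \<in> H ==> holo_on f domD"
 using H1 unfolding is_H1_def rkhs_def kf_def by auto

lemma nsq_kf: "w \<in> domD ==> nsq (kf w) = Re (ker1 w w)"
 using reproducing[OF _ kf_mem, of w w] by (simp add: nsq_def kf_def)

lemma eval_bound: "w \<in> domD ==> f \<in> H ==> cmod (f w) <= sqrt (Re (ker1 w w)) * sqrt (nsq f)"
 using cauchy_schwarz_sqrt[OF _ kf_mem, of f w] by (simp add: reproducing nsq_kf mult.commute)

lemma holomorphic_line:
 assumes f: "f \<in> H" and S: "open S" "!!t. t \<in> S ==> g t \<in> domD"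
 and g: "!!i j t. t \<in> S ==> ((%t. g t $ i $ j) has_field_derivative g' t $ i $ j) (at t)"
 shows "(%t. f (g t)) holomorphic_on S"
 unfolding holomorphic_on_open[OF S(1)]
proof
 fix t assume t: "t \<in> S"
 obtain f' where f': "(f has_derivative f') (at (g t))" and lin: "!!c v. f' (\<chi> i j. c * v $ i $ j) = c * f' v"
 using holo[OF f] S(2)[OF t] unfolding holo_on_def by blast
 have "(g has_derivative (%h. \<chi> i j. h * g' t $ i $ j)) (at t)"
 proof (rule has_derivative_matrix)
 fix i j
 have "(*) (g' t $ i $ j) = (%h. h * g' t $ i $ j)" by (auto simp: mult.commute)
 then show "((%t. g t $ i $ j) has_derivative (%h. (\<chi> i j. h * g' t $ i $ j) $ i $ j)) (at t)"
  using g[OF t, of i j] by (simp add: has_field_derivative_def)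
 qed
 then have "((%t. f (g t)) has_derivative (%h. f' (\<chi> i j. h * g' t $ i $ j))) (at t)"
 using f' by (rule has_derivative_compose)
 then show "\<exists>d. ((%t. f (g t)) has_field_derivative d) (at t)"
 proof -
 assume "((%t. f (g t)) has_derivative (%h. f' (\<chi> i j. h * g' t $ i $ j))) (at t)"
 moreover have "(%h. f' (\<chi> i j. h * g' t $ i $ j)) = (*) (f' (g' t))" by (auto simp: lin)
 ultimately show ?thesis unfolding has_field_derivative_def by auto
 qed
qed

lemma holomorphic_csm:
 assumes "f \<in> H" "open S" "!!t. t \<in> S ==> csm t w \<in> domD"
 shows "(%t. f (csm t w)) holomorphic_on S"
 by (rule holomorphic_line[OF assms, where g' = "%_. w"]) (auto intro!: derivative_eq_intros)

lemma cf_csm: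
 assumes f: "f \<in> H" and w: "csm r w \<in> domD" "r ~= 0"
 shows "cf k f (csm r w) = r ^ k * cf k f w"
proof -
 define s where "s = cmod r"
 have s: "s > 0" using w by (simp add: s_def)
 have h: "(%t. f (csm t w)) holomorphic_on ball 0 s"
 proof (rule holomorphic_csm[OF f])
 fix t :: complex assume "t \<in> ball 0 s"
 then have "cmod (t / r) <= 1" using w by (simp add: s_def norm_divide)
 then have "csm (t / r) (csm r w) \<in> domD" by (rule csm_domD[OF w(1)])
 then show "csm t w \<in> domD" using w by (simp add: csm_csm)
 qed simp
 have "(deriv ^^ k) (%t. f (csm (r * t) w)) 0 = r ^ k * (deriv ^^ k) (%t. f (csm t w)) (r * 0)"
 by (rule higher_deriv_compose_linear[OF h, of "ball 0 1"]) (use s in \<open>auto simp: norm_mult s_def\<close>)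
 then show ?thesis by (simp add: cf_def csm_csm mult.commute)
qed

text \<open>The Cauchy estimate on |t| = 1/2 bounds the functional, and Riesz gives r. Pairing r
  with the kernel function at z shows that cnj (r z) is the k-th coefficient in t of 1 / det (1 - t
  w z^H); by \<open>inverse_det_fps\<close> any solution h of Newton's recursion gives its
  value.\<close>

lemma coef_representation:
 assumes w: "w \<in> domD"
 shows "\<exists>r\<in>H. (\<forall>f\<in>H. cf k f w = ip f r) \<and>
 (\<forall>z\<in>domD. \<forall>h. h 0 = 1 --> (\<forall>l<k. of_nat (Suc l) * h (Suc l) = (\<Sum>j\<le>l. mtr (mpow (w ** conj_transpose z) (Suc j)) * h (l - j)))
  --> r z = cnj (h k))"
proof -
 have D: "csm t w \<in> domD" if "t \<in> ball 0 1" for t :: complex by (rule csm_domD[OF w]) (use that in auto)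
 have hol: "(%t. f (csm t w)) holomorphic_on ball 0 1" if "f \<in> H" for f
 by (rule holomorphic_csm[OF that]) (auto intro: D)
 \<comment> \<open>The kernel at the pair t w, t w depends on t only through |t|^2, so one constant
   serves the whole circle |t| = 1/2.\<close>
 define \<kappa> where "\<kappa> = sqrt (Re (ker1 (csm (1/2) w) (csm (1/2) w)))"
 have bnd: "cmod (f (csm t w)) <= \<kappa> * sqrt (nsq f)" if "f \<in> H" "cmod t = 1/2" for f t
 proof -
 have "t * cnj t = cr ((cmod t)\<^sup>2)" by (rule complex_norm_square[symmetric])
 then have tt: "t * cnj t = 1/4" using that by (simp add: power2_eq_square)
 have "csm t w ** conj_transpose (csm t w) = csm (1/2) w ** conj_transpose (csm (1/2) w)"
  using tt by (auto simp: vec_eq_iff matrix_matrix_mult_def conj_transpose_def intro!: sum.cong)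
  (metis (no_types, lifting) mult.assoc mult.left_commute mult.commute)
 then have "ker1 (csm t w) (csm t w) = ker1 (csm (1/2) w) (csm (1/2) w)" by (simp add: ker1_def)
 then show ?thesis using eval_bound[OF D that(1), of t] that(2) by (simp add: \<kappa>_def)
 qed
 have "\<exists>r\<in>H. \<forall>f\<in>H. cf k f w = ip f r"
 proof (rule riesz_representation)
 fix f g assume fg: "f \<in> H" "g \<in> H"
 show "cf k (%z. f z + g z) w = cf k f w + cf k g w"
  unfolding cf_def using higher_deriv_add[OF hol[OF fg(1)] hol[OF fg(2)], of 0 k] by (simp add: add_divide_distrib)
 next
 fix c f assume f: "f \<in> H"
 show "cf k (%z. c * f z) w = c * cf k f w"
  unfolding cf_def using higher_deriv_cmult[OF hol[OF f], of 0 k c] by simp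
 next
 fix f assume f: "f \<in> H"
 have "norm ((deriv ^^ k) (%t. f (csm t w)) 0) <= fact k * (\<kappa> * sqrt (nsq f)) / (1/2) ^ k"
 proof (rule Cauchy_inequality)
  show "(%t. f (csm t w)) holomorphic_on ball 0 (1/2)" by (rule holomorphic_on_subset[OF hol[OF f]]) auto
  show "continuous_on (cball 0 (1/2)) (%t. f (csm t w))"
  by (rule continuous_on_subset[OF holomorphic_on_imp_continuous_on[OF hol[OF f]]]) auto
  fix x :: complex assume "norm (0 - x) = 1/2"
  then show "norm (f (csm x w)) <= \<kappa> * sqrt (nsq f)" by (intro bnd f) simp
 qed simp
 then show "cmod (cf k f w) <= (\<kappa> * 2 ^ k) * sqrt (nsq f)"
  by (simp add: cf_def norm_divide field_simps)
 qed
 then obtain r where r: "r \<in> H" and rep: "!!f. f \<in> H ==> cf k f w = ip f r" by blast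
 have "r z = cnj (h k)" if z: "z \<in> domD" and h0: "h 0 = 1"
 and rec: "!!l. l < k ==> of_nat (Suc l) * h (Suc l) = (\<Sum>j\<le>l. mtr (mpow (w ** conj_transpose z) (Suc j)) * h (l - j))" for z h
 proof -
 obtain \<Phi> where \<Phi>: "(%t. inverse (det (mat 1 - csm t (w ** conj_transpose z)))) has_fps_expansion \<Phi>"
  and \<Phi>k: "fps_nth \<Phi> k = h k"
  using inverse_det_fps[of h k "w ** conj_transpose z", OF h0 rec] by blast
 have ev: "\<forall>\<^sub>F t in nhds 0. kf z (csm t w) = inverse (det (mat 1 - csm t (w ** conj_transpose z)))"
 proof -
  have "\<forall>\<^sub>F t in nhds 0. t \<in> ball (0::complex) 1" by (rule eventually_nhds_in_open) auto
  then show ?thesis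
  proof eventually_elim
  case (elim t)
  have "csm t w ** conj_transpose z = csm t (w ** conj_transpose z)"
   by (simp add: vec_eq_iff matrix_matrix_mult_def sum_distrib_left mult.assoc)
  then show ?case using D[OF elim] by (simp add: kf_def ker1_def)
  qed
 qed
 then have "(%t. kf z (csm t w)) has_fps_expansion \<Phi>"
  using \<Phi> has_fps_expansion_cong[OF ev refl] by blast
 then have "cf k (kf z) w = fps_nth \<Phi> k" unfolding cf_def by (rule fps_nth_fps_expansion[symmetric])
 then have "h k = ip (kf z) r" using rep[OF kf_mem[OF z]] \<Phi>k by simp
 then show ?thesis using reproducing[OF z r] ip_cnj[OF kf_mem[OF z] r] by simp
 qed
 then show ?thesis using r rep by blast
qed

text \<open>For w = a b^T the matrix w z^H has rank one and its powers are multiples of it: all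
  traces are powers of one number \<gamma>, so h k = \<gamma>^k solves Newton's recursion. Since a
  and b are real, the conjugate of \<gamma> is a^T z b.\<close>

lemma tform_small:
 fixes a :: "'n => real" and b :: "'m => real"
 assumes "(\<Oplus>i. (a i)\<^sup>2) * (\<Oplus>j. (b j)\<^sup>2) < 1"
 shows "tform k (cv a) (cv b) \<in> H \<and>
 (\<forall>f\<in>H. ip f (tform k (cv a) (cv b)) = cf k f (rk1 (cv a) (cv b)))"
proof -
 define w where "w = rk1 (%i::'n. cr (a i)) (%j::'m. cr (b j))"
 have w: "w \<in> domD" unfolding w_def by (rule rk1_domD) (use assms in simp)
 obtain r where r: "r \<in> H" "!!f. f \<in> H ==> cf k f w = ip f r"
 and rz: "!!z h. z \<in> domD ==> h 0 = 1 ==> (!!l. l<k ==> of_nat (Suc l) * h (Suc l) = (\<Sum>j\<le>l. mtr (mpow (w ** conj_transpose z) (Suc j)) * h (l - j))) ==> r z = cnj (h k)"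
 using coef_representation[OF w, of k] by auto
 have "r z = tform k (cv a) (cv b) z" for z
 proof (cases "z \<in> domD")
 case True
 define c where "c j = (\<Oplus>s. cr (b s) * cnj (z $ j $ s))" for j
 define \<gamma> where "\<gamma> = (\<Oplus>i. cr (a i) * c i)"
 define A where "A = w ** conj_transpose z"
 have A: "A $ i $ j = of_real (a i) * c j" for i j
  by (simp add: A_def w_def rk1_def matrix_matrix_mult_def conj_transpose_def c_def sum_distrib_left mult.assoc)
 have pw: "mpow A (Suc l) $ i $ j = \<gamma> ^ l * (of_real (a i) * c j)" for l i j
 proof (induction l arbitrary: i j)
  case (Suc l)
  have "mpow A (Suc (Suc l)) $ i $ j = (\<Oplus>q. A $ i $ q * mpow A (Suc l) $ q $ j)"
  by (subst mpow.simps(2)) (simp only: matrix_matrix_mult_def vec_lambda_beta)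
  also have "... = \<gamma> * (\<gamma> ^ l * (of_real (a i) * c j))"
  unfolding Suc A by (simp add: \<gamma>_def sum_distrib_left sum_distrib_right mult_ac)
  finally show ?case by simp
 qed (simp add: A)
 have "mtr (mpow A (Suc l)) = \<gamma> ^ Suc l" for l
  unfolding mtr_def pw by (simp add: \<gamma>_def flip: sum_distrib_left)
 then have "r z = cnj (\<gamma> ^ k)"
  by (intro rz[OF True]) (auto simp: A_def[symmetric] simp flip: power_add power_Suc)
 also have "... = (cnj \<gamma>) ^ k" by simp
 also have "cnj \<gamma> = (\<Oplus>i. \<Oplus>j. of_real (a i) * z $ i $ j * of_real (b j))"
  by (simp add: \<gamma>_def c_def sum_distrib_left mult_ac)
 finally show ?thesis using True by (simp add: tform_def)
 qed (use off_domD[OF r(1)] in \<open>simp add: tform_def\<close>)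
 then have "r = tform k (cv a) (cv b)" by blast
 then show ?thesis using r by (simp add: w_def)
qed

text \<open>Both the form and the coefficient are homogeneous in a, so a is shrunk by e until the
  rank-one matrix lies in the domain.\<close>

lemma tform_mem_ip:
 fixes a :: "'n => real" and b :: "'m => real"
 shows tform_mem: "tform k (cv a) (cv b) \<in> H"
 and ip_tform: "f \<in> H ==> ip f (tform k (cv a) (cv b)) = cf k f (rk1 (cv a) (cv b))"
proof -
 define A where "A = (\<Oplus>i. (a i)\<^sup>2) * (\<Oplus>j. (b j)\<^sup>2)"
 define e where "e = 1 / (A + 1)"
 have A0: "A \<ge> 0" unfolding A_def by (intro mult_nonneg_nonneg sum_nonneg) auto
 have e: "e > 0" "e <= 1" "e * A < 1" using A0 by (auto simp: e_def field_simps)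
 have "e\<^sup>2 * A = e * (e * A)" by (simp add: power2_eq_square)
 also have "... < 1" using e A0 by (smt (verit, best) mult_left_le_one_le mult_nonneg_nonneg)
 finally have "(\<Oplus>i. (e * a i)\<^sup>2) * (\<Oplus>j. (b j)\<^sup>2) < 1"
 by (simp add: A_def power_mult_distrib mult.assoc flip: sum_distrib_left)
 note s = tform_small[OF this, of k]
 have t: "tform k (%i. of_real (e * a i)) (%j. of_real (b j)) z = of_real e ^ k * tform k (cv a) (cv b) z" for z :: "complex^'m^'n"
 by (simp add: tform_def mult.assoc flip: sum_distrib_left power_mult_distrib)
 have t': "tform k (cv a) (cv b) = (%z :: complex^'m^'n. (1 / of_real e ^ k) * tform k (%i. of_real (e * a i)) (%j. of_real (b j)) z)"
 unfolding t using e by simp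
 show m: "tform k (cv a) (cv b) \<in> H"
 unfolding t' by (intro scale_mem) (use s in blast)
 define w where "w = rk1 (%i::'n. cr (a i)) (%j::'m. cr (b j))"
 have w: "rk1 (%i. of_real (e * a i)) (%j. of_real (b j)) = csm (of_real e) w"
 by (simp add: w_def csm_rk1)
 have wd: "csm (of_real e) w \<in> domD"
 unfolding w[symmetric] by (rule rk1_domD) (use \<open>(\<Oplus>i. (e * a i)\<^sup>2) * (\<Oplus>j. (b j)\<^sup>2) < 1\<close> in \<open>simp add: norm_mult power_mult_distrib\<close>)
 show "ip f (tform k (cv a) (cv b)) = cf k f (rk1 (cv a) (cv b))"
 if f: "f \<in> H"
 proof -
 have "ip f (tform k (cv a) (cv b)) = cnj (1 / of_real e ^ k) * ip f (tform k (%i. of_real (e * a i)) (%j. of_real (b j)))"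
  unfolding t' by (rule ip_scale_right) (use s f in auto)
 also have "ip f (tform k (%i. of_real (e * a i)) (%j. of_real (b j))) = of_real e ^ k * cf k f w"
 proof -
  have "ip f (tform k (%i. of_real (e * a i)) (%j. of_real (b j))) = cf k f (csm (of_real e) w)"
  using s f unfolding w by blast
  also have "... = of_real e ^ k * cf k f w" by (rule cf_csm[OF f wd]) (use e in simp)
  finally show ?thesis .
 qed
 finally show ?thesis using e by (simp add: w_def)
 qed
qed

text \<open>At a general w the coefficient functional is represented, by
  \<open>bil_moments_newton\<close>, by a finite combination of k-th powers of forms that are real
  in the row vector and complex in the column vector; interpolation makes both real. So all Taylor
  components of f at w vanish if those at real rank-one matrices do.\<close>

lemma zero_if_rank_one_coefs_zero:
 assumes f: "f \<in> H" and z0: "!!k (a :: 'n => real) (b :: 'm => real). cf k f (rk1 (cv a) (cv b)) = 0"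
 and w: "w \<in> domD"
 shows "f w = 0"
proof -
 have "cf k f w = 0" for k
 proof -
 obtain r where r: "r \<in> H" "!!f. f \<in> H ==> cf k f w = ip f r"
  and rz: "!!z h. z \<in> domD ==> h 0 = 1 ==> (!!l. l<k ==> of_nat (Suc l) * h (Suc l) = (\<Sum>j\<le>l. mtr (mpow (w ** conj_transpose z) (Suc j)) * h (l - j))) ==> r z = cnj (h k)"
  using coef_representation[OF w, of k] by auto
 \<comment> \<open>The margin that \<open>bil_moments_newton\<close> needs at all orders below
   k.\<close>
 define N where "N = 2 * k + 5"
 \<comment> \<open>These weights replace the imaginary unit by the integers 0..k: a polynomial of
   degree at most k, summed against them, gives its value at the imaginary unit.\<close>
 obtain v where v: "!!l. l <= k ==> (\<Sum>j\<le>k. v j * of_nat j ^ l) = \<i> ^ l"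
  using moment_weights[of k "%l. \<i> ^ l"] by blast
 have lag: "(x + \<i> * y) ^ k = (\<Sum>j\<le>k. v j * (x + of_nat j * y) ^ k)" for x y
 proof -
  have "(\<Sum>j\<le>k. v j * (x + of_nat j * y) ^ k) = (\<Sum>j\<le>k. \<Sum>l\<le>k. of_nat (k choose l) * x ^ (k - l) * y ^ l * (v j * of_nat j ^ l))"
  by (subst add.commute) (simp add: binomial_ring sum_distrib_left power_mult_distrib mult_ac)
  also have "... = (\<Sum>l\<le>k. of_nat (k choose l) * x ^ (k - l) * y ^ l * (\<Sum>j\<le>k. v j * of_nat j ^ l))"
  by (subst sum.swap) (simp add: sum_distrib_left)
  also have "... = (\<Sum>l\<le>k. of_nat (k choose l) * x ^ (k - l) * y ^ l * \<i> ^ l)" by (simp add: v)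
  also have "... = (\<i> * y + x) ^ k" by (simp add: binomial_ring power_mult_distrib mult_ac)
  finally show ?thesis by (simp add: add.commute)
 qed
 define W where "W p = (\<Prod>i\<in>UNIV. cr (wwt N (p i)))" for p :: "'n => nat \<times> nat"
 define c1 where "c1 p s = (\<Oplus>i. real (fst (p i)) * Re (w $ i $ s))" for p :: "'n => nat \<times> nat" and s
 define c2 where "c2 p s = - (\<Oplus>i. real (fst (p i)) * Im (w $ i $ s))" for p :: "'n => nat \<times> nat" and s
 define P where "P = (PiE UNIV (%_. {..N} \<times> {..N}) :: ('n => nat \<times> nat) set)"
 define R where "R = (%z. \<Sum>p\<in>P. (W p / fact k) * (\<Sum>j\<le>k. v j * tform k (%i. of_real (real (snd (p i)))) (%s. of_real (c1 p s + real j * c2 p s)) z))"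
 have "r z = R z" for z
 proof (cases "z \<in> domD")
  case True
  define A where "A = w ** conj_transpose z"
  define h where "h l = cexp N (%\<eta> \<xi>. bil A \<eta> \<xi> ^ l) / fact l" for l
  have "r z = cnj (h k)"
  proof (rule rz[OF True])
  show "h 0 = 1" by (simp add: h_def cexp_one)
  show "of_nat (Suc l) * h (Suc l) = (\<Sum>j\<le>l. mtr (mpow (w ** conj_transpose z) (Suc j)) * h (l - j))" if "l < k" for l
   unfolding h_def A_def[symmetric] by (rule bil_moments_newton) (use that in \<open>simp add: N_def\<close>)
  qed
  also have "... = (\<Sum>p\<in>P. (W p / fact k) * cnj (bil A (%i. of_nat (fst (p i))) (%i. of_nat (snd (p i)))) ^ k)"
  by (simp add: h_def cexp_def fexp_def P_def W_def sum_divide_distrib)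
  also have "... = R z"
  unfolding R_def
  proof (intro sum.cong refl arg_cong2[of _ _ _ _ "(*)"])
  fix p
  define x where "x = (\<Oplus>i. \<Oplus>s. of_nat (snd (p i)) * z $ i $ s * of_real (c1 p s))"
  define y where "y = (\<Oplus>i. \<Oplus>s. of_nat (snd (p i)) * z $ i $ s * of_real (c2 p s))"
  have c12: "cr (c1 p s) + \<i> * cr (c2 p s) = (\<Oplus>i. of_nat (fst (p i)) * cnj (w $ i $ s))" for s
   by (simp add: complex_eq_iff c1_def c2_def sum_negf)
  have "cnj (bil A (%i. of_nat (fst (p i))) (%i. of_nat (snd (p i))))
   = (\<Oplus>i. \<Oplus>j. \<Oplus>s. of_nat (fst (p i)) * (cnj (w $ i $ s) * z $ j $ s) * of_nat (snd (p j)))"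
   by (simp add: bil_def A_def matrix_matrix_mult_def conj_transpose_def sum_distrib_left sum_distrib_right)
  also have "... = (\<Oplus>j. \<Oplus>s. \<Oplus>i. of_nat (fst (p i)) * (cnj (w $ i $ s) * z $ j $ s) * of_nat (snd (p j)))"
   by (subst sum.swap) (intro sum.cong refl sum.swap)
  also have "... = (\<Oplus>j. \<Oplus>s. of_nat (snd (p j)) * z $ j $ s * (cr (c1 p s) + \<i> * cr (c2 p s)))"
   unfolding c12 by (simp add: sum_distrib_left mult_ac)
  also have "... = x + \<i> * y"
   unfolding x_def y_def by (simp add: distrib_left sum.distrib sum_distrib_left mult_ac)
  finally have A: "cnj (bil A (%i. of_nat (fst (p i))) (%i. of_nat (snd (p i)))) ^ k = (\<Sum>j\<le>k. v j * (x + of_nat j * y) ^ k)"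
   by (simp add: lag)
  have xy: "x + of_nat j * y = (\<Oplus>i. \<Oplus>s. of_real (real (snd (p i))) * z $ i $ s * of_real (c1 p s + real j * c2 p s))" for j
   unfolding x_def y_def by (simp add: distrib_left sum.distrib sum_distrib_left mult_ac)
  show "cnj (bil A (%i. of_nat (fst (p i))) (%i. of_nat (snd (p i)))) ^ k
   = (\<Sum>j\<le>k. v j * tform k (%i. of_real (real (snd (p i)))) (%s. of_real (c1 p s + real j * c2 p s)) z)"
   unfolding A using True by (simp only: tform_def if_True xy)
  qed
  finally show ?thesis .
 qed (use off_domD[OF r(1)] in \<open>simp add: R_def tform_def\<close>)
 then have "r = R" by blast
 have "ip f R = 0"
 proof -
  have "ip f R = (\<Sum>p\<in>P. cnj (W p / fact k) * (\<Sum>j\<le>k. cnj (v j) * ip f (tform k (%i. of_real (real (snd (p i)))) (%s. of_real (c1 p s + real j * c2 p s)))))"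
  unfolding R_def by (simp only: ip_sum_right ip_scale_right sum_mem scale_mem tform_mem f)
  then show ?thesis by (simp only: ip_tform[OF f] z0) simp
 qed
 then show ?thesis using r(2)[OF f] \<open>r = R\<close> by simp
 qed
 then have d0: "(deriv ^^ k) (%t. f (csm t w)) 0 = 0" for k by (simp add: cf_def)
 have D: "csm t w \<in> domD" if "t \<in> ball 0 1" for t :: complex by (rule csm_domD[OF w]) (use that in auto)
 have hol: "(%t. f (csm t w)) holomorphic_on ball 0 1" by (rule holomorphic_csm[OF f]) (auto intro: D)
 have F0: "f (csm t w) = 0" if "t \<in> ball 0 1" for t
 using holomorphic_fun_eq_on_ball[OF hol holomorphic_on_const[of 0], of t] that d0 by (simp add: higher_deriv_const)
 \<comment> \<open>Vanishing is known on the open disc |t| < 1 only; the point w itself, at t = 1,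
   is a radial limit.\<close>
 have "isCont f w" using holo[OF f] w unfolding holo_on_def by (metis has_derivative_continuous)
 moreover have "(%k. csm (of_real (1 - 1 / real (Suc (Suc k)))) w) \<longlonglongrightarrow> w"
 proof -
 have "(%k. 1 - 1 / real (Suc (Suc k))) \<longlonglongrightarrow> 1 - 0"
  by (intro tendsto_intros filterlim_compose[OF LIMSEQ_inverse_real_of_nat filterlim_Suc, unfolded inverse_eq_divide])
 then have "(%k. cr (1 - 1 / real (Suc (Suc k)))) \<longlonglongrightarrow> of_real 1" by (intro tendsto_of_real) simp
 then have "(%k. csm (of_real (1 - 1 / real (Suc (Suc k)))) w) \<longlonglongrightarrow> csm (of_real 1) w"
  unfolding csm_def by (intro tendsto_vec_lambda tendsto_mult tendsto_const)
 then show ?thesis by simp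
 qed
 ultimately have "(%k. f (csm (of_real (1 - 1 / real (Suc (Suc k)))) w)) \<longlonglongrightarrow> f w"
 by (rule isCont_tendsto_compose)
 moreover have "f (csm (of_real (1 - 1 / real (Suc (Suc k)))) w) = 0" for k
 proof (rule F0)
 have "0 < 1 / real (Suc (Suc k))" "1 / real (Suc (Suc k)) < 1" by simp_all
 then have "\<bar>1 - 1 / real (Suc (Suc k))\<bar> < 1" by linarith
 then show "cr (1 - 1 / real (Suc (Suc k))) \<in> ball 0 1"
  by (simp only: mem_ball dist_0_norm norm_of_real)
 qed
 ultimately show ?thesis by (simp add: LIMSEQ_const_iff)
qed

end

section \<open>Integrals along vertical lines and residues\<close>

lemma integral_symmetric_interval_tendsto:
 fixes h :: "real => complex"
 assumes h: "integrable lborel h"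
 shows "(%k. integral {- real k..real k} h) \<longlonglongrightarrow> (\<integral>y. h y \<partial>lborel)"
proof -
 have [measurable]: "h \<in> borel_measurable lborel" using h by auto
 have "integral {- real k..real k} h = (\<integral>y. indicator {- real k..real k} y *\<^sub>R h y \<partial>lborel)" for k
 proof -
 have "set_integrable lborel {- real k..real k} h"
  unfolding set_integrable_def by (rule integrable_mult_indicator[OF _ h]) simp
 then show ?thesis using set_borel_integral_eq_integral(2)[of "{- real k..real k}" h] by (simp add: set_lebesgue_integral_def)
 qed
 moreover have "(%k. \<integral>y. indicator {- real k..real k} y *\<^sub>R h y \<partial>lborel) \<longlonglongrightarrow> (\<integral>y. h y \<partial>lborel)"
 proof (rule integral_dominated_convergence)
 show "integrable lborel (%y. norm (h y))" using h by (rule integrable_norm)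
 show "AE y in lborel. (%k. indicator {- real k..real k} y *\<^sub>R h y) \<longlonglongrightarrow> h y"
 proof (intro AE_I2 tendsto_eventually)
  fix y :: real
  obtain N where N: "\<bar>y\<bar> <= real N" using real_arch_simple by blast
  have "indicator {- real k..real k} y *\<^sub>R h y = h y" if "k \<ge> N" for k
  proof -
  have "\<bar>y\<bar> <= real k" using N that by (meson le_trans of_nat_mono order_trans)
  then show ?thesis by (simp add: indicator_def abs_le_iff)
  qed
  then show "\<forall>\<^sub>F k in sequentially. indicator {- real k..real k} y *\<^sub>R h y = h y"
  using eventually_sequentially by blast
 qed
 qed (auto simp: indicator_def)
 ultimately show ?thesis by simp
qed

lemma poly_exp_tendsto_0:
 fixes c :: real assumes c: "c > 0"
 shows "(%k. C * (1 + real k) ^ K * exp (- (c * real k))) \<longlonglongrightarrow> 0"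
proof -
 obtain D where D: "D > 0" "!!y. (br y) ^ K <= D * exp (c / 2 * \<bar>y\<bar>)" using poly_le_exp[of "c/2" K] c by auto
 show ?thesis
 proof (rule Lim_null_comparison)
 show "\<forall>\<^sub>F k in sequentially. norm (C * (1 + real k) ^ K * exp (- (c * real k))) <= \<bar>C\<bar> * D * exp (- (c / 2)) ^ k"
 proof (intro always_eventually allI)
  fix k
  have "norm (C * (1 + real k) ^ K * exp (- (c * real k))) <= \<bar>C\<bar> * (D * exp (c / 2 * real k)) * exp (- (c * real k))"
  using D(2)[of "real k"] by (simp add: abs_mult mult_left_mono mult_right_mono)
  also have "... = \<bar>C\<bar> * D * exp (- (c / 2)) ^ k" by (simp add: field_simps flip: exp_add exp_of_nat_mult)
  finally show "norm (C * (1 + real k) ^ K * exp (- (c * real k))) <= \<bar>C\<bar> * D * exp (- (c / 2)) ^ k" .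
 qed
 show "(%k. \<bar>C\<bar> * D * exp (- (c / 2)) ^ k) \<longlonglongrightarrow> 0"
  using tendsto_mult_right_zero[OF LIMSEQ_realpow_zero[of "exp (- (c / 2))"], of "\<bar>C\<bar> * D"] c by simp
 qed
qed

text \<open>Cauchy's integral formula for g on rectangles of height growing to infinity; the decay
  kills the horizontal sides. The points of S are removable because g is continuous there.
  Integrating in y instead of s divides 2 pi i by i.\<close>

lemma vertical_strip_residue:
 fixes g :: "complex => complex" and \<alpha> \<beta> s0 c C :: real
 assumes s0: "\<alpha> < s0" "s0 < \<beta>" and S: "finite S"
 and cont: "continuous_on {s. \<alpha> <= Re s \<and> Re s <= \<beta>} g"
 and der: "!!s. \<alpha> < Re s ==> Re s < \<beta> ==> s \<notin> S ==> g field_differentiable at s"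
 and c: "c > 0"
 and bound: "!!x y. \<alpha> <= x ==> x <= \<beta> ==> cmod (g (Complex x y)) <= C * (br y) ^ K * exp (- (c * \<bar>y\<bar>))"
 shows "integrable lborel (%y. g (Complex \<alpha> y) / (Complex \<alpha> y - s0))"
 and "integrable lborel (%y. g (Complex \<beta> y) / (Complex \<beta> y - s0))"
 and "(\<integral>y. g (Complex \<beta> y) / (Complex \<beta> y - s0) \<partial>lborel) - (\<integral>y. g (Complex \<alpha> y) / (Complex \<alpha> y - s0) \<partial>lborel)
  = 2 * pi * g (of_real s0)"
proof -
 define F where "F s = g s / (s - of_real s0)" for s
 have intF: "integrable lborel (%y. F (Complex x y))" if x: "\<alpha> <= x" "x <= \<beta>" "x ~= s0" for x
 proof (rule integrable_exp_decay[OF _ c])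
 have cC: "continuous_on UNIV (%y. Complex x y)" unfolding Complex_eq by (intro continuous_intros)
 have "continuous_on UNIV (%y. F (Complex x y))"
  unfolding F_def using x
  by (intro continuous_intros continuous_on_compose2[OF cont cC] cC) (auto simp: complex_eq_iff)
 then show "(%y. F (Complex x y)) \<in> bmeas" by (rule borel_measurable_continuous_onI)
 fix y
 have "\<bar>x - s0\<bar> <= cmod (Complex x y - of_real s0)" using abs_Re_le_cmod[of "Complex x y - of_real s0"] by simp
 then have "cmod (F (Complex x y)) <= cmod (g (Complex x y)) / \<bar>x - s0\<bar>"
  unfolding F_def norm_divide using x by (intro divide_left_mono mult_pos_pos) auto
 also have "... <= (C * (br y) ^ K * exp (- (c * \<bar>y\<bar>))) / \<bar>x - s0\<bar>" by (intro divide_right_mono bound x) auto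
 finally show "norm (F (Complex x y)) <= (C / \<bar>x - s0\<bar>) * (br y) ^ K * exp (- (c * \<bar>y\<bar>))" by simp
 qed
 show "integrable lborel (%y. g (Complex \<alpha> y) / (Complex \<alpha> y - s0))"
 and "integrable lborel (%y. g (Complex \<beta> y) / (Complex \<beta> y - s0))"
 using intF[of \<alpha>] intF[of \<beta>] s0 by (auto simp: F_def)
 have holg: "g holomorphic_on {s. \<alpha> < Re s \<and> Re s < \<beta>}"
 proof (rule no_isolated_singularity[OF _ _ _ S])
 show op: "open {s. \<alpha> < Re s \<and> Re s < \<beta>}"
  unfolding Collect_conj_eq by (intro open_Int open_halfspace_Re_gt open_halfspace_Re_lt)
 show "continuous_on {s. \<alpha> < Re s \<and> Re s < \<beta>} g" by (rule continuous_on_subset[OF cont]) auto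
 have "open ({s. \<alpha> < Re s \<and> Re s < \<beta>} - S)" using op S by (intro open_Diff finite_imp_closed)
 then show "g holomorphic_on {s. \<alpha> < Re s \<and> Re s < \<beta>} - S"
  using der by (auto simp: holomorphic_on_def intro: field_differentiable_at_within)
 qed
 define E where "E k = C * (1 + real k) ^ K * exp (- (c * real k)) * (\<beta> - \<alpha>)" for k
 have eq: "cmod ((integral {- real k..real k} (%y. F (Complex \<beta> y)) - integral {- real k..real k} (%y. F (Complex \<alpha> y))) - 2 * pi * g s0) <= 2 * E k"
 if k: "k \<ge> 1" for k
 proof -
 define R where "R = real k"
 have R: "R \<ge> 1" using k by (simp add: R_def)
 define a1 a2 a3 a4 where "a1 = Complex \<alpha> (- R)" and "a2 = Complex \<beta> (- R)" and "a3 = Complex \<beta> R" and "a4 = Complex \<alpha> R"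
 define B where "B = cbox a1 a3"
 have Bi: "s \<in> B \<longleftrightarrow> \<alpha> <= Re s \<and> Re s <= \<beta> \<and> - R <= Im s \<and> Im s <= R" for s
  by (auto simp: B_def in_cbox_complex_iff a1_def a3_def)
 have Bint: "interior B = box a1 a3" by (simp add: B_def interior_cbox)
 have s0box: "cr s0 \<in> box a1 a3" using s0 R by (auto simp: in_box_complex_iff a1_def a3_def)
 have img: "path_image (rectpath a1 a3) \<subseteq> B - {cr s0}"
 proof -
  have "path_image (rectpath a1 a3) = cbox a1 a3 - box a1 a3"
  by (rule path_image_rectpath_cbox_minus_box) (use s0 R in \<open>auto simp: a1_def a3_def\<close>)
  then show ?thesis using s0box by (auto simp: B_def)
 qed
 have "(F has_contour_integral (2 * pi * \<i> * winding_number (rectpath a1 a3) s0 * g s0)) (rectpath a1 a3)"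
  unfolding F_def
 proof (rule Cauchy_integral_formula_weak[of B "{}"])
  show "convex B" by (simp add: B_def)
  show "continuous_on B g" by (rule continuous_on_subset[OF cont]) (auto simp: Bi)
  fix x assume "x \<in> interior B - {}"
  then have "\<alpha> < Re x" "Re x < \<beta>" by (auto simp: Bint in_box_complex_iff a1_def a3_def)
  moreover have "open {s. \<alpha> < Re s \<and> Re s < \<beta>}"
  unfolding Collect_conj_eq by (intro open_Int open_halfspace_Re_gt open_halfspace_Re_lt)
  ultimately show "g field_differentiable at x" using holomorphic_on_imp_differentiable_at[OF holg] by blast
 qed (use s0box img in \<open>auto simp: Bint\<close>)
 then have ci: "(F has_contour_integral (2 * pi * \<i> * g s0)) (rectpath a1 a3)"
  using winding_number_rectpath[OF s0box] by simp
 have contF: "continuous_on (closed_segment u v) F" if "closed_segment u v \<subseteq> B - {cr s0}" for u v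
  unfolding F_def by (intro continuous_intros continuous_on_subset[OF cont]) (use that in \<open>auto simp: Bi\<close>)
 have rp: "rectpath a1 a3 = linepath a1 a2 +++ linepath a2 a3 +++ linepath a3 a4 +++ linepath a4 a1"
  by (simp add: rectpath_def Let_def a1_def a2_def a3_def a4_def)
 have segs: "closed_segment a1 a2 \<subseteq> B - {cr s0}" "closed_segment a2 a3 \<subseteq> B - {cr s0}"
  "closed_segment a3 a4 \<subseteq> B - {cr s0}" "closed_segment a4 a1 \<subseteq> B - {cr s0}"
  using img unfolding rp by (auto simp: path_image_join)
 note cint = segs[THEN contF, THEN contour_integrable_continuous_linepath]
 have "2 * pi * \<i> * g s0 = contour_integral (rectpath a1 a3) F" using ci contour_integral_unique by metis
 also have "... = contour_integral (linepath a1 a2) F + (contour_integral (linepath a2 a3) F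
  + (contour_integral (linepath a3 a4) F + contour_integral (linepath a4 a1) F))"
  unfolding rp by (simp add: contour_integral_join cint contour_integrable_joinI)
 also have "contour_integral (linepath a2 a3) F = \<i> * integral {-R..R} (%y. F (Complex \<beta> y))"
  by (rule contour_integral_linepath_same_Re) (use R in \<open>auto simp: a2_def a3_def\<close>)
 also have "contour_integral (linepath a4 a1) F = - contour_integral (linepath a1 a4) F"
  using contour_integral_reverse_linepath[of a4 a1 F] contF[OF segs(4)] by (simp add: closed_segment_commute)
 also have "contour_integral (linepath a1 a4) F = \<i> * integral {-R..R} (%y. F (Complex \<alpha> y))"
  by (rule contour_integral_linepath_same_Re) (use R in \<open>auto simp: a1_def a4_def\<close>)
 finally have e1: "(integral {-R..R} (%y. F (Complex \<beta> y)) - integral {-R..R} (%y. F (Complex \<alpha> y))) - 2 * pi * g s0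
  = \<i> * (contour_integral (linepath a1 a2) F + contour_integral (linepath a3 a4) F)"
  by (simp add: complex_eq_iff algebra_simps)
 \<comment> \<open>R >= 1 keeps the horizontal sides at distance at least 1 from s0, so dividing by
   s - s0 preserves the bound on g.\<close>
 have FB: "norm (F s) <= C * (1 + R) ^ K * exp (- (c * R))" if "\<alpha> <= Re s" "Re s <= \<beta>" "\<bar>Im s\<bar> = R" for s
 proof -
  have "1 <= cmod (s - of_real s0)" using abs_Im_le_cmod[of "s - of_real s0"] that R by simp
  then have "norm (F s) <= cmod (g s) / 1" unfolding F_def norm_divide by (intro divide_left_mono) auto
  then show ?thesis using bound[of "Re s" "Im s"] that by simp
 qed
 have "norm (F a1) <= C * (1 + R) ^ K * exp (- (c * R))" by (rule FB) (use s0 R in \<open>auto simp: a1_def\<close>)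
 then have C0: "0 <= C * (1 + R) ^ K * exp (- (c * R))" by (rule order_trans[OF norm_ge_zero])
 have h1: "norm (contour_integral (linepath a1 a2) F) <= C * (1 + R) ^ K * exp (- (c * R)) * norm (a2 - a1)"
  by (rule contour_integral_bound_linepath[OF cint(1) C0 FB])
  (use s0 R segs(1) in \<open>auto simp: a1_def a2_def closed_segment_same_Im Bi\<close>)
 have h2: "norm (contour_integral (linepath a3 a4) F) <= C * (1 + R) ^ K * exp (- (c * R)) * norm (a4 - a3)"
  by (rule contour_integral_bound_linepath[OF cint(3) C0 FB])
  (use s0 R segs(3) in \<open>auto simp: a3_def a4_def closed_segment_same_Im Bi\<close>)
 have "norm (a2 - a1) = \<beta> - \<alpha>" "norm (a4 - a3) = \<beta> - \<alpha>"
  using s0 by (simp_all add: a1_def a2_def a3_def a4_def cmod_def)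
 then have "cmod (\<i> * (contour_integral (linepath a1 a2) F + contour_integral (linepath a3 a4) F)) <= 2 * E k"
  using h1 h2 norm_triangle_ineq[of "contour_integral (linepath a1 a2) F" "contour_integral (linepath a3 a4) F"]
  by (simp add: norm_mult E_def R_def)
 then show ?thesis unfolding R_def[symmetric] e1 .
 qed
 have E0: "(%k. 2 * E k) \<longlonglongrightarrow> 0"
 using tendsto_mult_right_zero[OF tendsto_mult_left_zero[OF poly_exp_tendsto_0[OF c, of C K], of "\<beta> - \<alpha>"], of 2] by (simp add: E_def)
 have "(%k. (integral {- real k..real k} (%y. F (Complex \<beta> y)) - integral {- real k..real k} (%y. F (Complex \<alpha> y))) - 2 * pi * g s0) \<longlonglongrightarrow> 0"
 by (rule Lim_null_comparison[OF _ E0]) (rule eventually_mono[OF eventually_ge_at_top[of 1] eq])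
 moreover have "(%k. (integral {- real k..real k} (%y. F (Complex \<beta> y)) - integral {- real k..real k} (%y. F (Complex \<alpha> y))) - 2 * pi * g s0)
  \<longlonglongrightarrow> ((\<integral>y. F (Complex \<beta> y) \<partial>lborel) - (\<integral>y. F (Complex \<alpha> y) \<partial>lborel)) - 2 * pi * g s0"
 using s0 by (intro tendsto_intros integral_symmetric_interval_tendsto intF) auto
 ultimately show "(\<integral>y. g (Complex \<beta> y) / (Complex \<beta> y - s0) \<partial>lborel) - (\<integral>y. g (Complex \<alpha> y) / (Complex \<alpha> y - s0) \<partial>lborel)
  = 2 * pi * g (of_real s0)"
 using LIMSEQ_unique by (fastforce simp: F_def)
qed

text \<open>z / sin (pi z) with the singularity at 0 removed. A factor cos (pi z) makes it z cot (pi
  z), so that the cotangent takes the form g s / (s - s0) of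
  \<open>vertical_strip_residue\<close>.\<close>

definition sc :: "complex => complex" where
 "sc z = (if z = 0 then 1 / of_real pi else z / sin (of_real pi * z))"

lemma sin_pi_nonzero:
 assumes "\<bar>Re z\<bar> < 1" "z ~= 0" shows "sin (of_real pi * z) ~= 0"
proof
 assume "sin (of_real pi * z) = 0"
 then obtain k :: int where "of_real pi * z = of_real (of_int k * pi)" by (auto simp: sin_eq_0)
 then have "of_real pi * z = of_real pi * of_int k" by simp
 then have z: "z = of_int k" by (subst (asm) mult_left_cancel) auto
 then have "\<bar>real_of_int k\<bar> < 1" using assms by simp
 then have "k = 0" by linarith
 then show False using z assms by simp
qed

lemma isCont_sc:
 assumes "\<bar>Re z\<bar> < 1" shows "isCont sc z"
proof (cases "z = 0")
 case True
 have "((%z. sin (of_real pi * z)) has_field_derivative of_real pi) (at (0::complex))"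
 by (auto intro!: derivative_eq_intros)
 then have "((%h. sin (of_real pi * h) / h) \<longlongrightarrow> of_real pi) (at (0::complex))"
 by (simp add: has_field_derivative_iff)
 then have "((%h. inverse (sin (of_real pi * h) / h)) \<longlongrightarrow> inverse (of_real pi)) (at (0::complex))"
 by (intro tendsto_inverse) auto
 then have "((%h. sc h) \<longlongrightarrow> inverse (of_real pi)) (at 0)"
 by (rule Lim_transform_eventually) (auto simp: eventually_at_filter sc_def)
 moreover have "sc 0 = inverse (of_real pi)" by (simp add: sc_def inverse_eq_divide)
 ultimately show ?thesis using True by (simp add: isCont_def)
next
 case False
 have "isCont (%z. z / sin (of_real pi * z)) z" using sin_pi_nonzero[OF assms False] by (intro continuous_intros) auto
 moreover have "\<forall>\<^sub>F w in nhds z. sc w = w / sin (of_real pi * w)"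
 using t1_space_nhds[OF False] by eventually_elim (simp add: sc_def)
 ultimately show ?thesis using isCont_cong by force
qed

lemma sc_field_differentiable:
 assumes "\<bar>Re z\<bar> < 1" "z ~= 0" shows "sc field_differentiable at z"
proof -
 have "(%z. z / sin (of_real pi * z)) field_differentiable at z"
 using sin_pi_nonzero[OF assms] by (intro derivative_intros field_differentiable_divide field_differentiable_compose[of "%z. of_real pi * z" _ sin, unfolded o_def] field_differentiable_at_sin) auto
 moreover have "\<forall>\<^sub>F w in nhds z. w / sin (of_real pi * w) = sc w"
 using t1_space_nhds[OF assms(2)] by eventually_elim (simp add: sc_def)
 ultimately show ?thesis
 unfolding field_differentiable_def using DERIV_cong_ev[OF refl _ refl] by force
qed

text \<open>Near the real axis by compactness; for |y| > 1 from |sin (pi z)| >= sinh (pi |y|) >= exp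
  (pi |y|) / 4.\<close>

lemma sc_bound:
 assumes \<eta>: "0 < \<eta>" "\<eta> < 1"
 shows "\<exists>C\<ge>0. \<forall>x y. \<bar>x\<bar> <= 1 - \<eta> --> cmod (sc (Complex x y)) <= C * (br y) * ep y"
proof -
 define B where "B = cbox (Complex (\<eta> - 1) (-1)) (Complex (1 - \<eta>) 1)"
 have "continuous_on B sc"
 by (rule continuous_at_imp_continuous_on) (use \<eta> in \<open>auto intro!: isCont_sc simp: B_def in_cbox_complex_iff\<close>)
 then have "bounded (sc ` B)" by (intro compact_imp_bounded compact_continuous_image) (auto simp: B_def)
 then obtain M where M: "!!z. z \<in> B ==> cmod (sc z) <= M" unfolding bounded_iff by force
 define C where "C = max 4 (\<bar>M\<bar> * exp pi)"
 have "cmod (sc (Complex x y)) <= C * (br y) * ep y" if x: "\<bar>x\<bar> <= 1 - \<eta>" for x y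
 proof (cases "\<bar>y\<bar> <= 1")
 case True
 have "Complex x y \<in> B" using x True by (auto simp: B_def in_cbox_complex_iff)
 then have "cmod (sc (Complex x y)) <= \<bar>M\<bar> * 1" using M by force
 also have "\<bar>M\<bar> * 1 <= \<bar>M\<bar> * (exp pi * ep y * (br y))"
 proof (rule mult_left_mono)
  have "1 <= exp pi * ep y" using True by (simp add: mult_left_le flip: exp_add)
  then have "1 * 1 <= exp pi * ep y * (br y)" by (intro mult_mono) auto
  then show "1 <= exp pi * ep y * (br y)" by simp
 qed auto
 also have "... = (\<bar>M\<bar> * exp pi) * ((br y) * ep y)" by simp
 also have "... <= C * ((br y) * ep y)" by (intro mult_right_mono) (auto simp: C_def)
 finally show ?thesis by simp
 next
 case False
 define v where "v = pi * \<bar>y\<bar>"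
 have v: "v \<ge> 1" using False pi_ge_two mult_mono[of 1 pi 1 "\<bar>y\<bar>"] by (simp add: v_def)
 have "sinh v ^ 2 <= (cmod (sin (of_real pi * Complex x y)))\<^sup>2"
 proof -
  have e: "exp (2 * (pi * y)) + inverse (exp (2 * (pi * y))) = exp (2 * v) + inverse (exp (2 * v))"
  by (cases "y \<ge> 0") (auto simp: v_def exp_minus)
  have "sinh v ^ 2 = (exp v - inverse (exp v))\<^sup>2 / 4"
  by (simp add: sinh_field_def exp_minus power_divide)
  also have "... = (exp (2 * v) + inverse (exp (2 * v)) - 2) / 4"
  by (simp add: power2_diff exp_double power_inverse)
  also have "... <= (exp (2 * v) + inverse (exp (2 * v)) - 2 * cos (2 * (pi * x))) / 4" by simp
  also have "... = (cmod (sin (of_real pi * Complex x y)))\<^sup>2" using e by (simp add: norm_sin_squared)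
  finally show ?thesis .
 qed
 then have s1: "sinh v <= cmod (sin (of_real pi * Complex x y))" by (rule power2_le_imp_le) simp
 have s2: "exp v / 4 <= sinh v"
 proof -
  have "2 <= exp v" using exp_ge_add_one_self[of v] v by linarith
  moreover have "inverse (exp v) <= inverse 1" using v by (intro le_imp_inverse_le) auto
  ultimately show ?thesis by (simp add: sinh_field_def exp_minus)
 qed
 have "Complex x y ~= 0" using False by (auto simp: complex_eq_iff)
 then have "cmod (sc (Complex x y)) = cmod (Complex x y) / cmod (sin (of_real pi * Complex x y))"
  by (simp add: sc_def norm_divide)
 also have "... <= (br y) / (exp v / 4)"
 proof (rule frac_le)
  show "cmod (Complex x y) <= 1 + \<bar>y\<bar>" using cmod_le[of "Complex x y"] x \<eta> by simp
  show "exp v / 4 <= cmod (sin (of_real pi * Complex x y))" using s1 s2 by linarith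
 qed auto
 also have "... = 4 * ((br y) * exp (- v))" by (simp add: exp_minus field_simps)
 also have "... <= C * ((br y) * exp (- v))" by (intro mult_right_mono) (auto simp: C_def)
 finally show ?thesis by (simp add: v_def)
 qed
 moreover have "C \<ge> 0" by (simp add: C_def)
 ultimately show ?thesis by blast
qed

lemma cmod_cos_pi_le: "cmod (cos (of_real pi * Complex x y)) <= exp (pi * \<bar>y\<bar>)"
proof (rule power2_le_imp_le)
 define E where "E = exp (pi * \<bar>y\<bar>)"
 have E: "E \<ge> 1" by (simp add: E_def)
 have "(exp (pi * y) - inverse (exp (pi * y)))\<^sup>2 = (E - inverse E)\<^sup>2"
 by (cases "y \<ge> 0") (auto simp: exp_minus E_def power2_commute)
 also have "... = E\<^sup>2 - 2 + (inverse E)\<^sup>2" using E by (simp add: power2_diff)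
 also have "... <= E\<^sup>2 - 2 + 1"
 using E power_mono[of "inverse E" 1 2] le_imp_inverse_le[of 1 E] by simp
 finally have 1: "(exp (pi * y) - inverse (exp (pi * y)))\<^sup>2 / 4 <= (E\<^sup>2 - 1) / 4" by simp
 have 2: "(cos (pi * x))\<^sup>2 <= 1" by (simp add: abs_square_le_1)
 have 3: "1 <= E\<^sup>2" using E by simp
 have "(cmod (cos (of_real pi * Complex x y)))\<^sup>2 = (cos (pi * x))\<^sup>2 + (exp (pi * y) - inverse (exp (pi * y)))\<^sup>2 / 4"
 by (simp add: norm_cos_squared)
 also have "... <= E\<^sup>2" using 1 2 3 by argo
 finally show "(cmod (cos (of_real pi * Complex x y)))\<^sup>2 <= (exp (pi * \<bar>y\<bar>))\<^sup>2" by (simp add: E_def)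
qed simp

lemma polynomial_factor_bound:
 "cmod (of_real u - (Complex x y + of_real v)\<^sup>2) <= (\<bar>u\<bar> + (\<bar>x\<bar> + \<bar>v\<bar> + 1)\<^sup>2) * (br y) ^ 2"
proof -
 have 1: "cmod (Complex x y + of_real v) <= (\<bar>x\<bar> + \<bar>v\<bar> + 1) * (br y)"
 proof -
 have "cmod (Complex x y + of_real v) <= \<bar>x + v\<bar> + \<bar>y\<bar>" using cmod_le[of "Complex x y + of_real v"] by simp
 also have "... <= (\<bar>x\<bar> + \<bar>v\<bar> + 1) * (br y)"
 proof -
  have "0 <= \<bar>x\<bar> * \<bar>y\<bar>" "0 <= \<bar>v\<bar> * \<bar>y\<bar>" by simp_all
  moreover have "(\<bar>x\<bar> + \<bar>v\<bar> + 1) * (br y) = \<bar>x\<bar> + \<bar>v\<bar> + 1 + \<bar>x\<bar> * \<bar>y\<bar> + \<bar>v\<bar> * \<bar>y\<bar> + \<bar>y\<bar>" by algebra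
  ultimately show ?thesis using abs_triangle_ineq[of x v] by linarith
 qed
 finally show ?thesis .
 qed
 have "cmod (of_real u - (Complex x y + of_real v)\<^sup>2) <= \<bar>u\<bar> + (cmod (Complex x y + of_real v))\<^sup>2"
 using norm_triangle_ineq4[of "cr u" "(Complex x y + of_real v)\<^sup>2"] by (simp add: norm_power)
 also have "... <= \<bar>u\<bar> * (br y) ^ 2 + ((\<bar>x\<bar> + \<bar>v\<bar> + 1) * (br y))\<^sup>2"
 using 1 by (intro add_mono power_mono) (auto simp: mult_le_cancel_left1)
 also have "... = (\<bar>u\<bar> + (\<bar>x\<bar> + \<bar>v\<bar> + 1)\<^sup>2) * (br y) ^ 2" by (subst power_mult_distrib) (rule distrib_right[symmetric])
 finally show ?thesis .
qed

lemma continuous_on_Gamma':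
 fixes f :: "'a::topological_space => complex"
 assumes "continuous_on A f" "!!x. x \<in> A ==> f x \<notin> \<int>\<^sub>\<le>\<^sub>0"
 shows "continuous_on A (%x. Gamma (f x))"
 by (rule continuous_on_compose2[OF continuous_on_Gamma[of "- \<int>\<^sub>\<le>\<^sub>0"] assms(1)]) (use assms(2) in auto)

text \<open>A primitive for the shift of s by 1: by \<open>Tfun_diff\<close> its difference is s
  (d^2 - a - 1/4 - s^2) Gamma (a + s) Gamma (a - s). Hence the integral of that expression against a
  function of period 1 is a boundary term of a strip of width one. The zeros at s = -1/2 - d and s =
  -1/2 + d come from the last factor.\<close>

definition Tfun :: "real => real => complex => complex" where
 "Tfun a d s = Gamma (of_real a + s + 1) * Gamma (of_real a - s) * (of_real (d\<^sup>2) - (s + of_real (1/2))\<^sup>2) / 2"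

lemma Tfun_diff:
 assumes "\<bar>Re s\<bar> < a"
 shows "Tfun a d s - Tfun a d (s - 1) = s * (of_real (d\<^sup>2 - a - 1/4) - s\<^sup>2) * (Gamma (of_real a + s) * Gamma (of_real a - s))"
proof -
 have n: "of_real a + s \<notin> \<int>\<^sub>\<le>\<^sub>0" "of_real a - s \<notin> \<int>\<^sub>\<le>\<^sub>0"
 using assms by (auto simp: complex_eq_iff elim!: nonpos_Ints_cases)
 have g: "Gamma (of_real a + s + 1) = (of_real a + s) * Gamma (of_real a + s)"
 "Gamma (of_real a - (s - 1)) = (of_real a - s) * Gamma (of_real a - s)"
 using Gamma_plus1[OF n(1)] Gamma_plus1[OF n(2)] by (simp_all add: algebra_simps)
 have e: "of_real a + (s - 1) + 1 = of_real a + s" by simp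
 show ?thesis unfolding Tfun_def e g by (simp add: field_simps power2_eq_square)
qed

lemma Gamma_not_nonpos: "0 < Re z ==> z \<notin> \<int>\<^sub>\<le>\<^sub>0"
 by (auto elim!: nonpos_Ints_cases)

lemma Gamma_product_bound:
 assumes p: "0 < p"
 shows "\<exists>C K. 0 <= C \<and> (\<forall>x x' y. p <= x \<and> x <= X \<and> p <= x' \<and> x' <= X -->
  cmod (Gamma (Complex x y) * Gamma (Complex x' (- y))) <= C * (br y) ^ K * ep y)"
proof -
 obtain C K where C: "0 <= C" "!!x y. p <= x ==> x <= X ==> cmod (Gamma (Complex x y)) <= C * (br y) ^ K * exp (- (pi * \<bar>y\<bar> / 2))"
 using Gamma_decay[OF p, of X] by blast
 have "cmod (Gamma (Complex x y) * Gamma (Complex x' (- y))) <= (C * C) * (br y) ^ (K + K) * ep y"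
 if "p <= x" "x <= X" "p <= x'" "x' <= X" for x x' y
 proof -
 have "cmod (Gamma (Complex x y) * Gamma (Complex x' (- y))) <= (C * (br y) ^ K * exp (- (pi * \<bar>y\<bar> / 2))) * (C * (1 + \<bar>- y\<bar>) ^ K * exp (- (pi * \<bar>- y\<bar> / 2)))"
  unfolding norm_mult by (intro mult_mono C that) (auto simp: C(1))
 also have "... = (C * C) * (br y) ^ (K + K) * (exp (- (pi * \<bar>y\<bar> / 2)) * exp (- (pi * \<bar>y\<bar> / 2)))"
  by (simp add: power_add)
 also have "exp (- (pi * \<bar>y\<bar> / 2)) * exp (- (pi * \<bar>y\<bar> / 2)) = ep y" by (simp flip: exp_add)
 finally show ?thesis .
 qed
 moreover have "0 <= C * C" using C by simp
 ultimately show ?thesis by blast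
qed

text \<open>Multiplied by \<open>Gamma (a + s) * Gamma (a - s)\<close>, the odd part of \<open>s * tan (pi * (s + d))\<close> at \<open>s = i y\<close>
 is the continuous part of the spectral density; \<open>p\<close> is the pole of the tangent in the strip \<open>-1 < Re s <= 0\<close>.\<close>
lemma strip_integral:
 fixes a d p :: real
 assumes a: "0 < a" and p: "-1 < p" "p <= 0" "0 < a + 1 + p"
 defines "q \<equiv> %y. d\<^sup>2 - a - 1/4 + y\<^sup>2"
 defines "w \<equiv> %y. Re (Gamma (Complex a y) * Gamma (Complex a (- y))) * (y * sinh (2 * pi * y) / (cosh (2 * pi * y) - cos (2 * pi * p)))"
 shows "integrable lborel (%y. q y * w y)" and "of_real (\<integral>y. q y * w y \<partial>lborel) = 2 * Tfun a d (of_real p)"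
proof -
 \<comment> \<open>The line Re s = e has the poles of Gamma (a - s) to its right, and the strip
   between it and Re s = e - 1 contains p and no other pole of the tangent.\<close>
 define e where "e = min (a / 2) ((p + 1) / 2)"
 have e: "0 < e" "e < a" "e < p + 1" "e <= 1/2" using a p by (auto simp: e_def min_def)
 \<comment> \<open>This is \<sigma> times the cotangent of pi \<sigma>, regular at 0.\<close>
 define cot where "cot \<sigma> = cos (of_real pi * \<sigma>) * sc \<sigma>" for \<sigma>
 have cont_cot: "continuous_on {\<sigma>. \<bar>Re \<sigma>\<bar> < 1} cot"
 unfolding cot_def by (intro continuous_intros continuous_at_imp_continuous_on ballI isCont_sc) auto
 have diff_cot: "cot field_differentiable at \<sigma>" if "\<bar>Re \<sigma>\<bar> < 1" "\<sigma> ~= 0" for \<sigma>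
 unfolding cot_def
 by (intro field_differentiable_mult sc_field_differentiable that field_differentiable_compose[of "%z. of_real pi * z" _ cos, unfolded o_def] field_differentiable_at_cos derivative_intros)
 define \<eta> where "\<eta> = min (p + 1 - e) e"
 have \<eta>: "0 < \<eta>" "\<eta> < 1" using e by (auto simp: \<eta>_def)
 obtain C1 where C1: "C1 \<ge> 0" "!!x y. \<bar>x\<bar> <= 1 - \<eta> ==> cmod (sc (Complex x y)) <= C1 * (br y) * ep y"
 using sc_bound[OF \<eta>] by blast
 have cot_bound: "cmod (cot (Complex x y)) <= C1 * (br y)" if "\<bar>x\<bar> <= 1 - \<eta>" for x y
 proof -
 have "cmod (cot (Complex x y)) <= exp (pi * \<bar>y\<bar>) * (C1 * (br y) * ep y)"
  unfolding cot_def norm_mult by (intro mult_mono cmod_cos_pi_le C1 that) auto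
 also have "... = C1 * (br y)" by (simp add: exp_minus)
 finally show ?thesis .
 qed
 define V where "V s = Gamma (of_real a + s) * Gamma (of_real a - s)" for s :: complex
 define Q where "Q s = (of_real (d\<^sup>2 - a - 1/4) - (s + of_real 0)\<^sup>2)" for s :: complex
 have Qs: "Q s = of_real (d\<^sup>2 - a - 1/4) - s\<^sup>2" for s by (simp add: Q_def)
 define tt where "tt s = - cos (of_real pi * (s - of_real p)) / sin (of_real pi * (s - of_real p))" for s :: complex
 \<comment> \<open>s times the tangent; for p = 0 the pole at 0 is cancelled by the factor s, and
   the regular value has to be supplied there.\<close>
 define st where "st s = (if p = 0 then - cot s else s * tt s)" for s :: complex
 have cotp: "s ~= of_real p ==> cot (s - of_real p) / (s - of_real p) = - tt s" for s
 by (simp add: cot_def sc_def tt_def)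
 have st_eq: "s ~= 0 ==> st s = s * tt s" for s
 by (simp add: st_def cot_def sc_def tt_def)
 have Cx: "of_real a + Complex x y = Complex (a + x) y" "of_real a - Complex x y = Complex (a - x) (- y)"
  "of_real a + Complex x y + 1 = Complex (a + x + 1) y" for x y
 by (auto simp: complex_eq_iff)
 \<comment> \<open>moving the line of integration into the strip, past a possible removable singularity at 0\<close>
 have step1: "integrable lborel (%y. Q (Complex 0 y) * V (Complex 0 y) * st (Complex 0 y))"
 "integrable lborel (%y. Q (Complex e y) * V (Complex e y) * st (Complex e y))"
 "(\<integral>y. Q (Complex e y) * V (Complex e y) * st (Complex e y) \<partial>lborel) = (\<integral>y. Q (Complex 0 y) * V (Complex 0 y) * st (Complex 0 y) \<partial>lborel)"
 proof -
 \<comment> \<open>\<open>vertical_strip_residue\<close> is applied with a fictitious pole at e / 2,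
   whose residue vanishes because of the factor put into g; the two line integrals therefore
   agree.\<close>
 define g where "g s = (s - of_real (e/2)) * (Q s * V s * st s)" for s
 have pe: "- 1 < - p + 0" "!!s. 0 <= Re s ==> Re s <= e ==> \<bar>Re (s - of_real p)\<bar> < 1"
  using p e by auto
 have st_cont: "continuous_on {s. 0 <= Re s \<and> Re s <= e} st"
 proof (cases "p = 0")
  case True
  then show ?thesis unfolding st_def using e by (auto intro!: continuous_intros continuous_on_subset[OF cont_cot])
 next
  case False
  have "s ~= of_real p" if "0 <= Re s" for s using False p that by auto
  then have "st s = - s * (cot (s - of_real p) / (s - of_real p))" if "0 <= Re s" for s
  using False cotp[of s] that by (simp add: st_def)
  moreover have "continuous_on {s. 0 <= Re s \<and> Re s <= e} (%s. - s * (cot (s - of_real p) / (s - of_real p)))"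
  using False p pe(2) by (intro continuous_intros continuous_on_compose2[OF cont_cot]) auto
  ultimately show ?thesis by (subst continuous_on_cong[OF refl]) auto
 qed
 have st_bound: "cmod (st (Complex x y)) <= C2 * (br y)\<^sup>2"
  if x: "0 <= x" "x <= e" and C2: "C2 = C1 * (1 + 2 / (if p = 0 then 1 else \<bar>p\<bar>))" for x y C2
 proof (cases "p = 0")
  case True
  have "cmod (st (Complex x y)) <= C1 * (br y)"
  using True cot_bound[of x y] x e by (simp add: st_def \<eta>_def min_def split: if_splits)
  also have "... <= (C2 * (br y)) * (br y)" using C1(1) True C2 by (simp add: mult_le_cancel_left1 mult_right_mono algebra_simps)
  finally show ?thesis by (simp add: power2_eq_square mult.assoc)
 next
  case False
  have ne: "Complex x y ~= of_real p" using False p x by (auto simp: complex_eq_iff)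
  have "\<bar>p\<bar> <= cmod (Complex x y - of_real p)" using abs_Re_le_cmod[of "Complex x y - of_real p"] x p by simp
  moreover have "cmod (cot (Complex x y - of_real p)) <= C1 * (br y)"
  proof -
  have "Complex x y - of_real p = Complex (x - p) y" by (simp add: complex_eq_iff)
  then show ?thesis using cot_bound[of "x - p" y] x p by (simp add: \<eta>_def)
  qed
  moreover have "cmod (Complex x y) <= 1 + \<bar>y\<bar>" using cmod_le[of "Complex x y"] x e by simp
  moreover have "st (Complex x y) = - Complex x y * (cot (Complex x y - of_real p) / (Complex x y - of_real p))"
  using False cotp[OF ne] by (simp add: st_def)
  ultimately have "cmod (st (Complex x y)) <= (br y) * ((C1 * (br y)) / \<bar>p\<bar>)"
  using False C1(1) by (simp only: norm_mult norm_divide norm_minus_cancel) (intro mult_mono frac_le; simp)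
  also have "... = (C1 / \<bar>p\<bar>) * (br y)\<^sup>2" by (simp add: power2_eq_square)
  also have "... <= C2 * (br y)\<^sup>2" using C1(1) False C2 by (intro mult_right_mono) (auto simp: distrib_left divide_simps)
  finally show ?thesis .
 qed
 obtain C3 K3 where C3: "0 <= C3" "!!x x' y. a - e <= x ==> x <= a + e ==> a - e <= x' ==> x' <= a + e ==>
  cmod (Gamma (Complex x y) * Gamma (Complex x' (- y))) <= C3 * (br y) ^ K3 * ep y"
  using Gamma_product_bound[of "a - e" "a + e"] e by fastforce
 define C2 where "C2 = C1 * (1 + 2 / (if p = 0 then 1 else \<bar>p\<bar>))"
 define C4 where "C4 = \<bar>d\<^sup>2 - a - 1/4\<bar> + (e + 1)\<^sup>2"
 have C2: "C2 \<ge> 0" using C1(1) by (simp add: C2_def)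
 have gb: "cmod (g (Complex x y)) <= (C4 * C3 * C2) * (br y) ^ (1 + 2 + K3 + 2) * ep y" if x: "0 <= x" "x <= e" for x y
 proof -
  have b1: "cmod (Complex x y - of_real (e/2)) <= 1 + \<bar>y\<bar>"
  using cmod_le[of "Complex x y - of_real (e/2)"] x e by (simp add: abs_le_iff)
  have b2: "cmod (Q (Complex x y)) <= C4 * (br y)\<^sup>2"
  proof -
  have "\<bar>d\<^sup>2 - a - 1/4\<bar> + (\<bar>x\<bar> + \<bar>0\<bar> + 1)\<^sup>2 <= C4" unfolding C4_def using x by (intro add_left_mono power_mono) auto
  then show ?thesis unfolding Q_def by (intro order_trans[OF polynomial_factor_bound]) (auto intro: mult_right_mono)
  qed
  have b3: "cmod (V (Complex x y)) <= C3 * (br y) ^ K3 * ep y"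
  unfolding V_def Cx by (rule C3(2)) (use x e in auto)
  have b4: "cmod (st (Complex x y)) <= C2 * (br y)\<^sup>2" by (rule st_bound[OF x C2_def])
  have "cmod (g (Complex x y)) <= (br y) * (C4 * (br y)\<^sup>2 * (C3 * (br y) ^ K3 * ep y) * (C2 * (br y)\<^sup>2))"
  unfolding g_def norm_mult
  using C2 C3(1) by (intro mult_mono b1 b2 b3 b4 mult_nonneg_nonneg) (auto simp: C4_def)
  also have "... = (C4 * C3 * C2) * (br y) ^ (1 + 2 + K3 + 2) * ep y"
  by (simp only: power_add power_one_right mult_ac)
  finally show ?thesis .
 qed
 have gc: "continuous_on {s. 0 <= Re s \<and> Re s <= e} g"
  unfolding g_def Q_def V_def using e
  by (intro continuous_intros st_cont continuous_on_Gamma' Gamma_not_nonpos) auto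
 have gd: "g field_differentiable at s" if s: "0 < Re s" "Re s < e" "s \<notin> {}" for s
 proof -
  have ne: "s - of_real p ~= 0" using s p by auto
  have "((%s. - s * (cot (s - of_real p) / (s - of_real p))) field_differentiable at s)"
  using ne s pe(2)[of s]
  by (intro field_differentiable_mult field_differentiable_divide field_differentiable_minus field_differentiable_ident
   field_differentiable_diff field_differentiable_const field_differentiable_compose[of "%s. s - of_real p" _ cot, unfolded o_def] diff_cot) auto
  moreover have "\<forall>\<^sub>F z in nhds s. - z * (cot (z - of_real p) / (z - of_real p)) = st z"
  proof -
  have "\<forall>\<^sub>F z in nhds s. z \<in> {z. 0 < Re z}" by (rule eventually_nhds_in_open) (use s in \<open>auto simp: open_halfspace_Re_gt\<close>)
  then show ?thesis
  proof eventually_elim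
   case (elim z)
   then have "z ~= of_real p" "z ~= 0" using p by auto
   then show ?case using cotp[of z] st_eq[of z] by simp
  qed
  qed
  ultimately have "st field_differentiable at s"
  unfolding field_differentiable_def using DERIV_cong_ev[OF refl _ refl] by force
  moreover have "(%s. Gamma (of_real a + s)) field_differentiable at s" "(%s. Gamma (of_real a - s)) field_differentiable at s"
  using s e by (auto intro!: field_differentiable_compose[of "%s. of_real a + s" s Gamma, unfolded o_def]
   field_differentiable_compose[of "%s. of_real a - s" s Gamma, unfolded o_def] field_differentiable_Gamma Gamma_not_nonpos derivative_intros)
  ultimately show ?thesis unfolding g_def Q_def V_def
  by (intro field_differentiable_mult field_differentiable_diff field_differentiable_const field_differentiable_ident field_differentiable_power field_differentiable_add)
 qed
 have div: "x ~= e/2 ==> g (Complex x y) / (Complex x y - of_real (e/2)) = Q (Complex x y) * V (Complex x y) * st (Complex x y)" for x y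
  by (simp add: g_def complex_eq_iff)
 have e2: "0 < e/2" "e/2 < e" using e by auto
 note r = vertical_strip_residue[OF e2 finite.emptyI gc gd pi_gt_zero gb]
 show "integrable lborel (%y. Q (Complex 0 y) * V (Complex 0 y) * st (Complex 0 y))"
  using r(1) div[of 0] e by simp
 show "integrable lborel (%y. Q (Complex e y) * V (Complex e y) * st (Complex e y))"
  using r(2) div[of e] e by simp
 show "(\<integral>y. Q (Complex e y) * V (Complex e y) * st (Complex e y) \<partial>lborel) = (\<integral>y. Q (Complex 0 y) * V (Complex 0 y) * st (Complex 0 y) \<partial>lborel)"
  using r(3) div[of 0] div[of e] e by (simp add: g_def)
 qed
 \<comment> \<open>the residue at \<open>p\<close>\<close>
 have step2: "(\<integral>y. Q (Complex e y) * V (Complex e y) * st (Complex e y) \<partial>lborel) = - 2 * Tfun a d (of_real p)"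
 proof -
 \<comment> \<open>Off p, g s / (s - p) is \<open>Tfun\<close> times the tangent. The tangent has
   period 1, so by \<open>Tfun_diff\<close> the values on the two edges of the strip differ by the
   integrand, and the integral is the residue at p.\<close>
 define g where "g s = - Tfun a d s * cot (s - of_real p)" for s
 have pe: "\<bar>Re (s - of_real p)\<bar> <= 1 - \<eta>" if "e - 1 <= Re s" "Re s <= e" for s
  using p e that by (auto simp: \<eta>_def min_def abs_le_iff)
 obtain C3 K3 where C3: "0 <= C3" "!!x x' y. min e (a - e) <= x ==> x <= a + 2 ==> min e (a - e) <= x' ==> x' <= a + 2 ==>
  cmod (Gamma (Complex x y) * Gamma (Complex x' (- y))) <= C3 * (br y) ^ K3 * ep y"
  using Gamma_product_bound[of "min e (a - e)" "a + 2"] e by fastforce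
 define C4 where "C4 = \<bar>d\<^sup>2\<bar> + (1 + \<bar>1/2\<bar> + 1)\<^sup>2"
 have gb: "cmod (g (Complex x y)) <= (C3 * C4 * C1) * (br y) ^ (K3 + 2 + 1) * ep y" if x: "e - 1 <= x" "x <= e" for x y
 proof -
  have b1: "cmod (Gamma (of_real a + Complex x y + 1) * Gamma (of_real a - Complex x y)) <= C3 * (br y) ^ K3 * ep y"
  unfolding Cx(3) Cx(2) by (rule C3(2)) (use x e a in auto)
  have b2: "cmod (of_real (d\<^sup>2) - (Complex x y + of_real (1/2))\<^sup>2) <= C4 * (br y)\<^sup>2"
  proof -
  have "\<bar>d\<^sup>2\<bar> + (\<bar>x\<bar> + \<bar>1/2\<bar> + 1)\<^sup>2 <= C4" unfolding C4_def using x e by (intro add_left_mono power_mono) auto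
  then show ?thesis by (intro order_trans[OF polynomial_factor_bound]) (auto intro: mult_right_mono)
  qed
  have b3: "cmod (cot (Complex x y - of_real p)) <= C1 * (br y)"
  proof -
  have "Complex x y - of_real p = Complex (x - p) y" by (simp add: complex_eq_iff)
  then show ?thesis using cot_bound[of "x - p" y] pe[of "Complex x y"] x by simp
  qed
  have T: "cmod (Tfun a d (Complex x y)) <= (C3 * (br y) ^ K3 * ep y) * (C4 * (br y)\<^sup>2)"
  proof -
  have "cmod (Tfun a d (Complex x y)) = cmod (Gamma (of_real a + Complex x y + 1) * Gamma (of_real a - Complex x y)) * cmod (of_real (d\<^sup>2) - (Complex x y + of_real (1/2))\<^sup>2) / 2"
   by (simp only: Tfun_def norm_mult norm_divide) simp
  also have "... <= cmod (Gamma (of_real a + Complex x y + 1) * Gamma (of_real a - Complex x y)) * cmod (of_real (d\<^sup>2) - (Complex x y + of_real (1/2))\<^sup>2)"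
   by simp
  also have "... <= (C3 * (br y) ^ K3 * ep y) * (C4 * (br y)\<^sup>2)"
   using C3(1) by (intro mult_mono b1 b2) auto
  finally show ?thesis .
  qed
  have "cmod (g (Complex x y)) <= ((C3 * (br y) ^ K3 * ep y) * (C4 * (br y)\<^sup>2)) * (C1 * (br y))"
  unfolding g_def norm_mult norm_minus_cancel using C3(1) by (intro mult_mono T b3) (auto simp: C4_def)
  also have "... = (C3 * C4 * C1) * (br y) ^ (K3 + 2 + 1) * ep y"
  by (simp only: power_add power_one_right mult_ac)
  finally show ?thesis .
 qed
 have gc: "continuous_on {s. e - 1 <= Re s \<and> Re s <= e} g"
 proof -
  let ?S = "{s. e - 1 <= Re s \<and> Re s <= e}"
  have 1: "continuous_on ?S (%s. cot (s - of_real p))"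
  by (rule continuous_on_compose2[OF cont_cot]) (intro continuous_intros, use pe \<eta> in fastforce)
  have 2: "continuous_on ?S (%s. Gamma (of_real a + s + 1))"
  by (intro continuous_on_Gamma' continuous_intros Gamma_not_nonpos) (use e a in auto)
  have 3: "continuous_on ?S (%s. Gamma (of_real a - s))"
  by (intro continuous_on_Gamma' continuous_intros Gamma_not_nonpos) (use e a in auto)
  show ?thesis unfolding g_def Tfun_def by (intro continuous_intros 1 2 3) auto
 qed
 have gd: "g field_differentiable at s" if s: "e - 1 < Re s" "Re s < e" "s \<notin> {of_real p}" for s
 proof -
  have "\<bar>Re (s - of_real p)\<bar> < 1" using pe[of s] s \<eta> by simp
  then have "(%s. cot (s - of_real p)) field_differentiable at s"
  using s by (intro field_differentiable_compose[of "%s. s - of_real p" _ cot, unfolded o_def] diff_cot derivative_intros) auto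
  moreover have "(%s. Gamma (of_real a + s + 1)) field_differentiable at s" "(%s. Gamma (of_real a - s)) field_differentiable at s"
  using s e a by (auto intro!: field_differentiable_compose[of "%s. of_real a + s + 1" s Gamma, unfolded o_def]
   field_differentiable_compose[of "%s. of_real a - s" s Gamma, unfolded o_def] field_differentiable_Gamma Gamma_not_nonpos derivative_intros)
  ultimately show ?thesis unfolding g_def Tfun_def
  by (intro field_differentiable_mult field_differentiable_divide field_differentiable_minus field_differentiable_diff field_differentiable_const field_differentiable_ident field_differentiable_power field_differentiable_add) auto
 qed
 have pp: "e - 1 < p" "p < e" using e p by auto
 have fin: "finite {cr p}" by simp
 note r = vertical_strip_residue[OF pp fin gc gd pi_gt_zero gb]
 have v: "g (Complex x y) / (Complex x y - of_real p) = Tfun a d (Complex x y) * tt (Complex x y)" if "x ~= p" for x y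
 proof -
  have "Complex x y ~= of_real p" using that by (simp add: complex_eq_iff)
  from cotp[OF this] show ?thesis unfolding g_def times_divide_eq_right[symmetric] by simp
 qed
 have per: "tt (Complex (e - 1) y) = tt (Complex e y)" for y
 proof -
  have "of_real pi * (Complex (e - 1) y - of_real p) = of_real pi * (Complex e y - of_real p) - of_real pi" by (simp add: complex_eq_iff algebra_simps)
  then show ?thesis unfolding tt_def by (simp add: cos_diff sin_diff flip: cos_of_real sin_of_real)
 qed
 have "Q (Complex e y) * V (Complex e y) * st (Complex e y) = g (Complex e y) / (Complex e y - of_real p) - g (Complex (e - 1) y) / (Complex (e - 1) y - of_real p)" for y
 proof -
  have "Complex (e - 1) y = Complex e y - 1" by (simp add: complex_eq_iff)
  then have "g (Complex e y) / (Complex e y - of_real p) - g (Complex (e - 1) y) / (Complex (e - 1) y - of_real p)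
  = (Tfun a d (Complex e y) - Tfun a d (Complex e y - 1)) * tt (Complex e y)"
  using v[of e y] v[of "e - 1" y] pp per[of y] by (simp add: left_diff_distrib)
  also have "... = Q (Complex e y) * V (Complex e y) * (Complex e y * tt (Complex e y))"
  using e by (subst Tfun_diff) (auto simp: Qs V_def mult_ac)
  also have "Complex e y * tt (Complex e y) = st (Complex e y)" using st_eq[of "Complex e y"] e by (simp add: complex_eq_iff)
  finally show ?thesis ..
 qed
 then have "(\<integral>y. Q (Complex e y) * V (Complex e y) * st (Complex e y) \<partial>lborel) = 2 * pi * g (of_real p)"
  using r by (simp add: Bochner_Integration.integral_diff)
 also have "g (of_real p) = - Tfun a d (of_real p) / pi" by (simp add: g_def cot_def sc_def)
 finally show ?thesis by simp
 qed
 \<comment> \<open>On the imaginary axis Q and V are real, so the real part falls on the tangent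
   factor. At y = 0 the quotient in w is 0 / 0 when p = 0, hence the exclusion of a null
   set.\<close>
 have re: "Re (Q (Complex 0 y) * V (Complex 0 y) * st (Complex 0 y)) = - (q y * w y)" if y: "y ~= 0" for y
 proof -
 have V: "V (Complex 0 y) = of_real (Re (Gamma (Complex a y) * Gamma (Complex a (- y))))"
 proof -
  have "Complex a (- y) = cnj (Complex a y)" by (simp add: complex_eq_iff)
  then have "Gamma (Complex a y) * Gamma (Complex a (- y)) = of_real ((cmod (Gamma (Complex a y)))\<^sup>2)"
  by (simp only: cnj_Gamma complex_norm_square)
  moreover have "V (Complex 0 y) = Gamma (Complex a y) * Gamma (Complex a (- y))"
  unfolding V_def Cx by simp
  ultimately show ?thesis by simp
 qed
 have Q: "Q (Complex 0 y) = of_real (q y)"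
  by (simp add: Qs q_def complex_eq_iff power2_eq_square)
 have st: "Re (st (Complex 0 y)) = - (y * sinh (2 * pi * y) / (cosh (2 * pi * y) - cos (2 * pi * p)))"
 proof -
  define z where "z = of_real pi * (Complex 0 y - of_real p)"
  have "st (Complex 0 y) = Complex 0 y * tt (Complex 0 y)" using y st_eq[of "Complex 0 y"] by (simp add: complex_eq_iff)
  also have "tt (Complex 0 y) = - (cos z * cnj (sin z)) / of_real ((cmod (sin z))\<^sup>2)"
  unfolding tt_def z_def[symmetric] by (cases "sin z = 0") (simp_all add: cmod_square_mult_cnj)
  finally have "Re (st (Complex 0 y)) = y * Im (cos z * cnj (sin z)) / (cmod (sin z))\<^sup>2"
  by (simp add: Re_divide_of_real Im_divide_of_real del: of_real_power)
  moreover have "Im (cos z * cnj (sin z)) = - sinh (2 * pi * y) / 2"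
  proof -
  have "cos z * cnj (sin z) = (sin (z + cnj z) - sin (z - cnj z)) / 2"
   by (simp add: sin_add sin_diff cnj_sin[symmetric] cnj_cos[symmetric])
  moreover have "z + cnj z = of_real (- (2 * pi * p))" "z - cnj z = \<i> * of_real (2 * pi * y)"
   by (simp_all add: z_def complex_eq_iff)
  moreover have "sin (\<i> * of_real (2 * pi * y)) = \<i> * of_real (sinh (2 * pi * y))"
  proof -
   have "sin (\<i> * of_real (2 * pi * y)) = \<i> * sinh (of_real (2 * pi * y))" by (simp add: sinh_conv_sin del: of_real_mult)
   also have "sinh (of_real (2 * pi * y)) = cr (sinh (2 * pi * y))"
   by (simp add: sinh_field_def exp_of_real flip: of_real_minus del: of_real_mult)
   finally show ?thesis .
  qed
  ultimately have eq: "cos z * cnj (sin z) = (of_real (sin (- (2 * pi * p))) - \<i> * of_real (sinh (2 * pi * y))) / 2"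
   by (simp only: sin_of_real)
  show ?thesis unfolding eq by simp
  qed
  moreover have "(cmod (sin z))\<^sup>2 = (cosh (2 * pi * y) - cos (2 * pi * p)) / 2"
  by (simp add: norm_sin_squared z_def cosh_field_def exp_minus mult.assoc field_simps)
  ultimately show ?thesis by simp
 qed
 show ?thesis unfolding V Q by (simp add: st w_def mult.assoc)
 qed
 have AE: "AE y in lborel. Re (Q (Complex 0 y) * V (Complex 0 y) * st (Complex 0 y)) = - (q y * w y)"
 proof -
 have "AE y in lborel. y ~= (0::real)" by (rule AE_lborel_singleton)
 then show ?thesis by (rule AE_mp) (use re in auto)
 qed
 have wm: "(%y. q y * w y) \<in> borel_measurable lborel"
 proof -
 have "continuous_on UNIV (%y. Gamma (Complex a y) * Gamma (Complex a (- y)))"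
  unfolding Complex_eq using a by (intro continuous_intros continuous_on_Gamma' Gamma_not_nonpos) auto
 then have [measurable]: "(%y. Gamma (Complex a y) * Gamma (Complex a (- y))) \<in> bmeas" by (rule borel_measurable_continuous_onI)
 have [measurable]: "(%y. sinh (2 * pi * y)) \<in> bmeas" "(%y. cosh (2 * pi * y)) \<in> bmeas"
  unfolding sinh_field_def cosh_field_def by measurable
 show ?thesis unfolding q_def w_def by measurable
 qed
 have i1: "integrable lborel (%y. - Re (Q (Complex 0 y) * V (Complex 0 y) * st (Complex 0 y)))"
 using step1(1) by (intro Bochner_Integration.integrable_minus integrable_Re)
 show "integrable lborel (%y. q y * w y)"
 by (rule integrable_cong_AE_imp[OF i1 wm]) (use AE in eventually_elim, simp)
 have "(\<integral>y. q y * w y \<partial>lborel) = (\<integral>y. - Re (Q (Complex 0 y) * V (Complex 0 y) * st (Complex 0 y)) \<partial>lborel)"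
 by (rule integral_cong_AE) (use AE wm i1 in \<open>auto elim: eventually_mono\<close>)
 also have "... = - Re (\<integral>y. Q (Complex 0 y) * V (Complex 0 y) * st (Complex 0 y) \<partial>lborel)"
 unfolding Bochner_Integration.integral_minus integral_Re[OF step1(1)] ..
 also have "... = Re (2 * Tfun a d (of_real p))" unfolding step1(3)[symmetric] step2 by simp
 also have "of_real ... = 2 * Tfun a d (of_real p)"
 proof -
 have "Tfun a d (of_real p) = of_real (Gamma (a + p + 1) * Gamma (a - p) * (d\<^sup>2 - (p + 1/2)\<^sup>2) / 2)"
 proof -
  have "cr a + of_real p + 1 = of_real (a + p + 1)" "cr a - of_real p = of_real (a - p)"
  "cr (d\<^sup>2) - (of_real p + of_real (1/2))\<^sup>2 = of_real (d\<^sup>2 - (p + 1/2)\<^sup>2)" by simp_all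
  then show ?thesis unfolding Tfun_def by (simp only: Gamma_complex_of_real of_real_mult of_real_divide of_real_numeral)
 qed
 then have "2 * Tfun a d (of_real p) = of_real (2 * (Gamma (a + p + 1) * Gamma (a - p) * (d\<^sup>2 - (p + 1/2)\<^sup>2) / 2))"
  by (simp only: of_real_mult of_real_numeral)
 then show ?thesis by (simp only: Re_complex_of_real)
 qed
 finally show "of_real (\<integral>y. q y * w y \<partial>lborel) = 2 * Tfun a d (of_real p)" .
qed

section \<open>Even functions with exponential decay are determined by their moments\<close>

text \<open>The cosine series may be integrated term by term: its partial sums at s x are bounded by
  exp (c |x| / 2), and the other half of the exponential moment absorbs x^(2 k).\<close>

lemma even_moments_cos:
 fixes v :: "real => real"
 assumes v: "v \<in> bmeas" and c: "c > 0" and int: "integrable lborel (%x. \<bar>v x\<bar> * exp (c * \<bar>x\<bar>))"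
 and zero: "!!k. (\<integral>x. v x * x ^ (2 * k) \<partial>lborel) = 0" and s: "\<bar>s\<bar> <= c / 2"
 shows "(\<integral>x. v x * x ^ (2 * k) * cos (s * x) \<partial>lborel) = 0"
proof -
 note [measurable] = v
 obtain D where D: "D > 0" "!!x. (br x) ^ (2 * k) <= D * exp (c / 2 * \<bar>x\<bar>)" using poly_le_exp[of "c/2" "2 * k"] c by auto
 have pw: "\<bar>x ^ (2 * k)\<bar> <= D * exp (c / 2 * \<bar>x\<bar>)" for x
 proof -
 have "\<bar>x ^ (2 * k)\<bar> <= (br x) ^ (2 * k)" unfolding power_abs by (intro power_mono) auto
 then show ?thesis using D(2)[of x] by linarith
 qed
 define S where "S L x = (\<Sum>l<L. cos_coeff l * (s * x) ^ l)" for L x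
 have Sb: "\<bar>S L x\<bar> <= exp (c / 2 * \<bar>x\<bar>)" for L x
 proof -
 have "\<bar>S L x\<bar> <= (\<Sum>l<L. \<bar>s * x\<bar> ^ l / fact l)"
  unfolding S_def by (rule order_trans[OF sum_abs]) (intro sum_mono, auto simp: cos_coeff_def abs_mult power_abs)
 also have "... <= exp \<bar>s * x\<bar>"
  using sum_le_suminf[of "%l. inverse (fact l) *\<^sub>R \<bar>s * x\<bar> ^ l" "{..<L}"] summable_exp_generic[of "\<bar>s * x\<bar>"]
  by (simp add: exp_def divide_inverse mult.commute)
 also have "... <= exp (c / 2 * \<bar>x\<bar>)"
  unfolding abs_mult exp_le_cancel_iff by (rule mult_right_mono[OF s]) simp
 finally show ?thesis .
 qed
 have Si: "integrable lborel (%x. v x * x ^ j)" for j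
 proof -
 obtain D' where D': "D' > 0" "!!x. (br x) ^ j <= D' * exp (c * \<bar>x\<bar>)" using poly_le_exp[of c j] c by auto
 show ?thesis
 proof (rule Bochner_Integration.integrable_bound[OF integrable_mult_right[OF int, of D']])
  have "norm (v x * x ^ j) <= norm (D' * (\<bar>v x\<bar> * exp (c * \<bar>x\<bar>)))" for x
  proof -
  have "\<bar>x ^ j\<bar> <= (br x) ^ j" unfolding power_abs by (intro power_mono) auto
  then have "\<bar>x ^ j\<bar> <= D' * exp (c * \<bar>x\<bar>)" using D'(2)[of x] by linarith
  from mult_left_mono[OF this, of "\<bar>v x\<bar>"] show ?thesis using D'(1) by (simp add: abs_mult mult_ac)
  qed
  then show "AE x in lborel. norm (v x * x ^ j) <= norm (D' * (\<bar>v x\<bar> * exp (c * \<bar>x\<bar>)))" by simp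
 qed measurable
 qed
 have "(%L. \<integral>x. v x * x ^ (2 * k) * S L x \<partial>lborel) \<longlonglongrightarrow> (\<integral>x. v x * x ^ (2 * k) * cos (s * x) \<partial>lborel)"
 proof (rule integral_dominated_convergence)
 show "integrable lborel (%x. D * (\<bar>v x\<bar> * exp (c * \<bar>x\<bar>)))" by (rule integrable_mult_right[OF int])
 show "AE x in lborel. (%L. v x * x ^ (2 * k) * S L x) \<longlonglongrightarrow> v x * x ^ (2 * k) * cos (s * x)"
 proof (intro AE_I2 tendsto_mult tendsto_const)
  fix x show "(%L. S L x) \<longlonglongrightarrow> cos (s * x)"
  using cos_converges[of "s * x"] unfolding sums_def S_def by (simp add: scaleR_conv_of_real)
 qed
 show "AE x in lborel. norm (v x * x ^ (2 * k) * S L x) <= D * (\<bar>v x\<bar> * exp (c * \<bar>x\<bar>))" for L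
 proof (intro AE_I2)
  fix x
  have "norm (v x * x ^ (2 * k) * S L x) <= \<bar>v x\<bar> * (D * exp (c / 2 * \<bar>x\<bar>)) * exp (c / 2 * \<bar>x\<bar>)"
  using pw[of x] Sb[of L x] D(1) by (simp add: abs_mult) (intro mult_mono; simp add: mult_left_mono)
  also have "... = D * (\<bar>v x\<bar> * exp (c * \<bar>x\<bar>))"
  proof -
  have "exp (c * \<bar>x\<bar>) = exp (c / 2 * \<bar>x\<bar>) * exp (c / 2 * \<bar>x\<bar>)" by (simp flip: exp_add)
  then show ?thesis by simp
  qed
  finally show "norm (v x * x ^ (2 * k) * S L x) <= D * (\<bar>v x\<bar> * exp (c * \<bar>x\<bar>))" .
 qed
 qed (simp_all add: S_def)
 moreover have "(\<integral>x. v x * x ^ (2 * k) * S L x \<partial>lborel) = 0" for L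
 proof -
 have "(\<integral>x. v x * x ^ (2 * k) * S L x \<partial>lborel) = (\<integral>x. (\<Sum>l<L. (cos_coeff l * s ^ l) * (v x * x ^ (2 * k + l))) \<partial>lborel)"
  unfolding S_def sum_distrib_left by (intro Bochner_Integration.integral_cong sum.cong refl) (simp add: power_mult_distrib power_add)
 also have "... = (\<Sum>l<L. (cos_coeff l * s ^ l) * (\<integral>x. v x * x ^ (2 * k + l) \<partial>lborel))"
  by (subst Bochner_Integration.integral_sum) (simp_all add: Si integrable_mult_right)
 also have "... = 0"
 proof (rule sum.neutral, clarify)
  fix l
  show "(cos_coeff l * s ^ l) * (\<integral>x. v x * x ^ (2 * k + l) \<partial>lborel) = 0"
  proof (cases "even l")
  case True
  then obtain i where "l = 2 * i" by blast
  then show ?thesis using zero[of "k + i"] by (simp add: distrib_left)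
  qed (simp add: cos_coeff_def)
 qed
 finally show ?thesis .
 qed
 ultimately show ?thesis by (simp add: LIMSEQ_const_iff)
qed

text \<open>Frequencies beyond c / 2 are reached in n equal steps of size s. By 2 cos A cos B = cos
  (A + B) + cos (A - B), once u cos (j s x) is known to have vanishing even moments,
  \<open>even_moments_cos\<close> applied to it yields the next frequency.\<close>

lemma even_moments_cos_all:
 fixes u :: "real => real"
 assumes u: "u \<in> bmeas" and c: "c > 0" and int: "integrable lborel (%x. \<bar>u x\<bar> * exp (c * \<bar>x\<bar>))"
 and zero: "!!k. (\<integral>x. u x * x ^ (2 * k) \<partial>lborel) = 0"
 shows "(\<integral>x. u x * cos (r * x) \<partial>lborel) = 0"
proof -
 note [measurable] = u
 have ub: "integrable lborel (%x. \<bar>u x * cos (t * x)\<bar> * exp (c * \<bar>x\<bar>))" for t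
 proof (rule Bochner_Integration.integrable_bound[OF int])
 have "\<bar>u x\<bar> * \<bar>cos (t * x)\<bar> * exp (c * \<bar>x\<bar>) <= \<bar>u x\<bar> * 1 * exp (c * \<bar>x\<bar>)" for x
  by (intro mult_right_mono mult_left_mono) auto
 then show "AE x in lborel. norm (\<bar>u x * cos (t * x)\<bar> * exp (c * \<bar>x\<bar>)) <= norm (\<bar>u x\<bar> * exp (c * \<bar>x\<bar>))"
  by (simp add: abs_mult)
 qed measurable
 have iu: "integrable lborel (%x. u x * x ^ (2 * k) * cos (t * x))" for k t
 proof -
 obtain D' where D': "D' > 0" "!!x. (br x) ^ (2*k) <= D' * exp (c * \<bar>x\<bar>)" using poly_le_exp[of c "2*k"] c by auto
 show ?thesis
 proof (rule Bochner_Integration.integrable_bound[OF integrable_mult_right[OF int, of D']])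
  have "norm (u x * x ^ (2*k) * cos (t * x)) <= norm (D' * (\<bar>u x\<bar> * exp (c * \<bar>x\<bar>)))" for x
  proof -
  have "\<bar>x ^ (2*k)\<bar> <= (br x) ^ (2*k)" unfolding power_abs by (intro power_mono) auto
  then have "\<bar>x ^ (2*k)\<bar> <= D' * exp (c * \<bar>x\<bar>)" using D'(2)[of x] by linarith
  then have "\<bar>u x\<bar> * \<bar>x ^ (2*k)\<bar> * \<bar>cos (t * x)\<bar> <= \<bar>u x\<bar> * (D' * exp (c * \<bar>x\<bar>)) * 1"
   using D'(1) by (intro mult_mono) auto
  then show ?thesis using D'(1) by (simp add: abs_mult mult_ac)
  qed
  then show "AE x in lborel. norm (u x * x ^ (2*k) * cos (t * x)) <= norm (D' * (\<bar>u x\<bar> * exp (c * \<bar>x\<bar>)))" by simp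
 qed measurable
 qed
 obtain n :: nat where n: "\<bar>r\<bar> / (c / 2) < real n" using reals_Archimedean2 by blast
 have n0: "n > 0" using n c by (cases n) (auto simp: divide_less_0_iff)
 define s where "s = r / real n"
 have s: "\<bar>s\<bar> <= c / 2" using n n0 c by (simp add: s_def field_simps)
 \<comment> \<open>Two consecutive frequencies are carried along, as the recursion has three
   terms.\<close>
 have "(\<integral>x. u x * x ^ (2 * k) * cos ((real j * s) * x) \<partial>lborel) = 0 \<and> (\<integral>x. u x * x ^ (2 * k) * cos ((real (Suc j) * s) * x) \<partial>lborel) = 0" for j k
 proof (induction j arbitrary: k)
 case 0
 show ?case using zero[of k] even_moments_cos[OF u c int zero s, of k] by simp
 next
 case (Suc j)
 have "(\<integral>x. u x * x ^ (2 * k) * cos ((real (Suc (Suc j)) * s) * x) \<partial>lborel) =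
  (\<integral>x. 2 * ((u x * cos ((real (Suc j) * s) * x)) * x ^ (2 * k) * cos (s * x)) - u x * x ^ (2 * k) * cos ((real j * s) * x) \<partial>lborel)"
 proof (intro Bochner_Integration.integral_cong refl)
  fix x
  have a: "(real (Suc (Suc j)) * s) * x = (real (Suc j) * s) * x + s * x" "(real j * s) * x = (real (Suc j) * s) * x - s * x"
  by (simp_all add: algebra_simps)
  show "u x * x ^ (2 * k) * cos ((real (Suc (Suc j)) * s) * x) = 2 * ((u x * cos ((real (Suc j) * s) * x)) * x ^ (2 * k) * cos (s * x)) - u x * x ^ (2 * k) * cos ((real j * s) * x)"
  unfolding a cos_add cos_diff by (simp add: algebra_simps)
 qed
 also have "... = 2 * (\<integral>x. (u x * cos ((real (Suc j) * s) * x)) * x ^ (2 * k) * cos (s * x) \<partial>lborel) - (\<integral>x. u x * x ^ (2 * k) * cos ((real j * s) * x) \<partial>lborel)"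
 proof -
  have "integrable lborel (%x. (u x * x ^ (2 * k) * cos ((real (Suc j) * s) * x)) * cos (s * x))"
  by (rule Bochner_Integration.integrable_bound[OF iu[of k "real (Suc j) * s"]]) (auto simp: abs_mult mult_left_le)
  then have "integrable lborel (%x. (u x * cos ((real (Suc j) * s) * x)) * x ^ (2 * k) * cos (s * x))" by (simp add: mult_ac)
  then show ?thesis using iu[of k "real j * s"] by simp
 qed
 also have "(\<integral>x. (u x * cos ((real (Suc j) * s) * x)) * x ^ (2 * k) * cos (s * x) \<partial>lborel) = 0"
 proof (rule even_moments_cos[OF _ c ub _ s])
  show "(%x. u x * cos ((real (Suc j) * s) * x)) \<in> bmeas" by measurable
  show "(\<integral>x. u x * cos ((real (Suc j) * s) * x) * x ^ (2 * l) \<partial>lborel) = 0" for l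
  using Suc.IH[of l] by (simp only: mult.assoc mult.commute[of "cos _"])
 qed
 finally show ?case using Suc.IH[of k] by simp
 qed
 from this[of 0 n] show ?thesis using n0 by (simp add: s_def)
qed

text \<open>The positive and negative parts of u have the same mass m. If m > 0, both are normalised
  to probability densities: their characteristic functions agree, the cosine part by
  \<open>even_moments_cos_all\<close> and the sine part by evenness, and Levy's uniqueness theorem
  identifies them.\<close>

lemma even_function_moments_zero_AE:
 fixes u :: "real => real"
 assumes u: "u \<in> bmeas" and c: "c > 0" and int: "integrable lborel (%x. \<bar>u x\<bar> * exp (c * \<bar>x\<bar>))"
 and even: "!!x. u (- x) = u x"
 and zero: "!!k. (\<integral>x. u x * x ^ (2 * k) \<partial>lborel) = 0"
 shows "AE x in lborel. u x = 0"
proof -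
 note [measurable] = u
 have ui: "integrable lborel u"
 by (rule Bochner_Integration.integrable_bound[OF int]) (use c in \<open>auto simp: mult_le_cancel_left1\<close>)
 define p where "p x = max 0 (u x)" for x
 define q where "q x = max 0 (- u x)" for x
 have pq: "p x - q x = u x" "0 <= p x" "0 <= q x" for x by (auto simp: p_def q_def)
 have [measurable]: "p \<in> bmeas" "q \<in> bmeas" unfolding p_def q_def by measurable
 have pi: "integrable lborel p" and qi: "integrable lborel q"
 using ui by (auto intro!: Bochner_Integration.integrable_bound[OF ui] simp: p_def q_def)
 define m where "m = (\<integral>x. p x \<partial>lborel)"
 have "(\<integral>x. p x - q x \<partial>lborel) = 0" unfolding pq(1) using zero[of 0] by simp
 then have mq: "(\<integral>x. q x \<partial>lborel) = m" using pi qi by (simp add: m_def)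
 show ?thesis
 proof (cases "m = 0")
 case True
 have "AE x in lborel. p x = 0" using True integral_nonneg_eq_0_iff_AE[OF pi] pq by (simp add: m_def)
 moreover have "AE x in lborel. q x = 0" using True mq integral_nonneg_eq_0_iff_AE[OF qi] pq by simp
 ultimately show ?thesis
 proof eventually_elim
  case (elim x)
  then show ?case using pq(1)[of x] by simp
 qed
 next
 case False
 then have m: "m > 0" using Bochner_Integration.integral_nonneg[of lborel p] pq(2) unfolding m_def by (metis less_eq_real_def)
 define P where "P = density lborel (%x. ennreal (p x / m))"
 define Q where "Q = density lborel (%x. ennreal (q x / m))"
 have rd: "real_distribution (density lborel (%x. ennreal (g x / m)))"
  if g: "g \<in> bmeas" "!!x. 0 <= g x" "integrable lborel g" "(\<integral>x. g x \<partial>lborel) = m" for g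
 proof -
  have "prob_space (density lborel (%x. ennreal (g x / m)))"
  proof
  have "(\<integral>\<^sup>+x. ennreal (g x / m) \<partial>lborel) = ennreal (\<integral>x. g x / m \<partial>lborel)"
   by (rule nn_integral_eq_integral) (use g m in auto)
  also have "(\<integral>x. g x / m \<partial>lborel) = 1" using g(4) m by simp
  finally show "emeasure (density lborel (%x. ennreal (g x / m))) (space (density lborel (%x. ennreal (g x / m)))) = 1"
   using g(1) by (simp add: emeasure_density)
  qed
  then show ?thesis by (auto simp: real_distribution_def real_distribution_axioms_def)
 qed
 have ch: "char (density lborel (%x. ennreal (g x / m))) t = (\<integral>x. (g x / m) *\<^sub>R cis (t * x) \<partial>lborel)"
  if g: "g \<in> bmeas" "!!x. 0 <= g x" for g t
  unfolding char_def using g m by (subst integral_density) (auto simp: cis_conv_exp)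
 have gi: "integrable lborel (%x. (g x / m) *\<^sub>R cis (t * x))" if g: "integrable lborel g" for g t
 proof -
  have [measurable]: "g \<in> bmeas" using g by auto
  have [measurable]: "(%x. cis (t * x)) \<in> bmeas" by (intro borel_measurable_continuous_onI continuous_intros)
  show ?thesis by (rule Bochner_Integration.integrable_bound[OF integrable_divide[OF g, of m]]) auto
 qed
 have "char P t = char Q t" for t
 proof -
  have "char P t - char Q t = (\<integral>x. (p x / m) *\<^sub>R cis (t * x) - (q x / m) *\<^sub>R cis (t * x) \<partial>lborel)"
  unfolding P_def Q_def using pq pi qi by (simp add: ch gi Bochner_Integration.integral_diff)
  also have "... = (\<integral>x. (u x / m) *\<^sub>R cis (t * x) \<partial>lborel)"
  unfolding pq(1)[symmetric] by (simp add: diff_divide_distrib scaleR_left_diff_distrib)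
  also have "... = 0"
  proof (rule complex_eqI)
  have "Re (\<integral>x. (u x / m) *\<^sub>R cis (t * x) \<partial>lborel) = (\<integral>x. u x * cos (t * x) / m \<partial>lborel)"
   by (subst integral_Re[symmetric]) (simp_all add: gi ui)
  then show "Re (\<integral>x. (u x / m) *\<^sub>R cis (t * x) \<partial>lborel) = Re 0"
   using even_moments_cos_all[OF u c int zero, of t] by simp
  have "Im (\<integral>x. (u x / m) *\<^sub>R cis (t * x) \<partial>lborel) = (\<integral>x. u x / m * sin (t * x) \<partial>lborel)"
   by (subst integral_Im[symmetric]) (simp_all add: gi ui)
  moreover have "(\<integral>x. u x / m * sin (t * x) \<partial>lborel) = (\<integral>x. u (- x) / m * sin (t * (- x)) \<partial>lborel)"
   using lborel_integral_real_affine[of "-1" "%x. u x / m * sin (t * x)" 0] by simp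
  ultimately show "Im (\<integral>x. (u x / m) *\<^sub>R cis (t * x) \<partial>lborel) = Im 0" by (simp add: even)
  qed
  finally show ?thesis by simp
 qed
 then have PQ: "P = Q" unfolding P_def Q_def using pq pi qi mq
  by (intro Levy_uniqueness rd) (auto simp: m_def)
 have "AE x in lborel. ennreal (p x / m) = ennreal (q x / m)"
  using PQ unfolding P_def Q_def by (subst (asm) sigma_finite_measure.density_unique_iff[OF lborel.sigma_finite_measure_axioms]) auto
 then show ?thesis
 proof eventually_elim
  case (elim x)
  then have "p x / m = q x / m" using pq m by (subst (asm) ennreal_inj) auto
  then show ?case using m pq(1)[of x] by simp
 qed
 qed
qed

section \<open>L2 spaces, Riesz-Fischer and the unitary map\<close>

lemma borel_measurable_cnj [measurable (raw)]: "f \<in> borel_measurable M ==> (%x. cnj (f x)) \<in> borel_measurable M"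
 by (rule measurable_compose[OF _ borel_measurable_continuous_onI]) (auto intro: continuous_intros)

lemma L2_measurable: "\<phi> \<in> L2 M ==> \<phi> \<in> borel_measurable M"
 and L2_integrable: "\<phi> \<in> L2 M ==> integrable M (%x. (cmod (\<phi> x))\<^sup>2)"
 by (auto simp: L2_def)

lemma L2_mult_integrable:
 assumes "\<phi> \<in> L2 M" "\<psi> \<in> L2 M" shows "integrable M (%x. \<phi> x * cnj (\<psi> x))"
proof (rule Bochner_Integration.integrable_bound[OF Bochner_Integration.integrable_add[OF L2_integrable[OF assms(1)] L2_integrable[OF assms(2)]]])
 note [measurable] = L2_measurable[OF assms(1)] L2_measurable[OF assms(2)]
 show "(%x. \<phi> x * cnj (\<psi> x)) \<in> borel_measurable M" by measurable
 have "cmod (\<phi> x) * cmod (\<psi> x) <= (cmod (\<phi> x))\<^sup>2 + (cmod (\<psi> x))\<^sup>2" for x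
 using sum_squares_bound[of "cmod (\<phi> x)" "cmod (\<psi> x)"] mult_nonneg_nonneg[OF norm_ge_zero[of "\<phi> x"] norm_ge_zero[of "\<psi> x"]]
 unfolding mult.assoc by linarith
 then show "AE x in M. norm (\<phi> x * cnj (\<psi> x)) <= norm ((cmod (\<phi> x))\<^sup>2 + (cmod (\<psi> x))\<^sup>2)"
 by (simp add: norm_mult)
qed

lemma L2_scale: "\<phi> \<in> L2 M ==> (%x. c * \<phi> x) \<in> L2 M"
 by (auto simp: L2_def norm_mult power_mult_distrib)

lemma L2_add:
 assumes "\<phi> \<in> L2 M" "\<psi> \<in> L2 M" shows "(%x. \<phi> x + \<psi> x) \<in> L2 M"
proof -
 note [measurable] = L2_measurable[OF assms(1)] L2_measurable[OF assms(2)]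
 have "integrable M (%x. (cmod (\<phi> x + \<psi> x))\<^sup>2)"
 proof (rule Bochner_Integration.integrable_bound)
 show "integrable M (%x. 2 * (cmod (\<phi> x))\<^sup>2 + 2 * (cmod (\<psi> x))\<^sup>2)"
  by (intro Bochner_Integration.integrable_add integrable_mult_right L2_integrable assms)
 have "(cmod (\<phi> x + \<psi> x))\<^sup>2 <= 2 * (cmod (\<phi> x))\<^sup>2 + 2 * (cmod (\<psi> x))\<^sup>2" for x
 proof -
  have "(cmod (\<phi> x + \<psi> x))\<^sup>2 <= (cmod (\<phi> x) + cmod (\<psi> x))\<^sup>2" by (intro power_mono norm_triangle_ineq) auto
  also have "... <= 2 * (cmod (\<phi> x))\<^sup>2 + 2 * (cmod (\<psi> x))\<^sup>2"
  using sum_squares_bound[of "cmod (\<phi> x)" "cmod (\<psi> x)"] by (simp add: power2_sum)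
  finally show ?thesis .
 qed
 then show "AE x in M. norm ((cmod (\<phi> x + \<psi> x))\<^sup>2) <= norm (2 * (cmod (\<phi> x))\<^sup>2 + 2 * (cmod (\<psi> x))\<^sup>2)" by simp
 qed measurable
 then show ?thesis by (simp add: L2_def)
qed

lemma L2_diff: "\<phi> \<in> L2 M ==> \<psi> \<in> L2 M ==> (%x. \<phi> x - \<psi> x) \<in> L2 M"
 using L2_add[of \<phi> M "%x. -1 * \<psi> x"] L2_scale[of \<psi> M "-1"] by simp

lemma L2_zero: "(%x. 0) \<in> L2 M" by (simp add: L2_def)

lemma L2_sum: "(!!i. i \<in> I ==> F i \<in> L2 M) ==> (%x. \<Sum>i\<in>I. F i x) \<in> L2 M"
 by (induction I rule: infinite_finite_induct) (auto intro: L2_zero L2_add)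

definition lip :: "'x measure => ('x => complex) => ('x => complex) => complex" where
 "lip M \<phi> \<psi> = (\<integral>x. \<phi> x * cnj (\<psi> x) \<partial>M)"

definition lnsq :: "'x measure => ('x => complex) => real" where
 "lnsq M \<phi> = (\<integral>x. (cmod (\<phi> x))\<^sup>2 \<partial>M)"

lemma lip_diff_left: "\<phi> \<in> L2 M ==> \<psi> \<in> L2 M ==> \<theta> \<in> L2 M ==> lip M (%x. \<phi> x - \<psi> x) \<theta> = lip M \<phi> \<theta> - lip M \<psi> \<theta>"
 by (simp add: lip_def left_diff_distrib L2_mult_integrable)

lemma lip_add_left: "\<phi> \<in> L2 M ==> \<psi> \<in> L2 M ==> \<theta> \<in> L2 M ==> lip M (%x. \<phi> x + \<psi> x) \<theta> = lip M \<phi> \<theta> + lip M \<psi> \<theta>"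
 by (simp add: lip_def distrib_right L2_mult_integrable)

lemma lip_scale_left: "lip M (%x. c * \<phi> x) \<theta> = c * lip M \<phi> \<theta>"
 by (simp add: lip_def mult.assoc)

lemma lip_sum_left: "(!!i. i \<in> I ==> F i \<in> L2 M) ==> \<theta> \<in> L2 M ==> lip M (%x. \<Sum>i\<in>I. F i x) \<theta> = (\<Sum>i\<in>I. lip M (F i) \<theta>)"
 by (simp add: lip_def sum_distrib_right L2_mult_integrable)

lemma lip_cnj: "lip M \<psi> \<phi> = cnj (lip M \<phi> \<psi>)"
 unfolding lip_def Bochner_Integration.integral_cnj[symmetric] by (simp add: mult.commute)

lemma lip_self: "lip M \<phi> \<phi> = of_real (lnsq M \<phi>)"
 by (simp add: lip_def lnsq_def cmod_square_mult_cnj[symmetric] flip: integral_complex_of_real of_real_power)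

lemma lnsq_nonneg: "0 <= lnsq M \<phi>" by (simp add: lnsq_def)

lemma lnsq_diff:
 assumes "\<phi> \<in> L2 M" "\<psi> \<in> L2 M"
 shows "lnsq M (%x. \<phi> x - \<psi> x) = lnsq M \<phi> + lnsq M \<psi> - 2 * Re (lip M \<phi> \<psi>)"
proof -
 have d: "(%x. \<phi> x - \<psi> x) \<in> L2 M" by (rule L2_diff[OF assms])
 have "of_real (lnsq M (%x. \<phi> x - \<psi> x)) = lip M \<phi> (%x. \<phi> x - \<psi> x) - lip M \<psi> (%x. \<phi> x - \<psi> x)"
 using lip_diff_left[OF assms d] by (simp add: lip_self)
 also have "... = cnj (lip M \<phi> \<phi> - lip M \<psi> \<phi>) - cnj (lip M \<phi> \<psi> - lip M \<psi> \<psi>)"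
 using lip_diff_left[OF assms assms(1)] lip_diff_left[OF assms assms(2)] lip_cnj[of M \<phi> "%x. \<phi> x - \<psi> x"] lip_cnj[of M \<psi> "%x. \<phi> x - \<psi> x"] by simp
 finally have "lnsq M (%x. \<phi> x - \<psi> x) = Re (cnj (lip M \<phi> \<phi> - lip M \<psi> \<phi>) - cnj (lip M \<phi> \<psi> - lip M \<psi> \<psi>))"
 by (metis Re_complex_of_real)
 then show ?thesis using lip_cnj[of M \<psi> \<phi>] by (simp add: lip_self)
qed

lemma lip_cauchy_schwarz:
 assumes "\<phi> \<in> L2 M" "\<psi> \<in> L2 M"
 shows "(cmod (lip M \<phi> \<psi>))\<^sup>2 <= lnsq M \<phi> * lnsq M \<psi>"
proof -
 define c where "c = lip M \<phi> \<psi>"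
 have q: "0 <= lnsq M \<phi> - 2 * t * (cmod c)\<^sup>2 + t\<^sup>2 * (cmod c)\<^sup>2 * lnsq M \<psi>" for t :: real
 proof -
 have "0 <= lnsq M (%x. \<phi> x - (of_real t * c) * \<psi> x)" by (rule lnsq_nonneg)
 also have "... = lnsq M \<phi> + lnsq M (%x. (of_real t * c) * \<psi> x) - 2 * Re (lip M \<phi> (%x. (of_real t * c) * \<psi> x))"
  by (rule lnsq_diff[OF assms(1) L2_scale[OF assms(2)]])
 also have "lip M \<phi> (%x. (of_real t * c) * \<psi> x) = cnj (of_real t * c) * c"
  using lip_cnj[of M \<phi> "%x. (of_real t * c) * \<psi> x"] lip_cnj[of M \<phi> \<psi>] by (simp add: lip_scale_left c_def)
 also have "cnj (of_real t * c) * c = of_real (t * (cmod c)\<^sup>2)" by (simp add: cmod_square_mult_cnj mult_ac)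
 also have "lnsq M (%x. (of_real t * c) * \<psi> x) = t\<^sup>2 * (cmod c)\<^sup>2 * lnsq M \<psi>"
  by (simp add: lnsq_def norm_mult power_mult_distrib)
 finally show ?thesis by simp
 qed
 have "(cmod c)\<^sup>2 <= lnsq M \<phi> * lnsq M \<psi>"
 proof (cases "lnsq M \<psi> = 0")
 case True
 show ?thesis
 proof (rule ccontr)
  assume "\<not> ?thesis"
  then have c: "(cmod c)\<^sup>2 > 0" using True by simp
  have "0 <= lnsq M \<phi> - 2 * ((lnsq M \<phi> + 1) / (cmod c)\<^sup>2) * (cmod c)\<^sup>2" using q[of "(lnsq M \<phi> + 1) / (cmod c)\<^sup>2"] True by simp
  then have "0 <= - lnsq M \<phi> - 2" using c by auto
  then show False using lnsq_nonneg[of M \<phi>] by simp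
 qed
 next
 case False
 then have p: "lnsq M \<psi> > 0" using lnsq_nonneg[of M \<psi>] by simp
 have "0 <= lnsq M \<phi> - 2 * (1 / lnsq M \<psi>) * (cmod c)\<^sup>2 + (1 / lnsq M \<psi>)\<^sup>2 * (cmod c)\<^sup>2 * lnsq M \<psi>" by (rule q)
 also have "... = lnsq M \<phi> - (cmod c)\<^sup>2 / lnsq M \<psi>" using p by (simp add: field_simps power2_eq_square)
 finally show ?thesis using p by (simp add: field_simps)
 qed
 then show ?thesis by (simp add: c_def)
qed

lemma lip_tendsto:
 assumes F: "!!k::nat. F k \<in> L2 M" and \<phi>: "\<phi> \<in> L2 M" and \<psi>: "\<psi> \<in> L2 M"
 and lim: "(%k. lnsq M (%x. \<phi> x - F k x)) \<longlonglongrightarrow> 0"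
 shows "(%k. lip M (F k) \<psi>) \<longlonglongrightarrow> lip M \<phi> \<psi>"
proof -
 have "(%k. lip M \<phi> \<psi> - lip M (F k) \<psi>) \<longlonglongrightarrow> 0"
 proof (rule Lim_null_comparison)
 have "cmod (lip M \<phi> \<psi> - lip M (F k) \<psi>) <= sqrt (lnsq M (%x. \<phi> x - F k x) * lnsq M \<psi>)" for k
  using real_le_rsqrt[OF lip_cauchy_schwarz[OF L2_diff[OF \<phi> F] \<psi>]] lip_diff_left[OF \<phi> F \<psi>] by simp
 then show "\<forall>\<^sub>F k in sequentially. norm (lip M \<phi> \<psi> - lip M (F k) \<psi>) <= sqrt (lnsq M (%x. \<phi> x - F k x) * lnsq M \<psi>)" by simp
 show "(%k. sqrt (lnsq M (%x. \<phi> x - F k x) * lnsq M \<psi>)) \<longlonglongrightarrow> 0"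
  using tendsto_real_sqrt[OF tendsto_mult_right[OF lim, of "lnsq M \<psi>"]] by simp
 qed
 from tendsto_diff[OF tendsto_const[of "lip M \<phi> \<psi>"] this] show ?thesis by simp
qed

locale L2_orthogonal =
 fixes M :: "'x measure" and E :: "nat => 'x => complex" and N :: "nat => real"
 assumes E_L2: "!!k. E k \<in> L2 M" and N_pos: "!!k. N k > 0"
 and lip_E: "!!j k. lip M (E j) (E k) = (if j = k then of_real (N k) else 0)"
 and E_complete: "!!\<phi>. \<phi> \<in> L2 M ==> (!!k. lip M \<phi> (E k) = 0) ==> AE x in M. \<phi> x = 0"
begin

definition S :: "(nat => complex) => nat => 'x => complex" where "S c K x = (\<Sum>k<K. c k * E k x)"

lemma S_L2: "S c K \<in> L2 M" unfolding S_def[abs_def] by (intro L2_sum L2_scale E_L2)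

lemma lip_S: "\<phi> \<in> L2 M ==> lip M (S c K) \<phi> = (\<Sum>k<K. c k * lip M (E k) \<phi>)"
 unfolding S_def[abs_def] by (subst lip_sum_left) (auto simp: L2_scale E_L2 lip_scale_left)

lemma lip_S_E: "lip M (S c K) (E j) = (if j < K then c j * of_real (N j) else 0)"
 by (simp add: lip_S E_L2 lip_E if_distrib[of "%x. _ * x"] sum.delta' cong: if_cong)

lemma lip_S_S: "lip M (S c K) (S d L) = (\<Sum>k<min K L. c k * cnj (d k) * of_real (N k))"
proof -
 have "lip M (E k) (S d L) = (if k < L then cnj (d k) * of_real (N k) else 0)" for k
 using lip_cnj[of M "E k" "S d L"] by (simp add: lip_S_E)
 then have "lip M (S c K) (S d L) = (\<Sum>k<K. if k < L then c k * cnj (d k) * of_real (N k) else 0)"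
 by (simp add: lip_S S_L2 if_distrib[of "%x. _ * x"] mult.assoc cong: if_cong)
 also have "... = (\<Sum>k\<in>{..<K} \<inter> {..<L}. c k * cnj (d k) * of_real (N k))"
 by (simp add: sum.inter_restrict lessThan_def)
 also have "{..<K} \<inter> {..<L} = {..<min K L}" by auto
 finally show ?thesis .
qed

definition en :: "(nat => complex) => nat => real" where "en c K = (\<Sum>k<K. (cmod (c k))\<^sup>2 * N k)"

lemma en_mono: "K <= L ==> en c K <= en c L"
 unfolding en_def by (rule sum_mono2) (auto intro!: mult_nonneg_nonneg less_imp_le[OF N_pos])

lemma lip_S_self: "lip M (S c K) (S c L) = of_real (en c (min K L))"
 unfolding lip_S_S en_def by (simp add: cmod_square_mult_cnj)

lemma lnsq_S_diff: "K <= L ==> lnsq M (%x. S c L x - S c K x) = en c L - en c K"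
proof -
 assume KL: "K <= L"
 have "lnsq M (S c j) = en c j" for j using lip_self[of M "S c j"] by (simp add: lip_S_self)
 then show ?thesis using KL by (simp add: lnsq_diff S_L2 lip_S_self min.absorb2)
qed

text \<open>A subsequence of the partial sums is taken with consecutive differences of square norm
  at most 4^(-j). The series of 2^j |d j|^2 is then still integrable, so almost everywhere |d j| is
  eventually at most 2^(-j/2) and the subsequence converges. Fatou's lemma turns the pointwise limit
  into a limit in L2.\<close>

lemma riesz_fischer:
 assumes sm: "summable (%k. (cmod (c k))\<^sup>2 * N k)"
 shows "\<exists>\<phi>\<in>L2 M. (%K. lnsq M (%x. \<phi> x - S c K x)) \<longlonglongrightarrow> 0"
proof -
 define l where "l = (\<Sum>k. (cmod (c k))\<^sup>2 * N k)"
 have en_lim: "en c \<longlonglongrightarrow> l" using summable_LIMSEQ[OF sm] by (simp add: en_def[abs_def] l_def)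
 have en_le: "en c K <= l" for K
 by (rule incseq_le[OF _ en_lim]) (auto simp: incseq_def en_mono)
 have "\<exists>K. l - (1/4) ^ j < en c K" for j
 proof -
 have "\<forall>\<^sub>F K in sequentially. l - (1/4) ^ j < en c K" by (rule order_tendstoD(1)[OF en_lim]) simp
 then show ?thesis by (auto simp: eventually_sequentially)
 qed
 then obtain \<kappa>0 where \<kappa>0: "!!j. l - (1/4) ^ j < en c (\<kappa>0 j)" by metis
 \<comment> \<open>Summing makes the indices monotone and at least \<kappa>0 j; the added j makes
   them tend to infinity.\<close>
 define \<kappa> where "\<kappa> j = (\<Sum>i\<le>j. \<kappa>0 i) + j" for j
 have \<kappa>_mono: "\<kappa> j <= \<kappa> (Suc j)" for j by (simp add: \<kappa>_def)
 have \<kappa>_ge: "j <= \<kappa> j" for j by (simp add: \<kappa>_def)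
 have \<kappa>en: "l - (1/4) ^ j < en c (\<kappa> j)" for j
 proof -
 have "\<kappa>0 j <= \<kappa> j" unfolding \<kappa>_def by (rule trans_le_add1[OF member_le_sum]) auto
 then show ?thesis using \<kappa>0[of j] en_mono[of "\<kappa>0 j" "\<kappa> j" c] by linarith
 qed
 have [measurable]: "S c K \<in> borel_measurable M" for K by (rule L2_measurable[OF S_L2])
 define d where "d j x = S c (\<kappa> (Suc j)) x - S c (\<kappa> j) x" for j x
 have [measurable]: "d j \<in> borel_measurable M" for j unfolding d_def by measurable
 have nn: "(\<integral>\<^sup>+x. ennreal ((cmod (f x))\<^sup>2) \<partial>M) = ennreal (lnsq M f)" if "f \<in> L2 M" for f
 unfolding lnsq_def by (rule nn_integral_eq_integral[OF L2_integrable[OF that]]) simp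
 have dL2: "d j \<in> L2 M" for j unfolding d_def[abs_def] by (intro L2_diff S_L2)
 have d_small: "lnsq M (d j) <= (1/4) ^ j" for j
 using lnsq_S_diff[OF \<kappa>_mono, of c j] \<kappa>en[of j] en_le[of "\<kappa> (Suc j)"] by (simp add: d_def[abs_def])
 have "(\<integral>\<^sup>+x. (\<Sum>j. ennreal (2 ^ j * (cmod (d j x))\<^sup>2)) \<partial>M) = (\<Sum>j. \<integral>\<^sup>+x. ennreal (2 ^ j * (cmod (d j x))\<^sup>2) \<partial>M)"
 by (rule nn_integral_suminf) measurable
 also have "... <= (\<Sum>j. ennreal ((1/2) ^ j))"
 proof (rule suminf_le)
 fix j
 have "(\<integral>\<^sup>+x. ennreal (2 ^ j * (cmod (d j x))\<^sup>2) \<partial>M) = ennreal (2 ^ j) * ennreal (lnsq M (d j))"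
  by (simp add: ennreal_mult nn_integral_cmult nn[OF dL2])
 also have "... = ennreal (2 ^ j * lnsq M (d j))" by (rule ennreal_mult[symmetric]) (auto simp: lnsq_nonneg)
 also have "... <= ennreal ((1/2) ^ j)"
 proof (rule ennreal_leI)
  have "2 ^ j * lnsq M (d j) <= 2 ^ j * (1/4) ^ j" by (intro mult_left_mono d_small) simp
  then show "2 ^ j * lnsq M (d j) <= (1/2) ^ j" by (simp flip: power_mult_distrib)
 qed
 finally show "(\<integral>\<^sup>+x. ennreal (2 ^ j * (cmod (d j x))\<^sup>2) \<partial>M) <= ennreal ((1/2) ^ j)" .
 qed auto
 also have "... = ennreal (\<Sum>j. (1/2) ^ j)" by (rule suminf_ennreal2) (auto intro: summable_geometric)
 also have "... < \<infinity>" by simp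
 finally have "AE x in M. (\<Sum>j. ennreal (2 ^ j * (cmod (d j x))\<^sup>2)) ~= \<infinity>"
 by (intro nn_integral_noteq_infinite less_imp_neq) measurable
 then have AEconv: "AE x in M. convergent (%j. S c (\<kappa> j) x)"
 proof eventually_elim
 case (elim x)
 have "summable (%j. 2 ^ j * (cmod (d j x))\<^sup>2)" by (rule summable_suminf_not_top) (use elim in auto)
 then have "(%j. 2 ^ j * (cmod (d j x))\<^sup>2) \<longlonglongrightarrow> 0" by (rule summable_LIMSEQ_zero)
 then obtain J where J: "!!j. j \<ge> J ==> 2 ^ j * (cmod (d j x))\<^sup>2 < 1"
  using order_tendstoD(2)[of _ 0 sequentially 1] by (fastforce simp: eventually_sequentially)
 have "summable (%j. d j x)"
 proof (rule summable_comparison_test'[of "%j. sqrt (1/2) ^ j" J])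
  show "summable (%j. sqrt (1/2) ^ j)" by (rule summable_geometric) (simp add: real_sqrt_lt_1_iff)
  fix j assume "j \<ge> J"
  then have "(cmod (d j x))\<^sup>2 <= (1/2) ^ j" using J[of j] by (simp add: power_one_over field_simps)
  also have "(1/2) ^ j = (sqrt (1/2) ^ j)\<^sup>2" by (simp add: power_mult[symmetric] mult.commute[of j] power_mult)
  finally show "norm (d j x) <= sqrt (1/2) ^ j" by (rule power2_le_imp_le) simp
 qed
 then have "convergent (%n. \<Sum>j<n. d j x)" by (simp add: summable_iff_convergent)
 moreover have "(\<Sum>j<n. d j x) = S c (\<kappa> n) x - S c (\<kappa> 0) x" for n
  unfolding d_def by (rule sum_lessThan_telescope)
 ultimately have "convergent (%n. (S c (\<kappa> n) x - S c (\<kappa> 0) x) + S c (\<kappa> 0) x)"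
  by (intro convergent_add convergent_const) simp
 then show ?case by simp
 qed
 define \<phi> where "\<phi> x = lim (%j. S c (\<kappa> j) x)" for x
 have [measurable]: "\<phi> \<in> borel_measurable M" unfolding \<phi>_def[abs_def] by measurable
 have AElim: "AE x in M. (%j. S c (\<kappa> j) x) \<longlonglongrightarrow> \<phi> x"
 using AEconv by eventually_elim (simp add: \<phi>_def convergent_LIMSEQ_iff)
 have fatou: "(\<integral>\<^sup>+x. ennreal ((cmod (\<phi> x - S c K x))\<^sup>2) \<partial>M) <= ennreal (l - en c K)" for K
 proof -
 have "(\<integral>\<^sup>+x. ennreal ((cmod (\<phi> x - S c K x))\<^sup>2) \<partial>M) = (\<integral>\<^sup>+x. liminf (%j. ennreal ((cmod (S c (\<kappa> j) x - S c K x))\<^sup>2)) \<partial>M)"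
 proof (rule nn_integral_cong_AE)
  show "AE x in M. ennreal ((cmod (\<phi> x - S c K x))\<^sup>2) = liminf (%j. ennreal ((cmod (S c (\<kappa> j) x - S c K x))\<^sup>2))"
  using AElim
  proof eventually_elim
  case (elim x)
  have "(%j. ennreal ((cmod (S c (\<kappa> j) x - S c K x))\<^sup>2)) \<longlonglongrightarrow> ennreal ((cmod (\<phi> x - S c K x))\<^sup>2)"
   by (intro tendsto_ennrealI tendsto_intros elim)
  then show ?case using lim_imp_Liminf[of sequentially] by (metis sequentially_bot)
  qed
 qed
 also have "... <= liminf (%j. \<integral>\<^sup>+x. ennreal ((cmod (S c (\<kappa> j) x - S c K x))\<^sup>2) \<partial>M)"
  by (rule nn_integral_liminf) measurable
 also have "... <= ennreal (l - en c K)"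
 proof (rule Liminf_le)
  have "(\<integral>\<^sup>+x. ennreal ((cmod (S c (\<kappa> j) x - S c K x))\<^sup>2) \<partial>M) <= ennreal (l - en c K)" if "j \<ge> K" for j
  proof -
  have "K <= \<kappa> j" using that \<kappa>_ge[of j] by simp
  then show ?thesis using nn[OF L2_diff[OF S_L2 S_L2], of c "\<kappa> j" c K] lnsq_S_diff[of K "\<kappa> j" c] en_le[of "\<kappa> j"] by (simp add: ennreal_leI)
  qed
  then show "\<forall>\<^sub>F j in sequentially. (\<integral>\<^sup>+x. ennreal ((cmod (S c (\<kappa> j) x - S c K x))\<^sup>2) \<partial>M) <= ennreal (l - en c K)"
  using eventually_sequentially by blast
 qed simp
 finally show ?thesis .
 qed
 have L2d: "(%x. \<phi> x - S c K x) \<in> L2 M" for K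
 proof -
 have "integrable M (%x. (cmod (\<phi> x - S c K x))\<^sup>2)"
 proof (rule integrableI_bounded)
  show "(\<integral>\<^sup>+x. ennreal (norm ((cmod (\<phi> x - S c K x))\<^sup>2)) \<partial>M) < \<infinity>"
  using fatou[of K] by (simp add: le_less_trans[OF _ ennreal_less_top])
 qed measurable
 then show ?thesis by (simp add: L2_def)
 qed
 have \<phi>L2: "\<phi> \<in> L2 M" using L2_add[OF L2d[of 0] S_L2[of c 0]] by simp
 have "lnsq M (%x. \<phi> x - S c K x) <= l - en c K" for K
 using fatou[of K] nn[OF L2d[of K]] en_le[of K] by (simp add: ennreal_le_iff)
 moreover have "(%K. l - en c K) \<longlonglongrightarrow> l - l" by (intro tendsto_intros en_lim)
 ultimately have "(%K. lnsq M (%x. \<phi> x - S c K x)) \<longlonglongrightarrow> 0"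
 by (intro Lim_null_comparison[of "%K. lnsq M (%x. \<phi> x - S c K x)" "%K. l - en c K"]) (auto simp: lnsq_nonneg)
 then show ?thesis using \<phi>L2 by blast
qed

lemma lip_riesz_fischer:
 assumes \<phi>: "\<phi> \<in> L2 M" and lim: "(%K. lnsq M (%x. \<phi> x - S c K x)) \<longlonglongrightarrow> 0"
 shows "lip M \<phi> (E k) = c k * of_real (N k)"
proof -
 have "(%K. lip M (S c K) (E k)) \<longlonglongrightarrow> lip M \<phi> (E k)" by (rule lip_tendsto[OF S_L2 \<phi> E_L2 lim])
 moreover have "(%K. lip M (S c K) (E k)) \<longlonglongrightarrow> c k * of_real (N k)"
 by (rule tendsto_eventually) (use eventually_gt_at_top[of k] in eventually_elim, simp add: lip_S_E)
 ultimately show ?thesis by (rule LIMSEQ_unique)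
qed

lemma bessel_L2:
 assumes \<phi>: "\<phi> \<in> L2 M"
 shows "summable (%k. (cmod (lip M \<phi> (E k) / of_real (N k)))\<^sup>2 * N k)"
proof (rule summableI_nonneg_bounded[of _ "lnsq M \<phi>"])
 define c where "c k = lip M \<phi> (E k) / of_real (N k)" for k
 show "0 <= (cmod (lip M \<phi> (E k) / of_real (N k)))\<^sup>2 * N k" for k using N_pos[of k] by simp
 fix K
 have "lip M (S c K) \<phi> = (\<Sum>k<K. c k * cnj (c k * of_real (N k)))"
 unfolding lip_S[OF \<phi>] using N_pos lip_cnj[of M "E _" \<phi>] by (intro sum.cong refl) (simp add: c_def less_imp_neq[symmetric])
 also have "... = of_real (en c K)" by (simp add: en_def cmod_square_mult_cnj mult.assoc)
 finally have "lip M \<phi> (S c K) = of_real (en c K)" using lip_cnj[of M \<phi> "S c K"] by simp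
 then have "0 <= lnsq M \<phi> + en c K - 2 * en c K"
 using lnsq_nonneg[of M "%x. \<phi> x - S c K x"] lnsq_diff[OF \<phi> S_L2, of c K] lip_self[of M "S c K"] by (simp add: lip_S_self)
 then show "(\<Sum>k<K. (cmod (lip M \<phi> (E k) / of_real (N k)))\<^sup>2 * N k) <= lnsq M \<phi>"
 by (simp add: en_def c_def)
qed

end

text \<open>U f is a Riesz-Fischer sum with the coefficients of f. Only these coefficients are
  controlled, so each identity for U holds almost everywhere, by completeness of the system
  E.\<close>

lemma unitary_L2_exists:
 assumes "hilbert_orthogonal H ip e N" and "L2_orthogonal M E N"
 and total: "!!f. f \<in> H ==> (!!k. ip f (e k) = 0) ==> f = (%z. 0)"
 shows "\<exists>U. isometric_iso_L2 H ip M U \<and> (\<forall>f\<in>H. U f \<in> L2 M \<and> (\<forall>k. lip M (U f) (E k) = ip f (e k)))"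
proof -
 interpret h: hilbert_orthogonal H ip e N by fact
 interpret l: L2_orthogonal M E N by fact
 have "\<forall>f. \<exists>\<phi>. f \<in> H --> \<phi> \<in> L2 M \<and> (%K. lnsq M (%x. \<phi> x - l.S (h.coef f) K x)) \<longlonglongrightarrow> 0"
 using l.riesz_fischer[OF h.bessel_summable] by blast
 then obtain U where U: "!!f. f \<in> H ==> U f \<in> L2 M" "!!f. f \<in> H ==> (%K. lnsq M (%x. U f x - l.S (h.coef f) K x)) \<longlonglongrightarrow> 0"
 by metis
 have Uc: "lip M (U f) (E k) = ip f (e k)" if f: "f \<in> H" for f k
 using l.lip_riesz_fischer[OF U(1)[OF f] U(2)[OF f], of k] h.N_pos[of k] by (simp add: h.coef_def)
 have hlim: "(%K. h.nsq (%z. (\<Sum>k<K. h.coef f k * e k z) - f z)) \<longlonglongrightarrow> 0" if f: "f \<in> H" for f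
 proof -
 obtain g where g: "g \<in> H" "(%K. h.nsq (%z. (\<Sum>k<K. h.coef f k * e k z) - g z)) \<longlonglongrightarrow> 0" "!!k. h.coef g k = h.coef f k"
  using h.series_exists[OF h.bessel_summable[OF f]] by blast
 have "(%z. f z - g z) = (%z. 0)"
 proof (rule total[OF h.diff_mem[OF f g(1)]])
  fix k
  have "ip f (e k) = ip g (e k)" using g(3)[of k] h.N_pos[of k] by (simp add: h.coef_def)
  then show "ip (%z. f z - g z) (e k) = 0" using f g(1) h.e_mem by (simp add: h.ip_diff_left)
 qed
 then have "f = g" by (auto simp: fun_eq_iff)
 then show ?thesis using g(2) by simp
 qed
 have iso: "(\<integral>x. U f x * cnj (U g x) \<partial>M) = ip f g" if f: "f \<in> H" and g: "g \<in> H" for f g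
 proof -
 have 1: "(%K. lip M (l.S (h.coef f) K) (U g)) \<longlonglongrightarrow> lip M (U f) (U g)"
  by (rule lip_tendsto[OF l.S_L2 U(1)[OF f] U(1)[OF g] U(2)[OF f]])
 have 2: "(%K. ip (%z. \<Sum>k<K. h.coef f k * e k z) g) \<longlonglongrightarrow> ip f g"
  by (rule h.ip_tendsto_left[OF h.partial_mem f g hlim[OF f]])
 have "lip M (l.S (h.coef f) K) (U g) = ip (%z. \<Sum>k<K. h.coef f k * e k z) g" for K
 proof -
  have "lip M (E k) (U g) = ip (e k) g" for k
  using lip_cnj[of M "E k" "U g"] h.ip_cnj[OF g h.e_mem, of k] Uc[OF g, of k] by simp
  then show ?thesis by (simp add: l.lip_S[OF U(1)[OF g]] h.ip_partial g)
 qed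
 then have "lip M (U f) (U g) = ip f g" using LIMSEQ_unique[OF 1] 2 by simp
 then show ?thesis by (simp add: lip_def)
 qed
 have AE_eq: "AE x in M. \<phi> x = \<psi> x" if "\<phi> \<in> L2 M" "\<psi> \<in> L2 M" "!!k. lip M \<phi> (E k) = lip M \<psi> (E k)" for \<phi> \<psi>
 proof -
 have "AE x in M. \<phi> x - \<psi> x = 0"
  by (rule l.E_complete[OF L2_diff[OF that(1,2)]]) (simp add: lip_diff_left that l.E_L2)
 then show ?thesis by eventually_elim simp
 qed
 have "isometric_iso_L2 H ip M U"
 unfolding isometric_iso_L2_def
 proof (intro conjI ballI allI)
 show "U f \<in> L2 M" if "f \<in> H" for f by (rule U(1)[OF that])
 show "AE x in M. U (%z. f z + g z) x = U f x + U g x" if "f \<in> H" "g \<in> H" for f g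
  by (rule AE_eq) (use that in \<open>simp_all add: U(1) h.add_mem L2_add lip_add_left l.E_L2 Uc h.ip_add_left h.e_mem\<close>)
 show "AE x in M. U (%z. c * f z) x = c * U f x" if "f \<in> H" for c f
  by (rule AE_eq) (use that in \<open>simp_all add: U(1) h.scale_mem L2_scale lip_scale_left Uc h.ip_scale_left h.e_mem\<close>)
 show "(\<integral>x. U f x * cnj (U g x) \<partial>M) = ip f g" if "f \<in> H" "g \<in> H" for f g by (rule iso[OF that])
 show "\<exists>f\<in>H. AE x in M. U f x = \<phi> x" if \<phi>: "\<phi> \<in> L2 M" for \<phi>
 proof -
  obtain f where f: "f \<in> H" "!!k. h.coef f k = lip M \<phi> (E k) / of_real (N k)"
  using h.series_exists[OF l.bessel_L2[OF \<phi>]] by blast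
  have "AE x in M. U f x = \<phi> x"
  proof (rule AE_eq[OF U(1)[OF f(1)] \<phi>])
  fix k show "lip M (U f) (E k) = lip M \<phi> (E k)"
   using f(2)[of k] h.N_pos[of k] by (simp add: Uc[OF f(1)] h.coef_def)
  qed
  then show ?thesis using f(1) by blast
 qed
 qed
 then show ?thesis using U(1) Uc by blast
qed

section \<open>The invariant forms and their norms\<close>

text \<open>gmom (2 k) is left by the Gaussian average over one vector and k! 2^k by the average
  over the other.\<close>

definition pcst :: "nat => real" where "pcst k = gmom (2 * k) * fact k * 2 ^ k"

text \<open>The average of \<open>(a\<^sup>T z b) ^ (2 * k)\<close> over Gaussian vectors \<open>a\<close> and \<open>b\<close>, normalised to have the value
 \<open>qpoly k\<close> of the squared diagonal entries at a diagonal matrix.\<close>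
definition pform :: "nat => complex^'m^'n => complex" where
 "pform k z = gexp (2 * k) (%p. gexp (2 * k) (%r.
  (\<Oplus>i. \<Oplus>j. of_nat (p i) * z $ i $ j * of_nat (r j)) ^ (2 * k))) / of_real (pcst k)"

definition pk :: "nat => complex^'m^'n => complex" where
 "pk k z = (if z \<in> domD then pform k z else 0)"

lemma gmom_pos: "gmom (2 * k) > 0" by (simp add: gmom_def)

lemma gexp_swap: "gexp N (%p. gexp N' (%r. F p r)) = gexp N' (%r. gexp N (%p. F p r))"
 unfolding gexp_def fexp_def sum_distrib_left
 by (subst sum.swap) (simp add: mult.left_commute)

lemma gexp_scale: "gexp N (%p. c * F p) = c * gexp N F"
 by (simp add: gexp_def fexp_def sum_distrib_left mult.left_commute)

text \<open>Averaging over the right vector first leaves a power of a sum of squares over the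
  columns, which is unchanged by an orthogonal factor on the right. \<open>pform_columns\<close>
  does the same on the left.\<close>

lemma pform_rows: "pform k z = gexp (2 * k) (%p. (\<Oplus>j. (\<Oplus>i. of_nat (p i) * z $ i $ j)\<^sup>2) ^ k) * of_real (gmom (2 * k) / pcst k)"
proof -
 have "gexp (2 * k) (%r. (\<Oplus>i. \<Oplus>j. of_nat (p i) * z $ i $ j * of_nat (r j)) ^ (2 * k))
  = of_real (gmom (2 * k)) * (\<Oplus>j. (\<Oplus>i. of_nat (p i) * z $ i $ j)\<^sup>2) ^ k" for p
 proof -
 have "(\<Oplus>i. \<Oplus>j. of_nat (p i) * z $ i $ j * of_nat (r j)) = (\<Oplus>j. of_nat (r j) * (\<Oplus>i. of_nat (p i) * z $ i $ j))" for r
  by (subst sum.swap) (simp add: sum_distrib_left mult.commute)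
 then show ?thesis using gexp_linear_power[of k "2 * k" "%j. \<Oplus>i. of_nat (p i) * z $ i $ j"] by simp
 qed
 then show ?thesis unfolding pform_def by (simp add: gexp_scale)
qed

lemma pform_columns: "pform k z = gexp (2 * k) (%r. (\<Oplus>i. (\<Oplus>j. z $ i $ j * of_nat (r j))\<^sup>2) ^ k) * of_real (gmom (2 * k) / pcst k)"
proof -
 have "gexp (2 * k) (%p. (\<Oplus>i. \<Oplus>j. of_nat (p i) * z $ i $ j * of_nat (r j)) ^ (2 * k))
  = of_real (gmom (2 * k)) * (\<Oplus>i. (\<Oplus>j. z $ i $ j * of_nat (r j))\<^sup>2) ^ k" for r
 proof -
 have "(\<Oplus>i. \<Oplus>j. of_nat (p i) * z $ i $ j * of_nat (r j)) = (\<Oplus>i. of_nat (p i) * (\<Oplus>j. z $ i $ j * of_nat (r j)))" for p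
  by (simp add: sum_distrib_left mult.assoc)
 then show ?thesis using gexp_linear_power[of k "2 * k" "%i. \<Oplus>j. z $ i $ j * of_nat (r j)"] by simp
 qed
 then show ?thesis unfolding pform_def by (subst gexp_swap) (simp add: gexp_scale)
qed

lemma pform_of_columns:
 assumes "!!r :: 'm::finite => nat. (\<Oplus>i. (\<Oplus>j. z $ i $ j * of_nat (r j))\<^sup>2) = (\<Oplus>j. y j * of_nat (r j) ^ 2)"
 shows "pform k z = qpoly k y"
proof -
 have "pform k z = (fact k * 2 ^ k * qpoly k y) * of_real (gmom (2 * k) / pcst k)"
 unfolding pform_columns assms using gexp_quadratic_power[of k "2 * k" y] by simp
 also have "gmom (2 * k) / pcst k = 1 / (fact k * 2 ^ k)" using gmom_pos[of k] by (simp add: pcst_def)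
 finally show ?thesis by simp
qed

lemma orthogonal_bilinear:
 fixes R :: "real^'n^'n"
 assumes "orthogonal_matrix R"
 shows "(\<Oplus>s. (\<Oplus>j. of_real (R $ j $ s) * x j) * (\<Oplus>j. of_real (R $ j $ s) * y j)) = (\<Oplus>j. x j * (y j :: complex))"
proof -
 have "R ** transpose R = mat 1" using assms by (simp add: orthogonal_matrix_def)
 then have *: "(\<Oplus>s. R $ j $ s * R $ l $ s) = (if j = l then 1 else 0)" for j l
 by (simp add: vec_eq_iff matrix_matrix_mult_def transpose_def mat_def)
 have d: "(\<Oplus>s. cr (R $ j $ s) * of_real (R $ l $ s)) = (if j = l then 1 else 0)" for j l
 using arg_cong[OF *[of j l], of cr] by (simp add: if_distrib cong: if_cong)
 have "(\<Oplus>s. (\<Oplus>j. of_real (R $ j $ s) * x j) * (\<Oplus>j. of_real (R $ j $ s) * y j))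
  = (\<Oplus>s. \<Oplus>j. \<Oplus>l. (x j * y l) * (of_real (R $ j $ s) * of_real (R $ l $ s)))"
 unfolding sum_product by (intro sum.cong refl) (simp add: mult_ac)
 also have "... = (\<Oplus>j. \<Oplus>l. \<Oplus>s. (x j * y l) * (of_real (R $ j $ s) * of_real (R $ l $ s)))"
 by (subst sum.swap) (intro sum.cong refl sum.swap)
 also have "... = (\<Oplus>j. \<Oplus>l. (x j * y l) * (if j = l then 1 else 0))"
 by (simp only: sum_distrib_left[symmetric] d)
 also have "... = (\<Oplus>j. x j * y j)"
 by (simp add: if_distrib[of "%u. _ * u"] cong: if_cong)
 finally show ?thesis .
qed

lemma pform_right_orthogonal:
 assumes "orthogonal_matrix Q" shows "pform k (z ** cmat Q) = pform k z"
proof -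
 have "(\<Oplus>s. (\<Oplus>i. of_nat (p i) * (z ** cmat Q) $ i $ s)\<^sup>2) = (\<Oplus>j. (\<Oplus>i. of_nat (p i) * z $ i $ j)\<^sup>2)" for p
 proof -
 have "(\<Oplus>i. of_nat (p i) * (z ** cmat Q) $ i $ s) = (\<Oplus>j. of_real (Q $ j $ s) * (\<Oplus>i. of_nat (p i) * z $ i $ j))" for s
 proof -
  have "(\<Oplus>i. of_nat (p i) * (z ** cmat Q) $ i $ s) = (\<Oplus>i. \<Oplus>j. of_real (Q $ j $ s) * (of_nat (p i) * z $ i $ j))"
  by (simp add: matrix_matrix_mult_def cmat_def sum_distrib_left mult_ac)
  also have "... = (\<Oplus>j. of_real (Q $ j $ s) * (\<Oplus>i. of_nat (p i) * z $ i $ j))"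
  by (subst sum.swap) (simp add: sum_distrib_left)
  finally show ?thesis .
 qed
 then show ?thesis
  using orthogonal_bilinear[OF assms, of "%j. \<Oplus>i. of_nat (p i) * z $ i $ j" "%j. \<Oplus>i. of_nat (p i) * z $ i $ j"]
  by (simp only: power2_eq_square)
 qed
 then show ?thesis unfolding pform_rows by simp
qed

lemma pform_left_orthogonal:
 assumes "orthogonal_matrix P" shows "pform k (cmat P ** z) = pform k z"
proof -
 have t: "orthogonal_matrix (transpose P)" using assms by (simp add: orthogonal_matrix_def transpose_transpose)
 have e: "(\<Oplus>i. (\<Oplus>j. (cmat P ** z) $ i $ j * of_nat (r j))\<^sup>2) = (\<Oplus>i. (\<Oplus>j. z $ i $ j * of_nat (r j))\<^sup>2)" for r
 proof -
 have "(\<Oplus>j. (cmat P ** z) $ i $ j * of_nat (r j)) = (\<Oplus>l. of_real (transpose P $ l $ i) * (\<Oplus>j. z $ l $ j * of_nat (r j)))" for i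
 proof -
  have "(\<Oplus>j. (cmat P ** z) $ i $ j * of_nat (r j)) = (\<Oplus>j. \<Oplus>l. of_real (transpose P $ l $ i) * (z $ l $ j * of_nat (r j)))"
  by (simp add: matrix_matrix_mult_def cmat_def transpose_def sum_distrib_right mult.assoc)
  also have "... = (\<Oplus>l. of_real (transpose P $ l $ i) * (\<Oplus>j. z $ l $ j * of_nat (r j)))"
  by (subst sum.swap) (simp add: sum_distrib_left)
  finally show ?thesis .
 qed
 then show ?thesis
  using orthogonal_bilinear[OF t, of "%i. \<Oplus>j. z $ i $ j * of_nat (r j)" "%i. \<Oplus>j. z $ i $ j * of_nat (r j)"]
  by (simp only: power2_eq_square)
 qed
 show ?thesis unfolding pform_columns e ..
qed

lemma domD_orthogonal:
 fixes z :: "complex^'m^'n"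
 assumes z: "z \<in> domD" and P: "orthogonal_matrix P" and Q: "orthogonal_matrix Q"
 shows "cmat P ** z ** cmat Q \<in> domD"
 unfolding domD_iff
proof (intro allI impI)
 fix v :: "complex^'n" assume v: "v ~= 0"
 have nrm: "(\<Oplus>s. (cmod (\<Oplus>j. of_real (R $ j $ s) * x j))\<^sup>2) = (\<Oplus>j. (cmod (x j))\<^sup>2)"
 if "orthogonal_matrix R" for R :: "real^'k^'k" and x
 proof -
 have "cr (\<Oplus>s. (cmod (\<Oplus>j. of_real (R $ j $ s) * x j))\<^sup>2) = of_real (\<Oplus>j. (cmod (x j))\<^sup>2)"
  using orthogonal_bilinear[OF that, of x "%j. cnj (x j)"] by (simp only: of_real_sum complex_norm_square cnj_sum complex_cnj_mult complex_cnj_complex_of_real)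
 then show ?thesis by (simp only: of_real_eq_iff)
 qed
 define v' where "v' = (\<chi> l. \<Oplus>i. cr (P $ i $ l) * v $ i)"
 define y where "y j = (\<Oplus>l. cnj (z $ l $ j) * v' $ l)" for j
 have e: "(\<Oplus>i. cnj ((cmat P ** z ** cmat Q) $ i $ s) * v $ i) = (\<Oplus>j. of_real (Q $ j $ s) * y j)" for s
 proof -
 have "(\<Oplus>i. cnj ((cmat P ** z ** cmat Q) $ i $ s) * v $ i) = (\<Oplus>i. \<Oplus>j. \<Oplus>l. of_real (Q $ j $ s) * (cnj (z $ l $ j) * (of_real (P $ i $ l) * v $ i)))"
  by (simp add: matrix_matrix_mult_def cmat_def sum_distrib_left sum_distrib_right mult_ac)
 also have "... = (\<Oplus>j. \<Oplus>l. \<Oplus>i. of_real (Q $ j $ s) * (cnj (z $ l $ j) * (of_real (P $ i $ l) * v $ i)))"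
  by (subst sum.swap) (intro sum.cong refl sum.swap)
 also have "... = (\<Oplus>j. of_real (Q $ j $ s) * y j)" by (simp add: y_def v'_def sum_distrib_left)
 finally show ?thesis .
 qed
 have vv: "(\<Oplus>i. (cmod (v' $ i))\<^sup>2) = (\<Oplus>i. (cmod (v $ i))\<^sup>2)"
 using nrm[OF P, of "%i. v $ i"] by (simp add: v'_def)
 have "v' ~= 0" using vv sum_cmod_pos[OF v] by auto
 then have "(\<Oplus>j. (cmod (y j))\<^sup>2) < (\<Oplus>i. (cmod (v' $ i))\<^sup>2)" using z by (simp add: domD_iff y_def)
 then show "(\<Oplus>s. (cmod (\<Oplus>i. cnj ((cmat P ** z ** cmat Q) $ i $ s) * v $ i))\<^sup>2) < (\<Oplus>i. (cmod (v $ i))\<^sup>2)"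
 unfolding e nrm[OF Q] vv .
qed

lemma matrix_inv_orthogonal:
 assumes "orthogonal_matrix (A :: real^'n^'n)" shows "matrix_inv A = transpose A"
proof -
 have 1: "A ** transpose A = mat 1" "transpose A ** A = mat 1" using assms by (auto simp: orthogonal_matrix_def)
 then have "A ** matrix_inv A = mat 1 \<and> matrix_inv A ** A = mat 1"
 using someI[of "%B. A ** B = mat 1 \<and> B ** A = mat 1" "transpose A"] by (simp add: matrix_inv_def)
 then show ?thesis using 1 by (metis matrix_mul_assoc matrix_mul_lid matrix_mul_rid)
qed

lemma act_inv_pair:
 assumes "(A, B) \<in> grpL" shows "act (inv_pair (A, B)) z = cmat (transpose A) ** z ** cmat B"
proof -
 have "orthogonal_matrix A" "orthogonal_matrix B" using assms by (auto simp: grpL_def)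
 moreover have "orthogonal_matrix (transpose B)" using \<open>orthogonal_matrix B\<close> by (simp add: orthogonal_matrix_def transpose_transpose)
 ultimately show ?thesis by (simp add: act_def inv_pair_def matrix_inv_orthogonal transpose_transpose)
qed

lemma L_invariants_iff:
 "f \<in> L_invariants H \<longleftrightarrow> f \<in> H \<and> (\<forall>P Q. orthogonal_matrix P \<and> orthogonal_matrix Q \<and> det P * det Q = 1 -->
  (\<forall>z\<in>domD. f (cmat P ** z ** cmat Q) = f z)) \<and> (CARD('n) = 1 --> (\<forall>z\<in>domD. f (- z) = f z))"
 for f :: "complex^'m^'n => complex"
proof -
 have "(\<forall>l\<in>grpL. \<forall>z\<in>domD. f (act (inv_pair l) z) = f z) \<longleftrightarrow> (\<forall>P Q. orthogonal_matrix P \<and> orthogonal_matrix Q \<and> det P * det Q = 1 -->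
  (\<forall>z\<in>domD. f (cmat P ** z ** cmat Q) = f z))" (is "?l = ?r")
 proof
 assume l: ?l
 show ?r
 proof (intro allI impI ballI)
  fix P :: "real^'n^'n" and Q :: "real^'m^'m" and z :: "complex^'m^'n" assume PQ: "orthogonal_matrix P \<and> orthogonal_matrix Q \<and> det P * det Q = 1" and z: "z \<in> domD"
  then have m: "(transpose P, Q) \<in> grpL" by (simp add: grpL_def orthogonal_matrix_def transpose_transpose det_transpose)
  from l z m have "f (act (inv_pair (transpose P, Q)) z) = f z" by blast
  then show "f (cmat P ** z ** cmat Q) = f z" by (simp add: act_inv_pair[OF m] transpose_transpose)
 qed
 next
 assume r: ?r
 show ?l
 proof (intro ballI)
  fix l :: "(real^'n^'n) \<times> (real^'m^'m)" and z :: "complex^'m^'n" assume l: "l \<in> grpL" and z: "z \<in> domD"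
  obtain A B where AB: "l = (A, B)" by (cases l)
  have "orthogonal_matrix (transpose A) \<and> orthogonal_matrix B \<and> det (transpose A) * det B = 1"
  using l AB by (auto simp: grpL_def orthogonal_matrix_def transpose_transpose det_transpose)
  then show "f (act (inv_pair l) z) = f z" using r z l unfolding AB by (simp add: act_inv_pair)
 qed
 qed
 then show ?thesis unfolding L_invariants_def by blast
qed

lemma uminus_domD: "z \<in> domD ==> - z \<in> domD"
proof -
 have "csm (- 1) z = - z" by (simp add: vec_eq_iff)
 then show "z \<in> domD ==> - z \<in> domD" using csm_domD[of z "-1"] by simp
qed

lemma pform_uminus: "pform k (- z) = pform k z"
 unfolding pform_columns by (simp add: sum_negf)

lemma qpoly_single: "qpoly k (%j. if j = j0 then c else 0) = of_real (hb k) * c ^ k"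
proof -
 have "qfps (%j. if j = j0 then c else 0) = Abs_fps (%l. of_real (hb l) * c ^ l) * (\<Prod>j\<in>UNIV - {j0}. Abs_fps (%l. of_real (hb l) * 0 ^ l))"
 unfolding qfps_def by (subst prod.remove[of UNIV j0]) (auto intro!: prod.cong)
 also have "Abs_fps (%l. cr (hb l) * 0 ^ l) = 1"
 by (simp add: fps_eq_iff power_0_left)
 finally show ?thesis by (simp add: qpoly_def)
qed

lemma pform_rk1_axis:
 fixes i0 :: "'n::finite" and j0 :: "'m::finite"
 shows "pform k (csm t (rk1 (uv i0) (uv j0)) :: complex^'m^'n) = of_real (hb k) * t ^ (2 * k)"
proof -
 have "(\<Oplus>j. csm t (rk1 (uv i0) (uv j0) :: complex^'m^'n) $ i $ j * of_nat (r j))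
  = (if i = i0 then t * of_nat (r j0) else 0)" for i and r :: "'m => nat"
 proof -
 have "(\<Oplus>j. csm t (rk1 (uv i0) (uv j0) :: complex^'m^'n) $ i $ j * of_nat (r j))
  = (\<Oplus>j. if j = j0 then (if i = i0 then t * of_nat (r j) else 0) else 0)"
  by (intro sum.cong refl) (simp add: rk1_def)
 then show ?thesis by simp
 qed
 then have "pform k (csm t (rk1 (uv i0) (uv j0)) :: complex^'m^'n) = qpoly k (%j::'m. if j = j0 then t\<^sup>2 else 0)"
 proof (intro pform_of_columns)
 fix r :: "'m => nat"
 assume *: "!!i r. (\<Oplus>j. csm t (rk1 (uv i0) (uv j0) :: complex^'m^'n) $ i $ j * of_nat (r j))
  = (if i = i0 then t * of_nat (r j0) else 0)"
 have "(\<Oplus>i. (if i = i0 then t * of_nat (r j0) else 0)\<^sup>2) = (\<Oplus>i. if i = i0 then (t * of_nat (r j0))\<^sup>2 else 0)"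
  by (intro sum.cong) auto
 moreover have "(\<Oplus>j. (if j = j0 then t\<^sup>2 else 0) * complex_of_nat (r j) ^ 2) = (\<Oplus>j. if j = j0 then t\<^sup>2 * of_nat (r j) ^ 2 else 0)"
  by (intro sum.cong) auto
 ultimately show "(\<Oplus>i. (\<Oplus>j. csm t (rk1 (uv i0) (uv j0) :: complex^'m^'n) $ i $ j * of_nat (r j))\<^sup>2)
  = (\<Oplus>j. (if j = j0 then t\<^sup>2 else 0) * of_nat (r j) ^ 2)"
  unfolding * by (simp add: power_mult_distrib)
 qed
 then show ?thesis by (simp add: qpoly_single power_mult)
qed

text \<open>The square norm of \<open>pk k\<close>, and also that of \<open>EE k\<close> in L2 of
  \<open>mu\<close>.\<close>

definition Nk :: "nat => nat => nat => real" where
 "Nk n m k = pochhammer (real n / 2) k * pochhammer (real m / 2) k / (fact k)\<^sup>2"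

lemma Nk_pos: "n > 0 ==> m > 0 ==> Nk n m k > 0"
 unfolding Nk_def by (intro divide_pos_pos mult_pos_pos pochhammer_pos) auto

lemma hb_pos: "hb k > 0" by (simp add: hb_def)

context H1_space
begin

abbreviation HL where "HL \<equiv> L_invariants H"

lemma HL_subset: "f \<in> HL ==> f \<in> H" by (simp add: L_invariants_def)

lemma eval_tendsto:
 assumes F: "!!k. F k \<in> H" and f: "f \<in> H" and lim: "(%k. nsq (%z. F k z - f z)) \<longlonglongrightarrow> 0"
 shows "(%k. F k z) \<longlonglongrightarrow> f z"
proof (cases "z \<in> domD")
 case True
 then show ?thesis using ip_tendsto_left[OF F f kf_mem[OF True] lim] by (simp add: reproducing[OF True] F f)
qed (simp add: off_domD F f)

text \<open>Completeness is inherited: convergence in H implies pointwise convergence, and the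
  invariance conditions are pointwise.\<close>

lemma HL_hilbert: "fun_hilbert_space HL ip"
proof -
 have main: "\<exists>f\<in>HL. (%k. Re (ip (%z. F k z - f z) (%z. F k z - f z))) \<longlonglongrightarrow> 0"
 if F: "!!k. F k \<in> HL" and C: "\<forall>e>0. \<exists>N. \<forall>k\<ge>N. \<forall>l\<ge>N. Re (ip (%z. F k z - F l z) (%z. F k z - F l z)) < e"
 for F :: "nat => complex^'m^'n => complex"
 proof -
 have FH: "F k \<in> H" for k using F HL_subset by blast
 obtain f where f: "f \<in> H" and lim: "(%k. nsq (%z. F k z - f z)) \<longlonglongrightarrow> 0"
  using complete[of F] FH C unfolding nsq_def by auto
 note ev = eval_tendsto[OF FH f lim]
 have "f \<in> HL"
  unfolding L_invariants_def mem_Collect_eq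
 proof (intro conjI f ballI impI)
  fix l :: "(real^'n^'n) \<times> (real^'m^'m)" and z :: "complex^'m^'n" assume lz: "l \<in> grpL" "z \<in> domD"
  have "F k (act (inv_pair l) z) = F k z" for k using F[of k] lz by (auto simp: L_invariants_def)
  then show "f (act (inv_pair l) z) = f z" using LIMSEQ_unique[OF ev[of "act (inv_pair l) z"]] ev[of z] by simp
 next
  fix z :: "complex^'m^'n" assume lz: "CARD('n) = 1" "z \<in> domD"
  have "F k (- z) = F k z" for k using F[of k] lz by (auto simp: L_invariants_def)
  then show "f (- z) = f z" using LIMSEQ_unique[OF ev[of "- z"]] ev[of z] by simp
 qed
 then show ?thesis using lim unfolding nsq_def by blast
 qed
 show ?thesis unfolding fun_hilbert_space_def
 proof (intro conjI ballI allI impI)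
 show "(%z. 0) \<in> HL" using zero_mem by (simp add: L_invariants_def)
 fix f assume f: "f \<in> HL"
 show "(%z. c * f z) \<in> HL" for c using scale_mem[OF HL_subset[OF f], of c] f by (auto simp: L_invariants_def)
 show "0 < Re (ip f f)" if "f ~= (%z. 0)" using nsq_pos[OF HL_subset[OF f] that] by (simp add: nsq_def)
 fix g assume g: "g \<in> HL"
 show "(%z. f z + g z) \<in> HL" using add_mem[OF HL_subset[OF f] HL_subset[OF g]] f g by (auto simp: L_invariants_def)
 show "ip g f = cnj (ip f g)" by (rule ip_cnj[OF HL_subset[OF f] HL_subset[OF g]])
 show "ip (%z. c * f z) g = c * ip f g" for c by (rule ip_scale_left[OF HL_subset[OF f] HL_subset[OF g]])
 show "ip (%z. f z + g z) h = ip f h + ip g h" if "h \<in> HL" for h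
  by (rule ip_add_left[OF HL_subset[OF f] HL_subset[OF g] HL_subset[OF that]])
 qed (use main in blast)
qed

text \<open>\<open>gexp\<close> is a finite sum, so \<open>pk k\<close> is a finite combination of
  the powers \<open>tform\<close>.\<close>

lemma pk_mem: "pk k \<in> H"
proof -
 have "pk k = (%z. \<Sum>p\<in>PiE UNIV (%_. {..2*k}). \<Sum>r\<in>PiE UNIV (%_. {..2*k}).
  ((\<Prod>i\<in>UNIV. cr (gwt (2*k) (p i))) * (\<Prod>j\<in>UNIV. cr (gwt (2*k) (r j))) / of_real (pcst k))
  * tform (2*k) (%i. of_real (real (p i))) (%j. of_real (real (r j))) z)"
 by (rule ext) (simp add: pk_def pform_def gexp_def fexp_def tform_def sum_distrib_left sum_divide_distrib mult.assoc)
 also have "... \<in> H" by (intro sum_mem scale_mem tform_mem)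
 finally show ?thesis .
qed

lemma ip_pk:
 assumes f: "f \<in> H"
 shows "ip f (pk k) = gexp (2 * k) (%p. gexp (2 * k) (%r. cf (2 * k) f (rk1 (%i. of_real (real (p i))) (%j. of_real (real (r j)))))) / of_real (pcst k)"
proof -
 have ip2: "ip f (%z. \<Sum>p\<in>I. \<Sum>r\<in>R. C p r * T p r z) = (\<Sum>p\<in>I. \<Sum>r\<in>R. cnj (C p r) * ip f (T p r))"
 if "!!p r. T p r \<in> H" for T :: "('n => nat) => ('m => nat) => _" and C I R
 proof -
 have "ip f (%z. \<Sum>p\<in>I. \<Sum>r\<in>R. C p r * T p r z) = (\<Sum>p\<in>I. ip f (%z. \<Sum>r\<in>R. C p r * T p r z))"
  by (rule ip_sum_right[OF sum_mem[OF scale_mem[OF that]] f])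
 also have "... = (\<Sum>p\<in>I. \<Sum>r\<in>R. ip f (%z. C p r * T p r z))"
  by (intro sum.cong refl ip_sum_right[OF scale_mem[OF that] f])
 also have "... = (\<Sum>p\<in>I. \<Sum>r\<in>R. cnj (C p r) * ip f (T p r))"
  by (intro sum.cong refl ip_scale_right[OF that f])
 finally show ?thesis .
 qed
 have pk_eq: "pk k = (%z. \<Sum>p\<in>PiE UNIV (%_. {..2*k}). \<Sum>r\<in>PiE UNIV (%_. {..2*k}).
  ((\<Prod>i\<in>UNIV. cr (gwt (2*k) (p i))) * (\<Prod>j\<in>UNIV. cr (gwt (2*k) (r j))) / of_real (pcst k))
  * tform (2*k) (%i. of_real (real (p i))) (%j. of_real (real (r j))) z)"
 by (rule ext) (simp add: pk_def pform_def gexp_def fexp_def tform_def sum_distrib_left sum_divide_distrib mult.assoc)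
 have "ip f (pk k) = (\<Sum>p\<in>PiE UNIV (%_. {..2*k}). \<Sum>r\<in>PiE UNIV (%_. {..2*k}).
  cnj ((\<Prod>i\<in>UNIV. cr (gwt (2*k) (p i))) * (\<Prod>j\<in>UNIV. cr (gwt (2*k) (r j))) / of_real (pcst k))
  * cf (2 * k) f (rk1 (%i. of_real (real (p i))) (%j. of_real (real (r j)))))"
 unfolding pk_eq ip2[of "%p r. tform (2*k) (%i. of_real (real (p i))) (%j. of_real (real (r j)))", OF tform_mem] ip_tform[OF f] ..
 then show ?thesis by (simp add: gexp_def fexp_def sum_distrib_left sum_divide_distrib mult.assoc)
qed

lemma rk1_small: "\<exists>e>0. \<forall>r. cmod r <= e --> csm r (rk1 a b :: complex^'m^'n) \<in> domD"
proof -
 define A where "A = (\<Oplus>i. (cmod (a i))\<^sup>2)"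
 define B where "B = (\<Oplus>j. (cmod (b j))\<^sup>2)"
 have AB: "A \<ge> 0" "B \<ge> 0" by (auto simp: A_def B_def sum_nonneg)
 define e where "e = 1 / (A * B + 1)"
 have p: "A * B + 1 > 0" using AB by (simp add: add_nonneg_pos)
 have "csm r (rk1 a b :: complex^'m^'n) \<in> domD" if r: "cmod r <= e" for r
 proof -
 have "e <= 1" using AB p by (simp add: e_def divide_le_eq)
 then have "(cmod r)\<^sup>2 <= e" using r power_mono[OF r, of 2] power_le_one_iff[of e 2] p
  by (smt (verit) e_def mult_left_le norm_ge_zero power2_eq_square)
 then have "(cmod r)\<^sup>2 * (A * B) <= e * (A * B)" using AB by (intro mult_right_mono) auto
 also have "... < 1" using p by (simp add: e_def field_simps)
 finally have "(\<Oplus>i. (cmod (r * a i))\<^sup>2) * (\<Oplus>j. (cmod (b j))\<^sup>2) < 1"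
  by (simp add: A_def B_def norm_mult power_mult_distrib mult.assoc flip: sum_distrib_left)
 then show ?thesis unfolding csm_rk1 by (rule rk1_domD)
 qed
 moreover have "e > 0" using p by (simp add: e_def)
 ultimately show ?thesis by blast
qed

text \<open>\<open>cf_csm\<close> asks for a nonzero factor that leads into the domain; a further
  small factor s achieves this, and r = 0 is separate.\<close>

lemma cf_rk1_scale:
 fixes a :: "'n => complex" and b :: "'m => complex"
 assumes f: "f \<in> H" shows "cf k f (csm r (rk1 a b)) = r ^ k * cf k f (rk1 a b)"
proof (cases "r = 0")
 case True
 have "csm t (csm 0 (rk1 a b)) = csm 0 (rk1 a b)" for t by (simp add: csm_csm)
 then have "cf k f (csm r (rk1 a b)) = (if k = 0 then f (csm 0 (rk1 a b)) else 0)"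
 using True by (simp add: cf_def higher_deriv_const)
 moreover have "cf 0 f (rk1 a b) = f (csm 0 (rk1 a b))" by (simp add: cf_def)
 ultimately show ?thesis using True by auto
next
 case False
 obtain e1 where e1: "e1 > 0" "!!s. cmod s <= e1 ==> csm s (rk1 a b :: complex^'m^'n) \<in> domD" using rk1_small by blast
 define s where "s = cr (e1 / (1 + cmod r))"
 have "e1 / (1 + cmod r) > 0" using e1 by (simp add: add_pos_nonneg)
 then have s0: "s ~= 0" unfolding s_def by (metis of_real_eq_0_iff less_irrefl)
 have "cmod (s * r) <= e1"
 proof -
 have "cmod s = e1 / (1 + cmod r)" using \<open>e1 / (1 + cmod r) > 0\<close> unfolding s_def norm_of_real by linarith
 then have "cmod (s * r) = e1 * (cmod r / (1 + cmod r))" by (simp add: norm_mult)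
 also have "... <= e1 * 1" using e1 by (intro mult_left_mono) (auto simp: divide_le_eq add_pos_nonneg)
 finally show ?thesis by simp
 qed
 then have d: "csm (s * r) (rk1 a b :: complex^'m^'n) \<in> domD" by (rule e1(2))
 have "cf k f (csm (s * r) (rk1 a b)) = (s * r) ^ k * cf k f (rk1 a b)" by (rule cf_csm[OF f d]) (use s0 False in auto)
 moreover have "cf k f (csm s (csm r (rk1 a b))) = s ^ k * cf k f (csm r (rk1 a b))"
 by (rule cf_csm[OF f]) (use s0 d in \<open>auto simp: csm_csm\<close>)
 ultimately show ?thesis using s0 by (simp add: csm_csm power_mult_distrib)
qed

lemma cf_orthogonal:
 assumes f: "f \<in> HL" and PQ: "orthogonal_matrix P" "orthogonal_matrix Q" "det P * det Q = 1"
 shows "cf k f (cmat P ** w ** cmat Q) = cf k f w"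
proof -
 have tr: "orthogonal_matrix (transpose P)" "orthogonal_matrix (transpose Q)"
 using PQ by (simp_all add: orthogonal_matrix_def transpose_transpose)
 have cm: "cmat A ** cmat B = cmat (A ** B)" for A :: "real^'a^'b" and B :: "real^'c^'a"
 by (simp add: cmat_def vec_eq_iff matrix_matrix_mult_def)
 have c1: "cmat (mat 1) = mat 1" by (simp add: cmat_def mat_def vec_eq_iff)
 have "f (csm t (cmat P ** w ** cmat Q)) = f (csm t w)" for t
 proof -
 have e: "csm t (cmat P ** w ** cmat Q) = cmat P ** csm t w ** cmat Q"
  by (simp add: csm_def vec_eq_iff matrix_matrix_mult_def sum_distrib_left sum_distrib_right mult_ac)
 show ?thesis
 proof (cases "csm t w \<in> domD")
  case True
  then show ?thesis using f PQ unfolding e L_invariants_iff by blast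
 next
  case False
  have "cmat (transpose P) ** (cmat P ** csm t w ** cmat Q) ** cmat (transpose Q) = (cmat (transpose P) ** cmat P) ** csm t w ** (cmat Q ** cmat (transpose Q))"
  by (simp only: matrix_mul_assoc)
  also have "... = csm t w" using PQ by (simp add: cm orthogonal_matrix_def c1)
  finally have "cmat P ** csm t w ** cmat Q \<notin> domD" using False domD_orthogonal[OF _ tr] by metis
  then show ?thesis using False off_domD[OF HL_subset[OF f]] unfolding e by simp
 qed
 qed
 then show ?thesis by (simp add: cf_def)
qed

lemma cmat_rk1:
 "cmat P ** rk1 (%i. cr (a $ i)) (%j. cr (b $ j)) ** cmat Q
 = rk1 (%i. of_real ((P *v a) $ i)) (%j. of_real ((transpose Q *v b) $ j))"
proof -
 have "(\<Oplus>k. (\<Oplus>l. cr (P $ i $ l) * (of_real (a $ l) * of_real (b $ k))) * of_real (Q $ k $ j))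
  = (\<Oplus>l. of_real (P $ i $ l) * of_real (a $ l)) * (\<Oplus>k. of_real (Q $ k $ j) * of_real (b $ k))" for i j
 proof -
 have "(\<Oplus>l. cr (P $ i $ l) * (of_real (a $ l) * of_real (b $ k))) * of_real (Q $ k $ j)
  = (\<Oplus>l. of_real (P $ i $ l) * of_real (a $ l)) * (of_real (Q $ k $ j) * of_real (b $ k))" for k
  unfolding sum_distrib_right by (intro sum.cong refl) (simp add: mult_ac)
 then show ?thesis by (simp only: sum_distrib_left)
 qed
 then show ?thesis
 by (simp add: vec_eq_iff rk1_def cmat_def matrix_matrix_mult_def matrix_vector_mult_def transpose_def)
qed

text \<open>The coefficient at a matrix unit, with \<open>undefined\<close> as the chosen index; by
  \<open>cf_rk1_HL\<close> it controls an invariant f at all real rank-one matrices.\<close>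

definition \<gamma> :: "(complex^'m^'n => complex) => nat => complex" where
 "\<gamma> f k = cf k f (rk1 (uv undefined) (uv undefined))"

lemma rotation_matrix:
 fixes a b :: "real^'k"
 assumes "2 <= CARD('k)" "norm a = norm b"
 obtains P where "orthogonal_matrix P" "det P = 1" "P *v a = b"
proof -
 obtain f where f: "orthogonal_transformation f" "det (matrix f) = 1" "f a = b"
 using rotation_exists[OF assms] by blast
 have "linear f" using f(1) by (simp add: orthogonal_transformation_def)
 then show ?thesis using that[of "matrix f"] f by (simp add: orthogonal_transformation_matrix matrix_vector_mul)
qed

lemma norm_vec_one:
 fixes b :: "real^'k"
 assumes "!!j::'k. j = undefined" shows "norm b = \<bar>b $ undefined\<bar>"
proof -
 have U: "UNIV = {undefined :: 'k}" using assms by auto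
 have "norm b = sqrt (\<Oplus>i. (b $ i)\<^sup>2)" by (simp add: norm_vec_def L2_set_def)
 also have "(\<Oplus>i. (b $ i)\<^sup>2) = (\<Sum>i\<in>{undefined}. (b $ i)\<^sup>2)" by (simp only: U)
 finally show ?thesis by simp
qed

text \<open>Rotations of determinant 1 take a and b to multiples of fixed axes. If m = 1 nothing can
  be rotated on the side of b, and its sign is moved into the rotation of a, which exists because n
  >= 2.\<close>

lemma rk1_normal_form:
 fixes a :: "real^'n" and b :: "real^'m"
 assumes n: "2 <= CARD('n)"
 obtains P Q where "orthogonal_matrix P" "orthogonal_matrix Q" "det P * det Q = 1"
 "cmat P ** rk1 (%i. cr (a $ i)) (%j. cr (b $ j)) ** cmat Q
  = csm (of_real (norm a * norm b)) (rk1 (uv undefined) (uv undefined))"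
proof (cases "2 <= CARD('m)")
 case True
 obtain P where P: "orthogonal_matrix P" "det P = 1" "P *v a = norm a *\<^sub>R axis undefined 1"
 by (rule rotation_matrix[OF n, of a "norm a *\<^sub>R axis undefined 1"]) auto
 obtain Q where Q: "orthogonal_matrix Q" "det Q = 1" "Q *v b = norm b *\<^sub>R axis undefined 1"
 by (rule rotation_matrix[OF True, of b "norm b *\<^sub>R axis undefined 1"]) auto
 show ?thesis
 proof (rule that[of P "transpose Q"])
 show "orthogonal_matrix (transpose Q)" using Q by (simp add: orthogonal_matrix_def transpose_transpose)
 show "cmat P ** rk1 (%i. cr (a $ i)) (%j. cr (b $ j)) ** cmat (transpose Q)
  = csm (of_real (norm a * norm b)) (rk1 (uv undefined) (uv undefined))"
  unfolding cmat_rk1 transpose_transpose P Q by (simp add: csm_rk1 rk1_def axis_def vec_eq_iff)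
 qed (use P Q in \<open>auto simp: det_transpose\<close>)
next
 case False
 then have c1: "CARD('m) = 1" using zero_less_card_finite[where 'a='m] by linarith
 then have u: "j = undefined" for j :: 'm by (metis card_1_singletonE UNIV_I singletonD)
 define s where "s = sgn (b $ undefined)"
 have nb: "norm b = \<bar>b $ undefined\<bar>" by (rule norm_vec_one[OF u])
 obtain P where P: "orthogonal_matrix P" "det P = 1" "P *v a = (if s = 0 then 1 else s) *\<^sub>R norm a *\<^sub>R axis undefined 1"
 by (rule rotation_matrix[OF n, of a "(if s = 0 then 1 else s) *\<^sub>R norm a *\<^sub>R axis undefined 1"]) (auto simp: s_def sgn_if)
 show ?thesis
 proof (rule that[of P "mat 1"])
 have "rk1 (%i. cr ((P *v a) $ i)) (%j. of_real (b $ j)) = csm (of_real (norm a * norm b)) (rk1 (%i::'n. if i = undefined then 1 else 0) (%j::'m. if j = undefined then 1 else 0))"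
  unfolding P by (simp add: csm_rk1 rk1_def axis_def vec_eq_iff nb s_def sgn_if) (use u in metis)
 then show "cmat P ** rk1 (%i. cr (a $ i)) (%j. cr (b $ j)) ** cmat (mat 1)
  = csm (of_real (norm a * norm b)) (rk1 (uv undefined) (uv undefined))"
  unfolding cmat_rk1 by (simp add: transpose_mat)
 qed (use P in \<open>auto simp: orthogonal_matrix_id\<close>)
qed

text \<open>\<open>rk1_normal_form\<close> moves every real rank-one matrix to a multiple of one
  matrix unit. Odd k drop out because a rotation takes the axis to its negative; for n = m = 1,
  where there is no such rotation, the evenness condition in \<open>L_invariants\<close> takes its
  place.\<close>

lemma cf_rk1_HL:
 fixes a :: "real^'n" and b :: "real^'m"
 assumes mn: "CARD('m) <= CARD('n)" and f: "f \<in> HL"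
 shows "cf k f (rk1 (%i. of_real (a $ i)) (%j. of_real (b $ j))) = of_real (norm a * norm b) ^ k * \<gamma> f k"
 and "odd k ==> \<gamma> f k = 0"
proof -
 note fH = HL_subset[OF f]
 let ?E = "rk1 (uv undefined) (uv undefined) :: complex^'m^'n"
 have E: "?E = rk1 (%i. of_real ((axis undefined 1 :: real^'n) $ i)) (%j. of_real ((axis undefined 1 :: real^'m) $ j))"
 by (simp add: rk1_def axis_def vec_eq_iff)
 have "(cf k f (rk1 (%i. of_real (a $ i)) (%j. of_real (b $ j))) = of_real (norm a * norm b) ^ k * \<gamma> f k) \<and> (odd k --> \<gamma> f k = 0)"
 proof (cases "2 <= CARD('n)")
 case True
 obtain P Q where PQ: "orthogonal_matrix P" "orthogonal_matrix Q" "det P * det Q = 1"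
  "cmat P ** rk1 (%i. cr (a $ i)) (%j. cr (b $ j)) ** cmat Q = csm (of_real (norm a * norm b)) ?E"
  using rk1_normal_form[OF True] by blast
 have 1: "cf k f (rk1 (%i. of_real (a $ i)) (%j. of_real (b $ j))) = of_real (norm a * norm b) ^ k * \<gamma> f k"
  using cf_orthogonal[OF f PQ(1-3), of k "rk1 (%i. cr (a $ i)) (%j. cr (b $ j))"]
  unfolding PQ(4) cf_rk1_scale[OF fH] \<gamma>_def by simp
 obtain P' :: "real^'n^'n" where P': "orthogonal_matrix P'" "det P' = 1" "P' *v axis undefined 1 = - axis undefined (1::real)"
  by (rule rotation_matrix[OF True, of "axis undefined 1" "- axis undefined 1"]) auto
 have "cmat P' ** ?E ** cmat (mat 1) = csm (-1) ?E"
  unfolding E cmat_rk1 P' by (simp add: transpose_mat csm_rk1)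
 then have "\<gamma> f k = (-1) ^ k * \<gamma> f k"
  using cf_orthogonal[OF f P'(1) orthogonal_matrix_id, of k ?E] P' cf_rk1_scale[OF fH, of k "-1"] unfolding \<gamma>_def by simp
 then show ?thesis using 1 by (cases "even k") auto
 next
 case False
 then have n1: "CARD('n) = 1" using zero_less_card_finite[where 'a='n] by linarith
 then have m1: "CARD('m) = 1" using mn zero_less_card_finite[where 'a='m] by linarith
 have un: "i = undefined" for i :: 'n using n1 by (metis card_1_singletonE UNIV_I singletonD)
 have um: "j = undefined" for j :: 'm using m1 by (metis card_1_singletonE UNIV_I singletonD)
 have "cf k f (csm (-1) ?E) = cf k f ?E"
 proof -
  have neg: "csm t (csm (-1) ?E) = - csm t ?E" for t by (simp add: csm_def vec_eq_iff)
  have "f (- csm t ?E) = f (csm t ?E)" for t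
  proof (cases "csm t ?E \<in> domD")
  case True
  then show ?thesis using f n1 by (simp add: L_invariants_def)
  next
  case False
  then have "- csm t ?E \<notin> domD" using uminus_domD[of "- csm t ?E"] by auto
  then show ?thesis using False off_domD[OF fH] by simp
  qed
  then show ?thesis unfolding cf_def neg by simp
 qed
 then have g: "\<gamma> f k = (-1) ^ k * \<gamma> f k" using cf_rk1_scale[OF fH, of k "-1"] unfolding \<gamma>_def by simp
 then have odd: "odd k ==> \<gamma> f k = 0" by simp
 have nab: "norm a = \<bar>a $ undefined\<bar>" "norm b = \<bar>b $ undefined\<bar>" by (rule norm_vec_one[OF un], rule norm_vec_one[OF um])
 have "rk1 (%i. of_real (a $ i)) (%j. of_real (b $ j)) = csm (of_real (a $ undefined * b $ undefined)) ?E"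
  by (simp add: csm_def rk1_def vec_eq_iff) (metis un um)
 then have "cf k f (rk1 (%i. of_real (a $ i)) (%j. of_real (b $ j))) = of_real (a $ undefined * b $ undefined) ^ k * \<gamma> f k"
  using cf_rk1_scale[OF fH] by (simp add: \<gamma>_def)
 also have "... = of_real (norm a * norm b) ^ k * \<gamma> f k"
 proof (cases "even k")
  case True
  have "(norm a * norm b) ^ k = (a $ undefined * b $ undefined) ^ k"
  unfolding nab abs_mult[symmetric] using True by (simp add: power_even_abs)
  then show ?thesis by (metis of_real_power)
 qed (use odd in simp)
 finally show ?thesis using odd by blast
 qed
 then show "cf k f (rk1 (%i. of_real (a $ i)) (%j. of_real (b $ j))) = of_real (norm a * norm b) ^ k * \<gamma> f k"
 and "odd k ==> \<gamma> f k = 0" by auto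
qed

text \<open>On an invariant f the average over the two Gaussian vectors separates into moments of
  order 2 k of |a| and |b|, given by \<open>gexp_quadratic_power\<close> and
  \<open>qpoly_one\<close>; this is where the two Pochhammer factors of \<open>Nk\<close> come
  from.\<close>

lemma ip_pk_HL:
 assumes mn: "CARD('m) <= CARD('n)" and f: "f \<in> HL"
 shows "ip f (pk k) = \<gamma> f (2 * k) * of_real (Nk CARD('n) CARD('m) k / hb k)"
proof -
 have c: "cf (2 * k) f (rk1 (%i. of_real (real (p i))) (%j. of_real (real (r j))))
  = \<gamma> f (2 * k) * ((\<Oplus>i. 1 * of_nat (p i) ^ 2) ^ k * (\<Oplus>j. 1 * of_nat (r j) ^ 2) ^ k)" for p r
 proof -
 have nn: "norm (\<chi> i. real (p i) :: real^'k) ^ (2 * k) = (\<Oplus>i. real (p i) ^ 2) ^ k" for p :: "'k::finite => nat"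
  unfolding power_mult by (simp add: norm_vec_def L2_set_def sum_nonneg)
 have "cf (2 * k) f (rk1 (%i. of_real (real (p i))) (%j. of_real (real (r j))))
  = of_real (norm (\<chi> i. real (p i)) ^ (2 * k) * norm (\<chi> j. real (r j)) ^ (2 * k)) * \<gamma> f (2 * k)"
  using cf_rk1_HL(1)[OF mn f, of "2 * k" "\<chi> i. real (p i)" "\<chi> j. real (r j)"] by (simp add: power_mult_distrib)
 then show ?thesis unfolding nn by (simp add: mult.commute)
 qed
 have g2: "gexp N (%p. gexp N' (%r. g * (A p * B r))) = g * (gexp N A * gexp N' B)" for g N N' and A :: "('n => nat) => complex" and B :: "('m => nat) => complex"
 proof -
 have i: "gexp N' (%r. g * (A p * B r)) = (g * gexp N' B) * A p" for p
  using gexp_scale[of N' "g * A p" B] by (simp add: mult_ac)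
 show ?thesis unfolding i unfolding gexp_scale by (simp only: mult_ac)
 qed
 have "ip f (pk k) = \<gamma> f (2 * k) * (gexp (2 * k) (%p::'n => nat. (\<Oplus>i. 1 * of_nat (p i) ^ 2) ^ k) * gexp (2 * k) (%r::'m => nat. (\<Oplus>j. 1 * of_nat (r j) ^ 2) ^ k)) / of_real (pcst k)"
 unfolding ip_pk[OF HL_subset[OF f]] c g2 ..
 also have "... = \<gamma> f (2 * k) * of_real ((fact k * 2 ^ k * (pochhammer (real CARD('n) / 2) k / fact k)) * (fact k * 2 ^ k * (pochhammer (real CARD('m) / 2) k / fact k)) / pcst k)"
 by (subst (1 2) gexp_quadratic_power) (simp_all add: qpoly_one)
 also have "(fact k * 2 ^ k * (pochhammer (real CARD('n) / 2) k / fact k)) * (fact k * 2 ^ k * (pochhammer (real CARD('m) / 2) k / fact k)) / pcst k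
  = Nk CARD('n) CARD('m) k / hb k"
 proof -
 have "(4::real) ^ k = 2 ^ k * 2 ^ k" by (simp flip: power_mult_distrib)
 then show ?thesis by (simp add: pcst_def gmom_def hb_def Nk_def power2_eq_square field_simps)
 qed
 finally show ?thesis .
qed

lemma pk_HL: "pk k \<in> HL"
 unfolding L_invariants_iff
proof (intro conjI pk_mem allI impI ballI)
 fix P :: "real^'n^'n" and Q :: "real^'m^'m" and z :: "complex^'m^'n" assume PQ: "orthogonal_matrix P \<and> orthogonal_matrix Q \<and> det P * det Q = 1" and z: "z \<in> domD"
 then show "pk k (cmat P ** z ** cmat Q) = pk k z"
 by (simp add: pk_def domD_orthogonal pform_right_orthogonal pform_left_orthogonal)
next
 fix z :: "complex^'m^'n" assume z: "z \<in> domD"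
 then show "pk k (- z) = pk k z" by (simp add: pk_def uminus_domD pform_uminus)
qed

lemma gamma_pk: "\<gamma> (pk k) (2 * l) = (if k = l then of_real (hb k) else 0)"
proof -
 let ?E = "rk1 (uv undefined) (uv undefined) :: complex^'m^'n"
 obtain e where e: "e > 0" "!!t. cmod t <= e ==> csm t ?E \<in> domD" using rk1_small by blast
 have "\<forall>\<^sub>F t in nhds 0. t \<in> ball (0::complex) e" by (rule eventually_nhds_in_open) (use e in auto)
 then have ev: "\<forall>\<^sub>F t in nhds 0. pk k (csm t ?E) = of_real (hb k) * (t - 0) ^ (2 * k)"
 by eventually_elim (use e in \<open>simp add: pk_def pform_rk1_axis\<close>)
 have "(deriv ^^ (2 * l)) (%t. pk k (csm t ?E)) 0 = (deriv ^^ (2 * l)) (%t. of_real (hb k) * (t - 0) ^ (2 * k)) 0"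
 by (rule higher_deriv_cong_ev[OF ev refl])
 also have "... = of_real (hb k) * (deriv ^^ (2 * l)) (%t. (t - 0) ^ (2 * k)) 0"
 by (rule higher_deriv_cmult[of _ UNIV]) (auto intro!: holomorphic_intros)
 also have "(deriv ^^ (2 * l)) (%t::complex. (t - 0) ^ (2 * k)) 0 = (if k = l then fact (2 * k) else 0)"
 proof -
 have "(deriv ^^ (2 * l)) (%t::complex. (t - 0) ^ (2 * k)) 0 = pochhammer (of_nat (Suc (2 * k) - 2 * l)) (2 * l) * (0 - 0) ^ (2 * k - 2 * l)"
  by (rule higher_deriv_power)
 also have "... = (if k = l then fact (2 * k) else 0)"
 proof (cases "k < l")
  case True
  then have "Suc (2 * k) - 2 * l = 0" by simp
  then show ?thesis using True by (cases l) (simp_all add: pochhammer_0_left)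
 next
  case False
  show ?thesis
  proof (cases "k = l")
  case True
  then show ?thesis by (simp add: pochhammer_fact)
  next
  case F: False
  then have "2 * k - 2 * l > 0" using False by simp
  then show ?thesis using F by (simp add: power_0_left)
  qed
 qed
 finally show ?thesis .
 qed
 finally show ?thesis by (auto simp: \<gamma>_def cf_def)
qed

lemma pk_orthogonal:
 assumes mn: "CARD('m) <= CARD('n)"
 shows "hilbert_orthogonal HL ip pk (Nk CARD('n) CARD('m))"
proof unfold_locales
 show "fun_hilbert_space HL ip" by (rule HL_hilbert)
 show "pk k \<in> HL" for k by (rule pk_HL)
 show "Nk CARD('n) CARD('m) k > 0" for k by (rule Nk_pos) auto
 show "ip (pk j) (pk k) = (if j = k then of_real (Nk CARD('n) CARD('m) k) else 0)" for j k
 using hb_pos[of k] by (auto simp: ip_pk_HL[OF mn pk_HL] gamma_pk)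
qed

text \<open>If all pairings vanish, the \<gamma> f k with even k vanish by \<open>ip_pk_HL\<close>
  and those with odd k always do, so every coefficient at a real rank-one matrix is 0.\<close>

lemma pk_total:
 assumes mn: "CARD('m) <= CARD('n)" and f: "f \<in> HL" and z: "!!k. ip f (pk k) = 0"
 shows "f = (%z. 0)"
proof
 fix w
 have "\<gamma> f (2 * k) = 0" for k
 using z[of k] Nk_pos[of "CARD('n)" "CARD('m)" k] hb_pos[of k] by (auto simp: ip_pk_HL[OF mn f])
 then have g: "\<gamma> f k = 0" for k using cf_rk1_HL(2)[OF mn f, of k] by (cases "even k") (auto elim!: evenE)
 show "f w = 0"
 proof (cases "w \<in> domD")
 case True
 show ?thesis
 proof (rule zero_if_rank_one_coefs_zero[OF HL_subset[OF f] _ True])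
  fix k and a :: "'n => real" and b :: "'m => real"
  show "cf k f (rk1 (cv a) (cv b)) = 0"
  using cf_rk1_HL(1)[OF mn f, of k "\<chi> i. a i" "\<chi> j. b j"] g by simp
 qed
 qed (use off_domD[OF HL_subset[OF f]] in simp)
qed

end

section \<open>The differential operator on generating functions\<close>

text \<open>u stands for x_i^2 and Z for 1 / (1 - u X). After multiplication by X, the part of the
  operator that involves x_i alone, applied to the generating function and divided by it, depends on
  x_i only through Z. The auxiliary w = (1 - u) X Z, equal to 1 - (1 - X) Z, collects the factors 1
  - x_i^2.\<close>

lemma operator_single_term:
 fixes u X Z :: "'a::idom"
 assumes "u * X * Z = Z - 1"
 shows "X * (- 1 - 2 * (1 - u) * (u * X * Z) + (1 - u)\<^sup>2 * (X * Z + 3 * u * X\<^sup>2 * Z\<^sup>2) + 2 * u - 2 * (1 - u) * (u * X * Z))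
 = (1 - X) - 2 * (1 - X) * (2 - X) * Z + 3 * (1 - X)\<^sup>2 * Z\<^sup>2"
proof -
 define w where "w = (1 - u) * X * Z"
 have w: "w = 1 - (1 - X) * Z" unfolding w_def using assms by (simp add: algebra_simps)
 have a: "X * ((1 - u)\<^sup>2 * (X * Z + 3 * u * X\<^sup>2 * Z\<^sup>2)) = (1 - u) * X * w + 3 * ((u * X) * w\<^sup>2)"
 by (simp add: w_def power2_eq_square algebra_simps)
 have b: "(u * X) * w\<^sup>2 = w\<^sup>2 - (1 - u) * X * w"
 proof -
 have "(u * X) * w\<^sup>2 = (u * X * Z) * ((1 - u) * X * w)" by (simp add: w_def power2_eq_square algebra_simps)
 also have "... = (Z - 1) * ((1 - u) * X * w)" unfolding assms ..
 also have "... = w\<^sup>2 - (1 - u) * X * w" by (simp add: w_def power2_eq_square algebra_simps)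
 finally show ?thesis .
 qed
 have c: "X * ((1 - u) * (u * X * Z)) = u * X * w" by (simp add: w_def algebra_simps)
 have d: "u * X * w = u * X - (1 - X) * (Z - 1)"
 proof -
 have "u * X * w = u * X - (1 - X) * (u * X * Z)" unfolding w by (simp add: algebra_simps)
 then show ?thesis unfolding assms .
 qed
 have "X * (- 1 - 2 * (1 - u) * (u * X * Z) + (1 - u)\<^sup>2 * (X * Z + 3 * u * X\<^sup>2 * Z\<^sup>2) + 2 * u - 2 * (1 - u) * (u * X * Z))
  = - X - 4 * (X * ((1 - u) * (u * X * Z))) + X * ((1 - u)\<^sup>2 * (X * Z + 3 * u * X\<^sup>2 * Z\<^sup>2)) + 2 * (u * X)"
 by (simp add: algebra_simps)
 also have "... = - X - 4 * (u * X * w) + ((1 - u) * X * w + 3 * (w\<^sup>2 - (1 - u) * X * w)) + 2 * (u * X)"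
 unfolding a c b ..
 also have "... = - X - 2 * (u * X * w) + 3 * w\<^sup>2 - 2 * X * w + 2 * (u * X)" by (simp add: algebra_simps)
 also have "... = - X + 2 * (1 - X) * (Z - 1) + 3 * w\<^sup>2 - 2 * X * w" unfolding d by (simp add: algebra_simps)
 also have "... = (1 - X) - 2 * (1 - X) * (2 - X) * Z + 3 * (1 - X)\<^sup>2 * Z\<^sup>2"
 unfolding w by (simp add: power2_eq_square algebra_simps)
 finally show ?thesis .
qed

text \<open>The denominator disappears because Z - W = (u - v) X Z W, so the mixed term is the
  product of (1 - u) X Z and (1 - v) X W.\<close>

lemma operator_pair_term:
 fixes u v c X Z W :: "'a::idom"
 assumes Z: "u * X * Z = Z - 1" and W: "v * X * W = W - 1" and c: "c * (u - v) = (1 - u) * (1 - v)"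
 shows "X * (- 1 + c * (u * X * Z - v * X * W)) = (1 - X) - (1 - X) * (Z + W) + (1 - X)\<^sup>2 * (Z * W)"
proof -
 have "(u - v) * X * (Z * W) = (u * X * Z) * W - (v * X * W) * Z" by (simp add: algebra_simps)
 also have "... = Z - W" unfolding Z W by (simp add: algebra_simps)
 finally have "u * X * Z - v * X * W = (u - v) * X * (Z * W)" unfolding Z W by simp
 then have "X * (c * (u * X * Z - v * X * W)) = (c * (u - v)) * (X * X * (Z * W))" by auto
 also have "... = ((1 - u) * X * Z) * ((1 - v) * X * W)" unfolding c by (simp add: algebra_simps)
 also have "(1 - u) * X * Z = 1 - (1 - X) * Z" using Z by (simp add: algebra_simps)
 also have "(1 - v) * X * W = 1 - (1 - X) * W" using W by (simp add: algebra_simps)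
 finally have e: "X * (c * (u * X * Z - v * X * W)) = (1 - (1 - X) * Z) * (1 - (1 - X) * W)" .
 show ?thesis unfolding distrib_left e by (simp add: power2_eq_square algebra_simps)
qed

lemma sum_ordered_pairs:
 fixes f :: "'i::{finite,linorder} => 'i => 'a::ab_group_add"
 assumes "!!i j. f i j = f j i"
 shows "(\<Sum>(i,j)\<in>{(i,j). j < i}. f i j) + (\<Sum>(i,j)\<in>{(i,j). j < i}. f i j) = (\<Oplus>i. \<Oplus>j. f i j) - (\<Oplus>i. f i i)"
proof -
 have "(\<Oplus>i. \<Oplus>j. f i j) = (\<Sum>(i,j)\<in>UNIV. f i j)"
 by (simp add: sum.cartesian_product)
 also have "UNIV = {(i,j). j < i} \<union> {(i,j). i < j} \<union> {(i::'i,j). i = j}" by auto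
 also have "(\<Sum>(i,j)\<in>.... f i j) = (\<Sum>(i,j)\<in>{(i,j). j < i}. f i j) + (\<Sum>(i,j)\<in>{(i,j). i < j}. f i j) + (\<Sum>(i,j)\<in>{(i,j). i = j}. f i j)"
 by (subst sum.union_disjoint, simp, simp, force, subst sum.union_disjoint) auto
 also have "(\<Sum>(i,j)\<in>{(i,j). i < j}. f i j) = (\<Sum>(i,j)\<in>{(i,j). j < i}. f i j)"
 by (rule sum.reindex_bij_witness[of _ prod.swap prod.swap]) (use assms in auto)
 also have "(\<Sum>(i,j)\<in>{(i,j). i = j}. f i j) = (\<Oplus>i. f i i)"
 by (rule sum.reindex_bij_witness[of _ "%i. (i, i)" fst]) auto
 finally show ?thesis by simp
qed

text \<open>\<open>bfps x\<close> is the expansion of (1 - x^2 X)^(-1/2), \<open>bfps1\<close> and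
  \<open>bfps2\<close> are its first two derivatives in x, and \<open>zfps x\<close> is 1 / (1 - x^2
  X).\<close>

definition bfps :: "complex => complex fps" where "bfps x = Abs_fps (%l. of_real (hb l) * x ^ (2 * l))"
definition bfps1 :: "complex => complex fps" where "bfps1 x = Abs_fps (%l. of_real (hb l) * (of_nat (2 * l) * x ^ (2 * l - 1)))"
definition bfps2 :: "complex => complex fps" where "bfps2 x = Abs_fps (%l. of_real (hb l) * (of_nat (2 * l) * (of_nat (2 * l - 1) * x ^ (2 * l - 1 - 1))))"
definition zfps :: "complex => complex fps" where "zfps x = Abs_fps (%l. x ^ (2 * l))"

lemma hb_Suc_complex: "cr (hb (Suc l)) * of_nat (Suc l) = (of_nat l + 1/2) * of_real (hb l)"
 using arg_cong[OF hb_Suc[of l], of cr] by (simp add: mult.commute)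

lemma hb_Suc_double: "of_real (hb (Suc l)) * of_nat (2 * Suc l) = (2 * of_nat l + 1) * cr (hb l)"
proof -
 have "of_nat (2 * Suc l) = (2 :: complex) * of_nat (Suc l)" by (simp only: of_nat_mult of_nat_numeral)
 then have "of_real (hb (Suc l)) * of_nat (2 * Suc l) = 2 * (cr (hb (Suc l)) * of_nat (Suc l))" by (simp only: mult_ac)
 then show ?thesis unfolding hb_Suc_complex by (simp add: algebra_simps)
qed

lemma fps_one_minus_mult: "fps_nth ((1 - fps_const c * fps_X) * A) (Suc l) = fps_nth A (Suc l) - c * fps_nth A l"
 "fps_nth ((1 - fps_const c * fps_X) * A) 0 = fps_nth A 0" for c :: complex
 by (simp_all add: left_diff_distrib mult.assoc)

lemma zfps: "(1 - fps_const (x\<^sup>2) * fps_X) * zfps x = 1"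
proof (rule fps_ext)
 fix l show "fps_nth ((1 - fps_const (x\<^sup>2) * fps_X) * zfps x) l = fps_nth 1 l"
 by (cases l) (simp_all add: fps_one_minus_mult zfps_def power2_eq_square)
qed

lemma zfps': "fps_const (x\<^sup>2) * fps_X * zfps x = zfps x - 1"
 using zfps[of x] by (simp add: left_diff_distrib) (simp add: algebra_simps)

lemma zfps_solve: "(1 - fps_const (x\<^sup>2) * fps_X) * A = C ==> A = zfps x * C"
proof -
 assume "(1 - fps_const (x\<^sup>2) * fps_X) * A = C"
 then have "zfps x * C = ((1 - fps_const (x\<^sup>2) * fps_X) * zfps x) * A" by (simp add: mult_ac)
 then show ?thesis by (simp add: zfps)
qed

lemma bfps1_eq: "bfps1 x = fps_const x * fps_X * zfps x * bfps x"
proof -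
 have "bfps1 x = zfps x * (fps_const x * fps_X * bfps x)"
 proof (rule zfps_solve, rule fps_ext)
 fix l show "fps_nth ((1 - fps_const (x\<^sup>2) * fps_X) * bfps1 x) l = fps_nth (fps_const x * fps_X * bfps x) l"
 proof (cases l)
  case (Suc l)
  have 1: "x\<^sup>2 * (of_nat (2 * l) * x ^ (2 * l - 1)) = of_nat (2 * l) * x ^ (2 * l + 1)"
  by (cases l) (simp_all add: power2_eq_square)
  have "fps_nth ((1 - fps_const (x\<^sup>2) * fps_X) * bfps1 x) (Suc l)
  = (of_real (hb (Suc l)) * of_nat (2 * Suc l)) * x ^ (2 * l + 1) - of_real (hb l) * (x\<^sup>2 * (of_nat (2 * l) * x ^ (2 * l - 1)))"
  unfolding fps_one_minus_mult bfps1_def by auto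
  also have "... = fps_nth (fps_const x * fps_X * bfps x) (Suc l)"
  unfolding hb_Suc_double 1 by (simp add: bfps_def mult.assoc) (simp add: algebra_simps)
  finally show ?thesis using Suc by simp
 qed (simp add: fps_one_minus_mult bfps1_def mult.assoc)
 qed
 then show ?thesis by (simp add: mult_ac)
qed

lemma bfps2_eq: "bfps2 x = (fps_X * zfps x + 3 * fps_const (x\<^sup>2) * fps_X\<^sup>2 * (zfps x)\<^sup>2) * bfps x"
proof -
 have "bfps2 x = zfps x * (fps_X * bfps x + fps_const (3 * x) * fps_X * bfps1 x)"
 proof (rule zfps_solve, rule fps_ext)
 fix l show "fps_nth ((1 - fps_const (x\<^sup>2) * fps_X) * bfps2 x) l = fps_nth (fps_X * bfps x + fps_const (3 * x) * fps_X * bfps1 x) l"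
 proof (cases l)
  case (Suc l)
  have 1: "x\<^sup>2 * (of_nat (2 * l) * (of_nat (2 * l - 1) * x ^ (2 * l - 1 - 1))) = of_nat (2 * l) * (2 * of_nat l - 1) * x ^ (2 * l)"
  by (cases l) (simp_all add: power2_eq_square algebra_simps)
  have 2: "x * (of_nat (2 * l) * x ^ (2 * l - 1)) = of_nat (2 * l) * x ^ (2 * l)"
  by (cases l) (simp_all add: power2_eq_square)

  have "fps_nth ((1 - fps_const (x\<^sup>2) * fps_X) * bfps2 x) (Suc l)
  = (of_real (hb (Suc l)) * of_nat (2 * Suc l)) * ((2 * of_nat l + 1) * x ^ (2 * l)) - of_real (hb l) * (x\<^sup>2 * (of_nat (2 * l) * (of_nat (2 * l - 1) * x ^ (2 * l - 1 - 1))))"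
  unfolding fps_one_minus_mult bfps2_def by auto
  also have "... = of_real (hb l) * x ^ (2 * l) + 3 * (of_real (hb l) * (x * (of_nat (2 * l) * x ^ (2 * l - 1))))"
  unfolding 1 2 hb_Suc_double by (simp add: algebra_simps)
  also have "... = fps_nth (fps_X * bfps x + fps_const (3 * x) * fps_X * bfps1 x) (Suc l)"
  by (simp add: bfps_def bfps1_def mult_ac)
  finally show ?thesis using Suc by simp
 qed (simp add: fps_one_minus_mult bfps2_def mult.assoc)
 qed
 also have "... = (fps_X * zfps x + 3 * fps_const (x\<^sup>2) * fps_X\<^sup>2 * (zfps x)\<^sup>2) * bfps x"
 unfolding bfps1_eq by (simp add: algebra_simps power2_eq_square flip: fps_const_mult fps_numeral_fps_const)
 finally show ?thesis .
qed

text \<open>The Euler operator X d/dX therefore acts on a product of such series as multiplication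
  by half the sum of the Z i - 1. It is the bridge from power sums of the Z i to powers of
  k.\<close>

lemma X_deriv_bfps: "fps_X * fps_deriv (bfps x) = fps_const (1/2) * (zfps x - 1) * bfps x"
proof -
 have "fps_deriv (bfps x) = zfps x * (fps_const (x\<^sup>2 / 2) * bfps x)"
 proof (rule zfps_solve, rule fps_ext)
 fix l show "fps_nth ((1 - fps_const (x\<^sup>2) * fps_X) * fps_deriv (bfps x)) l = fps_nth (fps_const (x\<^sup>2 / 2) * bfps x) l"
 proof (cases l)
  case 0
  show ?thesis using hb_Suc_complex[of 0] 0 by (simp add: fps_one_minus_mult bfps_def power2_eq_square)
 next
  case (Suc k)
  have "of_nat (Suc (Suc k)) * cr (hb (Suc (Suc k))) = (of_nat (Suc k) + 1/2) * of_real (hb (Suc k))"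
  using hb_Suc_complex[of "Suc k"] by (simp only: mult.commute)
  then have "fps_nth ((1 - fps_const (x\<^sup>2) * fps_X) * fps_deriv (bfps x)) (Suc k) = ((of_nat (Suc k) + 1/2) * of_real (hb (Suc k))) * x ^ (2 * Suc (Suc k)) - x\<^sup>2 * (of_nat (Suc k) * (of_real (hb (Suc k)) * x ^ (2 * Suc k)))"
  unfolding fps_one_minus_mult bfps_def by (simp add: mult.assoc del: of_nat_Suc)
  also have "x ^ (2 * Suc (Suc k)) = x\<^sup>2 * x ^ (2 * Suc k)" by (simp add: power2_eq_square)
  finally show ?thesis using Suc by (simp add: bfps_def algebra_simps del: of_nat_Suc)
 qed
 qed
 then have "fps_X * fps_deriv (bfps x) = fps_const (1/2) * (fps_const (x\<^sup>2) * fps_X * zfps x) * bfps x"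
 by auto
 then show ?thesis unfolding zfps' .
qed

lemma X_deriv_zfps: "fps_X * fps_deriv (zfps x) = (zfps x)\<^sup>2 - zfps x"
proof -
 have "fps_deriv ((1 - fps_const (x\<^sup>2) * fps_X) * zfps x) = 0" unfolding zfps by simp
 then have "(1 - fps_const (x\<^sup>2) * fps_X) * fps_deriv (zfps x) = fps_const (x\<^sup>2) * zfps x"
 by (simp add: algebra_simps)
 from zfps_solve[OF this] have "fps_X * fps_deriv (zfps x) = (fps_const (x\<^sup>2) * fps_X * zfps x) * zfps x" by (simp add: mult_ac)
 then show ?thesis unfolding zfps' by (simp add: algebra_simps power2_eq_square)
qed

text \<open>The differential expression \<open>four_L1\<close> as a function of the value and of the first and second partial
 derivatives.\<close>
definition four_L1_expr :: "nat => nat => real^'m::{finite,linorder} => complex => ('m => complex) => ('m => complex) => complex" where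
 "four_L1_expr n m x F D E =
  (\<Oplus>i. (- (1 - (x$i)\<^sup>2) - (x$i)\<^sup>2) *\<^sub>R F
  - (2 * x$i * (1 - (x$i)\<^sup>2)) *\<^sub>R D i
  + ((1 - (x$i)\<^sup>2)\<^sup>2) *\<^sub>R E i)
 + (\<Oplus>i. (2 * (x$i)\<^sup>2) *\<^sub>R F - (2 * x$i * (1 - (x$i)\<^sup>2)) *\<^sub>R D i)
 + (real n - real m) *\<^sub>R
  (\<Oplus>i. - F - (x$i) *\<^sub>R D i + (1 / x$i) *\<^sub>R D i)
 + 2 *\<^sub>R (\<Sum>(i,j)\<in>{(i,j). j < i}. - F +
  ((1 - (x$i)\<^sup>2) * (1 - (x$j)\<^sup>2) / ((x$i)\<^sup>2 - (x$j)\<^sup>2)) *\<^sub>R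
   ((x$i) *\<^sub>R D i - (x$j) *\<^sub>R D j))"

lemma four_L1_four_L1_expr: "four_L1 n m F x = four_L1_expr n m x (F x) (%i. pd i F x) (%i. pd i (pd i F) x)"
 by (simp add: four_L1_def four_L1_expr_def)

lemma four_L1_expr_scale: "four_L1_expr n m x (c * F) (%i. c * D i) (%i. c * E i) = c * four_L1_expr n m x F D E"
 unfolding four_L1_expr_def
 by (simp add: scaleR_conv_of_real sum_distrib_left distrib_left right_diff_distrib mult.left_commute[of _ c] case_prod_unfold)

lemma four_L1_expr_add: "four_L1_expr n m x (F + F') (%i. D i + D' i) (%i. E i + E' i) = four_L1_expr n m x F D E + four_L1_expr n m x F' D' E'"
proof -
 have a: "(\<Sum>i\<in>A. f i) + (\<Sum>i\<in>A. g i) = (\<Sum>i\<in>A. f i + g i)" for A and f g :: "'z => complex" by (simp add: sum.distrib)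
 have 1: "four_L1_expr n m x F D E = (\<Oplus>i. ((- (1 - (x$i)\<^sup>2) - (x$i)\<^sup>2) *\<^sub>R F
  - (2 * x$i * (1 - (x$i)\<^sup>2)) *\<^sub>R D i
  + ((1 - (x$i)\<^sup>2)\<^sup>2) *\<^sub>R E i)
 + ((2 * (x$i)\<^sup>2) *\<^sub>R F - (2 * x$i * (1 - (x$i)\<^sup>2)) *\<^sub>R D i)
 + (real n - real m) *\<^sub>R (- F - (x$i) *\<^sub>R D i + (1 / x$i) *\<^sub>R D i))
 + (\<Sum>p\<in>{(i,j). j < i}. 2 *\<^sub>R (- F +
  ((1 - (x$fst p)\<^sup>2) * (1 - (x$snd p)\<^sup>2) / ((x$fst p)\<^sup>2 - (x$snd p)\<^sup>2)) *\<^sub>R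
   ((x$fst p) *\<^sub>R D (fst p) - (x$snd p) *\<^sub>R D (snd p))))" for F D E
 unfolding four_L1_expr_def a scaleR_sum_right case_prod_unfold ..

 have e1: "\<alpha> *\<^sub>R (F + F') - \<beta> *\<^sub>R (D + D') + \<gamma> *\<^sub>R (E + E') + (\<delta> *\<^sub>R (F + F') - \<beta> *\<^sub>R (D + D')) + \<epsilon> *\<^sub>R (- (F + F') - \<zeta> *\<^sub>R (D + D') + \<eta> *\<^sub>R (D + D'))
 = (\<alpha> *\<^sub>R F - \<beta> *\<^sub>R D + \<gamma> *\<^sub>R E + (\<delta> *\<^sub>R F - \<beta> *\<^sub>R D) + \<epsilon> *\<^sub>R (- F - \<zeta> *\<^sub>R D + \<eta> *\<^sub>R D))
 + (\<alpha> *\<^sub>R F' - \<beta> *\<^sub>R D' + \<gamma> *\<^sub>R E' + (\<delta> *\<^sub>R F' - \<beta> *\<^sub>R D') + \<epsilon> *\<^sub>R (- F' - \<zeta> *\<^sub>R D' + \<eta> *\<^sub>R D'))"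
 for \<alpha> \<beta> \<gamma> \<delta> \<epsilon> \<zeta> \<eta> :: real and F F' D D' E E' :: complex
 by (simp add: scaleR_conv_of_real algebra_simps)
 have e2: "2 *\<^sub>R (- (F + F') + \<alpha> *\<^sub>R (\<beta> *\<^sub>R (D + D') - \<gamma> *\<^sub>R (E + E')))
 = 2 *\<^sub>R (- F + \<alpha> *\<^sub>R (\<beta> *\<^sub>R D - \<gamma> *\<^sub>R E)) + 2 *\<^sub>R (- F' + \<alpha> *\<^sub>R (\<beta> *\<^sub>R D' - \<gamma> *\<^sub>R E'))"
 for \<alpha> \<beta> \<gamma> :: real and F F' D D' E E' :: complex
 by (simp add: scaleR_conv_of_real algebra_simps)
 show ?thesis unfolding 1 e1 e2 sum.distrib by (simp only: add_ac)
qed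

lemma four_L1_expr_sum:
 "finite I ==> four_L1_expr n m x (\<Sum>k\<in>I. c k * F k) (%i. \<Sum>k\<in>I. c k * D k i) (%i. \<Sum>k\<in>I. c k * E k i) = (\<Sum>k\<in>I. c k * four_L1_expr n m x (F k) (D k) (E k))"
proof (induction I rule: finite_induct)
 case empty
 show ?case using four_L1_expr_scale[of n m x 0 0 "%_. 0" "%_. 0"] by simp
next
 case (insert k I)
 then show ?case by (simp add: four_L1_expr_add four_L1_expr_scale)
qed

lemma four_L1_expr_tendsto:
 assumes "(F \<longlongrightarrow> F') net" "!!i. ((%k. D k i) \<longlongrightarrow> D' i) net" "!!i. ((%k. E k i) \<longlongrightarrow> E' i) net"
 shows "((%k. four_L1_expr n m x (F k) (D k) (E k)) \<longlongrightarrow> four_L1_expr n m x F' D' E') net"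
 unfolding four_L1_expr_def case_prod_unfold by (intro tendsto_intros assms)

text \<open>Coefficient of \<open>X ^ k\<close> in the partial derivatives of \<open>qfps\<close> at the squares of the \<open>x i\<close>.\<close>
definition qD :: "nat => ('m::finite => complex) => 'm => complex" where
 "qD k x i = fps_nth (bfps1 (x i) * (\<Prod>j\<in>UNIV-{i}. bfps (x j))) k"
definition qE :: "nat => ('m::finite => complex) => 'm => complex" where
 "qE k x i = fps_nth (bfps2 (x i) * (\<Prod>j\<in>UNIV-{i}. bfps (x j))) k"

lemma qfps_squares: "qfps (%j. (x j)\<^sup>2) = (\<Prod>j\<in>UNIV. bfps (x j))"
 by (simp add: qfps_def bfps_def power_mult)

text \<open>The off-diagonal coefficient of the recurrence, linked to the norms by
  \<open>Nk_Suc\<close>.\<close>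

definition Ak :: "nat => nat => nat => real" where "Ak n m k = (real k + real n / 2) * (real k + real m / 2)"

text \<open>On the generating function G of the \<open>qpoly k\<close>, X times the operator is 4 (1
  - X) (D^2 - X (D + n/2) (D + m/2)) G, where D = X d/dX is the Euler operator. The coefficient of
  X^(k + 1) is the three-term recurrence.\<close>

lemma four_L1_qpoly:
 fixes x :: "real^'m::{finite,linorder}"
 assumes x0: "!!i. x $ i ~= 0" and xd: "!!i j. i ~= j ==> (x $ i)\<^sup>2 ~= (x $ j)\<^sup>2"
 defines "y \<equiv> %i. cr (x $ i)"
 shows "four_L1_expr n CARD('m) x (qpoly k (%i. (y i)\<^sup>2)) (qD k y) (qE k y)
 = 4 * (of_nat (Suc k) ^ 2 * qpoly (Suc k) (%i. (y i)\<^sup>2) - of_real (Ak n CARD('m) k + real k ^ 2) * qpoly k (%i. (y i)\<^sup>2)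
  + (if k = 0 then 0 else of_real (Ak n CARD('m) (k - 1)) * qpoly (k - 1) (%i. (y i)\<^sup>2)))"
proof -
 define G where "G = qfps (%i. (y i)\<^sup>2)"
 define Z where "Z i = zfps (y i)" for i
 define u where "u i = fps_const ((y i)\<^sup>2)" for i
 let ?X = "fps_X :: complex fps"
 have uXZ: "u i * ?X * Z i = Z i - 1" for i unfolding u_def Z_def by (rule zfps')
 have Gi: "G = bfps (y i) * (\<Prod>j\<in>UNIV-{i}. bfps (y j))" for i
 unfolding G_def qfps_squares by (rule prod.remove) auto
 define D where "D i = fps_const (y i) * ?X * Z i * G" for i
 define E where "E i = (?X * Z i + 3 * u i * ?X\<^sup>2 * (Z i)\<^sup>2) * G" for i
 have qD: "qD k y i = fps_nth (D i) k" for i k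
 unfolding qD_def D_def Gi[of i] bfps1_eq Z_def by (simp add: mult.assoc)
 have qE: "qE k y i = fps_nth (E i) k" for i k
 unfolding qE_def E_def Gi[of i] bfps2_eq Z_def u_def by (simp add: mult.assoc)
 define cc where "cc i j = fps_const (cr ((1 - (x$i)\<^sup>2) * (1 - (x$j)\<^sup>2) / ((x$i)\<^sup>2 - (x$j)\<^sup>2)))" for i j
 define m where "m = CARD('m)"
 define s where "s = (\<Oplus>i. Z i)"
 define s2 where "s2 = (\<Oplus>i. (Z i)\<^sup>2)"
 let ?c = "%r. fps_const (cr r)"
 have cu: "u i = ?c ((x $ i)\<^sup>2)" for i by (simp add: u_def y_def)
 have cy: "fps_const (y i) = ?c (x $ i)" for i by (simp add: y_def)
 define T1 where "T1 i = - 1 - 2 * (1 - u i) * (u i * ?X * Z i) + (1 - u i)\<^sup>2 * (?X * Z i + 3 * u i * ?X\<^sup>2 * (Z i)\<^sup>2) + 2 * u i - 2 * (1 - u i) * (u i * ?X * Z i)" for i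
 define T2 where "T2 i = - 1 - u i * ?X * Z i + ?X * Z i" for i
 define T3 where "T3 i j = - 1 + cc i j * (u i * ?X * Z i - u j * ?X * Z j)" for i j
 define L where "L = ((\<Oplus>i. T1 i) + ?c (real n - real m) * (\<Oplus>i. T2 i) + 2 * (\<Sum>(i,j)\<in>{(i,j). j < i}. T3 i j)) * G"
 have nth: "four_L1_expr n m x (fps_nth G k) (%i. fps_nth (D i) k) (%i. fps_nth (E i) k) = fps_nth L k" for k
 proof -
 have yD: "?c (x $ i) * D i = u i * ?X * Z i * G" for i
  by (simp add: D_def u_def y_def power2_eq_square mult.assoc[symmetric])
 have iD: "?c (1 / x $ i) * D i = ?X * Z i * G" for i
  using x0[of i] by (simp add: D_def y_def mult.assoc[symmetric])
 have sc: "r *\<^sub>R fps_nth A k = fps_nth (?c r * A) k" for r A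
  by (simp add: scaleR_conv_of_real)
 have t1: "((- (1 - (x$i)\<^sup>2) - (x$i)\<^sup>2) *\<^sub>R fps_nth G k - (2 * x$i * (1 - (x$i)\<^sup>2)) *\<^sub>R fps_nth (D i) k + ((1 - (x$i)\<^sup>2)\<^sup>2) *\<^sub>R fps_nth (E i) k)
  + ((2 * (x$i)\<^sup>2) *\<^sub>R fps_nth G k - (2 * x$i * (1 - (x$i)\<^sup>2)) *\<^sub>R fps_nth (D i) k) = fps_nth (T1 i * G) k" for i
 proof -
  have a: "?c (- (1 - (x$i)\<^sup>2) - (x$i)\<^sup>2) = - 1" by simp
  have b: "?c (2 * x$i * (1 - (x$i)\<^sup>2)) * D i = 2 * (1 - u i) * (u i * ?X * Z i) * G"
  proof -
  have "?c (2 * x$i * (1 - (x$i)\<^sup>2)) = 2 * (1 - u i) * ?c (x $ i)"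
   unfolding cu by (simp flip: fps_const_mult fps_const_sub fps_numeral_fps_const fps_const_1_eq_1 add: mult_ac)
  then show ?thesis using yD[of i] by (simp add: mult.assoc)
  qed
  have c: "?c ((1 - (x$i)\<^sup>2)\<^sup>2) = (1 - u i)\<^sup>2"
  unfolding cu by (simp add: fps_const_power[symmetric] del: fps_const_power flip: fps_const_sub)
  have d: "?c (2 * (x$i)\<^sup>2) = 2 * u i"
  unfolding cu by (simp flip: fps_const_mult fps_numeral_fps_const)
  show ?thesis unfolding sc a b c d T1_def E_def
  by (simp only: fps_add_nth[symmetric] fps_sub_nth[symmetric]) (rule arg_cong[of _ _ "%A. fps_nth A k"], simp add: algebra_simps)
 qed
 have t2: "- fps_nth G k - (x$i) *\<^sub>R fps_nth (D i) k + (1 / x$i) *\<^sub>R fps_nth (D i) k = fps_nth (T2 i * G) k" for i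
  unfolding sc yD iD T2_def by (simp only: fps_add_nth[symmetric] fps_sub_nth[symmetric] fps_neg_nth[symmetric])
  (rule arg_cong[of _ _ "%A. fps_nth A k"], simp add: algebra_simps)
 have t3: "- fps_nth G k + ((1 - (x$i)\<^sup>2) * (1 - (x$j)\<^sup>2) / ((x$i)\<^sup>2 - (x$j)\<^sup>2)) *\<^sub>R ((x$i) *\<^sub>R fps_nth (D i) k - (x$j) *\<^sub>R fps_nth (D j) k) = fps_nth (T3 i j * G) k" for i j
 proof -
  have e: "(x$i) *\<^sub>R fps_nth (D i) k - (x$j) *\<^sub>R fps_nth (D j) k = fps_nth ((u i * ?X * Z i - u j * ?X * Z j) * G) k"
  unfolding sc yD by (simp only: fps_sub_nth[symmetric] left_diff_distrib)
  show ?thesis unfolding T3_def cc_def e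
  by (simp only: sc fps_add_nth[symmetric] fps_neg_nth[symmetric]) (rule arg_cong[of _ _ "%A. fps_nth A k"], simp add: algebra_simps)
 qed
 have "four_L1_expr n m x (fps_nth G k) (%i. fps_nth (D i) k) (%i. fps_nth (E i) k)
  = (\<Oplus>i. fps_nth (T1 i * G) k) + (real n - real m) *\<^sub>R (\<Oplus>i. fps_nth (T2 i * G) k) + 2 *\<^sub>R (\<Sum>(i,j)\<in>{(i,j). j < i}. fps_nth (T3 i j * G) k)"
  unfolding four_L1_expr_def t2 t3 t1[symmetric] sum.distrib by simp
 also have "... = fps_nth L k"
 proof -
  have "(\<Sum>(i,j)\<in>{(i,j). j < i}. fps_nth (T3 i j * G) k) = fps_nth ((\<Sum>(i,j)\<in>{(i,j). j < i}. T3 i j) * G) k"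
  by (simp add: sum_distrib_right fps_sum_nth case_prod_unfold)
  moreover have "(\<Oplus>i. fps_nth (T i * G) k) = fps_nth ((\<Oplus>i. T i) * G) k" for T :: "'m => complex fps"
  by (simp add: sum_distrib_right fps_sum_nth)
  ultimately show ?thesis unfolding L_def
  by (simp add: distrib_right mult.assoc scaleR_conv_of_real flip: fps_numeral_fps_const)
 qed
 finally show ?thesis .
 qed
 have XT1: "?X * T1 i = (1 - ?X) - 2 * (1 - ?X) * (2 - ?X) * Z i + 3 * (1 - ?X)\<^sup>2 * (Z i)\<^sup>2" for i
 unfolding T1_def by (rule operator_single_term[OF uXZ])
 have XT2: "?X * T2 i = - (?X * (1 - ?X) * Z i)" for i
 proof -
 have "?X * T2 i = - ?X - ?X * (u i * ?X * Z i) + ?X * (?X * Z i)" unfolding T2_def by (simp add: algebra_simps)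
 then show ?thesis unfolding uXZ by (simp add: algebra_simps)
 qed
 have XT3: "?X * T3 i j = (1 - ?X) - (1 - ?X) * (Z i + Z j) + (1 - ?X)\<^sup>2 * (Z i * Z j)" if "j < i" for i j
 unfolding T3_def
 proof (rule operator_pair_term[OF uXZ uXZ])
 have "(x $ i)\<^sup>2 - (x $ j)\<^sup>2 ~= 0" using xd[of i j] that by simp
 then have "(1 - (x$i)\<^sup>2) * (1 - (x$j)\<^sup>2) / ((x$i)\<^sup>2 - (x$j)\<^sup>2) * ((x$i)\<^sup>2 - (x$j)\<^sup>2) = (1 - (x$i)\<^sup>2) * (1 - (x$j)\<^sup>2)" by simp
 from arg_cong[OF this, of ?c] show "cc i j * (u i - u j) = (1 - u i) * (1 - u j)"
  unfolding cc_def cu by (simp only: of_real_mult of_real_diff of_real_1 fps_const_mult[symmetric] fps_const_sub[symmetric] fps_const_1_eq_1)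
 qed
 \<comment> \<open>Twice the sum over pairs j < i is the full double sum less its diagonal; this
   produces s^2 and s2.\<close>
 have pairs: "2 * (\<Sum>(i,j)\<in>{(i,j). j < i}. ?X * T3 i j) = of_nat m * of_nat m * (1 - ?X) - 2 * of_nat m * (1 - ?X) * s + (1 - ?X)\<^sup>2 * s\<^sup>2
  - (of_nat m * (1 - ?X) - 2 * (1 - ?X) * s + (1 - ?X)\<^sup>2 * s2)"
 proof -
 define f where "f i j = (1 - ?X) - (1 - ?X) * (Z i + Z j) + (1 - ?X)\<^sup>2 * (Z i * Z j)" for i j
 have h: "(\<Sum>(i,j)\<in>{(i,j). j < i}. ?X * T3 i j) = (\<Sum>(i,j)\<in>{(i,j). j < i}. f i j)"
  by (intro sum.cong refl) (auto simp: XT3 f_def)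
 have fs: "f i j = f j i" for i j by (simp add: f_def add.commute mult.commute)
 have "2 * (\<Sum>(i,j)\<in>{(i,j). j < i}. ?X * T3 i j) = (\<Oplus>i. \<Oplus>j. f i j) - (\<Oplus>i. f i i)"
  unfolding h mult_2 by (rule sum_ordered_pairs[OF fs])
 also have "(\<Oplus>i. \<Oplus>j. f i j) = of_nat m * of_nat m * (1 - ?X) - 2 * of_nat m * (1 - ?X) * s + (1 - ?X)\<^sup>2 * s\<^sup>2"
 proof -
  have in1: "(\<Oplus>j. f i j) = of_nat m * (1 - ?X) - (1 - ?X) * (of_nat m * Z i + s) + (1 - ?X)\<^sup>2 * (Z i * s)" for i
  unfolding f_def by (simp add: sum.distrib sum_subtractf s_def m_def flip: sum_distrib_left)
  show ?thesis unfolding in1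
  by (simp only: sum.distrib sum_subtractf sum_distrib_left[symmetric] sum_distrib_right[symmetric] sum_constant s_def[symmetric])
   (simp add: m_def[symmetric] algebra_simps power2_eq_square)
 qed
 also have "(\<Oplus>i. f i i) = of_nat m * (1 - ?X) - 2 * (1 - ?X) * s + (1 - ?X)\<^sup>2 * s2"
  unfolding f_def by (simp only: sum.distrib sum_subtractf sum_distrib_left[symmetric] sum_constant power2_eq_square[symmetric] s_def[symmetric] s2_def[symmetric])
  (simp add: m_def[symmetric] algebra_simps)
 finally show ?thesis .
 qed
 have \<theta>G: "?X * fps_deriv G = fps_const (1/2) * (s - of_nat m) * G"
 proof -
 have "?X * fps_deriv (\<Prod>i\<in>I. bfps (y i)) = fps_const (1/2) * (\<Sum>i\<in>I. Z i - 1) * (\<Prod>i\<in>I. bfps (y i))" if "finite I" for I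
  using that
 proof (induction I rule: finite_induct)
  case (insert i I)
  have "?X * fps_deriv (bfps (y i) * (\<Prod>i\<in>I. bfps (y i))) = bfps (y i) * (?X * fps_deriv (\<Prod>i\<in>I. bfps (y i))) + (?X * fps_deriv (bfps (y i))) * (\<Prod>i\<in>I. bfps (y i))"
  by (simp add: algebra_simps)
  also have "... = fps_const (1/2) * ((Z i - 1) + (\<Sum>i\<in>I. Z i - 1)) * (bfps (y i) * (\<Prod>i\<in>I. bfps (y i)))"
  unfolding insert.IH X_deriv_bfps Z_def[symmetric] by (simp add: algebra_simps)
  finally show ?case using insert.hyps by simp
 qed simp
 from this[of UNIV] show ?thesis unfolding G_def qfps_squares by (simp add: sum_subtractf s_def m_def)
 qed
 have \<theta>s: "?X * fps_deriv s = s2 - s"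
 unfolding s_def s2_def fps_deriv_sum by (simp add: sum_distrib_left Z_def X_deriv_zfps sum_subtractf)
 have \<theta>\<theta>G: "?X * fps_deriv (?X * fps_deriv G) = (fps_const (1/4) * (s - of_nat m)\<^sup>2 + fps_const (1/2) * (s2 - s)) * G"
 proof -
 have "?X * fps_deriv (?X * fps_deriv G) = fps_const (1/2) * ((?X * fps_deriv s) * G + (s - of_nat m) * (?X * fps_deriv G))"
 proof -
  have dm: "fps_deriv (of_nat m :: complex fps) = 0" by (simp add: fps_of_nat[symmetric])
  have "fps_deriv (fps_const (1/2) * (s - of_nat m) * G) = fps_const (1/2) * (fps_deriv s * G + (s - of_nat m) * fps_deriv G)"
  by (simp add: dm algebra_simps)
  then show ?thesis by (subst \<theta>G) (simp only: distrib_left mult.left_commute mult.assoc)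
 qed
 also have "... = fps_const (1/2) * ((s2 - s) * G + (s - of_nat m) * (fps_const (1/2) * (s - of_nat m) * G))"
  unfolding \<theta>s \<theta>G ..
 also have "... = (fps_const (1/2) * fps_const (1/2) * (s - of_nat m)\<^sup>2 + fps_const (1/2) * (s2 - s)) * G"
  by (simp add: algebra_simps power2_eq_square del: fps_const_mult)
 finally show ?thesis by simp
 qed
 define R where "R = (1 - ?X) * (?X * fps_deriv (?X * fps_deriv G)
  - ?X * (?X * fps_deriv (?X * fps_deriv G) + fps_const (of_nat (n + m) / 2) * (?X * fps_deriv G) + fps_const (of_nat (n * m) / 4) * G))"
 \<comment> \<open>Both sides are G times a polynomial in X, s and s2; up to constants, the Euler
   operator and its square supply s - m and (s - m)^2 + 2 (s2 - s).\<close>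
 have main: "?X * L = 4 * R"
 proof -
 have "?X * L = ((\<Oplus>i. ?X * T1 i) + ?c (real n - real m) * (\<Oplus>i. ?X * T2 i) + 2 * (\<Sum>(i,j)\<in>{(i,j). j < i}. ?X * T3 i j)) * G"
  unfolding L_def by (simp add: sum_distrib_left[symmetric] case_prod_unfold) (simp add: algebra_simps)
 also have "(\<Oplus>i. ?X * T1 i) = of_nat m * (1 - ?X) - 2 * (1 - ?X) * (2 - ?X) * s + 3 * (1 - ?X)\<^sup>2 * s2"
  unfolding XT1 by (simp add: sum.distrib sum_subtractf s_def s2_def m_def sum_distrib_left)
 also have "(\<Oplus>i. ?X * T2 i) = - (?X * (1 - ?X) * s)"
  unfolding XT2 by (simp add: sum_negf s_def sum_distrib_left)
 also have "?c (real n - real m) = of_nat n - of_nat m" by (simp add: fps_of_nat flip: fps_const_sub)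
 finally have XL: "?X * L = (of_nat m * (1 - ?X) - 2 * (1 - ?X) * (2 - ?X) * s + 3 * (1 - ?X)\<^sup>2 * s2
  + (of_nat n - of_nat m) * - (?X * (1 - ?X) * s)
  + (of_nat m * of_nat m * (1 - ?X) - 2 * of_nat m * (1 - ?X) * s + (1 - ?X)\<^sup>2 * s\<^sup>2
  - (of_nat m * (1 - ?X) - 2 * (1 - ?X) * s + (1 - ?X)\<^sup>2 * s2))) * G"
  unfolding pairs .
 have c4: "4 * fps_const (1/4 :: complex) = 1" "4 * fps_const (1/2 :: complex) = 2"
  by (simp_all flip: fps_numeral_fps_const)
 have cn: "4 * fps_const (of_nat (n + m) / 2 :: complex) * fps_const (1/2) = of_nat n + of_nat m" "4 * fps_const (of_nat (n * m) / 4 :: complex) = of_nat n * of_nat m"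
 proof -
  have 4: "(4 :: complex fps) = fps_const 4" by (rule numeral_fps_const)
  show "4 * fps_const (of_nat (n + m) / 2 :: complex) * fps_const (1/2) = of_nat n + of_nat m" "4 * fps_const (of_nat (n * m) / 4 :: complex) = of_nat n * of_nat m"
  unfolding 4 fps_of_nat[symmetric] by simp_all
 qed
 have gen: "4 * ((1 - X) * ((\<alpha> * A + \<beta> * B) * G - X * ((\<alpha> * A + \<beta> * B) * G + \<gamma> * (\<beta> * C * G) + \<delta> * G)))
  = (1 - X) * ((1 - X) * ((4 * \<alpha>) * A + (4 * \<beta>) * B) - X * ((4 * \<gamma> * \<beta>) * C + 4 * \<delta>)) * G"
  for X A B C G \<alpha> \<beta> \<gamma> \<delta> :: "complex fps" by (simp add: algebra_simps)
 have "4 * R = (1 - ?X) * ((1 - ?X) * ((4 * fps_const (1/4)) * (s - of_nat m)\<^sup>2 + (4 * fps_const (1/2)) * (s2 - s))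
  - ?X * ((4 * fps_const (of_nat (n + m) / 2) * fps_const (1/2)) * (s - of_nat m) + 4 * fps_const (of_nat (n * m) / 4))) * G"
  unfolding R_def \<theta>\<theta>G unfolding \<theta>G by (rule gen)
 also have "... = (1 - ?X) * ((1 - ?X) * ((s - of_nat m)\<^sup>2 + 2 * (s2 - s)) - ?X * ((of_nat n + of_nat m) * (s - of_nat m) + of_nat n * of_nat m)) * G"
  unfolding c4 cn by simp
 also have "... = ?X * L" unfolding XL by (simp add: algebra_simps power2_eq_square)
 finally show ?thesis ..
 qed
 have "fps_nth L k = fps_nth (?X * L) (Suc k)" by simp
 also have "... = 4 * fps_nth R (Suc k)" unfolding main by (simp flip: fps_numeral_fps_const)
 also have "fps_nth R (Suc k) = of_nat (Suc k) ^ 2 * fps_nth G (Suc k) - of_real (Ak n m k + real k ^ 2) * fps_nth G k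
  + (if k = 0 then 0 else of_real (Ak n m (k - 1)) * fps_nth G (k - 1))"
 proof -
 have t: "fps_nth (?X * fps_deriv A) l = of_nat l * fps_nth A l" for A l by (cases l) auto
 have tt: "fps_nth (?X * fps_deriv (?X * fps_deriv G)) l = of_nat l ^ 2 * fps_nth G l" for l
  unfolding t by (simp add: power2_eq_square mult.assoc)
 define C where "C = ?X * fps_deriv (?X * fps_deriv G) + fps_const (of_nat (n + m) / 2) * (?X * fps_deriv G) + fps_const (of_nat (n * m) / 4) * G"
 have C: "fps_nth C l = of_real (Ak n m l) * fps_nth G l" for l
  unfolding C_def fps_add_nth tt fps_mult_left_const_nth t by (simp add: Ak_def algebra_simps power2_eq_square)
 have "R = (?X * fps_deriv (?X * fps_deriv G) - ?X * C) - ?X * (?X * fps_deriv (?X * fps_deriv G) - ?X * C)"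
  unfolding R_def C_def[symmetric] by (simp add: algebra_simps)
 then have "fps_nth R (Suc k) = (fps_nth (?X * fps_deriv (?X * fps_deriv G)) (Suc k) - fps_nth C k) - (fps_nth (?X * fps_deriv (?X * fps_deriv G)) k - fps_nth (?X * C) k)"
  by simp
 also have "fps_nth (?X * C) k = (if k = 0 then 0 else fps_nth C (k - 1))" by simp
 finally show ?thesis unfolding tt C by (simp add: algebra_simps)
 qed
 finally have "fps_nth L k = 4 * (of_nat (Suc k) ^ 2 * fps_nth G (Suc k) - of_real (Ak n m k + real k ^ 2) * fps_nth G k
  + (if k = 0 then 0 else of_real (Ak n m (k - 1)) * fps_nth G (k - 1)))" .
 then show ?thesis using nth[of k] unfolding qD[abs_def] qE[abs_def] qpoly_def G_def m_def qD qE by simp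
qed

section \<open>Diagonal matrices, and bounds for the forms and the kernel\<close>

lemma pos_less: "i < j ==> pos i < pos (j :: 'i::{finite,linorder})"
 unfolding pos_def by (rule psubset_card_mono) auto

lemma pos_eq_iff: "pos i = pos j \<longleftrightarrow> i = (j :: 'i::{finite,linorder})"
 using pos_less[of i j] pos_less[of j i] by (metis less_irrefl linorder_cases)

lemma pos_range: "range (pos :: 'i => nat) = {..<CARD('i::{finite,linorder})}"
proof (rule card_subset_eq)
 have "pos i < CARD('i)" for i :: 'i unfolding pos_def by (rule psubset_card_mono) auto
 then show "range (pos :: 'i => nat) \<subseteq> {..<CARD('i)}" by auto
 show "card (range (pos :: 'i => nat)) = card {..<CARD('i)}"
 by (simp add: card_image inj_on_def pos_eq_iff)
qed simp

lemma pos_row: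
 fixes s :: "'m::{finite,linorder}"
 assumes "CARD('m) <= CARD('n::{finite,linorder})"
 obtains r :: "'n::{finite,linorder}" where "pos r = pos s"
proof -
 have "pos s \<in> range (pos :: 'm => nat)" by simp
 then have "pos s \<in> range (pos :: 'n => nat)" using assms unfolding pos_range by simp
 then show ?thesis using that by auto
qed

type_synonym ('m, 'n) cmatrix = "((complex, 'm) vec, 'n) vec"

definition cdiag :: "('m::{finite,linorder} => complex) => ('m, 'n::{finite,linorder}) cmatrix" where
 "cdiag z = (\<chi> r s. if pos r = pos s then z s else 0)"

lemma diag_mat_cdiag: "diag_mat x = cdiag (%s. of_real (x $ s))"
 by (simp add: diag_mat_def cdiag_def)

lemma sum_row:
 fixes F :: "'m::{finite,linorder} => 'a::comm_monoid_add"
 assumes "pos (r :: 'n::{finite,linorder}) = pos s" shows "(\<Oplus>j. if pos r = pos j then F j else 0) = F s"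
proof -
 have "(\<Oplus>j. if pos r = pos j then F j else 0) = (\<Oplus>j. if j = s then F j else 0)"
 unfolding assms pos_eq_iff by (intro sum.cong refl) auto
 then show ?thesis by simp
qed

lemma sum_row_image:
 fixes F :: "'m::{finite,linorder} => 'a::comm_monoid_add" and r :: "'n::{finite,linorder}"
 assumes "h 0 = 0" shows "h (\<Oplus>j. if pos r = pos j then F j else 0) = (\<Oplus>j. if pos r = pos j then h (F j) else 0)"
proof (cases "\<exists>s::'m. pos r = pos s")
 case True
 then obtain s :: 'm where s: "pos r = pos s" by blast
 show ?thesis unfolding sum_row[OF s] ..
next
 case False
 then have "(\<Oplus>j. if pos r = pos j then F j else 0) = 0" "(\<Oplus>j. if pos r = pos j then h (F j) else 0) = 0"
 by (auto intro!: sum.neutral)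
 then show ?thesis using assms by (simp only:)
qed

lemma sum_rows:
 fixes F :: "'m::{finite,linorder} => 'a::comm_monoid_add"
 assumes mn: "CARD('m) <= CARD('n::{finite,linorder})"
 shows "(\<Sum>i\<in>(UNIV::'n set). \<Oplus>j. if pos i = pos j then F j else 0) = (\<Oplus>j. F j)"
proof -
 have "(\<Sum>i\<in>(UNIV::'n set). if pos i = pos j then F j else 0) = F j" for j
 proof -
 obtain r :: 'n where r: "pos r = pos j" using pos_row[OF mn] by blast
 have "(\<Sum>i\<in>(UNIV::'n set). if pos i = pos j then F j else 0) = (\<Oplus>i. if i = r then F j else 0)"
  by (intro sum.cong refl) (simp add: pos_eq_iff flip: r)
 then show ?thesis by simp
 qed
 then show ?thesis by (subst sum.swap) simp
qed

lemma cdiag_domD: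
 fixes z :: "'m::{finite,linorder} => complex"
 assumes mn: "CARD('m) <= CARD('n::{finite,linorder})"
 shows "(cdiag z :: ('m, 'n) cmatrix) \<in> domD \<longleftrightarrow> (\<forall>s. cmod (z s) < 1)"
proof
 assume d: "(cdiag z :: ('m, 'n) cmatrix) \<in> domD"
 show "\<forall>s. cmod (z s) < 1"
 proof
 fix s :: 'm
 obtain r :: 'n where r: "pos r = pos s" using pos_row[OF mn] by blast
 have "(axis r 1 :: (complex, 'n) vec) ~= 0" by (simp add: axis_eq_0_iff)
 then have *: "(\<Oplus>s'. (cmod (\<Oplus>i. cnj ((cdiag z :: ('m, 'n) cmatrix) $ i $ s') * (axis r 1 :: (complex, 'n) vec) $ i))\<^sup>2)
  < (\<Oplus>i. (cmod ((axis r 1 :: (complex, 'n) vec) $ i))\<^sup>2)" using d unfolding domD_iff by blast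
 have 1: "(\<Oplus>i. cnj ((cdiag z :: ('m, 'n) cmatrix) $ i $ s') * (axis r 1 :: (complex, 'n) vec) $ i) = (if s' = s then cnj (z s) else 0)" for s'
 proof -
  have "(\<Oplus>i. cnj ((cdiag z :: ('m, 'n) cmatrix) $ i $ s') * (axis r 1 :: (complex, 'n) vec) $ i) = (\<Oplus>i. if i = r then (if s' = s then cnj (z s) else 0) else 0)"
  by (intro sum.cong refl) (auto simp: axis_def cdiag_def r pos_eq_iff)
  then show ?thesis by simp
 qed
 have 2: "(\<Oplus>i. (cmod ((axis r 1 :: (complex, 'n) vec) $ i))\<^sup>2) = 1"
  by (simp add: axis_def if_distrib[of "%x. (cmod x)\<^sup>2"] cong: if_cong)
 have "(\<Oplus>s'. (cmod (if s' = s then cnj (z s) else 0))\<^sup>2) = (cmod (z s))\<^sup>2"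
  by (simp add: if_distrib[of "%x. (cmod x)\<^sup>2"] cong: if_cong)
 with * have "(cmod (z s))\<^sup>2 < 1" unfolding 1 2 by simp
 then show "cmod (z s) < 1" by (simp add: power_less_one_iff)
 qed
next
 assume z: "\<forall>s. cmod (z s) < 1"
 define M where "M = Max (range (%s. (cmod (z s))\<^sup>2))"
 have M: "(cmod (z s))\<^sup>2 <= M" for s unfolding M_def by (rule Max_ge) auto
 have M1: "M < 1" "0 <= M"
 proof -
 have "M \<in> range (%s. (cmod (z s))\<^sup>2)" unfolding M_def by (rule Max_in) auto
 then show "M < 1" "0 <= M" using z by (auto simp: power_less_one_iff)
 qed
 show "(cdiag z :: ('m, 'n) cmatrix) \<in> domD" unfolding domD_iff
 proof (intro allI impI)
 fix v :: "(complex, 'n) vec" assume v: "v ~= 0"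
 have e: "(cmod (\<Oplus>i. cnj ((cdiag z :: ('m, 'n) cmatrix) $ i $ s) * v $ i))\<^sup>2 <= M * (\<Oplus>i. if pos i = pos s then (cmod (v $ i))\<^sup>2 else 0)" for s
 proof -
  obtain r :: 'n where r: "pos r = pos s" using pos_row[OF mn] by blast
  have "(\<Oplus>i. cnj ((cdiag z :: ('m, 'n) cmatrix) $ i $ s) * v $ i) = (\<Oplus>i. if i = r then cnj (z s) * v $ r else 0)"
  by (intro sum.cong refl) (auto simp: cdiag_def pos_eq_iff simp flip: r)
  moreover have "(\<Oplus>i. if pos i = pos s then (cmod (v $ i))\<^sup>2 else 0) = (\<Oplus>i. if i = r then (cmod (v $ r))\<^sup>2 else 0)"
  by (intro sum.cong refl) (auto simp: pos_eq_iff simp flip: r)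
  ultimately show ?thesis using M[of s] by (simp add: norm_mult power_mult_distrib mult_right_mono)
 qed
 have "(\<Oplus>s. (cmod (\<Oplus>i. cnj ((cdiag z :: ('m, 'n) cmatrix) $ i $ s) * v $ i))\<^sup>2)
  <= M * (\<Sum>s\<in>(UNIV::'m set). \<Oplus>i. if pos i = pos s then (cmod (v $ i))\<^sup>2 else 0)"
  unfolding sum_distrib_left[of M] using e by (intro sum_mono) (simp add: sum_distrib_left)
 also have "... = M * (\<Oplus>i. \<Sum>s\<in>(UNIV::'m set). if pos i = pos s then (cmod (v $ i))\<^sup>2 else 0)"
  by (subst sum.swap) simp
 also have "... <= M * (\<Oplus>i. (cmod (v $ i))\<^sup>2)"
 proof (intro mult_left_mono sum_mono M1)
  fix i
  show "(\<Sum>s\<in>(UNIV::'m set). if pos i = pos s then (cmod (v $ i))\<^sup>2 else 0) <= (cmod (v $ i))\<^sup>2"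
  proof (cases "\<exists>s::'m. pos i = pos s")
  case True
  then obtain s :: 'm where s: "pos i = pos s" by blast
  show ?thesis using sum_row[OF s, of "%_. (cmod (v $ i))\<^sup>2"] by simp
  qed simp
 qed
 also have "... < (\<Oplus>i. (cmod (v $ i))\<^sup>2)" using sum_cmod_pos[OF v] M1 by simp
 finally show "(\<Oplus>s. (cmod (\<Oplus>i. cnj ((cdiag z :: ('m, 'n) cmatrix) $ i $ s) * v $ i))\<^sup>2) < (\<Oplus>i. (cmod (v $ i))\<^sup>2)" .
 qed
qed

lemma diag_mat_domD:
 fixes x :: "real^'m::{finite,linorder}"
 assumes mn: "CARD('m) <= CARD('n::{finite,linorder})"
 shows "(diag_mat x :: ('m, 'n) cmatrix) \<in> domD \<longleftrightarrow> (\<forall>s. \<bar>x $ s\<bar> < 1)"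
 unfolding diag_mat_cdiag cdiag_domD[OF mn] by simp

lemma pk_cdiag:
 fixes z :: "'m::{finite,linorder} => complex"
 assumes mn: "CARD('m) <= CARD('n::{finite,linorder})" and z: "!!s. cmod (z s) < 1"
 shows "pk k (cdiag z :: ('m, 'n) cmatrix) = qpoly k (%j. (z j)\<^sup>2)"
proof -
 have "pform k (cdiag z :: ('m, 'n) cmatrix) = qpoly k (%j. (z j)\<^sup>2)"
 proof (rule pform_of_columns)
 fix r :: "'m => nat"
 have "(\<Oplus>j. (cdiag z :: ('m, 'n) cmatrix) $ i $ j * of_nat (r j))\<^sup>2 = (\<Oplus>j. if pos i = pos j then (z j * of_nat (r j))\<^sup>2 else 0)" for i
  using sum_row_image[of "%x. x\<^sup>2" i "%j. z j * of_nat (r j)"] by (simp add: cdiag_def if_distrib[of "%x. x * _"] cong: if_cong)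
 then show "(\<Oplus>i. (\<Oplus>j. (cdiag z :: ('m, 'n) cmatrix) $ i $ j * of_nat (r j))\<^sup>2) = (\<Oplus>j. (z j)\<^sup>2 * of_nat (r j) ^ 2)"
  using sum_rows[OF mn, of "%j. (z j * of_nat (r j))\<^sup>2"] by (simp add: power_mult_distrib)
 qed
 then show ?thesis using cdiag_domD[OF mn, of z] z by (simp add: pk_def)
qed

text \<open>For a diagonal Z the matrix 1 - Z Z^H is diagonal with entries at least 1 - \<rho>^2.
  The bound is uniform on a polydisc, which later turns convergence in H into uniform
  convergence.\<close>

lemma ker1_cdiag_bound:
 fixes z :: "'m::{finite,linorder} => complex"
 assumes z: "!!s. cmod (z s) <= \<rho>" and \<rho>: "0 <= \<rho>" "\<rho> < 1"
 shows "Re (ker1 (cdiag z :: ('m, 'n::{finite,linorder}) cmatrix) (cdiag z)) <= (1 / (1 - \<rho>\<^sup>2)) ^ CARD('n)"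
proof -
 define Z where "Z = (cdiag z :: ('m, 'n) cmatrix)"
 define A where "A = mat 1 - Z ** conj_transpose Z"
 have ent: "(Z ** conj_transpose Z) $ i $ j = (\<Oplus>s. if pos i = pos s then (if pos j = pos s then z s * cnj (z s) else 0) else 0)" for i j
 by (simp add: Z_def matrix_matrix_mult_def conj_transpose_def cdiag_def) (rule sum.cong, auto)
 have off: "A $ i $ j = 0" if "i ~= j" for i j
 proof -
 have "(Z ** conj_transpose Z) $ i $ j = 0" unfolding ent using that by (intro sum.neutral) (metis pos_eq_iff)
 then show ?thesis using that by (simp add: A_def mat_def)
 qed
 have \<rho>2: "\<rho>\<^sup>2 < 1" using \<rho> by (simp add: power_less_one_iff)
 have dia: "\<exists>d. A $ i $ i = of_real d \<and> 1 - \<rho>\<^sup>2 <= d" for i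
 proof -
 have "\<exists>e. (Z ** conj_transpose Z) $ i $ i = of_real e \<and> e <= \<rho>\<^sup>2"
 proof (cases "\<exists>s::'m. pos i = pos s")
  case True
  then obtain s :: 'm where s: "pos i = pos s" by blast
  have "(Z ** conj_transpose Z) $ i $ i = of_real ((cmod (z s))\<^sup>2)"
  unfolding ent complex_norm_square sum_row[OF s] using s by simp
  moreover have "(cmod (z s))\<^sup>2 <= \<rho>\<^sup>2" using z by (intro power_mono) auto
  ultimately show ?thesis by blast
 next
  case False
  then have "(Z ** conj_transpose Z) $ i $ i = of_real 0" unfolding ent by simp
  then show ?thesis using zero_le_power2[of \<rho>] by blast
 qed
 then obtain e where "(Z ** conj_transpose Z) $ i $ i = of_real e" "e <= \<rho>\<^sup>2" by blast
 then show ?thesis by (intro exI[of _ "1 - e"]) (simp add: A_def mat_def)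
 qed
 then obtain d where d: "!!i. A $ i $ i = of_real (d i)" "!!i. 1 - \<rho>\<^sup>2 <= d i" by metis
 have "det A = of_real (\<Prod>i\<in>UNIV. d i)" using det_diagonal[of A, OF off] by (simp add: d)
 then have "Re (ker1 Z Z) = 1 / (\<Prod>i\<in>UNIV. d i)"
 unfolding ker1_def A_def[symmetric] by (simp add: divide_inverse del: of_real_prod flip: of_real_inverse)
 also have "... = (\<Prod>i\<in>UNIV. 1 / d i)" by (simp add: prod_dividef)
 also have "... <= (\<Prod>i\<in>(UNIV::'n set). 1 / (1 - \<rho>\<^sup>2))"
 proof (intro prod_mono conjI)
 fix i
 have "0 < d i" using d(2)[of i] \<rho>2 by linarith
 then show "0 <= 1 / d i" "1 / d i <= 1 / (1 - \<rho>\<^sup>2)" using d(2)[of i] \<rho>2 by (auto intro: frac_le)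
 qed
 finally show ?thesis by (simp add: Z_def)
qed

text \<open>With the other variables frozen, \<open>qpoly k\<close> is a polynomial in t whose
  coefficients come from the product P over the other indices; \<open>bfps1\<close> and
  \<open>bfps2\<close> differentiate it term by term.\<close>

lemma qpoly_update:
 fixes y :: "'i::finite => complex"
 shows "((%t. qpoly k (%j. ((y(i := t)) j)\<^sup>2)) has_field_derivative qD k (y(i := t)) i) (at t)"
 and "((%t. qD k (y(i := t)) i) has_field_derivative qE k (y(i := t)) i) (at t)"
proof -
 define P where "P = (\<Prod>j\<in>UNIV - {i}. bfps (y j))"
 have P: "(\<Prod>j\<in>UNIV - {i}. bfps ((y(i := t)) j)) = P" for t unfolding P_def by (intro prod.cong) auto
 have q: "qpoly k (%j. ((y(i := t)) j)\<^sup>2) = (\<Sum>l\<le>k. of_real (hb l) * t ^ (2 * l) * fps_nth P (k - l))" for t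
 proof -
 have e: "(\<Prod>j\<in>UNIV. bfps ((y(i := t)) j)) = bfps ((y(i := t)) i) * P" unfolding P[of t, symmetric] by (rule prod.remove) auto
 show ?thesis unfolding qpoly_def qfps_squares e fun_upd_same by (simp add: fps_mult_nth bfps_def atMost_atLeast0)
 qed
 have D: "qD k (y(i := t)) i = (\<Sum>l\<le>k. of_real (hb l) * (of_nat (2 * l) * t ^ (2 * l - 1)) * fps_nth P (k - l))" for t
 unfolding qD_def P by (simp add: fps_mult_nth bfps1_def atMost_atLeast0)
 have E: "qE k (y(i := t)) i = (\<Sum>l\<le>k. of_real (hb l) * (of_nat (2 * l) * (of_nat (2 * l - 1) * t ^ (2 * l - 1 - 1))) * fps_nth P (k - l))" for t
 unfolding qE_def P by (simp add: fps_mult_nth bfps2_def atMost_atLeast0)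
 have pw: "((%t. t ^ n) has_field_derivative of_nat n * t ^ (n - 1)) (at t)" for n and t :: complex
 using DERIV_power[OF DERIV_ident, of n t UNIV] by (simp add: mult.commute)
 show "((%t. qpoly k (%j. ((y(i := t)) j)\<^sup>2)) has_field_derivative qD k (y(i := t)) i) (at t)"
 unfolding q D by (intro DERIV_sum DERIV_cmult_right DERIV_cmult pw)
 show "((%t. qD k (y(i := t)) i) has_field_derivative qE k (y(i := t)) i) (at t)"
 unfolding D E by (intro DERIV_sum DERIV_cmult_right DERIV_cmult pw)
qed

lemma hb_le_1: "hb k <= 1" and hb_ge: "1 / (2 * real k + 1) <= hb k"
proof (induction k)
 case (Suc k)
 have s: "hb (Suc k) = hb k * ((real k + 1/2) / real (Suc k))" using hb_Suc[of k] by (simp add: field_simps)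
 { case 1
 show ?case unfolding s using Suc.IH hb_pos[of k] by (intro mult_le_one) (auto simp: divide_le_eq less_imp_le) }
 { case 2
 have e: "real k + 1/2 = (2 * real k + 1) / 2" by simp
 have "1 / (2 * real (Suc k) + 1) <= 1 / (2 * real (Suc k))" by (intro frac_le) auto
 also have "... = 1 / (2 * real k + 1) * ((real k + 1/2) / real (Suc k))" unfolding e by simp
 also have "... <= hb (Suc k)" unfolding s using Suc.IH by (intro mult_right_mono) auto
 finally show ?case . }
qed simp_all

lemma fps_prod_bound:
 fixes F :: "'i => complex fps"
 assumes "finite I" "r \<ge> 0" "!!i k. i \<in> I ==> cmod (fps_nth (F i) k) <= r ^ k"
 shows "cmod (fps_nth (\<Prod>i\<in>I. F i) k) <= (1 + real k) ^ card I * r ^ k"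
 using assms(1,3)
proof (induction I arbitrary: k rule: finite_induct)
 case (insert i I)
 have "cmod (fps_nth (\<Prod>i\<in>insert i I. F i) k) <= (\<Sum>l=0..k. cmod (fps_nth (F i) l * fps_nth (\<Prod>i\<in>I. F i) (k - l)))"
 using insert(1,2) by (simp add: fps_mult_nth norm_sum)
 also have "... <= (\<Sum>l=0..k. (1 + real k) ^ card I * r ^ k)"
 proof (rule sum_mono)
 fix l assume l: "l \<in> {0..k}"
 have "cmod (fps_nth (F i) l * fps_nth (\<Prod>i\<in>I. F i) (k - l)) <= r ^ l * ((1 + real (k - l)) ^ card I * r ^ (k - l))"
  unfolding norm_mult using insert assms(2) by (intro mult_mono) auto
 also have "... = (1 + real (k - l)) ^ card I * r ^ k" using l by (simp flip: power_add)
 also have "... <= (1 + real k) ^ card I * r ^ k" using assms(2) by (intro mult_right_mono power_mono) auto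
 finally show "cmod (fps_nth (F i) l * fps_nth (\<Prod>i\<in>I. F i) (k - l)) <= (1 + real k) ^ card I * r ^ k" .
 qed
 also have "... = (1 + real k) ^ card (insert i I) * r ^ k" using insert(1,2) by (simp add: distrib_right)
 finally show ?case .
qed (use assms(2) in \<open>auto simp: fps_one_nth\<close>)

lemma qpoly_bound:
 fixes y :: "'i::finite => complex"
 assumes "!!i. cmod (y i) <= r" "r \<ge> 0"
 shows "cmod (qpoly k y) <= (1 + real k) ^ CARD('i) * r ^ k"
 unfolding qpoly_def qfps_def
proof (rule fps_prod_bound)
 fix i k
 have "cmod (of_real (hb k) * y i ^ k) = hb k * cmod (y i) ^ k" using hb_pos[of k] by (simp add: norm_mult norm_power)
 also have "... <= 1 * r ^ k" using hb_le_1[of k] hb_pos[of k] assms(1)[of i] by (intro mult_mono power_mono) (auto simp: assms(2))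
 finally show "cmod (fps_nth (Abs_fps (%j. of_real (hb j) * y i ^ j)) k) <= r ^ k" by simp
qed (use assms in auto)

text \<open>All values of \<open>hb\<close> are positive, so every coefficient of the product is
  positive.\<close>

lemma qpoly_nonzero:
 fixes y :: "'i::finite => real"
 assumes "!!i. y i > 0" shows "qpoly k (%i. cr (y i)) ~= 0"
proof -
 have "\<exists>r>0. fps_nth (\<Prod>i\<in>I. Abs_fps (%j. of_real (hb j) * cr (y i) ^ j)) k = of_real r"
 if "finite I" "I ~= {}" for I k
 using that
 proof (induction I arbitrary: k rule: finite_ne_induct)
 case (singleton i)
 have "hb k * y i ^ k > 0" using assms hb_pos by simp
 then show ?case by (intro exI[of _ "hb k * y i ^ k"]) simp
 next
 case (insert i I)
 then obtain r where r: "!!k. r k > 0" "!!k. fps_nth (\<Prod>i\<in>I. Abs_fps (%j. of_real (hb j) * cr (y i) ^ j)) k = of_real (r k)" by metis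
 have "fps_nth (\<Prod>i\<in>insert i I. Abs_fps (%j. of_real (hb j) * cr (y i) ^ j)) k
  = of_real (\<Sum>l=0..k. hb l * y i ^ l * r (k - l))" using insert by (simp add: fps_mult_nth r)
 moreover have "(\<Sum>l=0..k. hb l * y i ^ l * r (k - l)) > 0" using assms hb_pos r by (intro sum_pos) auto
 ultimately show ?case by blast
 qed
 from this[of UNIV k] show ?thesis unfolding qpoly_def qfps_def by auto
qed

lemma poly_geometric_tendsto_0:
 assumes r: "0 <= r" "r < 1" shows "(%k. (1 + real k) ^ p * r ^ k) \<longlonglongrightarrow> 0"
proof (cases "r = 0")
 case True
 have "\<forall>\<^sub>F k in sequentially. (1 + real k) ^ p * r ^ k = 0" using eventually_gt_at_top[of 0] by eventually_elim (simp add: True)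
 then show ?thesis by (rule tendsto_eventually)
next
 case False
 define c where "c = - ln r / 2"
 have c: "c > 0" using r False by (simp add: c_def)
 obtain D where D: "D > 0" "!!x. (br x) ^ p <= D * exp (c * \<bar>x\<bar>)" using poly_le_exp[OF c] by auto
 have e: "exp (c * real k) * r ^ k = exp (- c) ^ k" for k
 proof -
 have "r = exp (- 2 * c)" using r False by (simp add: c_def)
 then have "exp (c * real k) * r ^ k = exp (c * real k + real k * (- 2 * c))" by (simp only: exp_of_nat_mult[symmetric] exp_add)
 also have "... = exp (real k * (- c))" by (simp add: algebra_simps)
 also have "... = exp (- c) ^ k" by (rule exp_of_nat_mult)
 finally show ?thesis .
 qed
 have b: "(1 + real k) ^ p * r ^ k <= D * exp (- c) ^ k" for k
 proof -
 have "(1 + real k) ^ p * r ^ k <= (D * exp (c * real k)) * r ^ k" using D(2)[of "real k"] r by (intro mult_right_mono) auto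
 then show ?thesis by (simp add: mult.assoc e)
 qed
 have l: "(%k. D * exp (- c) ^ k) \<longlonglongrightarrow> 0"
 using tendsto_mult_right[OF LIMSEQ_power_zero[of "exp (- c)"], of D] c by (simp add: mult.commute)
 show ?thesis
 proof (rule tendsto_sandwich[OF _ _ tendsto_const l])
 show "\<forall>\<^sub>F k in sequentially. (1 + real k) ^ p * r ^ k <= D * exp (- c) ^ k" using b by simp
 qed (use r in simp)
qed

text \<open>A power series that vanishes on an interval (0, 1] cannot have 0 as an isolated
  zero.\<close>

lemma power_series_zero:
 fixes c :: "nat => complex"
 assumes s: "!!t. 0 < t ==> t <= 1 ==> (%k. c k * of_real t ^ k) sums 0"
 shows "c k = 0"
proof -
 define F where "F x = (\<Sum>k. c k * x ^ k)" for x
 have sm: "(%k. c k * x ^ k) sums F x" if "cmod x < 1" for x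
 proof -
 have "summable (%k. c k * 1 ^ k)" using s[of 1] by (simp add: sums_iff)
 then have "summable (%k. c k * x ^ k)" by (rule powser_inside) (use that in simp)
 then show ?thesis by (simp add: F_def summable_sums)
 qed
 \<comment> \<open>The factor x gives the value 0 at the origin and moves every coefficient to a
   positive index, as \<open>powser_0_nonzero\<close> requires.\<close>
 define G where "G x = x * F x" for x
 have Gs: "(%k. (case k of 0 => 0 | Suc j => c j) * (x - 0) ^ k) sums G x" if "cmod (x - 0) < 1" for x
 proof -
 have "(%k. x * (c k * x ^ k)) sums (x * F x)" using that by (intro sums_mult sm) simp
 then have "(%k. (case Suc k of 0 => 0 | Suc j => c j) * (x - 0) ^ Suc k) sums G x" by (simp add: G_def mult_ac)
 then show ?thesis by (drule_tac sums_Suc) simp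
 qed
 show ?thesis
 proof (rule ccontr)
 assume "c k ~= 0"
 then have "(case Suc k of 0 => 0 | Suc j => c j) ~= 0" by simp
 from powser_0_nonzero[OF zero_less_one Gs _ this zero_less_Suc] obtain \<sigma> where \<sigma>: "0 < \<sigma>" "!!z. z \<in> cball 0 \<sigma> - {0} ==> G z ~= 0"
  by (auto simp: G_def)
 define t where "t = min \<sigma> (1/2)"
 have t: "0 < t" "t < 1" "t <= \<sigma>" using \<sigma> by (auto simp: t_def)
 then have "F (of_real t) = 0" using s[of t] sm[of "of_real t"] sums_unique2 by fastforce
 then show False using \<sigma>(2)[of "of_real t"] t by (simp add: G_def)
 qed
qed

section \<open>The spectral weight and continuous dual Hahn polynomials\<close>

text \<open>y times the imaginary part of tan (pi (d + i y)). By the reflection formula it is |Gamma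
  (b + i y) Gamma (c + i y) / Gamma (2 i y)|^2 / (4 pi) for y > 0, where b = 1/2 + d and c = 1/2 -
  d.\<close>

definition tn :: "real => real => real" where
 "tn d y = y * sinh (2 * pi * y) / (cosh (2 * pi * y) + cos (2 * pi * d))"

lemma cosh_gt_1: "y ~= 0 ==> 1 < cosh (y::real)"
 using cosh_real_ge_1[of y] cosh_real_one_iff[of y] by linarith

lemma tn_denominator_pos: "y ~= 0 ==> 0 < cosh (2 * pi * y) + cos (2 * pi * d)"
 using cosh_gt_1[of "2 * pi * y"] cos_ge_minus_one[of "2 * pi * d"] by (simp del: cos_ge_minus_one)

lemma tn_even: "tn d (- y) = tn d y" by (simp add: tn_def)

lemma sinh_mult_nonneg: "0 <= (y::real) * sinh (c * y)" if "0 <= c"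
 using that by (cases "y \<ge> 0") (auto simp: zero_le_mult_iff mult_le_0_iff)

text \<open>The denominator is at least cosh (2 pi y) - 1 = 2 sinh^2 (pi y), which reduces the upper
  bound to |y| coth (pi |y|) <= |y| + 1 / pi.\<close>

lemma tn_bound: "0 <= tn d y \<and> tn d y <= 1 + \<bar>y\<bar>"
proof (cases "y = 0")
 case False
 define v where "v = pi * \<bar>y\<bar>"
 have v: "v > 0" using False by (simp add: v_def)
 have num: "y * sinh (2 * pi * y) = \<bar>y\<bar> * (2 * sinh v * cosh v)"
 proof (cases "y \<ge> 0")
 case True then show ?thesis using sinh_double[of v] by (simp add: v_def mult_ac)
 next
 case False then show ?thesis using sinh_double[of v] by (simp add: v_def mult_ac)
 qed
 have c: "cosh (2 * pi * y) = 1 + 2 * (sinh v)\<^sup>2"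
 proof -
 have "cosh (2 * pi * y) = cosh (2 * v)" by (cases "y \<ge> 0") (auto simp: v_def mult_ac)
 also have "... = (cosh v)\<^sup>2 + (sinh v)\<^sup>2" by (rule cosh_double)
 also have "(cosh v)\<^sup>2 = 1 + (sinh v)\<^sup>2" using cosh_square_eq[of v] by simp
 finally show ?thesis by simp
 qed
 have s: "sinh v > 0" using v by simp
 have d: "2 * (sinh v)\<^sup>2 <= cosh (2 * pi * y) + cos (2 * pi * d)" unfolding c using cos_ge_minus_one[of "2 * pi * d"] by linarith
 have "tn d y <= \<bar>y\<bar> * (2 * sinh v * cosh v) / (2 * (sinh v)\<^sup>2)"
 unfolding tn_def num using s d v by (intro divide_left_mono mult_pos_pos mult_nonneg_nonneg) (auto intro: less_le_trans[OF _ d])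
 also have "... = \<bar>y\<bar> * (cosh v / sinh v)" using s by (simp add: power2_eq_square)
 also have "... <= \<bar>y\<bar> * (1 + 1 / v)"
 proof (rule mult_left_mono)
 have "exp (- v) * (1 + 2 * v) <= exp (- v) * exp (2 * v)" by (intro mult_left_mono exp_ge_add_one_self) simp
 then have "v * exp (- v) <= sinh v" by (simp add: sinh_field_def exp_add[symmetric] algebra_simps)
 then have "v * (cosh v - sinh v) <= sinh v" by (simp add: cosh_minus_sinh)
 then show "cosh v / sinh v <= 1 + 1 / v" using s v by (simp add: field_simps)
 qed simp
 also have "... <= 1 + \<bar>y\<bar>"
 proof -
 have "\<bar>y\<bar> * (1 / v) = 1 / pi" using False by (simp add: v_def)
 also have "... <= 1" using pi_ge_two by simp
 finally show ?thesis by (simp add: distrib_left)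
 qed
 finally have "tn d y <= 1 + \<bar>y\<bar>" .
 moreover have "0 <= tn d y"
 unfolding tn_def using tn_denominator_pos[OF False, of d] sinh_mult_nonneg[of "2 * pi" y] by simp
 ultimately show ?thesis by simp
qed (simp add: tn_def)

lemma tn_pos: "y > 0 ==> tn d y > 0"
 unfolding tn_def using tn_denominator_pos[of y d] by (intro divide_pos_pos mult_pos_pos) auto

definition Gsq :: "real => real => real" where "Gsq a y = Re (Gamma (Complex a y) * Gamma (Complex a (- y)))"

lemma Gsq_norm: "Gsq a y = (cmod (Gamma (Complex a y)))\<^sup>2"
proof -
 have "Complex a (- y) = cnj (Complex a y)" by (simp add: complex_eq_iff)
 then have "Gamma (Complex a y) * Gamma (Complex a (- y)) = of_real ((cmod (Gamma (Complex a y)))\<^sup>2)"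
 by (simp only: cnj_Gamma complex_norm_square)
 then show ?thesis by (simp add: Gsq_def)
qed

lemma Gsq_even: "Gsq a (- y) = Gsq a y" by (simp add: Gsq_def mult.commute)

lemma Gsq_Suc:
 assumes "a > 0" shows "Gsq (a + 1) y = (a\<^sup>2 + y\<^sup>2) * Gsq a y"
proof -
 have "Complex (a + 1) y = Complex a y + 1" by (simp add: complex_eq_iff)
 moreover have "Gamma (Complex a y + 1) = Complex a y * Gamma (Complex a y)"
 by (rule Gamma_plus1) (use assms in \<open>auto intro!: Gamma_not_nonpos\<close>)
 ultimately show ?thesis by (simp add: Gsq_norm norm_mult power_mult_distrib cmod_power2)
qed

lemma Gsq_pos: "a > 0 ==> Gsq a y > 0"
 by (simp add: Gsq_norm Gamma_eq_zero_iff Gamma_not_nonpos)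

lemma measurable_tn [measurable]: "tn d \<in> bmeas"
 unfolding tn_def[abs_def] sinh_field_def cosh_field_def by measurable

lemma measurable_Gsq [measurable]: "a > 0 ==> Gsq a \<in> bmeas"
proof -
 assume a: "a > 0"
 have "continuous_on UNIV (%y. Gamma (Complex a y) * Gamma (Complex a (- y)))"
 unfolding Complex_eq using a by (intro continuous_intros continuous_on_Gamma' Gamma_not_nonpos) auto
 then have "(%y. Gamma (Complex a y) * Gamma (Complex a (- y))) \<in> bmeas" by (rule borel_measurable_continuous_onI)
 then show ?thesis unfolding Gsq_def[abs_def] by measurable
qed

locale spectral_params =
 fixes n m :: nat
 assumes m1: "1 <= m" and mn: "m <= n"
begin

definition a where "a = par_a n m"
definition c where "c = par_c n m"
definition d where "d = (real n - real m) / 4"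
definition J where "J = nat \<lceil>- c\<rceil>"

lemma c_d: "c = 1/2 - d" by (simp add: c_def d_def par_c_def)
lemma d_nonneg: "d \<ge> 0" using mn by (simp add: d_def)
lemma a_nonneg: "a \<ge> 0" using mn m1 by (simp add: a_def par_a_def)
lemma a_c: "a + c = real m / 2" by (simp add: a_def c_def par_a_def par_c_def field_simps)
lemma a_c_pos: "a + c > 0" using m1 by (simp add: a_c)
lemma a_half: "a + 1/2 + d = real n / 2" "a + 1/2 - d = real m / 2"
 by (simp_all add: a_def d_def par_a_def field_simps)

text \<open>a vanishes only for m = n = 1. Then Gamma (a + i y) has a pole at y = 0, and the
  estimates and the moment relation take a different form.\<close>

lemma a_zero: "a = 0 ==> d = 0"
proof -
 assume "a = 0"
 moreover have "1 <= real m" "real m <= real n" using m1 mn by auto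
 ultimately have "real n <= real m" unfolding a_def par_a_def by (simp add: field_simps)
 then have "n = m" using mn by (meson le_antisym of_nat_le_iff)
 then show "d = 0" unfolding d_def by simp
qed

lemma less_J_iff: "j < J \<longleftrightarrow> c + real j < 0"
proof -
 have "j < J \<longleftrightarrow> int j < \<lceil>- c\<rceil>" unfolding J_def by linarith
 also have "... \<longleftrightarrow> c + real j < 0" unfolding less_ceiling_iff by auto
 finally show ?thesis .
qed

lemma disc_ind_eq: "disc_ind n m = {..<J}"
 using less_J_iff by (auto simp: disc_ind_def c_def)

lemma c_J: "0 <= c + real J" "c + real J < 1"
proof -
 show "0 <= c + real J" using less_J_iff[of J] by auto
 have c: "c <= 1/2" using d_nonneg by (simp add: c_d)
 show "c + real J < 1"
 proof (cases J)
 case (Suc i)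
 then show ?thesis using less_J_iff[of i] by simp
 qed (use c in simp)
qed

text \<open>|Gamma (a + i y)|^2 times \<open>tn d y\<close>, with the argument raised by one and the
  new factor divided out again, so that it makes sense for a = 0.\<close>

definition wd :: "real => real" where "wd y = Gsq (a + 1) y * tn d y / (a\<^sup>2 + y\<^sup>2)"
text \<open>The value of - s Gamma (a + s) Gamma (a - s) at the pole s = c + j of tan (pi (s + d)):
  the residue that goes with the density \<open>wd\<close>, up to a constant common to all
  j.\<close>

definition ms :: "nat => real" where "ms j = - (c + real j) * (Gamma (a + (c + real j)) * Gamma (a - (c + real j)))"

lemma wd_even: "wd (- y) = wd y" by (simp add: wd_def tn_even Gsq_even)

lemma wd_pos: "y > 0 ==> wd y > 0"
 unfolding wd_def using a_nonneg by (intro divide_pos_pos mult_pos_pos Gsq_pos tn_pos) (auto simp: add_nonneg_pos)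

lemma wd_nonneg: "wd y \<ge> 0"
 unfolding wd_def using a_nonneg Gsq_pos[of "a + 1" y] tn_bound[of d y] by (intro divide_nonneg_nonneg mult_nonneg_nonneg) auto

lemma ms_pos: "j < J ==> ms j > 0"
proof -
 assume "j < J"
 then have "c + real j < 0" by (simp add: less_J_iff)
 then show ?thesis using a_c_pos a_nonneg unfolding ms_def
 by (intro mult_pos_pos Gamma_real_pos) auto
qed

lemma measurable_wd [measurable]: "wd \<in> bmeas"
proof -
 have [measurable]: "Gsq (a + 1) \<in> bmeas" using a_nonneg by (intro measurable_Gsq) simp
 show ?thesis unfolding wd_def[abs_def] by measurable
qed

text \<open>For a > 0 the denominator is bounded below. For a = 0 also d = 0, and \<open>tn\<close>
  is y tanh (pi y), whose double zero cancels y^2.\<close>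

lemma wd_decay: "\<exists>C K. \<forall>y. wd y <= C * (br y) ^ K * ep y"
proof -
 obtain C K where C: "C \<ge> 0" "!!y. cmod (Gamma (Complex (a + 1) y)) <= C * (br y) ^ K * exp (- (pi * \<bar>y\<bar> / 2))"
 using Gamma_decay[of "a + 1" "a + 1"] a_nonneg by auto
 have G: "Gsq (a + 1) y <= C\<^sup>2 * (br y) ^ (2 * K) * ep y" for y
 proof -
 have "Gsq (a + 1) y <= (C * (br y) ^ K * exp (- (pi * \<bar>y\<bar> / 2)))\<^sup>2"
  unfolding Gsq_norm by (intro power_mono C) simp
 also have "... = C\<^sup>2 * (br y) ^ (2 * K) * ep y"
  by (simp add: power_mult_distrib power_mult mult.commute[of 2] flip: exp_double)
 finally show ?thesis .
 qed
 obtain D where D: "!!y. tn d y / (a\<^sup>2 + y\<^sup>2) <= D * (br y)"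
 proof (cases "a = 0")
 case False
 have "tn d y / (a\<^sup>2 + y\<^sup>2) <= (1 / a\<^sup>2) * (br y)" for y
 proof -
  have "tn d y / (a\<^sup>2 + y\<^sup>2) <= (br y) / a\<^sup>2"
  using tn_bound[of d y] False by (intro frac_le) auto
  then show ?thesis by simp
 qed
 then show ?thesis by (rule that)
 next
 case True
 then have d0: "d = 0" by (rule a_zero)
 have "tn d y / (a\<^sup>2 + y\<^sup>2) <= (2 * pi) * (br y)" for y
 proof (cases "y = 0")
  case False
  define v where "v = pi * \<bar>y\<bar>"
  have v: "v > 0" using False by (simp add: v_def)
  have num: "y * sinh (2 * pi * y) = \<bar>y\<bar> * (2 * sinh v * cosh v)"
  using sinh_double[of v] by (cases "y \<ge> 0") (simp_all add: v_def mult_ac)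
  have c: "cosh (2 * pi * y) + 1 = 2 * (cosh v)\<^sup>2"
  proof -
  have "cosh (2 * pi * y) = cosh (2 * v)" by (cases "y \<ge> 0") (auto simp: v_def mult_ac)
  also have "... = (cosh v)\<^sup>2 + (sinh v)\<^sup>2" by (rule cosh_double)
  also have "(sinh v)\<^sup>2 = (cosh v)\<^sup>2 - 1" using cosh_square_eq[of v] by simp
  finally show ?thesis by simp
  qed
  have "tn d y = \<bar>y\<bar> * (sinh v / cosh v)"
  unfolding tn_def num d0 using c cosh_real_pos[of v] by (simp add: power2_eq_square)
  also have "... <= \<bar>y\<bar> * (2 * v)"
  proof (rule mult_left_mono)
  have "exp (- 2 * v) <= 1" using v by simp
  then have "tanh v <= (1 - exp (- 2 * v)) / 1" unfolding tanh_real_altdef by (intro divide_left_mono) (simp_all add: add_pos_pos)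
  also have "... <= 2 * v" using exp_ge_add_one_self[of "- 2 * v"] by simp
  finally show "sinh v / cosh v <= 2 * v" by (simp add: tanh_def)
  qed simp
  also have "... = 2 * pi * y\<^sup>2" by (simp add: v_def power2_eq_square)
  finally have "tn d y / y\<^sup>2 <= 2 * pi" using False by (simp add: divide_le_eq)
  also have "2 * pi <= (2 * pi) * (br y)" by (simp add: distrib_left)
  finally show ?thesis using True by simp
 qed (simp add: tn_def)
 then show ?thesis by (rule that)
 qed
 have "wd y <= (C\<^sup>2 * D) * (br y) ^ (2 * K + 1) * ep y" for y
 proof -
 have "wd y = Gsq (a + 1) y * (tn d y / (a\<^sup>2 + y\<^sup>2))" by (simp add: wd_def)
 also have "... <= (C\<^sup>2 * (br y) ^ (2 * K) * ep y) * (D * (br y))"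
  using tn_bound[of d y] by (intro mult_mono G D) auto
 also have "... = (C\<^sup>2 * D) * (br y) ^ (2 * K + 1) * ep y" by (simp add: power_add)
 finally show ?thesis .
 qed
 then show ?thesis by blast
qed

lemma poly_neg_square_bound:
 fixes p :: "real poly"
 shows "\<exists>C K. \<forall>y. \<bar>poly p (- (y\<^sup>2))\<bar> <= C * (br y) ^ K"
proof (induction p)
 case 0
 show ?case by (intro exI[of _ 0]) simp
next
 case (pCons b p)
 then obtain C K where C: "!!y. \<bar>poly p (- (y\<^sup>2))\<bar> <= C * (br y) ^ K" by blast
 have C0: "C \<ge> 0" using C[of 0] abs_ge_zero order_trans by fastforce
 have "\<bar>poly (pCons b p) (- (y\<^sup>2))\<bar> <= (\<bar>b\<bar> + C) * (br y) ^ (K + 2)" for y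
 proof -
 have "\<bar>poly (pCons b p) (- (y\<^sup>2))\<bar> <= \<bar>b\<bar> + y\<^sup>2 * \<bar>poly p (- (y\<^sup>2))\<bar>"
  using abs_triangle_ineq[of b "- (y\<^sup>2) * poly p (- (y\<^sup>2))"] by (simp add: abs_mult)
 also have "... <= \<bar>b\<bar> * (br y) ^ (K + 2) + (br y)\<^sup>2 * (C * (br y) ^ K)"
 proof (intro add_mono mult_mono C)
  have "1 <= (br y) ^ (K + 2)" by (intro one_le_power) simp
  then show "\<bar>b\<bar> <= \<bar>b\<bar> * (br y) ^ (K + 2)" using mult_left_mono[of 1 _ "\<bar>b\<bar>"] by simp
  have "\<bar>y\<bar>\<^sup>2 <= (br y)\<^sup>2" by (intro power_mono) auto
  then show "y\<^sup>2 <= (br y)\<^sup>2" by simp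
 qed (use C0 in auto)
 also have "... = (\<bar>b\<bar> + C) * (br y) ^ (K + 2)" by (simp add: power_add power2_eq_square algebra_simps)
 finally show ?thesis .
 qed
 then show ?case by blast
qed

lemma poly_wd_exp_integrable:
 assumes e: "e < pi"
 shows "integrable lborel (%y. poly p (- (y\<^sup>2)) * wd y * exp (e * \<bar>y\<bar>))"
proof -
 obtain C K where C: "!!y. wd y <= C * (br y) ^ K * ep y" using wd_decay by blast
 obtain C' K' where C': "!!y. \<bar>poly p (- (y\<^sup>2))\<bar> <= C' * (br y) ^ K'" using poly_neg_square_bound by blast
 have C0: "C' \<ge> 0" using C'[of 0] abs_ge_zero order_trans by fastforce
 show ?thesis
 proof (rule integrable_exp_decay)
 show "(%y. poly p (- (y\<^sup>2)) * wd y * exp (e * \<bar>y\<bar>)) \<in> bmeas"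
 proof -
  have [measurable]: "(%y::real. poly p (- (y\<^sup>2))) \<in> bmeas"
  by (intro borel_measurable_continuous_onI continuous_intros)
  show ?thesis by measurable
 qed
 show "0 < pi - e" using e by simp
 fix y
 have "norm (poly p (- (y\<^sup>2)) * wd y * exp (e * \<bar>y\<bar>)) <= (C' * (br y) ^ K') * (C * (br y) ^ K * ep y) * exp (e * \<bar>y\<bar>)"
  unfolding real_norm_def abs_mult abs_exp_cancel using C[of y] C'[of y] wd_nonneg[of y] C0
  by (intro mult_right_mono mult_mono) auto
 also have "... = (C' * C) * (br y) ^ (K' + K) * (ep y * exp (e * \<bar>y\<bar>))"
  by (simp add: power_add mult_ac)
 also have "ep y * exp (e * \<bar>y\<bar>) = exp (- ((pi - e) * \<bar>y\<bar>))" by (simp add: left_diff_distrib flip: exp_add)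
 finally show "norm (poly p (- (y\<^sup>2)) * wd y * exp (e * \<bar>y\<bar>)) <= (C' * C) * (br y) ^ (K' + K) * exp (- ((pi - e) * \<bar>y\<bar>))" .
 qed
qed

lemma poly_wd_integrable: "integrable lborel (%y. poly p (- (y\<^sup>2)) * wd y)"
 using poly_wd_exp_integrable[of 0 p] by simp

text \<open>Integration of polynomials in \<open>- x\<^sup>2\<close> against the spectral measure.\<close>
definition Lam :: "real poly => real" where
 "Lam p = (\<integral>y. poly p (- (y\<^sup>2)) * wd y \<partial>lborel) / 2 + (\<Sum>j<J. poly p ((c + real j)\<^sup>2) * ms j)"

lemma Lam_add: "Lam (p + q) = Lam p + Lam q"
 by (simp add: Lam_def distrib_right poly_wd_integrable sum.distrib add_divide_distrib)

lemma Lam_smult: "Lam (smult r p) = r * Lam p"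
 by (simp add: Lam_def mult.assoc sum_distrib_left distrib_left)

lemma Lam_diff: "Lam (p - q) = Lam p - Lam q"
 using Lam_add[of "p - q" q] by simp

lemma Lam_if: "Lam (if b then 0 else p) = (if b then 0 else Lam p)"
 by (simp add: Lam_def)

text \<open>A basis adapted to the weight: the factor (a + k)^2 + y^2 raises the parameter of |Gamma
  (a + k + i y)|^2 by one, so multiplying the weight by \<open>phi k\<close> replaces a by a +
  k.\<close>

definition phi :: "nat => real poly" where "phi k = (\<Prod>i<k. [:(a + real i)\<^sup>2, -1:])"

lemma phi_Suc: "phi (Suc k) = [:(a + real k)\<^sup>2, -1:] * phi k"
 by (simp add: phi_def mult.commute)

lemma poly_linear_factor: "poly (p * [:e, -1:]) x = (e - x) * poly p x" for p :: "real poly"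
 by (simp add: algebra_simps)

lemma poly_phi_Suc: "poly (phi (Suc k)) x = ((a + real k)\<^sup>2 - x) * poly (phi k) x"
 unfolding phi_Suc mult.commute[of _ "phi k"] poly_linear_factor ..

lemma phi_wd:
 assumes "a + real k > 0"
 shows "poly (phi k) (- (y\<^sup>2)) * wd y = Gsq (a + real k) y * tn d y"
 using assms
proof (induction k)
 case 0
 then have "a\<^sup>2 + y\<^sup>2 > 0" by (simp add: add_pos_nonneg)
 then show ?case using Gsq_Suc[of a y] 0 by (simp add: phi_def wd_def)
next
 case (Suc k)
 show ?case
 proof (cases "a + real k > 0")
 case True
 have "poly (phi (Suc k)) (- (y\<^sup>2)) * wd y = ((a + real k)\<^sup>2 + y\<^sup>2) * (poly (phi k) (- (y\<^sup>2)) * wd y)"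
  by (simp only: poly_phi_Suc mult.assoc diff_minus_eq_add)
 also have "... = Gsq (a + real k + 1) y * tn d y" unfolding Suc.IH[OF True] using Gsq_Suc[OF True, of y] by simp
 finally show ?thesis by (simp add: add_ac)
 next
 case False
 then have k: "k = 0" "a = 0" using a_nonneg by auto
 show ?thesis using k by (cases "y = 0") (simp_all add: phi_def wd_def tn_def)
 qed
qed

lemma phi_ms: "poly (phi k) ((c + real j)\<^sup>2) * ms j = - (c + real j) * (Gamma (a + real k + (c + real j)) * Gamma (a + real k - (c + real j)))" if j: "j < J"
proof (induction k)
 case (Suc k)
 define s where "s = c + real j"
 have s: "s < 0" "a + s > 0" using j a_c_pos unfolding s_def less_J_iff by auto
 have g: "Gamma (a + real k + s + 1) = (a + real k + s) * Gamma (a + real k + s)" "Gamma (a + real k - s + 1) = (a + real k - s) * Gamma (a + real k - s)"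
 using s a_nonneg by (auto intro!: Gamma_plus1 elim!: nonpos_Ints_cases)
 have e: "a + real (Suc k) + s = a + real k + s + 1" "a + real (Suc k) - s = a + real k - s + 1" by simp_all
 have "poly (phi (Suc k)) (s\<^sup>2) * ms j = ((a + real k)\<^sup>2 - s\<^sup>2) * (poly (phi k) (s\<^sup>2) * ms j)" by (simp only: poly_phi_Suc mult.assoc)
 also have "... = - s * ((a + real k + s) * Gamma (a + real k + s) * ((a + real k - s) * Gamma (a + real k - s)))"
 unfolding Suc[folded s_def] by (simp add: power2_eq_square algebra_simps)
 finally show ?case unfolding s_def[symmetric] e g .
qed (simp add: phi_def ms_def)

text \<open>\<open>strip_integral\<close> for b = a + k evaluates the line integral as twice a value
  of T = \<open>Tfun\<close>. The masses contribute differences of T, which telescope from c - 1 =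
  -1/2 - d, a zero of T, up to r = c + J - 1. Since \<open>Lam\<close> halves the line integral, the
  two contributions are T r with opposite signs.\<close>

lemma Lam_phi_rel_pos:
 assumes k: "a + real k > 0"
 shows "Lam (phi k * [:d\<^sup>2 - (a + real k) - 1/4, -1:]) = 0"
proof -
 define b where "b = a + real k"
 \<comment> \<open>The largest pole of the tangent on the negative axis.\<close>
 define r where "r = c + real J - 1"
 \<comment> \<open>\<open>strip_integral\<close> wants -1 < p. If r = -1, the pole 0 of the same
   tangent is used instead; T takes the same value there because the difference in
   \<open>Tfun_diff\<close> vanishes at 0.\<close>
 define p where "p = (if r = -1 then 0 else r)"
 have r: "-1 <= r" "r < 0" using c_J by (auto simp: r_def)
 have p: "-1 < p" "p <= 0" "0 < b + 1 + p" using r k by (auto simp: p_def b_def)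
 have b: "b > 0" "b + c > 0" using k a_c_pos by (auto simp: b_def)
 \<comment> \<open>p and c = 1/2 - d differ by an integer.\<close>
 have cosp: "cos (2 * pi * p) = - cos (2 * pi * d)"
 proof -
 obtain l :: int where l: "p = c + of_int l"
 proof (cases "r = -1")
  case True
  then have "p = c + of_int (int J)" by (simp add: p_def r_def)
  then show ?thesis by (rule that)
 next
  case False
  then have "p = c + of_int (int J - 1)" by (simp add: p_def r_def)
  then show ?thesis by (rule that)
 qed
 have "2 * pi * p = (pi - 2 * pi * d) + 2 * pi * of_int l" by (simp add: l c_d algebra_simps)
 then have "cos (2 * pi * p) = cos (pi - 2 * pi * d)" using cos_int_2pin sin_int_2pin by (simp add: cos_add)
 then show ?thesis by (simp add: cos_diff)
 qed
 have "of_real (\<integral>y. (d\<^sup>2 - b - 1/4 + y\<^sup>2) * (Re (Gamma (Complex b y) * Gamma (Complex b (- y))) * (y * sinh (2 * pi * y) / (cosh (2 * pi * y) - cos (2 * pi * p)))) \<partial>lborel)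
  = 2 * Tfun b d (of_real p)"
 by (rule strip_integral(2)[OF b(1) p])
 moreover have "(d\<^sup>2 - b - 1/4 + y\<^sup>2) * (Re (Gamma (Complex b y) * Gamma (Complex b (- y))) * (y * sinh (2 * pi * y) / (cosh (2 * pi * y) - cos (2 * pi * p))))
  = poly (phi k * [:d\<^sup>2 - (a + real k) - 1/4, -1:]) (- (y\<^sup>2)) * wd y" for y
 proof -
 have "poly (phi k * [:d\<^sup>2 - (a + real k) - 1/4, -1:]) (- (y\<^sup>2)) * wd y = (d\<^sup>2 - b - 1/4 + y\<^sup>2) * (poly (phi k) (- (y\<^sup>2)) * wd y)"
  by (simp only: poly_linear_factor b_def mult.assoc diff_minus_eq_add)
 then show ?thesis unfolding phi_wd[OF k] cosp by (simp add: b_def Gsq_def tn_def)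
 qed
 ultimately have I: "of_real (\<integral>y. poly (phi k * [:d\<^sup>2 - (a + real k) - 1/4, -1:]) (- (y\<^sup>2)) * wd y \<partial>lborel) = 2 * Tfun b d (of_real p)"
 by simp
 define T where "T s = Tfun b d (of_real s)" for s
 have Tp: "Tfun b d (of_real p) = T r"
 proof (cases "r = -1")
 case True
 have "Tfun b d 0 - Tfun b d (0 - 1) = 0" using b by (subst Tfun_diff) auto
 then show ?thesis using True by (simp add: T_def p_def)
 qed (simp add: T_def p_def)
 have step: "T (c + real j) - T (c + real j - 1) = of_real ((c + real j) * (d\<^sup>2 - b - 1/4 - (c + real j)\<^sup>2) * (Gamma (b + (c + real j)) * Gamma (b - (c + real j))))"
 if j: "j < J" for j
 proof -
 have "c + real j < 0" using j by (simp add: less_J_iff)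
 then have "\<bar>Re (cr (c + real j))\<bar> < b" using b by simp
 from Tfun_diff[OF this, of d] show ?thesis
  unfolding T_def by (simp flip: Gamma_complex_of_real)
 qed
 have "(\<Sum>j<J. of_real ((c + real j) * (d\<^sup>2 - b - 1/4 - (c + real j)\<^sup>2) * (Gamma (b + (c + real j)) * Gamma (b - (c + real j))))) = (\<Sum>j<J. T (c + real (Suc j) - 1) - T (c + real j - 1))"
 by (intro sum.cong refl) (use step in \<open>simp add: algebra_simps\<close>)
 also have "... = T r - T (c - 1)" unfolding r_def by (subst sum_lessThan_telescope) simp
 also have "T (c - 1) = 0"
 proof -
 have "cr (c - 1) + of_real (1/2) = - of_real d" by (simp add: c_d flip: of_real_add)
 then show ?thesis unfolding T_def Tfun_def by (simp only:) simp
 qed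
 finally have S: "of_real (\<Sum>j<J. (c + real j) * (d\<^sup>2 - b - 1/4 - (c + real j)\<^sup>2) * (Gamma (b + (c + real j)) * Gamma (b - (c + real j)))) = T r"
 by simp
 have "(\<Sum>j<J. poly (phi k * [:d\<^sup>2 - (a + real k) - 1/4, -1:]) ((c + real j)\<^sup>2) * ms j) = - (\<Sum>j<J. (c + real j) * (d\<^sup>2 - b - 1/4 - (c + real j)\<^sup>2) * (Gamma (b + (c + real j)) * Gamma (b - (c + real j))))"
 unfolding sum_negf[symmetric]
 proof (intro sum.cong refl)
 fix j assume j: "j \<in> {..<J}"
 have "poly (phi k * [:d\<^sup>2 - (a + real k) - 1/4, -1:]) ((c + real j)\<^sup>2) * ms j = (d\<^sup>2 - b - 1/4 - (c + real j)\<^sup>2) * (poly (phi k) ((c + real j)\<^sup>2) * ms j)"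
  by (simp only: poly_linear_factor b_def mult.assoc)
 also have "poly (phi k) ((c + real j)\<^sup>2) * ms j = - (c + real j) * (Gamma (b + (c + real j)) * Gamma (b - (c + real j)))"
  using phi_ms[of j k] j by (simp add: b_def)
 finally show "poly (phi k * [:d\<^sup>2 - (a + real k) - 1/4, -1:]) ((c + real j)\<^sup>2) * ms j = - ((c + real j) * (d\<^sup>2 - b - 1/4 - (c + real j)\<^sup>2) * (Gamma (b + (c + real j)) * Gamma (b - (c + real j))))"
  by (simp only: mult_minus_left mult_minus_right mult_ac)
 qed
 then have "cr (Lam (phi k * [:d\<^sup>2 - (a + real k) - 1/4, -1:])) = T r - T r"
 unfolding Lam_def of_real_add of_real_divide I Tp using S by simp
 then show ?thesis by simp
qed

text \<open>For a = 0 and k = 0 the gamma factor has a pole on the line, outside the scope of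
  \<open>strip_integral\<close>. There are no atoms and the weight is pi / cosh (pi y); the relation
  says that (1/2 - 2 y^2) / cosh (pi y) has integral 0. This comes from moving (s + 1/2)^2 / sin (pi
  (s + 1/2)) between Re s = -1 and Re s = 0, the residue at -1/2 being 0.\<close>

lemma Lam_phi_rel_zero:
 assumes a0: "a = 0"
 shows "Lam (phi 0 * [:d\<^sup>2 - (a + real 0) - 1/4, -1:]) = 0"
proof -
 have d0: "d = 0" by (rule a_zero[OF a0])
 have J0: "J = 0" by (simp add: J_def c_d d0)
 define g where "g s = (s + 1/2)\<^sup>2 * sc (s + 1/2)" for s :: complex
 obtain C where C: "C \<ge> 0" "!!x y. \<bar>x\<bar> <= 1/2 ==> cmod (sc (Complex x y)) <= C * (br y) * ep y"
 using sc_bound[of "1/2"] by auto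
 have gb: "cmod (g (Complex x y)) <= C * (br y) ^ 3 * ep y" if x: "-1 <= x" "x <= 0" for x y
 proof -
 have e: "Complex x y + 1/2 = Complex (x + 1/2) y" by (simp add: complex_eq_iff)
 have c1: "cmod (Complex (x + 1/2) y) <= 1 + \<bar>y\<bar>" using cmod_le[of "Complex (x + 1/2) y"] x by simp
 have c2: "cmod (sc (Complex (x + 1/2) y)) <= C * (br y) * ep y" by (rule C(2)) (use x in linarith)
 have "cmod (g (Complex x y)) <= (br y)\<^sup>2 * (C * (br y) * ep y)"
  unfolding g_def e norm_mult norm_power by (intro mult_mono power_mono c1 c2) auto
 then show ?thesis by (simp add: power2_eq_square power3_eq_cube mult_ac)
 qed
 have gc: "continuous_on {s. -1 <= Re s \<and> Re s <= 0} g"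
 proof -
 have "continuous_on {s. \<bar>Re s\<bar> < 1} sc" by (auto intro!: continuous_at_imp_continuous_on isCont_sc)
 then have "continuous_on {s. -1 <= Re s \<and> Re s <= 0} (%s. sc (s + 1/2))"
  by (rule continuous_on_compose2) (auto intro!: continuous_intros)
 then show ?thesis unfolding g_def[abs_def] by (intro continuous_intros)
 qed
 have gd: "g field_differentiable at s" if s: "-1 < Re s" "Re s < 0" "s \<notin> {- (1/2)}" for s
 proof -
 have "s + 1/2 ~= 0" using s by (metis add_eq_0_iff2 insertI1)
 then have "(%s. sc (s + 1/2)) field_differentiable at s"
  using s by (intro field_differentiable_compose[of "%s. s + 1/2" _ sc, unfolded o_def] sc_field_differentiable derivative_intros) auto
 then show ?thesis unfolding g_def[abs_def]
  by (intro field_differentiable_mult field_differentiable_power field_differentiable_add field_differentiable_ident field_differentiable_const)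
 qed
 have ss: "-1 < - (1/2::real)" "- (1/2::real) < 0" by auto
 have fin: "finite {- (1/2) :: complex}" by simp
 note R = vertical_strip_residue[OF ss fin gc gd pi_gt_zero gb]
 have cosh: "sin (of_real pi * Complex (1/2) y) = of_real (cosh (pi * y))" for y
 proof -
 have "of_real pi * Complex (1/2) y = of_real pi / 2 + \<i> * of_real (pi * y)" by (simp add: complex_eq_iff)
 then have "sin (of_real pi * Complex (1/2) y) = cos (\<i> * of_real (pi * y))" by (simp add: sin_add del: of_real_mult flip: cos_of_real sin_of_real)
 also have "... = cosh (of_real (pi * y))" by (simp add: cosh_conv_cos)
 also have "... = of_real (cosh (pi * y))" by (simp add: cosh_field_def exp_of_real flip: of_real_minus del: of_real_mult)
 finally show ?thesis .
 qed
 have f1: "g (Complex 0 y) / (Complex 0 y - of_real (- (1/2))) = (Complex (1/2) y)\<^sup>2 / of_real (cosh (pi * y))" for y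
 proof -
 have e: "Complex 0 y + 1/2 = Complex (1/2) y" "Complex 0 y - of_real (- (1/2)) = Complex (1/2) y" by (simp_all add: complex_eq_iff)
 have ne: "Complex (1/2) y ~= 0" by (simp add: complex_eq_iff)
 show ?thesis unfolding g_def e using ne cosh[of y] by (simp add: sc_def power2_eq_square)
 qed
 have f2: "g (Complex (-1) y) / (Complex (-1) y - of_real (- (1/2))) = - (Complex (- (1/2)) y)\<^sup>2 / of_real (cosh (pi * y))" for y
 proof -
 have e: "Complex (-1) y + 1/2 = Complex (- (1/2)) y" "Complex (-1) y - of_real (- (1/2)) = Complex (- (1/2)) y" by (simp_all add: complex_eq_iff)
 have ne: "Complex (- (1/2)) y ~= 0" by (simp add: complex_eq_iff)
 have "of_real pi * Complex (- (1/2)) y = - (of_real pi * Complex (1/2) (- y))" by (simp add: complex_eq_iff)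
 then have "sin (of_real pi * Complex (- (1/2)) y) = - of_real (cosh (pi * y))" using cosh[of "- y"] by simp
 then show ?thesis unfolding g_def e using ne by (simp add: sc_def power2_eq_square)
 qed
 have "(\<integral>y. (Complex (1/2) y)\<^sup>2 / of_real (cosh (pi * y)) - (- (Complex (- (1/2)) y)\<^sup>2 / of_real (cosh (pi * y))) \<partial>lborel) = 2 * pi * g (of_real (- (1/2)))"
 using R(3) Bochner_Integration.integral_diff[OF R(2,1)] unfolding f1 f2 by simp
 also have "g (of_real (- (1/2))) = 0" by (simp add: g_def)
 also have "(%y. (Complex (1/2) y)\<^sup>2 / of_real (cosh (pi * y)) - (- (Complex (- (1/2)) y)\<^sup>2 / of_real (cosh (pi * y)))) = (%y. of_real ((1/2 - 2 * y\<^sup>2) / cosh (pi * y)))"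
 proof
 fix y
 have "(Complex (1/2) y)\<^sup>2 + (Complex (- (1/2)) y)\<^sup>2 = of_real (1/2 - 2 * y\<^sup>2)"
  by (simp add: complex_eq_iff power2_eq_square)
 then show "(Complex (1/2) y)\<^sup>2 / of_real (cosh (pi * y)) - (- (Complex (- (1/2)) y)\<^sup>2 / of_real (cosh (pi * y))) = of_real ((1/2 - 2 * y\<^sup>2) / cosh (pi * y))"
  by (simp only: diff_minus_eq_add minus_divide_left[symmetric] add_divide_distrib[symmetric] of_real_divide)
 qed
 finally have I0: "(\<integral>y. (1/2 - 2 * y\<^sup>2) / cosh (pi * y) \<partial>lborel) = 0" by (simp del: of_real_divide)
 have wdc: "wd y = pi / cosh (pi * y)" if y: "y ~= 0" for y
 proof -
 define v where "v = pi * y"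
 have v: "v ~= 0" using y by (simp add: v_def)
 have G: "Gsq (a + 1) y = v / sinh v"
 proof -
  define z where "z = Complex 0 y"
  have "z \<notin> \<int>\<^sub>\<le>\<^sub>0" using y by (auto simp: z_def complex_eq_iff elim!: nonpos_Ints_cases)
  then have "Gamma (z + 1) = z * Gamma z" by (rule Gamma_plus1)
  then have "Gamma (z + 1) * Gamma (1 - z) = z * (of_real pi / sin (of_real pi * z))"
  using Gamma_reflection_complex[of z] by (simp add: mult.assoc)
  moreover have "z + 1 = Complex (a + 1) y" "1 - z = Complex (a + 1) (- y)" by (simp_all add: z_def a0 complex_eq_iff)
  moreover have "sin (of_real pi * z) = \<i> * of_real (sinh v)"
  proof -
  have "of_real pi * z = \<i> * of_real v" by (simp add: z_def v_def complex_eq_iff)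
  then have "sin (of_real pi * z) = \<i> * sinh (of_real v)"
   by (simp add: sinh_conv_sin del: of_real_mult)
  also have "sinh (of_real v) = cr (sinh v)"
   by (simp add: sinh_field_def exp_of_real flip: of_real_minus del: of_real_mult)
  finally show ?thesis .
  qed
  moreover have "z = \<i> * of_real y" by (simp add: z_def complex_eq_iff)
  ultimately have "Gamma (Complex (a + 1) y) * Gamma (Complex (a + 1) (- y)) = of_real (v / sinh v)"
  by (simp add: v_def)
  then show ?thesis by (simp add: Gsq_def)
 qed
 have s2: "sinh (2 * pi * y) = 2 * sinh v * cosh v" using sinh_double[of v] by (simp add: v_def mult.assoc)
 have c2: "cosh (2 * pi * y) + 1 = 2 * (cosh v)\<^sup>2"
 proof -
  have "cosh (2 * pi * y) = (cosh v)\<^sup>2 + (sinh v)\<^sup>2" using cosh_double[of v] by (simp add: v_def mult.assoc)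
  also have "(sinh v)\<^sup>2 = (cosh v)\<^sup>2 - 1" using cosh_square_eq[of v] by simp
  finally show ?thesis by simp
 qed
 have "sinh v ~= 0" "cosh v ~= 0" using v cosh_real_pos[of v] by auto
 then show ?thesis unfolding wd_def G tn_def s2 d0 using c2 y by (simp add: a0 power2_eq_square v_def)
 qed
 have E: "(\<integral>y. poly (phi 0 * [:d\<^sup>2 - (a + real 0) - 1/4, -1:]) (- (y\<^sup>2)) * wd y \<partial>lborel) = (\<integral>y. (- pi / 2) * ((1/2 - 2 * y\<^sup>2) / cosh (pi * y)) \<partial>lborel)"
 proof (rule integral_cong_AE)
 have [measurable]: "(%y. cosh (pi * y)) \<in> bmeas" unfolding cosh_field_def by measurable
 show "(%y. (- pi / 2) * ((1/2 - 2 * y\<^sup>2) / cosh (pi * y))) \<in> borel_measurable lborel" by measurable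
 have [measurable]: "(%y::real. poly (phi 0 * [:d\<^sup>2 - (a + real 0) - 1/4, -1:]) (- (y\<^sup>2))) \<in> bmeas"
  by (intro borel_measurable_continuous_onI continuous_intros)
 show "(%y. poly (phi 0 * [:d\<^sup>2 - (a + real 0) - 1/4, -1:]) (- (y\<^sup>2)) * wd y) \<in> borel_measurable lborel" by measurable
 have "poly (phi 0 * [:d\<^sup>2 - (a + real 0) - 1/4, -1:]) (- (y\<^sup>2)) * wd y = (- pi / 2) * ((1/2 - 2 * y\<^sup>2) / cosh (pi * y))" if "y ~= 0" for y
 proof -
  have p: "poly (phi 0 * [:d\<^sup>2 - (a + real 0) - 1/4, -1:]) (- (y\<^sup>2)) = y\<^sup>2 - 1/4" by (simp add: phi_def a0 d0)
  have e: "(y\<^sup>2 - 1/4) * pi = (- pi / 2) * (1/2 - 2 * y\<^sup>2)" by (simp add: algebra_simps)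
  show ?thesis unfolding p wdc[OF that] times_divide_eq_right e ..
 qed
 then show "AE y in lborel. poly (phi 0 * [:d\<^sup>2 - (a + real 0) - 1/4, -1:]) (- (y\<^sup>2)) * wd y = (- pi / 2) * ((1/2 - 2 * y\<^sup>2) / cosh (pi * y))"
  using AE_lborel_singleton[of "0::real"] by (auto elim: AE_mp)
 qed
 show ?thesis unfolding Lam_def J0 E integral_mult_right_zero I0 by simp
qed

lemma Lam_phi_rel: "Lam (phi k * [:d\<^sup>2 - (a + real k) - 1/4, -1:]) = 0"
 using Lam_phi_rel_pos[of k] Lam_phi_rel_zero a_nonneg by (cases "a + real k > 0"; cases k) auto

definition M0 where "M0 = Lam 1"

lemma const_poly_mult: "[:r:] * p = smult r p" for p :: "real poly" by simp

text \<open>(a + k)^2 - x splits as (d^2 - (a + k) - 1/4 - x) + \<open>Ak n m k\<close>, because (a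
  + k + 1/2)^2 - d^2 = \<open>Ak n m k\<close>; the first summand is annihilated by
  \<open>Lam_phi_rel\<close>.\<close>

lemma Lam_phi: "Lam (phi k) = M0 * (\<Prod>i<k. Ak n m i)"
proof (induction k)
 case 0
 then show ?case by (simp add: phi_def M0_def)
next
 case (Suc k)
 have p: "phi (Suc k) = phi k * [:d\<^sup>2 - (a + real k) - 1/4, -1:] + smult (Ak n m k) (phi k)"
 proof -
 have "Ak n m k = (a + real k + 1/2)\<^sup>2 - d\<^sup>2"
 proof -
  have "Ak n m k = (real k + (a + 1/2 + d)) * (real k + (a + 1/2 - d))" unfolding a_half by (simp add: Ak_def)
  then show ?thesis by (simp add: power2_eq_square algebra_simps)
 qed
 then have e: "[:(a + real k)\<^sup>2, -1:] = [:d\<^sup>2 - (a + real k) - 1/4, -1:] + [:Ak n m k:]" by (simp add: power2_eq_square algebra_simps)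
 show ?thesis unfolding phi_Suc e distrib_right const_poly_mult by (simp only: mult.commute)
 qed
 show ?case unfolding p Lam_add Lam_smult Lam_phi_rel Suc by simp
qed

text \<open>Multiples of the continuous dual Hahn polynomials.\<close>
fun PP :: "nat => real poly" where
 "PP 0 = 1"
| "PP (Suc 0) = [:Ak n m 0 - a\<^sup>2, 1:]"
| "PP (Suc (Suc k)) = smult (1 / (real (Suc (Suc k)))\<^sup>2) ([:Ak n m (Suc k) + (real (Suc k))\<^sup>2 - a\<^sup>2, 1:] * PP (Suc k) - smult (Ak n m k) (PP k))"

lemma PP_rec: "[:- (a\<^sup>2), 1:] * PP k = smult ((real (Suc k))\<^sup>2) (PP (Suc k)) - smult (Ak n m k + (real k)\<^sup>2) (PP k) + (if k = 0 then 0 else smult (Ak n m (k - 1)) (PP (k - 1)))"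
proof -
 have s: "[:x + y - a\<^sup>2, 1:] * p = [:- (a\<^sup>2), 1:] * p + smult (x + y) p" for x y and p :: "real poly"
 proof -
 have e: "[:x + y - a\<^sup>2, 1:] = [:- (a\<^sup>2), 1:] + [:x + y:]" by simp
 show ?thesis unfolding e distrib_right const_poly_mult ..
 qed
 show ?thesis
 proof (cases k)
 case 0
 then show ?thesis by simp
 next
 case (Suc l)
 have "smult ((real (Suc k))\<^sup>2) (PP (Suc k)) = [:Ak n m k + (real k)\<^sup>2 - a\<^sup>2, 1:] * PP k - smult (Ak n m l) (PP l)"
  using Suc by (simp del: of_nat_Suc)
 then show ?thesis using Suc unfolding s by simp
 qed
qed

lemma binomial_Suc_real: "real (Suc q) * real (l choose Suc q) = (real l - real q) * real (l choose q)"
proof (cases "q <= l")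
 case True
 have "Suc q * (l choose Suc q) = (l - q) * (l choose q)" unfolding binomial_absorption binomial_absorb_comp ..
 then have "real (Suc q) * real (l choose Suc q) = real (l - q) * real (l choose q)" by (metis of_nat_mult)
 then show ?thesis using True by (simp only: of_nat_diff)
qed (simp add: binomial_eq_0)

text \<open>Induction on k through the recurrence of \<open>PP\<close>, using that x acts on
  \<open>phi l\<close> by a shift of l, which is why all l are needed together. The case l = 0 is
  orthogonality to constants.\<close>

lemma Lam_PP_phi: "Lam (PP k * phi l) = (-1) ^ k * real (l choose k) * (M0 * (\<Prod>i<l. Ak n m i))"
proof (induction k arbitrary: l rule: less_induct)
 case (less k)
 show ?case
 proof (cases k)
 case 0
 then show ?thesis by (simp add: Lam_phi)
 next
 case (Suc q)
 define D where "D l = M0 * (\<Prod>i<l. Ak n m i)" for l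
 have DS: "D (Suc l) = Ak n m l * D l" for l by (simp add: D_def mult_ac)
 have IHq: "Lam (PP q * phi l) = (-1) ^ q * real (l choose q) * D l" for l using less(1)[of q] Suc by (simp add: D_def)
 have IHp: "(if q = 0 then 0 else Ak n m (q - 1) * Lam (PP (q - 1) * phi l)) = - ((-1) ^ q * (if q = 0 then 0 else Ak n m (q - 1) * real (l choose (q - 1)))) * D l"
  using less(1)[of "q - 1"] Suc by (cases q) (simp_all add: D_def)
 have "[:- (a\<^sup>2), 1:] * (PP q * phi l) = smult ((a + real l)\<^sup>2 - a\<^sup>2) (PP q * phi l) - PP q * phi (Suc l)"
 proof -
  have e: "[:- (a\<^sup>2), 1:] = [:(a + real l)\<^sup>2 - a\<^sup>2:] - [:(a + real l)\<^sup>2, -1:]" by simp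
  show ?thesis unfolding phi_Suc e left_diff_distrib const_poly_mult mult.left_commute[of "PP q"] ..
 qed
 moreover have "[:- (a\<^sup>2), 1:] * (PP q * phi l) = smult ((real (Suc q))\<^sup>2) (PP (Suc q) * phi l) - smult (Ak n m q + (real q)\<^sup>2) (PP q * phi l) + (if q = 0 then 0 else smult (Ak n m (q - 1)) (PP (q - 1) * phi l))"
  unfolding mult.assoc[symmetric] PP_rec by (simp add: distrib_right left_diff_distrib)
 ultimately have "(real (Suc q))\<^sup>2 * Lam (PP (Suc q) * phi l) - (Ak n m q + (real q)\<^sup>2) * Lam (PP q * phi l) + (if q = 0 then 0 else Ak n m (q - 1) * Lam (PP (q - 1) * phi l))
  = ((a + real l)\<^sup>2 - a\<^sup>2) * Lam (PP q * phi l) - Lam (PP q * phi (Suc l))"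
  using Lam_add Lam_diff Lam_smult by (smt (verit, ccfv_threshold) add_cancel_right_right)
 then have "(real (Suc q))\<^sup>2 * Lam (PP (Suc q) * phi l) = (-1) ^ q * D l * ((Ak n m q + (real q)\<^sup>2 + (a + real l)\<^sup>2 - a\<^sup>2) * real (l choose q)
  - Ak n m l * real (Suc l choose q) + (if q = 0 then 0 else Ak n m (q - 1) * real (l choose (q - 1))))"
  unfolding IHq IHp DS by (simp add: algebra_simps)
 also have "... = (-1) ^ q * D l * (- ((real (Suc q))\<^sup>2 * real (l choose Suc q)))"
 proof -
  \<comment> \<open>After the common factors the claim is an identity between neighbouring binomial
    coefficients, settled by absorption and Pascal's rule.\<close>
  define C where "C = real (l choose q)"
  define B where "B = (if q = 0 then 0 else real (l choose (q - 1)))"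
  have 1: "real (Suc q) * real (l choose Suc q) = (real l - real q) * C"
  unfolding C_def by (rule binomial_Suc_real)
  have 2: "real q * C = (real l - real q + 1) * B"
  proof (cases q)
  case (Suc r)
  then show ?thesis using binomial_Suc_real[of r l] by (simp add: C_def B_def)
  qed (simp add: B_def)
  have 3: "real (Suc l choose q) = C + B" by (cases q) (auto simp: C_def B_def)
  have A: "Ak n m i = (real i)\<^sup>2 + (2 * a + 1) * real i + Ak n m 0" for i
  proof -
  have e: "2 * a + 1 = (real n + real m) / 2" using a_half by simp
  show ?thesis unfolding e by (simp add: Ak_def power2_eq_square algebra_simps add_divide_distrib)
  qed
  have 4: "(if q = 0 then 0 else Ak n m (q - 1) * real (l choose (q - 1))) = ((real q - 1)\<^sup>2 + (2 * a + 1) * (real q - 1) + Ak n m 0) * B"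
  proof (cases q)
  case (Suc r)
  then show ?thesis using A[of r] by (simp add: B_def)
  qed (simp add: B_def)
  have "(Ak n m q + (real q)\<^sup>2 + (a + real l)\<^sup>2 - a\<^sup>2) * C - Ak n m l * (C + B) + ((real q - 1)\<^sup>2 + (2 * a + 1) * (real q - 1) + Ak n m 0) * B
   = ((real q)\<^sup>2 + (2 * a + 1) * real q + (real q)\<^sup>2 - real l) * C - (real q + real l + 2 * a) * ((real l - real q + 1) * B)"
  unfolding A[of q] A[of l] by (simp add: power2_eq_square algebra_simps)
  also have "... = - ((real q + 1) * ((real l - real q) * C))" unfolding 2[symmetric] by (simp add: power2_eq_square algebra_simps)
  also have "... = - ((real (Suc q))\<^sup>2 * real (l choose Suc q))" unfolding 1[symmetric] by (simp add: power2_eq_square algebra_simps)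
  finally show ?thesis unfolding 3 4 C_def[symmetric] by simp
 qed
 finally have "(real (Suc q))\<^sup>2 * Lam (PP (Suc q) * phi l) = (real (Suc q))\<^sup>2 * ((-1) ^ Suc q * real (l choose Suc q) * D l)" by simp
 then show ?thesis using Suc unfolding D_def by (metis (no_types, lifting) mult_left_cancel of_nat_eq_0_iff power_not_zero nat.distinct(1))
 qed
qed

lemma Nk_Suc: "(real (Suc k))\<^sup>2 * Nk n m (Suc k) = Ak n m k * Nk n m k"
 by (simp add: Nk_def Ak_def pochhammer_rec' power2_eq_square divide_simps del: of_nat_Suc) (simp add: algebra_simps)

text \<open>Multiplication by x - a^2 is symmetric for \<open>Lam\<close>. Applying
  \<open>PP_rec\<close> to the right or to the left factor expresses one value in two ways, and this
  determines the column Suc q from the columns q and q - 1.\<close>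

lemma Lam_PP_PP: "Lam (PP k * PP j) = (if k = j then M0 * Nk n m k else 0)"
proof (induction j arbitrary: k rule: less_induct)
 case (less j)
 show ?case
 proof (cases j)
 case 0
 have "Lam (PP k * phi 0) = (if k = 0 then M0 else 0)" unfolding Lam_PP_phi by (cases k) auto
 then show ?thesis using 0 by (simp add: phi_def Nk_def)
 next
 case (Suc q)
 have IHq: "Lam (PP k * PP q) = (if k = q then M0 * Nk n m k else 0)" for k using less[of q] Suc by simp
 have IHp: "(if q = 0 then 0 else Ak n m (q - 1) * Lam (PP k * PP (q - 1))) = (if Suc k = q then Ak n m k * (M0 * Nk n m k) else 0)"
  using less[of "q - 1" k] Suc by (cases q) auto
 have r1: "Lam ([:- (a\<^sup>2), 1:] * (PP k * PP q)) = (real (Suc q))\<^sup>2 * Lam (PP k * PP (Suc q)) - (Ak n m q + (real q)\<^sup>2) * Lam (PP k * PP q) + (if q = 0 then 0 else Ak n m (q - 1) * Lam (PP k * PP (q - 1)))"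
 proof -
  have "[:- (a\<^sup>2), 1:] * (PP k * PP q) = PP k * ([:- (a\<^sup>2), 1:] * PP q)" by (rule mult.left_commute)
  also have "... = smult ((real (Suc q))\<^sup>2) (PP k * PP (Suc q)) - smult (Ak n m q + (real q)\<^sup>2) (PP k * PP q) + (if q = 0 then 0 else smult (Ak n m (q - 1)) (PP k * PP (q - 1)))"
  unfolding PP_rec by (simp add: distrib_left right_diff_distrib)
  finally have e: "[:- (a\<^sup>2), 1:] * (PP k * PP q) = smult ((real (Suc q))\<^sup>2) (PP k * PP (Suc q)) - smult (Ak n m q + (real q)\<^sup>2) (PP k * PP q) + (if q = 0 then 0 else smult (Ak n m (q - 1)) (PP k * PP (q - 1)))" .
  show ?thesis unfolding e Lam_add Lam_diff Lam_if Lam_smult ..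
 qed
 have r2: "Lam ([:- (a\<^sup>2), 1:] * (PP k * PP q)) = (real (Suc k))\<^sup>2 * Lam (PP (Suc k) * PP q) - (Ak n m k + (real k)\<^sup>2) * Lam (PP k * PP q) + (if k = 0 then 0 else Ak n m (k - 1) * Lam (PP (k - 1) * PP q))"
 proof -
  have "[:- (a\<^sup>2), 1:] * (PP k * PP q) = ([:- (a\<^sup>2), 1:] * PP k) * PP q" by (simp only: mult.assoc)
  also have "... = smult ((real (Suc k))\<^sup>2) (PP (Suc k) * PP q) - smult (Ak n m k + (real k)\<^sup>2) (PP k * PP q) + (if k = 0 then 0 else smult (Ak n m (k - 1)) (PP (k - 1) * PP q))"
  unfolding PP_rec by (simp add: distrib_right left_diff_distrib)
  finally have e: "[:- (a\<^sup>2), 1:] * (PP k * PP q) = smult ((real (Suc k))\<^sup>2) (PP (Suc k) * PP q) - smult (Ak n m k + (real k)\<^sup>2) (PP k * PP q) + (if k = 0 then 0 else smult (Ak n m (k - 1)) (PP (k - 1) * PP q))" .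
  show ?thesis unfolding e Lam_add Lam_diff Lam_if Lam_smult ..
 qed
 have e: "(real (Suc q))\<^sup>2 * Lam (PP k * PP (Suc q)) = (real (Suc k))\<^sup>2 * Lam (PP (Suc k) * PP q) - (Ak n m k + (real k)\<^sup>2) * Lam (PP k * PP q) + (if k = 0 then 0 else Ak n m (k - 1) * Lam (PP (k - 1) * PP q))
  + (Ak n m q + (real q)\<^sup>2) * Lam (PP k * PP q) - (if Suc k = q then Ak n m k * (M0 * Nk n m k) else 0)"
  using r1 r2 unfolding IHp by linarith
 have "(real (Suc q))\<^sup>2 * Lam (PP k * PP (Suc q)) = (real (Suc q))\<^sup>2 * (if k = Suc q then M0 * Nk n m k else 0)"
 proof -
  consider "Suc k = q" | "k = q" | "k = Suc q" | "Suc k ~= q" "k ~= q" "k ~= Suc q" by blast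
  then show ?thesis
  proof cases
  case 1
  then show ?thesis using Nk_Suc[of k] unfolding e IHq by (auto simp del: of_nat_Suc)
  next
  case 2
  then show ?thesis unfolding e IHq by (cases k) (auto simp del: of_nat_Suc)
  next
  case 3
  then show ?thesis using Nk_Suc[of q] unfolding e IHq by (auto simp del: of_nat_Suc)
  next
  case 4
  then show ?thesis unfolding e IHq by (cases k) (auto simp del: of_nat_Suc)
  qed
 qed
 then show ?thesis using Suc by auto
 qed
qed

lemma M0_pos: "M0 > 0"
proof -
 have "(\<integral>y. wd y \<partial>lborel) > 0"
 proof -
 have i: "integrable lborel wd" using poly_wd_integrable[of 1] by simp
 have "(\<integral>y. wd y \<partial>lborel) ~= 0"
 proof
  assume "(\<integral>y. wd y \<partial>lborel) = 0"
  then have "AE y in lborel. wd y = 0" using integral_nonneg_eq_0_iff_AE[OF i] wd_nonneg by simp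
  then have "AE y in lborel. y \<notin> {0<..<1::real}" by eventually_elim (use wd_pos in force)
  moreover have "(AE y in lborel. y \<notin> {0<..<1::real}) \<longleftrightarrow> emeasure lborel {0<..<1::real} = 0" by (rule AE_iff_measurable) auto
  ultimately show False by simp
 qed
 then show ?thesis using Bochner_Integration.integral_nonneg[of lborel wd] wd_nonneg by fastforce
 qed
 moreover have "(\<Sum>j<J. ms j) \<ge> 0" by (intro sum_nonneg) (use ms_pos in \<open>auto intro: less_imp_le\<close>)
 ultimately show ?thesis by (simp add: M0_def Lam_def add_pos_nonneg)
qed

end

section \<open>The measure \<open>mu\<close>: integrals, null sets and completeness\<close>

lemma cont_wt_pos:
 assumes y: "y > 0" shows "cont_wt n m y > 0"
proof -
 have nz: "cr p + \<i> * cr y \<notin> \<int>\<^sub>\<le>\<^sub>0" for p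
 using y by (auto elim!: nonpos_Ints_cases simp: complex_eq_iff)
 have nz2: "2 * \<i> * cr y \<notin> \<int>\<^sub>\<le>\<^sub>0"
 using y by (auto elim!: nonpos_Ints_cases simp: complex_eq_iff)
 show ?thesis unfolding cont_wt_def using pi_gt_zero by (simp add: Gamma_eq_zero_iff nz nz2)
qed

lemma pochhammer_sign:
 fixes x :: real
 assumes "!!i. i < j ==> x + real i < 0" shows "pochhammer x j * (- 1) ^ j > 0"
 using assms
proof (induction j)
 case (Suc j)
 have IH: "pochhammer x j * (- 1) ^ j > 0" by (rule Suc.IH) (use Suc.prems in force)
 have "pochhammer x (Suc j) * (- 1) ^ Suc j = (pochhammer x j * (- 1) ^ j) * - (x + real j)" by (simp add: pochhammer_Suc algebra_simps)
 also have "... > 0" by (rule mult_pos_pos[OF IH]) (use Suc.prems[of j] in simp)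
 finally show ?case .
qed simp

text \<open>Every measurable set of \<open>mu\<close> splits into a part of the half line and finitely many atoms; on the
 former \<open>mu\<close> agrees with the image of a weighted Lebesgue measure.\<close>

definition half_line :: "complex set" where "half_line = cr ` {0<..}"

lemma half_line_eq: "half_line = {z. Im z = 0 \<and> 0 < Re z}"
 by (auto simp: half_line_def image_iff complex_eq_iff)

lemma half_line_borel [measurable]: "half_line \<in> sets borel"
 unfolding half_line_eq by measurable

definition line_measure :: "nat => nat => complex measure" where
 "line_measure n m = distr (density lborel (%y. ennreal (indicator {0<..} y * cont_wt n m y))) borel cr"

lemma disc_pt_not_half_line: "disc_pt n m j \<notin> half_line"
 by (simp add: half_line_eq disc_pt_def)

lemma spec_set_half_line: "spec_set n m = half_line \<union> disc_pt n m ` disc_ind n m"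
 by (simp add: spec_set_def half_line_def)

lemma sets_muI: "A \<in> sets borel ==> A \<subseteq> spec_set n m ==> A \<in> sets (mu n m)"
 using spec_set_borel[of n m] by (simp add: sets_mu sets_restrict_space_iff)

lemma borel_measurable_mu: "h \<in> bmeas ==> h \<in> borel_measurable (mu n m)"
 using measurable_restrict_space1[of h borel borel "spec_set n m"] measurable_cong_sets[OF sets_mu refl] by blast

lemma emeasure_mu_half_line:
 assumes A: "A \<in> sets borel" "A \<subseteq> half_line"
 shows "emeasure (mu n m) A = emeasure (line_measure n m) A"
proof -
 note [measurable] = A(1)
 have [measurable]: "(%y. ennreal (indicator {0<..} y * cont_wt n m y)) \<in> bmeas" by auto
 have "emeasure (line_measure n m) A = emeasure (density lborel (%y. ennreal (indicator {0<..} y * cont_wt n m y))) (cr -` A)"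
 unfolding line_measure_def by (subst emeasure_distr) auto
 also have "... = (\<integral>\<^sup>+y. ennreal (indicator {0<..} y * cont_wt n m y) * indicator (cr -` A) y \<partial>lborel)"
 by (rule emeasure_density) (simp_all add: measurable_sets_borel[of cr borel A])
 also have "... = (\<integral>\<^sup>+x\<in>{0<..}. ennreal (cont_wt n m x) * indicator A (cr x) \<partial>lborel)"
 by (intro nn_integral_cong) (auto simp: indicator_def)
 also have "... = emeasure (mu n m) A"
 proof -
 have "A \<in> sets (mu n m)" using A by (intro sets_muI) (auto simp: spec_set_half_line)
 moreover have "indicator A (disc_pt n m j) = (0::ennreal)" for j using A(2) disc_pt_not_half_line[of n m j] by (auto simp: indicator_def)
 ultimately show ?thesis by (simp add: emeasure_mu)
 qed
 finally show ?thesis by simp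
qed

lemma restrict_space_mu_half_line: "restrict_space (mu n m) half_line = restrict_space (line_measure n m) half_line"
proof (rule measure_eqI)
 have hl: "half_line \<in> sets (mu n m)" by (intro sets_muI) (auto simp: spec_set_half_line)
 have hl2: "half_line \<inter> space (mu n m) = half_line" by (auto simp: spec_set_half_line)
 have s: "A \<in> sets (restrict_space (mu n m) half_line) \<longleftrightarrow> A \<in> sets borel \<and> A \<subseteq> half_line" for A
 proof -
 have "A \<in> sets (restrict_space (mu n m) half_line) \<longleftrightarrow> A \<in> sets (mu n m) \<and> A \<subseteq> half_line"
  by (subst sets_restrict_space_iff) (use hl in \<open>auto simp: hl2 simp del: space_mu\<close>)
 also have "A \<in> sets (mu n m) \<longleftrightarrow> A \<in> sets borel \<and> A \<subseteq> spec_set n m"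
  using spec_set_borel[of n m] by (auto simp: sets_mu sets_restrict_space_iff)
 finally show ?thesis by (auto simp: spec_set_half_line)
 qed
 have s': "A \<in> sets (restrict_space (line_measure n m) half_line) \<longleftrightarrow> A \<in> sets borel \<and> A \<subseteq> half_line" for A
 by (subst sets_restrict_space_iff) (auto simp: line_measure_def)
 show "sets (restrict_space (mu n m) half_line) = sets (restrict_space (line_measure n m) half_line)"
 using s s' by blast
 fix A assume A: "A \<in> sets (restrict_space (mu n m) half_line)"
 have "emeasure (restrict_space (mu n m) half_line) A = emeasure (mu n m) A"
 using A unfolding s by (subst emeasure_restrict_space) (use hl in \<open>auto simp: hl2 simp del: space_mu\<close>)
 also have "... = emeasure (line_measure n m) A" using A unfolding s by (intro emeasure_mu_half_line) auto
 also have "... = emeasure (restrict_space (line_measure n m) half_line) A"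
 using A unfolding s by (subst emeasure_restrict_space) (auto simp: line_measure_def)
 finally show "emeasure (restrict_space (mu n m) half_line) A = emeasure (restrict_space (line_measure n m) half_line) A" .
qed

lemma mu_half_line_integral:
 fixes h :: "complex => complex"
 assumes h: "h \<in> bmeas"
 shows "integrable (mu n m) (%z. indicator half_line z *\<^sub>R h z) \<longleftrightarrow> integrable lborel (%y. (indicator {0<..} y * cont_wt n m y) *\<^sub>R h (of_real y))"
 and "(\<integral>z. indicator half_line z *\<^sub>R h z \<partial>mu n m) = (\<integral>y. (indicator {0<..} y * cont_wt n m y) *\<^sub>R h (of_real y) \<partial>lborel)"
proof -
 note [measurable] = h
 have hl: "half_line \<inter> space (mu n m) \<in> sets (mu n m)" "half_line \<inter> space (line_measure n m) \<in> sets (line_measure n m)"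
 using sets_muI[of half_line n m] by (auto simp: spec_set_half_line line_measure_def Int_absorb2)
 have i: "(indicator {0<..} y * cont_wt n m y) *\<^sub>R indicator half_line (cr y) *\<^sub>R h (of_real y)
  = (indicator {0<..} y * cont_wt n m y) *\<^sub>R h (of_real y)" for y
 by (auto simp: indicator_def half_line_def)
 have nn: "AE y in lborel. 0 <= indicator {0<..} y * cont_wt n m y"
 using cont_wt_pos[of _ n m] by (intro AE_I2) (auto simp: indicator_def less_imp_le)
 have m: "(%z. indicator half_line z *\<^sub>R h z) \<in> bmeas" by measurable
 have mc: "(%y. indicator half_line (cr y) *\<^sub>R h (of_real y)) \<in> borel_measurable lborel" by measurable
 have cm: "(%y. indicator {0<..} y * cont_wt n m y) \<in> borel_measurable lborel" by auto
 have rm: "cr \<in> density lborel (%y. ennreal (indicator {0<..} y * cont_wt n m y)) \<rightarrow>\<^sub>M borel" by simp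
 show "integrable (mu n m) (%z. indicator half_line z *\<^sub>R h z) \<longleftrightarrow> integrable lborel (%y. (indicator {0<..} y * cont_wt n m y) *\<^sub>R h (of_real y))"
 unfolding integrable_restrict_space[OF hl(1), symmetric] restrict_space_mu_half_line integrable_restrict_space[OF hl(2)]
 unfolding line_measure_def integrable_distr_eq[OF rm m] integrable_density[OF mc cm nn] i ..
 show "(\<integral>z. indicator half_line z *\<^sub>R h z \<partial>mu n m) = (\<integral>y. (indicator {0<..} y * cont_wt n m y) *\<^sub>R h (of_real y) \<partial>lborel)"
 unfolding integral_restrict_space[OF hl(1), symmetric] restrict_space_mu_half_line integral_restrict_space[OF hl(2)]
 unfolding line_measure_def integral_distr[OF rm m] integral_density[OF mc cm nn] i ..
qed

context spectral_params
begin

abbreviation "pt \<equiv> disc_pt n m"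
abbreviation "cw y \<equiv> indicator {0<..} y * cont_wt n m y"
abbreviation "dw \<equiv> disc_wt n m"

lemma pt_eq: "pt j = \<i> * cr (c + real j)" by (simp add: disc_pt_def c_def)

lemma pt_inj: "pt i = pt j \<longleftrightarrow> i = j" by (simp add: pt_eq complex_eq_iff)

text \<open>Here c + b = 1 and c - b + 1 = 2 c, so (2 c)_j cancels; (c + 1)_j / (c)_j = (c + j) / c
  is a quotient of negative numbers, and the sign of (c - a + 1)_j is that of (-1)^j.\<close>

lemma dw_pos:
 assumes j: "j < J" shows "dw j > 0"
proof -
 define b where "b = par_b n m"
 have cj: "c + real j < 0" using j by (simp add: less_J_iff)
 have c0: "c < 0" using cj by linarith
 have b1: "c + b = 1" "b - c = 2 * d" "c - b + 1 = 2 * c" by (simp_all add: b_def c_d par_b_def d_def)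
 have d1: "d > 1/2" using c0 by (simp add: c_d)
 have ac: "a - c > 0" using a_nonneg c0 by simp
 define Q where "Q = pochhammer (c - a + 1) j"
 have Q: "Q * (-1) ^ j > 0" unfolding Q_def
 proof (rule pochhammer_sign)
 fix i assume "i < j"
 then have "c + real i + 1 <= c + real j" by linarith
 then show "c - a + 1 + real i < 0" using cj a_nonneg by linarith
 qed
 have Q': "(-1) ^ j / Q > 0" using Q by (auto simp: zero_less_mult_iff zero_less_divide_iff)
 have p1: "pochhammer (2 * c) j * (-1) ^ j > 0"
 proof (rule pochhammer_sign)
 fix i assume "i < j"
 then show "2 * c + real i < 0" using cj c0 by linarith
 qed
 have p2: "pochhammer c j * (-1) ^ j > 0"
 proof (rule pochhammer_sign)
 fix i assume "i < j"
 then show "c + real i < 0" using cj by linarith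
 qed
 have nz: "pochhammer (2 * c) j ~= 0" "pochhammer c j ~= 0" using p1 p2 by auto
 have r: "pochhammer (c + 1) j = pochhammer c j * ((c + real j) / c)"
 using pochhammer_rec[of c j] pochhammer_rec'[of c j] c0 by (simp add: field_simps)
 have "dw j = Gamma (a + c) * Gamma 1 * Gamma (2 * d) * Gamma (a - c) / Gamma (- 2 * c) *
  ((c + real j) / c * pochhammer 1 j * pochhammer (c + a) j * ((-1) ^ j / Q))"
 unfolding disc_wt_def Let_def b_def[symmetric] a_def[symmetric] c_def[symmetric] b1 Q_def[symmetric] r using nz by simp
 also have "... > 0"
 proof -
 have g: "Gamma (a + c) > 0" "Gamma 1 > (0::real)" "Gamma (2 * d) > 0" "Gamma (a - c) > 0" "Gamma (- 2 * c) > 0"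
  using a_c_pos d1 ac c0 by (auto intro: Gamma_real_pos)
 have p: "(c + real j) / c > 0" "pochhammer 1 j > (0::real)" "pochhammer (c + a) j > 0"
  using a_c_pos c0 cj by (auto intro: divide_neg_neg pochhammer_pos)
 show ?thesis
  by (rule mult_pos_pos[OF divide_pos_pos[OF mult_pos_pos[OF mult_pos_pos[OF mult_pos_pos[OF g(1,2)] g(3)] g(4)] g(5)]
   mult_pos_pos[OF mult_pos_pos[OF mult_pos_pos[OF p(1,2)] p(3)] Q']])
 qed
 finally show ?thesis .
qed

lemma measure_mu_pt:
 assumes j: "j < J" shows "emeasure (mu n m) {pt j} = ennreal (dw j)"
proof -
 have "{pt j} \<in> sets (mu n m)" using j by (intro sets_muI) (auto simp: spec_set_half_line disc_ind_eq)
 then have "emeasure (mu n m) {pt j} = (\<integral>\<^sup>+x\<in>{0<..}. ennreal (cont_wt n m x) * indicator {pt j} (cr x) \<partial>lborel)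
  + (\<Sum>i\<in>disc_ind n m. ennreal (dw i) * indicator {pt j} (pt i))" by (rule emeasure_mu)
 also have "(%x. ennreal (cont_wt n m x) * indicator {pt j} (cr x) * indicator {0<..} x) = (%x. 0)"
 by (auto simp: indicator_def pt_eq complex_eq_iff)
 also have "(\<Sum>i\<in>disc_ind n m. ennreal (dw i) * indicator {pt j} (pt i)) = (\<Sum>i\<in>disc_ind n m. if i = j then ennreal (dw i) else 0)"
 by (intro sum.cong refl) (simp add: indicator_def pt_inj)
 finally show ?thesis using j by (simp add: disc_ind_eq)
qed

text \<open>h is split into its part on the half line and a finite sum T over the atoms; T is always
  integrable, so integrability is decided on the line.\<close>

lemma mu_integral:
 fixes h :: "complex => complex"
 assumes h: "h \<in> bmeas"
 shows mu_integrable_iff: "integrable (mu n m) h \<longleftrightarrow> integrable lborel (%y. cw y *\<^sub>R h (of_real y))"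
 and mu_integral_eq: "integrable lborel (%y. cw y *\<^sub>R h (of_real y)) ==>
  (\<integral>z. h z \<partial>mu n m) = (\<integral>y. cw y *\<^sub>R h (of_real y) \<partial>lborel) + (\<Sum>j<J. dw j *\<^sub>R h (pt j))"
proof -
 define T where "T z = (\<Sum>j<J. indicator {pt j} z *\<^sub>R h (pt j))" for z
 have fin: "{pt j} \<in> sets (mu n m)" "emeasure (mu n m) {pt j} < \<infinity>" if "j < J" for j
 using that by (auto intro!: sets_muI simp: spec_set_half_line disc_ind_eq measure_mu_pt)
 have split: "h z = indicator half_line z *\<^sub>R h z + T z" if z: "z \<in> space (mu n m)" for z
 proof (cases "z \<in> half_line")
 case True
 then have "!!j. z ~= pt j" using disc_pt_not_half_line by blast
 then show ?thesis using True by (simp add: T_def)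
 next
 case False
 then obtain j where j: "j < J" "z = pt j" using z by (auto simp: spec_set_half_line disc_ind_eq)
 have "T z = (\<Sum>i<J. if i = j then h (pt i) else 0)" unfolding T_def by (intro sum.cong refl) (auto simp: j pt_inj)
 then show ?thesis using False j by simp
 qed
 have Ti: "integrable (mu n m) T" unfolding T_def[abs_def]
 by (intro Bochner_Integration.integrable_sum integrable_scaleR_left integrable_real_indicator fin) auto
 have Tv: "integral\<^sup>L (mu n m) T = (\<Sum>j<J. dw j *\<^sub>R h (pt j))"
 proof -
 have "integral\<^sup>L (mu n m) T = (\<Sum>j<J. (\<integral>z. indicator {pt j} z *\<^sub>R h (pt j) \<partial>mu n m))"
  unfolding T_def[abs_def] by (intro Bochner_Integration.integral_sum integrable_scaleR_left integrable_real_indicator fin) auto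
 also have "... = (\<Sum>j<J. measure (mu n m) {pt j} *\<^sub>R h (pt j))"
  using fin sets.sets_into_space[OF fin(1)] by (intro sum.cong refl) (simp add: Int_absorb2)
 also have "... = (\<Sum>j<J. dw j *\<^sub>R h (pt j))"
  using dw_pos by (intro sum.cong refl) (simp add: measure_def measure_mu_pt less_imp_le)
 finally show ?thesis .
 qed
 have iff: "integrable (mu n m) h \<longleftrightarrow> integrable (mu n m) (%z. indicator half_line z *\<^sub>R h z)"
 proof
 assume "integrable (mu n m) h"
 then have "integrable (mu n m) (%z. h z - T z)" using Ti by simp
 moreover have "integrable (mu n m) (%z. h z - T z) \<longleftrightarrow> integrable (mu n m) (%z. indicator half_line z *\<^sub>R h z)"
  by (intro Bochner_Integration.integrable_cong refl diff_eq_eq[THEN iffD2, OF split])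
 ultimately show "integrable (mu n m) (%z. indicator half_line z *\<^sub>R h z)" by blast
 next
 assume "integrable (mu n m) (%z. indicator half_line z *\<^sub>R h z)"
 then have "integrable (mu n m) (%z. indicator half_line z *\<^sub>R h z + T z)" using Ti by simp
 then show "integrable (mu n m) h"
  by (subst Bochner_Integration.integrable_cong[OF refl, OF split]) auto
 qed
 then show "integrable (mu n m) h \<longleftrightarrow> integrable lborel (%y. cw y *\<^sub>R h (of_real y))"
 using mu_half_line_integral(1)[OF h] by simp
 assume "integrable lborel (%y. cw y *\<^sub>R h (of_real y))"
 then have i: "integrable (mu n m) (%z. indicator half_line z *\<^sub>R h z)" using mu_half_line_integral(1)[OF h] by simp
 have "(\<integral>z. h z \<partial>mu n m) = (\<integral>z. indicator half_line z *\<^sub>R h z + T z \<partial>mu n m)"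
 by (intro Bochner_Integration.integral_cong refl split)
 also have "... = (\<integral>z. indicator half_line z *\<^sub>R h z \<partial>mu n m) + integral\<^sup>L (mu n m) T" using i Ti by simp
 finally show "(\<integral>z. h z \<partial>mu n m) = (\<integral>y. cw y *\<^sub>R h (of_real y) \<partial>lborel) + (\<Sum>j<J. dw j *\<^sub>R h (pt j))"
 unfolding Tv mu_half_line_integral(2)[OF h] .
qed

lemma cw_nonneg: "cw y \<ge> 0"
 using cont_wt_pos[of y n m] by (auto simp: indicator_def less_imp_le)

lemma mu_null:
 fixes h :: "complex => complex"
 assumes h [measurable]: "h \<in> bmeas"
 and line: "AE y in lborel. y > 0 --> h (of_real y) = 0" and atoms: "!!j. j < J ==> h (pt j) = 0"
 shows "AE z in mu n m. h z = 0"
proof -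
 \<comment> \<open>A bounded substitute with the same zeros as h, so that integrability does not
   depend on the growth of h.\<close>
 define g where "g z = cr (cmod (h z) / (1 + cmod (h z)))" for z
 have g: "g \<in> bmeas" unfolding g_def[abs_def] by measurable
 have g0: "g z = 0 \<longleftrightarrow> h z = 0" for z
 proof -
 have "1 + cmod (h z) ~= 0" using norm_ge_zero[of "h z"] by linarith
 then show ?thesis unfolding g_def of_real_eq_0_iff by simp
 qed
 have ae: "AE y in lborel. cw y *\<^sub>R g (of_real y) = 0" using line by eventually_elim (auto simp: g0 indicator_def)
 have i: "integrable lborel (%y. cw y *\<^sub>R g (of_real y))"
 proof -
 have "(%y. cw y *\<^sub>R g (of_real y)) \<in> borel_measurable lborel" using g by auto
 then show ?thesis by (subst integrable_cong_AE[OF _ _ ae]) auto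
 qed
 have "(\<integral>z. g z \<partial>mu n m) = (\<integral>y. cw y *\<^sub>R g (of_real y) \<partial>lborel) + (\<Sum>j<J. dw j *\<^sub>R g (pt j))" by (rule mu_integral_eq[OF g i])
 also have "(\<integral>y. cw y *\<^sub>R g (of_real y) \<partial>lborel) = 0" using integral_eq_zero_AE[OF ae] .
 also have "(\<Sum>j<J. dw j *\<^sub>R g (pt j)) = 0" using atoms by (intro sum.neutral) (simp add: g0)
 finally have z: "(\<integral>z. g z \<partial>mu n m) = 0" by simp
 have gi: "integrable (mu n m) g" using mu_integrable_iff[OF g] i by simp
 have gr: "(\<integral>z. Re (g z) \<partial>mu n m) = 0" using z integral_Re[OF gi] by simp
 have "AE z in mu n m. 0 <= Re (g z)" unfolding g_def Re_complex_of_real by (intro AE_I2 divide_nonneg_nonneg) auto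
 then have "AE z in mu n m. Re (g z) = 0" using integral_nonneg_eq_0_iff_AE[OF integrable_Re[OF gi]] gr by simp
 then show ?thesis
 proof eventually_elim
 case (elim z)
 then have "g z = 0" by (simp only: g_def Re_complex_of_real of_real_0)
 then show ?case by (simp add: g0)
 qed
qed

lemma mu_measurable_extension:
 assumes "\<phi> \<in> borel_measurable (mu n m)"
 obtains \<phi>' :: "complex => complex" where "\<phi>' \<in> bmeas" "!!z. z \<in> spec_set n m ==> \<phi>' z = \<phi> z"
proof
 have "\<phi> \<in> borel_measurable (restrict_space borel (spec_set n m))"
 using assms measurable_cong_sets[OF sets_mu refl] by blast
 then show "(%z. indicator (spec_set n m) z *\<^sub>R \<phi> z) \<in> bmeas"
 using spec_set_borel[of n m] by (subst borel_measurable_restrict_space_iff[symmetric]) auto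
qed simp

abbreviation "xs j \<equiv> (c + real j)\<^sup>2"

lemma xs_inj: "i < J ==> j < J ==> xs i = xs j \<longleftrightarrow> i = j"
 unfolding less_J_iff by (auto simp: power2_eq_iff)

lemma integral_half_line_even:
 fixes v :: "real => real"
 assumes v: "integrable lborel v" and e: "!!y. v (- y) = v y"
 shows "(\<integral>y. v y \<partial>lborel) = 2 * (\<integral>y. indicator {0<..} y * v y \<partial>lborel)"
proof -
 have i: "integrable lborel (%y. indicator A y * v y)" if "A \<in> sets borel" for A
 using integrable_mult_indicator[of A lborel v] v that by simp
 have "(\<integral>y. v y \<partial>lborel) = (\<integral>y. indicator {0<..} y * v y + indicator {..<0} y * v y \<partial>lborel)"
 proof (rule integral_cong_AE)
 show "AE y in lborel. v y = indicator {0<..} y * v y + indicator {..<0} y * v y"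
  using AE_lborel_singleton[of "0::real"] by eventually_elim (auto simp: indicator_def)
 qed (use v in auto)
 also have "... = (\<integral>y. indicator {0<..} y * v y \<partial>lborel) + (\<integral>y. indicator {..<0} y * v y \<partial>lborel)"
 by (rule Bochner_Integration.integral_add[OF i i]) auto
 also have "(\<integral>y. indicator {..<0} y * v y \<partial>lborel) = (\<integral>y. indicator {..<0} (- y) * v (- y) \<partial>lborel)"
 using lborel_integral_real_affine[of "-1" "%y. indicator {..<0} y * v y" 0] by simp
 also have "(%y. indicator {..<0} (- y) * v (- y)) = (%y. indicator {0<..} y * v y)" by (auto simp: e indicator_def)
 finally show ?thesis by simp
qed

lemma integrable_even_extension:
 fixes g :: "real => real"
 assumes "integrable lborel (%y. indicator {0<..} y * g y)"
 shows "integrable lborel (%y. indicator {0<..} \<bar>y\<bar> * g \<bar>y\<bar>)"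
proof -
 have "integrable lborel (%y. indicator {0<..} (0 + (-1) * y) * g (0 + (-1) * y))"
 using lborel_integrable_real_affine_iff[of "-1" "%y. indicator {0<..} y * g y" 0] assms by simp
 with assms have "integrable lborel (%y. indicator {0<..} y * g y + indicator {0<..} (- y) * g (- y))" by simp
 also have "(%y. indicator {0<..} y * g y + indicator {0<..} (- y) * g (- y)) = (%y. indicator {0<..} \<bar>y\<bar> * g \<bar>y\<bar>)"
 by (auto simp: indicator_def abs_if)
 finally show ?thesis .
qed

text \<open>The polynomial Q vanishes at all atoms and at no point of the half line, so testing with
  multiples of Q isolates the line part; its even extension has vanishing even moments and
  \<open>even_function_moments_zero_AE\<close> applies. Once the line part is gone, the product over
  the other atoms isolates each atom.\<close>

lemma moments_zero_real:
 fixes r :: "real => real" and q :: "nat => real"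
 assumes r: "(%y. indicator {0<..} y * r y) \<in> bmeas"
 and int: "!!p. integrable lborel (%y. indicator {0<..} y * (r y * poly p (- (y\<^sup>2)) * exp \<bar>y\<bar>))"
 and zero: "!!p. (\<integral>y. indicator {0<..} y * (r y * poly p (- (y\<^sup>2))) \<partial>lborel) + (\<Sum>j<J. q j * poly p (xs j)) = 0"
 shows "AE y in lborel. y > 0 --> r y = 0" and "!!j. j < J ==> q j = 0"
proof -
 define Q where "Q = (\<Prod>j<J. [:- xs j, 1:])"
 have Q_xs: "poly Q (xs j) = 0" if "j < J" for j
 unfolding Q_def poly_prod using that by (intro prod_zero) auto
 have Q_nz: "poly Q (- (y\<^sup>2)) ~= 0" if "y > 0" for y
 proof -
 have "- (y\<^sup>2) - xs j < 0" for j using that zero_less_power[of y 2] zero_le_power2[of "c + real j"] by linarith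
 then show ?thesis unfolding Q_def poly_prod by (auto simp: algebra_simps) (metis less_irrefl)
 qed
 define u where "u y = indicator {0<..} \<bar>y\<bar> * (r \<bar>y\<bar> * poly Q (- (y\<^sup>2)))" for y
 have u_even: "u (- y) = u y" for y by (simp add: u_def)
 have mp [measurable]: "(%y::real. poly p (- (y\<^sup>2))) \<in> bmeas" for p
 by (intro borel_measurable_continuous_onI continuous_intros)
 have u_meas [measurable]: "u \<in> bmeas"
 proof -
 have "(%y. (%y. indicator {0<..} y * r y) \<bar>y\<bar> * poly Q (- (y\<^sup>2))) \<in> bmeas"
  using measurable_compose[OF borel_measurable_abs[OF measurable_ident_sets[OF refl]] r] by measurable
 then show ?thesis by (simp add: u_def[abs_def] mult.assoc)
 qed
 have ui: "integrable lborel (%y. \<bar>u y\<bar> * exp (1 * \<bar>y\<bar>))"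
 using integrable_abs[OF integrable_even_extension[OF int[of Q]]] by (simp add: u_def abs_mult mult_ac)
 have uk: "(\<integral>y. u y * y ^ (2 * k) \<partial>lborel) = 0" for k
 proof -
 define p where "p = Q * [:0, -1:] ^ k"
 have pk: "poly p (- (y\<^sup>2)) = poly Q (- (y\<^sup>2)) * y ^ (2 * k)" for y :: real by (simp add: p_def power_mult)
 have i: "integrable lborel (%y. u y * y ^ (2 * k))"
 proof (rule Bochner_Integration.integrable_bound[OF integrable_even_extension[OF int[of p]]])
  have e: "norm (u y * y ^ (2 * k)) <= norm (u y * y ^ (2 * k)) * exp \<bar>y\<bar>" for y by (simp add: mult_le_cancel_left1)
  then show "AE y in lborel. norm (u y * y ^ (2 * k)) <= norm (indicator {0<..} \<bar>y\<bar> * (r \<bar>y\<bar> * poly p (- (\<bar>y\<bar>\<^sup>2)) * exp \<bar>\<bar>y\<bar>\<bar>))"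
  unfolding power2_abs pk by (intro AE_I2 order_trans[OF e]) (simp add: u_def abs_mult mult_ac)
 qed measurable
 have "(\<integral>y. u y * y ^ (2 * k) \<partial>lborel) = 2 * (\<integral>y. indicator {0<..} y * (u y * y ^ (2 * k)) \<partial>lborel)"
  by (rule integral_half_line_even[OF i]) (simp add: u_even)
 also have "(%y. indicator {0<..} y * (u y * y ^ (2 * k))) = (%y. indicator {0<..} y * (r y * poly p (- (y\<^sup>2))))"
  by (auto simp: u_def pk indicator_def)
 also have "2 * (\<integral>y. indicator {0<..} y * (r y * poly p (- (y\<^sup>2))) \<partial>lborel) = 0"
  using zero[of p] by (simp add: p_def Q_xs)
 finally show ?thesis .
 qed
 have "AE y in lborel. u y = 0" by (rule even_function_moments_zero_AE[OF u_meas zero_less_one ui u_even uk])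
 then show line: "AE y in lborel. y > 0 --> r y = 0"
 by eventually_elim (auto simp: u_def Q_nz)
 fix j assume j: "j < J"
 define p where "p = (\<Prod>i\<in>{..<J} - {j}. [:- xs i, 1:])"
 have 0: "(\<integral>y. indicator {0<..} y * (r y * poly p (- (y\<^sup>2))) \<partial>lborel) = 0"
 by (rule integral_eq_zero_AE) (use line in eventually_elim, auto simp: indicator_def)
 have "poly p (xs i) = 0" if "i < J" "i ~= j" for i unfolding p_def poly_prod using that by (intro prod_zero) auto
 then have "(\<Sum>i<J. q i * poly p (xs i)) = (\<Sum>i<J. if i = j then q i * poly p (xs i) else 0)" by (intro sum.cong) auto
 then have "q j * poly p (xs j) = 0" using zero[of p] 0 j by simp
 moreover have "poly p (xs j) ~= 0" unfolding p_def poly_prod using j xs_inj by (auto simp: prod_zero_iff)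
 ultimately show "q j = 0" by simp
qed

text \<open>Multiplication by x preserves the span of the \<open>PP k\<close>, so Z kills p times
  \<open>PP k\<close> for every p by induction on p; k = 0 is the claim.\<close>

lemma linear_functional_PP_zero:
 fixes Z :: "real poly => complex"
 assumes add: "!!p q. Z (p + q) = Z p + Z q" and smult: "!!r p. Z (smult r p) = of_real r * Z p" and PP: "!!k. Z (PP k) = 0"
 shows "Z p = 0"
proof -
 have "\<forall>k. Z (p * PP k) = 0"
 proof (induction p)
 case 0
 then show ?case using smult[of 0 0] by simp
 next
 case (pCons b p)
 show ?case
 proof
  fix k
  have "[:0, 1:] * PP k = [:- (a\<^sup>2), 1:] * PP k + smult (a\<^sup>2) (PP k)"
  by (simp flip: smult_add_left)
  then have x: "[:0, 1:] * PP k = smult ((real (Suc k))\<^sup>2) (PP (Suc k)) + smult (a\<^sup>2 - (Ak n m k + (real k)\<^sup>2)) (PP k) + (if k = 0 then 0 else smult (Ak n m (k - 1)) (PP (k - 1)))"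
  unfolding PP_rec by (simp add: smult_diff_left algebra_simps)
  have "pCons b p * PP k = smult b (PP k) + p * ([:0, 1:] * PP k)" by simp
  also have "p * ([:0, 1:] * PP k) = smult ((real (Suc k))\<^sup>2) (p * PP (Suc k)) + smult (a\<^sup>2 - (Ak n m k + (real k)\<^sup>2)) (p * PP k) + smult (if k = 0 then 0 else Ak n m (k - 1)) (p * PP (k - 1))"
  unfolding x by (simp add: distrib_left)
  finally show "Z (pCons b p * PP k) = 0" using pCons by (simp only: add smult PP) simp
 qed
 qed
 then show ?thesis by (metis PP.simps(1) mult.right_neutral)
qed

text \<open>\<open>sw\<close> is the square root of the density with respect to \<open>mu\<close> of the measure defining \<open>Lam\<close>;
 \<open>wd / cw\<close> is \<open>0\<close> off the half line.\<close>

definition sw :: "complex => real" where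
 "sw z = (if Im z = 0 then sqrt (wd (Re z) / cw (Re z)) else \<Sum>j<J. if z = pt j then sqrt (ms j / dw j) else 0)"

text \<open>The spectral variable - z^2. It is real on the support, and the real part makes
  \<open>us\<close> real everywhere.\<close>

definition us :: "complex => real" where "us z = Re (- (z\<^sup>2))"

lemma us_simps: "us (of_real y) = - (y\<^sup>2)" "us (pt j) = xs j"
 by (simp_all add: us_def pt_eq power2_eq_square)

lemma us_spec: "z \<in> spec_set n m ==> - z\<^sup>2 = of_real (us z)"
 by (auto simp: spec_set_half_line half_line_def us_simps disc_ind_eq) (auto simp: pt_eq power_mult_distrib)

lemma sw_line: "y > 0 ==> cw y * (sw (of_real y))\<^sup>2 = wd y"
 using cont_wt_pos[of y n m] wd_nonneg[of y] by (simp add: sw_def)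

lemma sw_pt: "j < J ==> sw (pt j) = sqrt (ms j / dw j)"
proof -
 assume j: "j < J"
 then have "Im (pt j) ~= 0" by (simp add: pt_eq less_J_iff)
 moreover have "(\<Sum>i<J. if pt j = pt i then sqrt (ms i / dw i) else 0) = (\<Sum>i<J. if i = j then sqrt (ms i / dw i) else 0)"
 by (intro sum.cong refl) (auto simp: pt_inj)
 ultimately show ?thesis using j by (simp add: sw_def)
qed

lemma sw_pos: "y > 0 ==> sw (of_real y) > 0" "j < J ==> sw (pt j) > 0"
 using cont_wt_pos[of y n m] wd_pos[of y] ms_pos dw_pos by (simp_all add: sw_pt) (simp add: sw_def)

lemma measurable_sw [measurable]: "sw \<in> bmeas"
 unfolding sw_def[abs_def] by auto

lemma measurable_us [measurable]: "us \<in> bmeas"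
 unfolding us_def[abs_def] by (intro borel_measurable_continuous_onI continuous_intros)

lemma measurable_poly_us [measurable]: "(%z. poly p (us z)) \<in> bmeas"
 unfolding us_def by (intro borel_measurable_continuous_onI continuous_intros)

definition PE :: "real poly => complex => complex" where "PE p z = of_real (sw z * poly p (us z))"

lemma measurable_PE [measurable]: "PE p \<in> bmeas"
 unfolding PE_def[abs_def] by measurable

lemma PE_add: "PE (p + q) z = PE p z + PE q z" by (simp add: PE_def distrib_left)
lemma PE_smult: "PE (smult r p) z = of_real r * PE p z" by (simp add: PE_def)

lemma PE_product_line: "cw y *\<^sub>R (PE p (of_real y) * cnj (PE q (of_real y))) = of_real (indicator {0<..} y * (poly (p * q) (- (y\<^sup>2)) * wd y))"
proof (cases "y > 0")
 case True
 have "cw y *\<^sub>R (PE p (of_real y) * cnj (PE q (of_real y))) = of_real ((cw y * (sw (of_real y))\<^sup>2) * poly (p * q) (- (y\<^sup>2)))"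
 by (simp add: PE_def us_simps power2_eq_square scaleR_conv_of_real)
 then show ?thesis unfolding sw_line[OF True] using True by simp
qed simp

text \<open>The square of \<open>sw\<close> times the weight of \<open>mu\<close> is
  \<open>wd\<close> on the line and \<open>ms\<close> at the atoms; the factor 1/2 in
  \<open>Lam\<close> passes from the whole line to the half line, the integrand being even.\<close>

lemma PE_product:
 shows PE_integrable: "integrable (mu n m) (%z. PE p z * cnj (PE q z))"
 and lip_PE: "lip (mu n m) (PE p) (PE q) = of_real (Lam (p * q))"
proof -
 have h: "(%z. PE p z * cnj (PE q z)) \<in> bmeas" by measurable
 have i0: "integrable lborel (%y. indicator {0<..} y * (poly (p * q) (- (y\<^sup>2)) * wd y))"
 using integrable_mult_indicator[of "{0<..}" lborel, OF _ poly_wd_integrable[of "p * q"]] by simp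
 have i: "integrable lborel (%y. cw y *\<^sub>R (PE p (of_real y) * cnj (PE q (of_real y))))"
 unfolding PE_product_line using integrable_of_real[OF i0] .
 then show "integrable (mu n m) (%z. PE p z * cnj (PE q z))" using mu_integrable_iff[OF h] by simp
 have at: "dw j *\<^sub>R (PE p (pt j) * cnj (PE q (pt j))) = of_real (poly (p * q) (xs j) * ms j)" if j: "j < J" for j
 proof -
 have "dw j *\<^sub>R (PE p (pt j) * cnj (PE q (pt j))) = of_real (dw j * (sw (pt j))\<^sup>2 * poly (p * q) (xs j))"
  by (simp add: PE_def us_simps power2_eq_square scaleR_conv_of_real)
 also have "dw j * (sw (pt j))\<^sup>2 = ms j" using dw_pos[OF j] ms_pos[OF j] by (simp add: sw_pt[OF j])
 finally show ?thesis by simp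
 qed
 have "lip (mu n m) (PE p) (PE q) = (\<integral>y. cr (indicator {0<..} y * (poly (p * q) (- (y\<^sup>2)) * wd y)) \<partial>lborel) + (\<Sum>j<J. of_real (poly (p * q) (xs j) * ms j))"
 unfolding lip_def mu_integral_eq[OF h i] PE_product_line using at by (intro arg_cong2[where f = "(+)"] refl sum.cong) auto
 also have "... = of_real ((\<integral>y. indicator {0<..} y * (poly (p * q) (- (y\<^sup>2)) * wd y) \<partial>lborel) + (\<Sum>j<J. poly (p * q) (xs j) * ms j))"
 by (simp only: integral_complex_of_real of_real_add of_real_sum)
 also have "(\<integral>y. indicator {0<..} y * (poly (p * q) (- (y\<^sup>2)) * wd y) \<partial>lborel) = (\<integral>y. poly (p * q) (- (y\<^sup>2)) * wd y \<partial>lborel) / 2"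
 using integral_half_line_even[OF poly_wd_integrable[of "p * q"]] by (simp add: wd_even)
 finally show "lip (mu n m) (PE p) (PE q) = of_real (Lam (p * q))" by (simp add: Lam_def)
qed

lemma PE_L2: "PE p \<in> L2 (mu n m)"
proof -
 have "integrable (mu n m) (%z. cr ((cmod (PE p z))\<^sup>2))"
 using PE_integrable[of p p] by (simp only: complex_norm_square)
 then have "integrable (mu n m) (%z. (cmod (PE p z))\<^sup>2)" by (drule_tac integrable_Re) (simp only: Re_complex_of_real)
 then show ?thesis by (simp add: L2_def borel_measurable_mu[OF measurable_PE])
qed

text \<open>The product is at most the sum of two squares; the exponential goes with the polynomial
  factor, where exp (2 |y|) is harmless because 2 < pi.\<close>

lemma L2_exp_integrable:
 assumes f: "f \<in> L2 (mu n m)" and b: "f \<in> bmeas"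
 shows "integrable lborel (%y. cw y *\<^sub>R (f (of_real y) * PE p (of_real y) * of_real (exp \<bar>y\<bar>)))"
proof -
 note [measurable] = b
 have "integrable (mu n m) (%z. of_real ((cmod (f z))\<^sup>2) :: complex)" using L2_integrable[OF f] by fastforce
 then have "integrable lborel (%y. cw y *\<^sub>R cr ((cmod (f (of_real y)))\<^sup>2))"
 by (subst (asm) mu_integrable_iff) measurable
 then have "integrable lborel (%y. cr (cw y * (cmod (f (of_real y)))\<^sup>2))"
 by (simp add: scaleR_conv_of_real)
 then have i1: "integrable lborel (%y. cw y * (cmod (f (of_real y)))\<^sup>2)" by (drule_tac integrable_Re) (simp only: Re_complex_of_real)
 have i2: "integrable lborel (%y. indicator {0<..} y * (poly (p * p) (- (y\<^sup>2)) * wd y * exp (2 * \<bar>y\<bar>)))"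
 using integrable_mult_indicator[of "{0<..}" lborel, OF _ poly_wd_exp_integrable[of 2 "p * p"]] pi_gt3 by simp
 show ?thesis
 proof (rule Bochner_Integration.integrable_bound[OF Bochner_Integration.integrable_add[OF i1 i2]])
 have "norm (cw y *\<^sub>R (f (of_real y) * PE p (of_real y) * of_real (exp \<bar>y\<bar>))) <=
  norm (cw y * (cmod (f (of_real y)))\<^sup>2 + indicator {0<..} y * (poly (p * p) (- (y\<^sup>2)) * wd y * exp (2 * \<bar>y\<bar>)))" for y
 proof (cases "y > 0")
  case True
  define g where "g = sw (of_real y) * poly p (- (y\<^sup>2)) * exp \<bar>y\<bar>"
  have g2: "cw y * g\<^sup>2 = poly (p * p) (- (y\<^sup>2)) * wd y * exp (2 * \<bar>y\<bar>)"
  unfolding sw_line[OF True, symmetric] g_def by (simp add: power2_eq_square exp_double)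
  have "norm (cw y *\<^sub>R (f (of_real y) * PE p (of_real y) * of_real (exp \<bar>y\<bar>))) = cw y * (cmod (f (of_real y)) * \<bar>g\<bar>)"
  unfolding norm_scaleR abs_of_nonneg[OF cw_nonneg] norm_mult PE_def norm_of_real us_simps g_def by (simp add: abs_mult)
  also have "... <= cw y * ((cmod (f (of_real y)))\<^sup>2 + g\<^sup>2)"
  proof (rule mult_left_mono[OF _ cw_nonneg])
  have "2 * (cmod (f (of_real y)) * \<bar>g\<bar>) <= (cmod (f (of_real y)))\<^sup>2 + g\<^sup>2"
   using sum_squares_bound[of "cmod (f (of_real y))" "\<bar>g\<bar>"] by (simp add: mult.assoc)
  moreover have "0 <= cmod (f (of_real y)) * \<bar>g\<bar>" by simp
  ultimately show "cmod (f (of_real y)) * \<bar>g\<bar> <= (cmod (f (of_real y)))\<^sup>2 + g\<^sup>2" by linarith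
  qed
  also have "... = cw y * (cmod (f (of_real y)))\<^sup>2 + poly (p * p) (- (y\<^sup>2)) * wd y * exp (2 * \<bar>y\<bar>)"
  unfolding distrib_left g2 ..
  finally show ?thesis using True by simp
 qed simp
 then show "AE y in lborel. norm (cw y *\<^sub>R (f (of_real y) * PE p (of_real y) * of_real (exp \<bar>y\<bar>))) <=
  norm (cw y * (cmod (f (of_real y)))\<^sup>2 + indicator {0<..} y * (poly (p * p) (- (y\<^sup>2)) * wd y * exp (2 * \<bar>y\<bar>)))" by simp
 qed measurable
qed

text \<open>The unbounded multiplier \<open>us - a\<^sup>2\<close> is allowed in this form of completeness so that it also
 characterizes the graph of the multiplication operator.\<close>

lemma PE_complete:
 assumes f: "f \<in> L2 (mu n m)" and g: "g \<in> L2 (mu n m)"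
 and zero: "!!k. lip (mu n m) f (PE (PP k)) + lip (mu n m) g (PE ([:- (a\<^sup>2), 1:] * PP k)) = 0"
 shows "AE z in mu n m. f z + of_real (us z - a\<^sup>2) * g z = 0"
proof -
 obtain f' where f': "f' \<in> bmeas" "!!z. z \<in> spec_set n m ==> f' z = f z"
 using mu_measurable_extension[OF L2_measurable[OF f]] by blast
 obtain g' where g': "g' \<in> bmeas" "!!z. z \<in> spec_set n m ==> g' z = g z"
 using mu_measurable_extension[OF L2_measurable[OF g]] by blast
 note [measurable] = f'(1) g'(1)
 have fL: "f' \<in> L2 (mu n m)" using f f' borel_measurable_mu[OF f'(1)]
 by (simp add: L2_def) (subst Bochner_Integration.integrable_cong[OF refl, of _ _ "%x. (cmod (f x))\<^sup>2"], auto)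
 have gL: "g' \<in> L2 (mu n m)" using g g' borel_measurable_mu[OF g'(1)]
 by (simp add: L2_def) (subst Bochner_Integration.integrable_cong[OF refl, of _ _ "%x. (cmod (g x))\<^sup>2"], auto)
 have lf: "lip (mu n m) f h = lip (mu n m) f' h" "lip (mu n m) g h = lip (mu n m) g' h" for h
 unfolding lip_def using f'(2) g'(2) by (auto intro!: Bochner_Integration.integral_cong)
 \<comment> \<open>h need not be in L2, as \<open>us\<close> is unbounded, but h times
   \<open>PE p\<close> is f' times \<open>PE p\<close> plus g' times \<open>PE (t * p)\<close> and
   hence integrable.\<close>
 define h where "h z = f' z + of_real (us z - a\<^sup>2) * g' z" for z
 have [measurable]: "h \<in> bmeas" unfolding h_def[abs_def] by measurable
 define t where "t = [:- (a\<^sup>2), 1:]"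
 have hp: "h z * PE p z = f' z * PE p z + g' z * PE (t * p) z" for z p
 by (simp add: h_def PE_def t_def algebra_simps)
 have cn: "cnj (PE p z) = PE p z" for p z by (simp add: PE_def)
 define Z where "Z p = (\<integral>z. h z * PE p z \<partial>mu n m)" for p
 have hi: "integrable (mu n m) (%z. h z * PE p z)" for p
 unfolding hp using L2_mult_integrable[OF fL PE_L2[of p]] L2_mult_integrable[OF gL PE_L2[of "t * p"]] by (simp add: cn)
 have Z0: "Z (PP k) = 0" for k
 proof -
 have i1: "integrable (mu n m) (%z. f' z * PE (PP k) z)" using L2_mult_integrable[OF fL PE_L2[of "PP k"]] by (simp only: cn)
 have i2: "integrable (mu n m) (%z. g' z * PE (t * PP k) z)" using L2_mult_integrable[OF gL PE_L2[of "t * PP k"]] by (simp only: cn)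
 show ?thesis unfolding Z_def hp Bochner_Integration.integral_add[OF i1 i2] using zero[of k] unfolding lf unfolding lip_def cn t_def .
 qed
 have Zp: "Z p = 0" for p
 proof (rule linear_functional_PP_zero[where Z = Z])
 show "Z (p + q) = Z p + Z q" for p q unfolding Z_def PE_add distrib_left by (rule Bochner_Integration.integral_add[OF hi hi])
 show "Z (smult r p) = of_real r * Z p" for r p unfolding Z_def PE_smult by (simp add: mult.left_commute)
 qed (rule Z0)
 have he: "integrable lborel (%y. cw y *\<^sub>R (h (of_real y) * PE p (of_real y) * of_real (exp \<bar>y\<bar>)))" for p
 unfolding hp distrib_right scaleR_add_right
 by (intro Bochner_Integration.integrable_add L2_exp_integrable fL gL f'(1) g'(1))
 have hl: "integrable lborel (%y. cw y *\<^sub>R (h (of_real y) * PE p (of_real y)))" for p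
 using hi[of p] by (subst (asm) mu_integrable_iff) measurable
 have Zs: "(\<integral>y. cw y *\<^sub>R (h (of_real y) * PE p (of_real y)) \<partial>lborel) + (\<Sum>j<J. dw j *\<^sub>R (h (pt j) * PE p (pt j))) = 0" for p
 proof -
 have "(%z. h z * PE p z) \<in> bmeas" by measurable
 from mu_integral_eq[OF this hl[of p]] show ?thesis using Zp[of p] by (simp add: Z_def)
 qed
 \<comment> \<open>Real and imaginary part are treated together as values of a real linear map R,
   since \<open>moments_zero_real\<close> is about real functions.\<close>
 have main: "(AE y in lborel. y > 0 --> R (h (of_real y)) = 0) \<and> (\<forall>j<J. R (h (pt j)) = 0)"
 if R: "bounded_linear (R :: complex => real)" for R
 proof -
 interpret R: bounded_linear R by fact
 have Rm: "R \<in> bmeas" using R.linear_axioms by (intro borel_measurable_continuous_onI linear_continuous_on R)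
 define r where "r y = cont_wt n m y * (sw (of_real y) * R (h (of_real y)))" for y
 have e1: "R (cw y *\<^sub>R (h (of_real y) * PE p (of_real y))) = indicator {0<..} y * (r y * poly p (- (y\<^sup>2)))" for y p
  using R.scaleR[of "cw y * sw (of_real y) * poly p (- (y\<^sup>2))" "h (of_real y)"]
  by (simp add: PE_def us_simps scaleR_conv_of_real r_def mult_ac)
 have e2: "R (cw y *\<^sub>R (h (of_real y) * PE p (of_real y) * of_real (exp \<bar>y\<bar>))) = indicator {0<..} y * (r y * poly p (- (y\<^sup>2)) * exp \<bar>y\<bar>)" for y p
  using R.scaleR[of "cw y * sw (of_real y) * poly p (- (y\<^sup>2)) * exp \<bar>y\<bar>" "h (of_real y)"]
  by (simp add: PE_def us_simps scaleR_conv_of_real r_def mult_ac)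
 have e3: "R (dw j *\<^sub>R (h (pt j) * PE p (pt j))) = (dw j * sw (pt j) * R (h (pt j))) * poly p (xs j)" for j p
  using R.scaleR[of "dw j * sw (pt j) * poly p (xs j)" "h (pt j)"]
  by (simp add: PE_def us_simps scaleR_conv_of_real mult_ac)
 have r: "(%y. indicator {0<..} y * r y) \<in> bmeas"
 proof -
  have "(%y. cw y * (sw (of_real y) * R (h (of_real y)))) \<in> bmeas" using Rm by auto
  then show ?thesis by (simp add: r_def mult.assoc)
 qed
 have i: "integrable lborel (%y. indicator {0<..} y * (r y * poly p (- (y\<^sup>2)) * exp \<bar>y\<bar>))" for p
  using integrable_bounded_linear[OF R he[of p]] unfolding e2 .
 have z: "(\<integral>y. indicator {0<..} y * (r y * poly p (- (y\<^sup>2))) \<partial>lborel) + (\<Sum>j<J. (dw j * sw (pt j) * R (h (pt j))) * poly p (xs j)) = 0" for p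
  using arg_cong[OF Zs[of p], of R] integral_bounded_linear[OF R hl[of p]] by (simp add: R.add R.sum R.zero e1 e3)
 have "AE y in lborel. y > 0 --> r y = 0" by (rule moments_zero_real(1)[OF r i z])
 then have "AE y in lborel. y > 0 --> R (h (of_real y)) = 0"
  by eventually_elim (use sw_pos(1) cont_wt_pos[of _ n m] in \<open>force simp: r_def\<close>)
 moreover have "R (h (pt j)) = 0" if j: "j < J" for j
  using moments_zero_real(2)[OF r i z j] dw_pos[OF j] sw_pos(2)[OF j] by simp
 ultimately show ?thesis by blast
 qed
 have "AE z in mu n m. h z = 0"
 proof (rule mu_null)
 have "AE y in lborel. y > 0 --> Re (h (of_real y)) = 0" "AE y in lborel. y > 0 --> Im (h (of_real y)) = 0"
  using main[OF bounded_linear_Re] main[OF bounded_linear_Im] by auto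
 then show "AE y in lborel. y > 0 --> h (of_real y) = 0" by eventually_elim (simp add: complex_eq_iff)
 show "h (pt j) = 0" if "j < J" for j
  using that main[OF bounded_linear_Re] main[OF bounded_linear_Im] by (simp add: complex_eq_iff)
 qed measurable
 then show ?thesis by (rule AE_mp) (auto intro!: AE_I2 simp: h_def f' g')
qed

text \<open>The factor turns the square norms M0 times \<open>Nk\<close> into \<open>Nk\<close>,
  those of the \<open>pk\<close> in H.\<close>

definition EE :: "nat => complex => complex" where "EE k z = of_real (1 / sqrt M0) * PE (PP k) z"

lemma EE_L2: "EE k \<in> L2 (mu n m)" unfolding EE_def[abs_def] by (rule L2_scale[OF PE_L2])

lemma lip_EE_right: "lip (mu n m) f (EE k) = of_real (1 / sqrt M0) * lip (mu n m) f (PE (PP k))"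
proof -
 have "lip (mu n m) f (EE k) = cnj (lip (mu n m) (EE k) f)" by (rule lip_cnj)
 also have "... = of_real (1 / sqrt M0) * cnj (lip (mu n m) (PE (PP k)) f)" unfolding EE_def[abs_def] lip_scale_left by simp
 finally show ?thesis by (simp flip: lip_cnj)
qed

lemma EE_orthogonal: "L2_orthogonal (mu n m) EE (Nk n m)"
proof
 show "EE k \<in> L2 (mu n m)" for k by (rule EE_L2)
 have m: "0 < real m / 2" "0 < real n / 2" using m1 mn by auto
 show "Nk n m k > 0" for k unfolding Nk_def using pochhammer_pos[OF m(1), of k] pochhammer_pos[OF m(2), of k] by simp
 show "lip (mu n m) (EE j) (EE k) = (if j = k then of_real (Nk n m k) else 0)" for j k
 proof -
 have "lip (mu n m) (EE j) (EE k) = of_real (1 / sqrt M0 * (1 / sqrt M0) * Lam (PP j * PP k))"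
  unfolding lip_EE_right unfolding EE_def[abs_def] lip_scale_left lip_PE by (simp only: of_real_mult mult.assoc)
 then show ?thesis using M0_pos by (simp add: Lam_PP_PP flip: real_sqrt_mult)
 qed
 fix f assume f: "f \<in> L2 (mu n m)" and z: "!!k. lip (mu n m) f (EE k) = 0"
 have "lip (mu n m) f (PE (PP k)) = 0" for k using z[of k] M0_pos unfolding lip_EE_right by simp
 then have "AE z in mu n m. f z + of_real (us z - a\<^sup>2) * 0 = 0"
 by (intro PE_complete[OF f L2_zero]) (simp add: lip_def)
 then show "AE z in mu n m. f z = 0" by simp
qed

text \<open>On the support the multiplier - (a^2 + z^2) is us z - a^2, the one in
  \<open>PP_rec\<close>, so moving it onto \<open>PE (PP k)\<close> yields the recurrence. The
  converse is \<open>PE_complete\<close> for the pair g and - f. That f lies in the domain of the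
  multiplication is expressed by g being in L2.\<close>

lemma multiplication_graph_iff:
 assumes f: "f \<in> L2 (mu n m)" and g: "g \<in> L2 (mu n m)"
 shows "(AE z in mu n m. g z = - ((cr (par_a n m))\<^sup>2 + z\<^sup>2) * f z) \<longleftrightarrow>
 (\<forall>k. lip (mu n m) g (EE k) = of_real ((real (Suc k))\<^sup>2) * lip (mu n m) f (EE (Suc k)) - of_real (Ak n m k + (real k)\<^sup>2) * lip (mu n m) f (EE k)
  + (if k = 0 then 0 else of_real (Ak n m (k - 1)) * lip (mu n m) f (EE (k - 1))))"
proof -
 define t where "t = [:- (a\<^sup>2), 1:]"
 have cn: "cnj (PE p z) = PE p z" for p z by (simp add: PE_def)
 have ad: "lip (mu n m) h (PE (p + q)) = lip (mu n m) h (PE p) + lip (mu n m) h (PE q)" if "h \<in> L2 (mu n m)" for h p q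
 using L2_mult_integrable[OF that PE_L2[of p]] L2_mult_integrable[OF that PE_L2[of q]]
 unfolding lip_def by (simp add: cn PE_add distrib_left)
 have sm: "lip (mu n m) h (PE (smult r p)) = of_real r * lip (mu n m) h (PE p)" for h r p
 unfolding lip_def by (simp add: cn PE_smult mult.left_commute)
 have Et: "of_real (1 / sqrt M0) * lip (mu n m) f (PE (t * PP k)) =
  of_real ((real (Suc k))\<^sup>2) * lip (mu n m) f (EE (Suc k)) - of_real (Ak n m k + (real k)\<^sup>2) * lip (mu n m) f (EE k)
  + (if k = 0 then 0 else of_real (Ak n m (k - 1)) * lip (mu n m) f (EE (k - 1)))" for k
 proof -
 have "t * PP k = smult ((real (Suc k))\<^sup>2) (PP (Suc k)) + smult (- (Ak n m k + (real k)\<^sup>2)) (PP k) + smult (if k = 0 then 0 else Ak n m (k - 1)) (PP (k - 1))"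
 proof -
  have i: "smult (if k = 0 then 0 else r) p = (if k = 0 then 0 else smult r p)" for r and p :: "real poly" by simp
  show ?thesis unfolding t_def PP_rec i smult_minus_left by (simp only: diff_conv_add_uminus)
 qed
 then have "lip (mu n m) f (PE (t * PP k)) = of_real ((real (Suc k))\<^sup>2) * lip (mu n m) f (PE (PP (Suc k)))
  + of_real (- (Ak n m k + (real k)\<^sup>2)) * lip (mu n m) f (PE (PP k)) + of_real (if k = 0 then 0 else Ak n m (k - 1)) * lip (mu n m) f (PE (PP (k - 1)))"
  by (simp only: ad[OF f] sm)
 moreover have i: "(if k = 0 then 0 else of_real r * z) = of_real (if k = 0 then 0 else r) * z" for r and z :: complex by simp
 ultimately have e: "lip (mu n m) f (PE (t * PP k)) = of_real ((real (Suc k))\<^sup>2) * lip (mu n m) f (PE (PP (Suc k)))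
  - of_real (Ak n m k + (real k)\<^sup>2) * lip (mu n m) f (PE (PP k)) + (if k = 0 then 0 else of_real (Ak n m (k - 1)) * lip (mu n m) f (PE (PP (k - 1))))"
  by (simp only: of_real_minus mult_minus_left diff_conv_add_uminus i)
 have gen: "e * (x * p - y * q + (if k = 0 then 0 else z * r)) = x * (e * p) - y * (e * q) + (if k = 0 then 0 else z * (e * r))"
  for e x y z p q r :: complex by (simp add: algebra_simps)
 show ?thesis unfolding lip_EE_right e gen ..
 qed
 have mult: "- ((cr (par_a n m))\<^sup>2 + z\<^sup>2) = of_real (us z - a\<^sup>2)" if "z \<in> spec_set n m" for z
 proof -
 have "z\<^sup>2 = - of_real (us z)" using us_spec[OF that] by (metis minus_minus)
 then show ?thesis by (simp add: a_def)
 qed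
 have tp: "of_real (us z - a\<^sup>2) * PE p z = PE (t * p) z" for z p by (simp add: PE_def t_def algebra_simps)
 have "(AE z in mu n m. g z = - ((cr (par_a n m))\<^sup>2 + z\<^sup>2) * f z) \<longleftrightarrow>
  (AE z in mu n m. g z = of_real (us z - a\<^sup>2) * f z)"
 by (rule AE_cong) (simp only: space_mu mult)
 also have "... \<longleftrightarrow> (\<forall>k. lip (mu n m) g (PE (PP k)) = lip (mu n m) f (PE (t * PP k)))"
 proof
 assume ae: "AE z in mu n m. g z = of_real (us z - a\<^sup>2) * f z"
 show "\<forall>k. lip (mu n m) g (PE (PP k)) = lip (mu n m) f (PE (t * PP k))"
 proof
  fix k
  show "lip (mu n m) g (PE (PP k)) = lip (mu n m) f (PE (t * PP k))" unfolding lip_def cn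
  proof (rule integral_cong_AE)
  show "AE z in mu n m. g z * PE (PP k) z = f z * PE (t * PP k) z"
   using ae by eventually_elim (simp add: tp[symmetric] mult_ac)
  qed (intro borel_measurable_times L2_measurable f g PE_L2)+
 qed
 next
 assume e: "\<forall>k. lip (mu n m) g (PE (PP k)) = lip (mu n m) f (PE (t * PP k))"
 have "AE z in mu n m. g z + of_real (us z - a\<^sup>2) * (-1 * f z) = 0"
 proof (rule PE_complete[OF g L2_scale[OF f]])
  show "lip (mu n m) g (PE (PP k)) + lip (mu n m) (%x. - 1 * f x) (PE ([:- (a\<^sup>2), 1:] * PP k)) = 0" for k
  using e unfolding lip_scale_left by (simp add: t_def)
 qed
 then show "AE z in mu n m. g z = of_real (us z - a\<^sup>2) * f z" by eventually_elim simp
 qed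
 also have "... \<longleftrightarrow> (\<forall>k. of_real (1 / sqrt M0) * lip (mu n m) g (PE (PP k)) = of_real (1 / sqrt M0) * lip (mu n m) f (PE (t * PP k)))"
 using M0_pos by simp
 finally show ?thesis unfolding Et lip_EE_right[of g] .
qed

end

section \<open>Expansion of the invariants and the operator on coefficients\<close>

lemma pochhammer_mono:
 fixes a b :: real
 assumes "0 < a" "a <= b" shows "pochhammer a k <= pochhammer b k"
proof (induction k)
 case (Suc k)
 have "pochhammer a k * (a + real k) <= pochhammer b k * (b + real k)"
 using Suc assms pochhammer_pos[of b k] by (intro mult_mono) auto
 then show ?case by (simp add: pochhammer_Suc)
qed simp

lemma Nk_ge: "n > 0 ==> m > 0 ==> (hb k)\<^sup>2 <= Nk n m k"
proof -
 assume nm: "n > 0" "m > 0"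
 have "pochhammer (1/2) k * pochhammer (1/2) k <= pochhammer (real n / 2) k * pochhammer (real m / 2) k"
 using nm pochhammer_pos[of "1/2 :: real" k] pochhammer_pos[of "real n / 2" k]
 by (intro mult_mono pochhammer_mono) auto
 then show ?thesis unfolding Nk_def hb_pochhammer by (simp add: power2_eq_square divide_right_mono)
qed

locale H1_diagonal = H1_space H ip
 for H :: "(complex^'m::{finite,linorder}^'n::{finite,linorder} => complex) set" and ip +
 assumes mn: "CARD('m) <= CARD('n)"
begin

sublocale h: hilbert_orthogonal "L_invariants H" ip pk "Nk CARD('n) CARD('m)"
 by (rule pk_orthogonal[OF mn])

text \<open>Bessel's inequality bounds |coef|^2 times \<open>Nk\<close>, and \<open>Nk\<close> is at
  least hb^2 >= (2 k + 1)^(-2) by \<open>Nk_ge\<close>. Linear growth is good enough against the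
  geometric decay of \<open>qpoly k\<close>.\<close>

lemma coef_bound:
 assumes f: "f \<in> HL" shows "cmod (h.coef f k) <= sqrt (nsq f) * (2 * real k + 1)"
proof -
 have N: "(hb k)\<^sup>2 <= Nk CARD('n) CARD('m) k" by (rule Nk_ge) auto
 have "(cmod (h.coef f k) * hb k)\<^sup>2 <= (cmod (h.coef f k))\<^sup>2 * Nk CARD('n) CARD('m) k"
 unfolding power_mult_distrib by (rule mult_left_mono[OF N]) simp
 also have "... <= (\<Sum>k<Suc k. (cmod (h.coef f k))\<^sup>2 * Nk CARD('n) CARD('m) k)"
 using h.N_pos by (intro member_le_sum) (auto simp: less_imp_le)
 also have "... <= nsq f"
 using h.nsq_remainder[OF f, of "Suc k"] h.nsq_nonneg[OF h.diff_mem[OF h.partial_mem f], of "h.coef f" "{..<Suc k}"] by linarith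
 finally have "cmod (h.coef f k) * hb k <= sqrt (nsq f)" by (rule real_le_rsqrt)
 moreover have "cmod (h.coef f k) * (1 / (2 * real k + 1)) <= cmod (h.coef f k) * hb k"
 by (intro mult_left_mono hb_ge) simp
 ultimately have "cmod (h.coef f k) / (2 * real k + 1) <= sqrt (nsq f)" by simp
 then show ?thesis by (simp add: divide_le_eq)
qed

lemma series_norm:
 assumes f: "f \<in> HL" shows "(%K. nsq (%z. (\<Sum>k<K. h.coef f k * pk k z) - f z)) \<longlonglongrightarrow> 0"
proof -
 obtain g where g: "g \<in> HL" "(%K. nsq (%z. (\<Sum>k<K. h.coef f k * pk k z) - g z)) \<longlonglongrightarrow> 0" "!!k. h.coef g k = h.coef f k"
 using h.series_exists[OF h.bessel_summable[OF f]] by blast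
 have "(%z. f z - g z) = (%z. 0)"
 proof (rule pk_total[OF mn h.diff_mem[OF f g(1)]])
 fix k
 have "ip f (pk k) = ip g (pk k)" using g(3)[of k] h.N_pos[of k] by (simp add: h.coef_def)
 then show "ip (%z. f z - g z) (pk k) = 0" using f g(1) h.e_mem by (simp add: h.ip_diff_left)
 qed
 then have "f = g" by (auto simp: fun_eq_iff)
 then show ?thesis using g(2) by simp
qed

lemma series_diagonal:
 fixes x :: "(real, 'm) vec"
 assumes f: "f \<in> HL" and x: "!!i. \<bar>x $ i\<bar> < 1"
 shows "(%K. \<Sum>k<K. h.coef f k * qpoly k (%j. (cr (x $ j))\<^sup>2)) \<longlonglongrightarrow> f (diag_mat x)"
proof -
 have "(%K. \<Sum>k<K. h.coef f k * pk k (diag_mat x :: ('m, 'n) cmatrix)) \<longlonglongrightarrow> f (diag_mat x)"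
 using eval_tendsto[of "%K z. \<Sum>k<K. h.coef f k * pk k z" f "diag_mat x", OF HL_subset[OF h.partial_mem] HL_subset[OF f] series_norm[OF f]] .
 moreover have e: "pk k (diag_mat x :: ('m, 'n) cmatrix) = qpoly k (%j. (cr (x $ j))\<^sup>2)" for k
 unfolding diag_mat_cdiag by (rule pk_cdiag[OF mn]) (use x in simp)
 ultimately show ?thesis by (simp only: e)
qed

text \<open>Evaluation is bounded by the kernel, uniformly for |t| < \<rho>, so convergence in norm
  becomes uniform convergence on the slice; derivatives of uniform limits of holomorphic functions
  converge too.\<close>

lemma slice_limit:
 fixes y :: "'m => complex" and i :: 'm
 assumes f: "f \<in> HL" and y: "!!j. cmod (y j) < 1"
 defines "g \<equiv> %t. f (cdiag (y(i := t)))"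
 shows slice_holomorphic: "g holomorphic_on ball 0 1"
 and "(%K. \<Sum>k<K. h.coef f k * qD k y i) \<longlonglongrightarrow> deriv g (y i)"
 and "(%K. \<Sum>k<K. h.coef f k * qE k y i) \<longlonglongrightarrow> deriv (deriv g) (y i)"
proof -
 define S where "S K t = (\<Sum>k<K. h.coef f k * qpoly k (%j. ((y(i := t)) j)\<^sup>2))" for K t
 define M where "M = Max (range (%j. cmod (y j)))"
 have M: "cmod (y j) <= M" for j unfolding M_def by (rule Max_ge) auto
 have M1: "M < 1" "0 <= M"
 proof -
 have "M \<in> range (%j. cmod (y j))" unfolding M_def by (rule Max_in) auto
 then show "M < 1" "0 <= M" using y by auto
 qed
 \<comment> \<open>Strictly between all |y j| and 1, so that the disc contains y i and the kernel
   stays bounded.\<close>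
 define \<rho> where "\<rho> = (1 + M) / 2"
 have \<rho>: "M < \<rho>" "\<rho> < 1" "0 <= \<rho>" using M1 by (auto simp: \<rho>_def)
 have sub: "cmod ((y(i := t)) j) <= \<rho>" if "t \<in> ball 0 \<rho>" for t j
 using that M[of j] \<rho> by auto
 have dom: "(cdiag (y(i := t)) :: ('m, 'n) cmatrix) \<in> domD" if "cmod t < 1" for t
 unfolding cdiag_domD[OF mn] using that y by simp
 show hol: "g holomorphic_on ball 0 1" unfolding g_def
 proof (rule holomorphic_line[OF HL_subset[OF f] open_ball, where g' = "%t. \<chi> r s. if pos r = pos s \<and> s = i then 1 else 0"])
 show "(cdiag (y(i := t)) :: ('m, 'n) cmatrix) \<in> domD" if "t \<in> ball 0 1" for t by (rule dom) (use that in simp)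
 show "((%t. (cdiag (y(i := t)) :: ('m, 'n) cmatrix) $ r $ s) has_field_derivative (\<chi> r s. if pos r = pos s \<and> s = i then 1 else 0) $ r $ s) (at t)" for r s t
  by (cases "pos r = pos s"; cases "s = i") (simp_all add: cdiag_def)
 qed
 have S_eq: "S K t - g t = (%z. (\<Sum>k<K. h.coef f k * pk k z) - f z) (cdiag (y(i := t)))" if "t \<in> ball 0 \<rho>" for K t
 proof -
 have e: "pk k (cdiag (y(i := t)) :: ('m, 'n) cmatrix) = qpoly k (%j. ((y(i := t)) j)\<^sup>2)" for k
  by (rule pk_cdiag[OF mn]) (rule le_less_trans[OF sub[OF that] \<rho>(2)])
 show ?thesis unfolding S_def g_def e ..
 qed
 define C where "C = sqrt ((1 / (1 - \<rho>\<^sup>2)) ^ CARD('n))"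
 have bd: "cmod (S K t - g t) <= C * sqrt (nsq (%z. (\<Sum>k<K. h.coef f k * pk k z) - f z))" if t: "t \<in> ball 0 \<rho>" for K t
 proof -
 have Fm: "(%z. (\<Sum>k<K. h.coef f k * pk k z) - f z) \<in> H" by (rule HL_subset[OF h.diff_mem[OF h.partial_mem f]])
 have d: "(cdiag (y(i := t)) :: ('m, 'n) cmatrix) \<in> domD" using t \<rho> by (intro dom) auto
 have "cmod (S K t - g t) <= sqrt (Re (ker1 (cdiag (y(i := t)) :: ('m, 'n) cmatrix) (cdiag (y(i := t))))) * sqrt (nsq (%z. (\<Sum>k<K. h.coef f k * pk k z) - f z))"
  unfolding S_eq[OF t] by (rule eval_bound[OF d Fm])
 also have "... <= C * sqrt (nsq (%z. (\<Sum>k<K. h.coef f k * pk k z) - f z))"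
  unfolding C_def using ker1_cdiag_bound[of "y(i := t)" \<rho>, OF sub[OF t] \<rho>(3,2), where 'n='n] nsq_nonneg[OF Fm]
  by (intro mult_right_mono) auto
 finally show ?thesis .
 qed
 have ul: "uniform_limit (ball 0 \<rho>) S g sequentially"
 proof (rule uniform_limitI)
 fix e :: real assume e: "e > 0"
 have "(%K. C * sqrt (nsq (%z. (\<Sum>k<K. h.coef f k * pk k z) - f z))) \<longlonglongrightarrow> C * sqrt 0"
  by (intro tendsto_intros series_norm f)
 then have "\<forall>\<^sub>F K in sequentially. C * sqrt (nsq (%z. (\<Sum>k<K. h.coef f k * pk k z) - f z)) < e"
  by (rule order_tendstoD) (use e in simp)
 then show "\<forall>\<^sub>F K in sequentially. \<forall>t\<in>ball 0 \<rho>. dist (S K t) (g t) < e"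
  by eventually_elim (auto simp: dist_norm intro: le_less_trans[OF bd])
 qed
 have dS: "(S K has_field_derivative (\<Sum>k<K. h.coef f k * qD k (y(i := t)) i)) (at t)" for K t
 unfolding S_def[abs_def] by (intro DERIV_sum DERIV_cmult qpoly_update(1))
 then have dS': "deriv (S K) = (%t. \<Sum>k<K. h.coef f k * qD k (y(i := t)) i)" for K by (intro ext DERIV_imp_deriv)
 have ddS: "deriv (%t. \<Sum>k<K. h.coef f k * qD k (y(i := t)) i) t = (\<Sum>k<K. h.coef f k * qE k (y(i := t)) i)" for K t
 by (intro DERIV_imp_deriv DERIV_sum DERIV_cmult qpoly_update(2))
 have yi: "y i \<in> ball 0 \<rho>" using M[of i] \<rho> by auto
 have "\<forall>\<^sub>F K in sequentially. S K holomorphic_on ball 0 \<rho>"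
 using dS by (intro always_eventually allI holomorphic_onI) (meson field_differentiable_at_within field_differentiable_def)
 note lim = higher_deriv_complex_uniform_limit[OF ul this sequentially_bot open_ball yi]
 show "(%K. \<Sum>k<K. h.coef f k * qD k y i) \<longlonglongrightarrow> deriv g (y i)" using lim[of 1] by (simp add: dS')
 show "(%K. \<Sum>k<K. h.coef f k * qE k y i) \<longlonglongrightarrow> deriv (deriv g) (y i)" using lim[of 2] by (simp add: dS' ddS numeral_2_eq_2)
qed

text \<open>The partial derivatives \<open>pd\<close> on real diagonals are complex derivatives
  along slices, so \<open>slice_limit\<close> allows passing to the limit inside the
  operator.\<close>

lemma four_L1_limit:
 fixes x :: "(real, 'm) vec"
 assumes f: "f \<in> HL" and x: "!!i. \<bar>x $ i\<bar> < 1"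
 defines "y \<equiv> %i. cr (x $ i)"
 shows "(%K. \<Sum>k<K. h.coef f k * four_L1_expr CARD('n) CARD('m) x (qpoly k (%i. (y i)\<^sup>2)) (qD k y) (qE k y))
 \<longlonglongrightarrow> four_L1 CARD('n) CARD('m) (%y. f (diag_mat y)) x"
proof -
 define F where "F = (%y :: (real, 'm) vec. f (diag_mat y))"
 have y: "cmod (y j) < 1" for j using x by (simp add: y_def)
 have pd: "pd i F x = deriv (%t. f (cdiag (y(i := t)))) (y i)"
 "pd i (pd i F) x = deriv (deriv (%t. f (cdiag (y(i := t))))) (y i)" for i
 proof -
 define g where "g = (%t. f (cdiag (y(i := t)) :: ('m, 'n) cmatrix))"
 have hol: "g holomorphic_on ball 0 1" unfolding g_def by (rule slice_holomorphic[OF f y])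
 have F: "F (\<chi> k. if k = i then t else x $ k) = g (of_real t)" for t
 proof -
  have "(%s. cr ((\<chi> k. if k = i then t else x $ k) $ s)) = y(i := of_real t)" by (auto simp: y_def)
  then show ?thesis by (simp add: F_def g_def diag_mat_cdiag)
 qed
 \<comment> \<open>Stated for all |t| < 1 and not only at x i, since the second \<open>pd\<close>
   differentiates this function of t.\<close>
 have p: "pd i F (\<chi> k. if k = i then t else x $ k) = deriv g (of_real t)" if t: "\<bar>t\<bar> < 1" for t
 proof -
  have "(\<chi> k. if k = i then s else (\<chi> k. if k = i then t else x $ k) $ k) = (\<chi> k. if k = i then s else x $ k)" for s
  by (simp add: vec_eq_iff)
  then have "pd i F (\<chi> k. if k = i then t else x $ k) = vector_derivative (%s. g (of_real s)) (at t)"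
  unfolding pd_def F[symmetric] by simp
  also have "... = deriv g (of_real t)"
  proof -
  have D: "(g has_field_derivative deriv g (of_real t)) (at (of_real t))"
   by (rule holomorphic_derivI[OF hol open_ball]) (use t in simp)
  show ?thesis by (rule vector_derivative_at[OF has_vector_derivative_real_field[OF D]])
  qed
  finally show ?thesis .
 qed
 have x_eq: "(\<chi> k. if k = i then x $ i else x $ k) = x" by (simp add: vec_eq_iff)
 show "pd i F x = deriv (%t. f (cdiag (y(i := t)))) (y i)" using p[OF x[of i]] unfolding x_eq by (simp add: y_def g_def)
 have d: "((%t. deriv g (of_real t)) has_vector_derivative deriv (deriv g) (of_real (x $ i))) (at (x $ i))"
 proof -
  have "(deriv g has_field_derivative deriv (deriv g) (of_real (x $ i))) (at (of_real (x $ i)))"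
  by (rule holomorphic_derivI[OF holomorphic_deriv[OF hol open_ball] open_ball]) (use x[of i] in simp)
  then show ?thesis by (rule has_vector_derivative_real_field)
 qed
 have "((%t. pd i F (\<chi> k. if k = i then t else x $ k)) has_vector_derivative deriv (deriv g) (of_real (x $ i))) (at (x $ i))"
  by (rule has_vector_derivative_transform_within_open[OF d, of "{-1<..<1}"]) (use x[of i] p in \<open>auto simp: abs_less_iff\<close>)
 then show "pd i (pd i F) x = deriv (deriv (%t. f (cdiag (y(i := t))))) (y i)"
  unfolding pd_def[of i "pd i F"] by (simp add: vector_derivative_at y_def g_def)
 qed
 have "(%K. four_L1_expr CARD('n) CARD('m) x (\<Sum>k<K. h.coef f k * qpoly k (%i. (y i)\<^sup>2)) (%i. \<Sum>k<K. h.coef f k * qD k y i) (%i. \<Sum>k<K. h.coef f k * qE k y i))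
 \<longlonglongrightarrow> four_L1_expr CARD('n) CARD('m) x (F x) (%i. pd i F x) (%i. pd i (pd i F) x)"
 unfolding pd using series_diagonal[OF f x] slice_limit(2,3)[OF f y]
 by (intro four_L1_expr_tendsto) (simp_all add: F_def y_def)
 then show ?thesis unfolding four_L1_four_L1_expr F_def[symmetric] by (simp add: four_L1_expr_sum)
qed

text \<open>The k-th coefficient of the image of f, from transposing the recurrence of
  \<open>four_L1_qpoly\<close>. These numbers are defined for every f, also when no member of the
  space has them as coefficients.\<close>

definition Rc :: "(('m, 'n) cmatrix => complex) => nat => complex" where
 "Rc f k = (if k = 0 then 0 else of_nat k ^ 2 * h.coef f (k - 1)) - of_real (Ak CARD('n) CARD('m) k + real k ^ 2) * h.coef f k
  + of_real (Ak CARD('n) CARD('m) k) * h.coef f (Suc k)"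

text \<open>Transposes the three-term operator from q to c; the two leftover terms are the boundary
  terms at K.\<close>

lemma summation_by_parts:
 fixes c q A :: "nat => complex"
 shows "(\<Sum>k<Suc K. c k * (of_nat (Suc k) ^ 2 * q (Suc k) - (A k + of_nat k ^ 2) * q k + (if k = 0 then 0 else A (k - 1) * q (k - 1))))
 = (\<Sum>k<Suc K. ((if k = 0 then 0 else of_nat k ^ 2 * c (k - 1)) - (A k + of_nat k ^ 2) * c k + A k * c (Suc k)) * q k)
  + of_nat (Suc K) ^ 2 * c K * q (Suc K) - A K * c (Suc K) * q K"
proof (induction K)
 case (Suc K)
 show ?case unfolding sum.lessThan_Suc[of _ "Suc K"] Suc by (simp add: algebra_simps)
qed (simp add: algebra_simps)

text \<open>The boundary terms of \<open>summation_by_parts\<close> tend to 0: coefficients grow at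
  most linearly by \<open>coef_bound\<close>, and q k decays like r^k up to a power of k, with r < 1
  the largest (x i)^2.\<close>

lemma four_L1_series:
 fixes x :: "(real, 'm) vec"
 assumes f: "f \<in> HL" and x: "!!i. \<bar>x $ i\<bar> < 1" and x0: "!!i. x $ i ~= 0" and xd: "!!i j. i ~= j ==> (x $ i)\<^sup>2 ~= (x $ j)\<^sup>2"
 shows "(%K. 4 * (\<Sum>k<K. Rc f k * qpoly k (%i. (cr (x $ i))\<^sup>2))) \<longlonglongrightarrow> four_L1 CARD('n) CARD('m) (%y. f (diag_mat y)) x"
proof -
 define q where "q k = qpoly k (%i. (cr (x $ i))\<^sup>2)" for k
 define A where "A k = cr (Ak CARD('n) CARD('m) k)" for k
 define c where "c = h.coef f"
 define r where "r = Max (range (%i. (x $ i)\<^sup>2))"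
 have r: "(x $ i)\<^sup>2 <= r" for i unfolding r_def by (rule Max_ge) auto
 have r1: "0 <= r" "r < 1"
 proof -
 have "r \<in> range (%i. (x $ i)\<^sup>2)" unfolding r_def by (rule Max_in) auto
 then show "0 <= r" "r < 1" using x by (auto simp: abs_square_less_1)
 qed
 have qb: "cmod (q k) <= (1 + real k) ^ CARD('m) * r ^ k" for k
 unfolding q_def by (rule qpoly_bound) (auto simp: norm_power r r1)
 define B where "B = sqrt (nsq f)"
 have B: "B \<ge> 0" unfolding B_def using nsq_nonneg[OF HL_subset[OF f]] by simp
 have cb: "cmod (c k) <= B * (2 * real k + 1)" for k unfolding c_def B_def by (rule coef_bound[OF f])
 \<comment> \<open>Two powers from (K + 1)^2 or from \<open>Ak\<close>, one from the coefficient
   bound, the rest from \<open>qpoly_bound\<close>.\<close>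
 define p where "p = CARD('m) + 3"
 have l0: "(%k. (1 + real k) ^ p * r ^ k) \<longlonglongrightarrow> 0" by (rule poly_geometric_tendsto_0[OF r1])
 have b1: "(%K. of_nat (Suc K) ^ 2 * c K * q (Suc K)) \<longlonglongrightarrow> 0"
 proof (rule Lim_null_comparison)
 show "(%K. 2 * B * ((1 + real (Suc K)) ^ p * r ^ Suc K)) \<longlonglongrightarrow> 0"
  using tendsto_mult_left[OF LIMSEQ_Suc[OF l0], of "2 * B"] by simp
 have "norm (of_nat (Suc K) ^ 2 * c K * q (Suc K)) <= 2 * B * ((1 + real (Suc K)) ^ p * r ^ Suc K)" for K
 proof -
  have "norm (of_nat (Suc K) ^ 2 * c K * q (Suc K)) = real (Suc K) ^ 2 * cmod (c K) * cmod (q (Suc K))"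
  unfolding norm_mult norm_power norm_of_nat ..
  also have "... <= (1 + real (Suc K)) ^ 2 * (B * (2 * (1 + real (Suc K)))) * ((1 + real (Suc K)) ^ CARD('m) * r ^ Suc K)"
  using B r1 by (intro mult_mono power_mono qb order_trans[OF cb mult_left_mono]) auto
  also have "... = 2 * B * ((1 + real (Suc K)) ^ p * r ^ Suc K)" unfolding p_def power_add by (simp add: power3_eq_cube power2_eq_square)
  finally show ?thesis .
 qed
 then show "\<forall>\<^sub>F K in sequentially. norm (of_nat (Suc K) ^ 2 * c K * q (Suc K)) <= 2 * B * ((1 + real (Suc K)) ^ p * r ^ Suc K)" by simp
 qed
 have b2: "(%K. A K * c (Suc K) * q K) \<longlonglongrightarrow> 0"
 proof (rule Lim_null_comparison)
 define D where "D = real CARD('n) * real CARD('n)"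
 show "(%K. 3 * D * B * ((1 + real K) ^ p * r ^ K)) \<longlonglongrightarrow> 0"
  using tendsto_mult_left[OF l0, of "3 * D * B"] by simp
 have "norm (A K * c (Suc K) * q K) <= 3 * D * B * ((1 + real K) ^ p * r ^ K)" for K
 proof -
  have n1: "1 <= real CARD('n)" by simp
  have e: "real K + real j / 2 <= real CARD('n) * (1 + real K)" if "j <= CARD('n)" for j
  proof -
  have "real K <= real CARD('n) * real K" using mult_right_mono[OF n1, of "real K"] by simp
  moreover have "real j <= real CARD('n)" using that by simp
  ultimately show ?thesis unfolding distrib_left mult_1_right by linarith
  qed
  have "norm (A K) <= (real CARD('n) * (1 + real K)) * (real CARD('n) * (1 + real K))"
  unfolding A_def norm_of_real Ak_def abs_mult using e[OF order_refl] e[OF mn] by (intro mult_mono) auto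
  also have "... = D * (1 + real K) ^ 2" by (simp add: D_def power2_eq_square)
  finally have Ab: "norm (A K) <= D * (1 + real K) ^ 2" .
  have "norm (A K * c (Suc K) * q K) <= (D * (1 + real K) ^ 2) * (B * (3 * (1 + real K))) * ((1 + real K) ^ CARD('m) * r ^ K)"
  unfolding norm_mult using B r1 by (intro mult_mono Ab qb order_trans[OF cb mult_left_mono]) (auto simp: D_def)
  also have "... = 3 * D * B * ((1 + real K) ^ p * r ^ K)" unfolding p_def power_add by (simp add: power3_eq_cube power2_eq_square)
  finally show ?thesis .
 qed
 then show "\<forall>\<^sub>F K in sequentially. norm (A K * c (Suc K) * q K) <= 3 * D * B * ((1 + real K) ^ p * r ^ K)" by simp
 qed
 have "(%K. \<Sum>k<K. c k * four_L1_expr CARD('n) CARD('m) x (q k) (qD k (%i. cr (x $ i))) (qE k (%i. cr (x $ i))))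
 \<longlonglongrightarrow> four_L1 CARD('n) CARD('m) (%y. f (diag_mat y)) x"
 unfolding c_def q_def by (rule four_L1_limit[OF f x])
 moreover have "four_L1_expr CARD('n) CARD('m) x (q k) (qD k (%i. cr (x $ i))) (qE k (%i. cr (x $ i)))
 = 4 * (of_nat (Suc k) ^ 2 * q (Suc k) - (A k + of_nat k ^ 2) * q k + (if k = 0 then 0 else A (k - 1) * q (k - 1)))" for k
 using four_L1_qpoly[OF x0 xd, of "CARD('n)" k] unfolding q_def A_def by auto
 ultimately have "(%K. \<Sum>k<K. c k * (4 * (of_nat (Suc k) ^ 2 * q (Suc k) - (A k + of_nat k ^ 2) * q k + (if k = 0 then 0 else A (k - 1) * q (k - 1)))))
 \<longlonglongrightarrow> four_L1 CARD('n) CARD('m) (%y. f (diag_mat y)) x" by (simp only:)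
 then have "(%K. \<Sum>k<Suc K. c k * (4 * (of_nat (Suc k) ^ 2 * q (Suc k) - (A k + of_nat k ^ 2) * q k + (if k = 0 then 0 else A (k - 1) * q (k - 1)))))
 \<longlonglongrightarrow> four_L1 CARD('n) CARD('m) (%y. f (diag_mat y)) x"
 by (rule LIMSEQ_Suc)
 moreover have "(\<Sum>k<Suc K. c k * (4 * (of_nat (Suc k) ^ 2 * q (Suc k) - (A k + of_nat k ^ 2) * q k + (if k = 0 then 0 else A (k - 1) * q (k - 1)))))
 = 4 * (\<Sum>k<Suc K. Rc f k * q k) + 4 * (of_nat (Suc K) ^ 2 * c K * q (Suc K)) - 4 * (A K * c (Suc K) * q K)" for K
 proof -
 have "(\<Sum>k<Suc K. c k * (4 * (of_nat (Suc k) ^ 2 * q (Suc k) - (A k + of_nat k ^ 2) * q k + (if k = 0 then 0 else A (k - 1) * q (k - 1)))))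
  = 4 * (\<Sum>k<Suc K. c k * (of_nat (Suc k) ^ 2 * q (Suc k) - (A k + of_nat k ^ 2) * q k + (if k = 0 then 0 else A (k - 1) * q (k - 1))))"
  unfolding sum_distrib_left by (intro sum.cong refl) (simp only: mult.left_commute)
 moreover have "Rc f k = (if k = 0 then 0 else of_nat k ^ 2 * c (k - 1)) - (A k + of_nat k ^ 2) * c k + A k * c (Suc k)" for k
  unfolding Rc_def A_def c_def by simp
 ultimately show ?thesis unfolding summation_by_parts by (simp only: distrib_left right_diff_distrib)
 qed
 ultimately have "(%K. 4 * (\<Sum>k<Suc K. Rc f k * q k) + 4 * (of_nat (Suc K) ^ 2 * c K * q (Suc K)) - 4 * (A K * c (Suc K) * q K))
 \<longlonglongrightarrow> four_L1 CARD('n) CARD('m) (%y. f (diag_mat y)) x" by simp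
 from tendsto_add[OF tendsto_diff[OF this tendsto_mult_left[OF b1, of 4]] tendsto_mult_left[OF b2, of 4]]
 have "(%K. 4 * (\<Sum>k<Suc K. Rc f k * q k)) \<longlonglongrightarrow> four_L1 CARD('n) CARD('m) (%y. f (diag_mat y)) x" by simp
 then show ?thesis unfolding q_def by (rule LIMSEQ_imp_Suc)
qed

text \<open>If the coefficients agree, both sides have the same series. Conversely, on the curve (x
  i)^2 = t w i the homogeneity of \<open>qpoly k\<close> makes the difference a power series in t,
  whose coefficients are those of g minus \<open>Rc f\<close>, times nonzero numbers q k.\<close>

lemma L1_rel_iff:
 assumes f: "f \<in> HL" and g: "g \<in> HL"
 shows "L1_rel f g \<longleftrightarrow> (\<forall>k. h.coef g k = Rc f k)"
proof
 assume e: "\<forall>k. h.coef g k = Rc f k"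
 show "L1_rel f g" unfolding L1_rel_def
 proof (intro allI impI)
 fix x :: "(real, 'm) vec"
 assume "(diag_mat x :: ('m, 'n) cmatrix) \<in> domD" and x0: "\<forall>i. x $ i ~= 0" and xd: "\<forall>i j. i ~= j --> (x $ i)\<^sup>2 ~= (x $ j)\<^sup>2"
 then have x: "!!i. \<bar>x $ i\<bar> < 1" by (simp add: diag_mat_domD[OF mn])
 have "(%K. 4 * (\<Sum>k<K. Rc f k * qpoly k (%i. (cr (x $ i))\<^sup>2))) \<longlonglongrightarrow> 4 * g (diag_mat x)"
  using tendsto_mult_left[OF series_diagonal[OF g x], of 4] e by simp
 moreover have "(%K. 4 * (\<Sum>k<K. Rc f k * qpoly k (%i. (cr (x $ i))\<^sup>2))) \<longlonglongrightarrow> four_L1 CARD('n) CARD('m) (%y. f (diag_mat y)) x"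
  by (rule four_L1_series[OF f x]) (use x0 xd in auto)
 ultimately show "4 * g (diag_mat x) = four_L1 CARD('n) CARD('m) (%y. f (diag_mat y)) x" by (rule LIMSEQ_unique)
 qed
next
 assume rel: "L1_rel f g"
 \<comment> \<open>Distinct numbers in (0, 1), so that for 0 < t <= 1 the point with (x i)^2 = t w i
   stays in the domain and off the singular set of the operator.\<close>
 define w where "w i = (real (pos i) + 1) / (real CARD('m) + 1)" for i :: 'm
 have w: "0 < w i" "w i < 1" for i
 proof -
 have "pos i < CARD('m)" using pos_range[where 'i='m] by blast
 then show "0 < w i" "w i < 1" by (simp_all add: w_def)
 qed
 have w_inj: "i ~= j ==> w i ~= w j" for i j by (simp add: w_def pos_eq_iff)
 define q where "q k = qpoly k (%i. cr (w i))" for k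
 have "(h.coef g k - Rc f k) * q k = 0" for k
 proof (rule power_series_zero[where c = "%k. (h.coef g k - Rc f k) * q k"])
 fix t :: real assume t: "0 < t" "t <= 1"
 define x :: "(real, 'm) vec" where "x = (\<chi> i. sqrt (t * w i))"
 have x2: "(x $ i)\<^sup>2 = t * w i" for i using t w[of i] by (simp add: x_def)
 have x: "\<bar>x $ i\<bar> < 1" for i
 proof -
  have "t * w i < 1" using t w[of i] mult_left_le_one_le[of "w i" t] by linarith
  then show ?thesis using t w[of i] by (simp add: x_def)
 qed
 have x0: "x $ i ~= 0" for i using t w[of i] by (simp add: x_def)
 have xd: "(x $ i)\<^sup>2 ~= (x $ j)\<^sup>2" if "i ~= j" for i j unfolding x2 using t w_inj[OF that] by simp
 have qt: "qpoly k (%i. (cr (x $ i))\<^sup>2) = of_real t ^ k * q k" for k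
 proof -
  have "(%i. (cr (x $ i))\<^sup>2) = (%i. of_real t * cr (w i))" by (simp add: x2 flip: of_real_power of_real_mult)
  then show ?thesis by (simp add: q_def qpoly_scale)
 qed
 have "4 * g (diag_mat x) = four_L1 CARD('n) CARD('m) (%y. f (diag_mat y)) x"
  using rel x x0 xd unfolding L1_rel_def diag_mat_domD[OF mn] by blast
 with four_L1_series[OF f x x0 xd] have "(%K. 4 * (\<Sum>k<K. Rc f k * (of_real t ^ k * q k))) \<longlonglongrightarrow> 4 * g (diag_mat x)"
  unfolding qt by simp
 from tendsto_diff[OF series_diagonal[OF g x, unfolded qt] tendsto_mult_left[OF this, of "1/4"]]
 have "(%K. (\<Sum>k<K. h.coef g k * (of_real t ^ k * q k)) - (\<Sum>k<K. Rc f k * (of_real t ^ k * q k))) \<longlonglongrightarrow> 0" by simp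
 then have "(%K. \<Sum>k<K. (h.coef g k - Rc f k) * q k * of_real t ^ k) \<longlonglongrightarrow> 0"
  unfolding sum_subtractf[symmetric] by (simp add: algebra_simps)
 then show "(%k. (h.coef g k - Rc f k) * q k * of_real t ^ k) sums 0" by (simp add: sums_def)
 qed
 moreover have "q k ~= 0" for k unfolding q_def using w by (intro qpoly_nonzero)
 ultimately show "\<forall>k. h.coef g k = Rc f k" by auto
qed

end

section \<open>The isometry and the correspondence of the operators\<close>

theorem theorem8:
  fixes H :: "(complex^'m::{finite,linorder}^'n::{finite,linorder} \<Rightarrow> complex) set"
    and ip :: "(complex^'m::{finite,linorder}^'n::{finite,linorder} \<Rightarrow> complex) \<Rightarrow> (complex^'m::{finite,linorder}^'n::{finite,linorder} \<Rightarrow> complex) \<Rightarrow> complex"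
  assumes "CARD('m) \<le> CARD('n)"
    and "is_H1 H ip"
  shows "\<exists>U. isometric_iso_L2 (L_invariants H) ip (mu CARD('n) CARD('m)) U \<and>
    (\<forall>f\<in>L_invariants H. \<forall>g\<in>L_invariants H.
       L1_rel f g \<longleftrightarrow>
       (AE x in mu CARD('n) CARD('m).
          U g x = - ((complex_of_real (par_a CARD('n) CARD('m)))\<^sup>2 + x\<^sup>2) * U f x))"
proof -
  interpret D: H1_diagonal H ip by unfold_locales (use assms in auto)
  interpret S: spectral_params "CARD('n)" "CARD('m)" by unfold_locales (use assms(1) in \<open>auto simp: Suc_leI\<close>)
  let ?M = "mu CARD('n) CARD('m)"
  let ?N = "Nk CARD('n) CARD('m)"
  let ?A = "Ak CARD('n) CARD('m)"
  obtain U where U: "isometric_iso_L2 (L_invariants H) ip ?M U"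
    "\<And>f. f \<in> L_invariants H \<Longrightarrow> U f \<in> L2 ?M" "\<And>f k. f \<in> L_invariants H \<Longrightarrow> lip ?M (U f) (S.EE k) = ip f (pk k)"
    using unitary_L2_exists[OF D.h.hilbert_orthogonal_axioms S.EE_orthogonal D.pk_total[OF assms(1)]] by blast
  have ipc: "ip f (pk k) = D.h.coef f k * of_real (?N k)" for f k
    using D.h.N_pos[of k] by (simp add: D.h.coef_def)
  have "L1_rel f g \<longleftrightarrow> (AE x in ?M. U g x = - ((complex_of_real (par_a CARD('n) CARD('m)))\<^sup>2 + x\<^sup>2) * U f x)"
    if f: "f \<in> L_invariants H" and g: "g \<in> L_invariants H" for f g
  proof -
    \<comment> \<open>Inner products are coefficients times \<open>Nk\<close>, and (k + 1)^2
      \<open>Nk\<close> at k + 1 equals \<open>Ak\<close> times \<open>Nk\<close> at k. This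
      exchanges the two off-diagonal coefficients and turns the recurrence of
      \<open>multiplication_graph_iff\<close> into that of \<open>Rc\<close>.\<close>
    have "lip ?M (U g) (S.EE k) = of_real ((real (Suc k))\<^sup>2) * lip ?M (U f) (S.EE (Suc k)) - of_real (?A k + (real k)\<^sup>2) * lip ?M (U f) (S.EE k)
       + (if k = 0 then 0 else of_real (?A (k - 1)) * lip ?M (U f) (S.EE (k - 1))) \<longleftrightarrow> D.h.coef g k = D.Rc f k" for k
    proof -
      have n1: "complex_of_real ((real (Suc k))\<^sup>2) * of_real (?N (Suc k)) = of_real (?A k) * of_real (?N k)"
        unfolding of_real_mult[symmetric] S.Nk_Suc ..
      have n2: "complex_of_real (?A (k - 1)) * of_real (?N (k - 1)) = of_nat k ^ 2 * of_real (?N k)" if "k \<noteq> 0"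
      proof -
        have "real k ^ 2 * ?N k = ?A (k - 1) * ?N (k - 1)" using S.Nk_Suc[of "k - 1"] that by simp
        from arg_cong[OF this, of complex_of_real] show ?thesis by (simp only: of_real_mult of_real_power of_real_of_nat_eq)
      qed
      have "of_real ((real (Suc k))\<^sup>2) * (D.h.coef f (Suc k) * of_real (?N (Suc k))) - of_real (?A k + (real k)\<^sup>2) * (D.h.coef f k * of_real (?N k))
         + (if k = 0 then 0 else of_real (?A (k - 1)) * (D.h.coef f (k - 1) * of_real (?N (k - 1)))) = D.Rc f k * of_real (?N k)"
      proof -
        have "of_real ((real (Suc k))\<^sup>2) * (D.h.coef f (Suc k) * of_real (?N (Suc k))) = of_real (?A k) * D.h.coef f (Suc k) * of_real (?N k)"
          unfolding mult.left_commute[of "of_real ((real (Suc k))\<^sup>2)"] n1 by (simp only: mult_ac)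
        moreover have "(if k = 0 then 0 else of_real (?A (k - 1)) * (D.h.coef f (k - 1) * of_real (?N (k - 1)))) = (if k = 0 then 0 else of_nat k ^ 2 * D.h.coef f (k - 1)) * of_real (?N k)"
        proof (cases "k = 0")
          case False
          show ?thesis unfolding mult.left_commute[of "of_real (?A (k - 1))"] n2[OF False] using False by (simp add: mult_ac)
        qed simp
        ultimately show ?thesis unfolding D.Rc_def by (simp add: algebra_simps)
      qed
      then show ?thesis unfolding U(3)[OF f] U(3)[OF g] ipc using D.h.N_pos[of k] by (metis less_irrefl mult_cancel_right of_real_eq_0_iff)
    qed
    then show ?thesis unfolding D.L1_rel_iff[OF f g] S.multiplication_graph_iff[OF U(2)[OF f] U(2)[OF g]] by simp
  qed
  then show ?thesis using U(1) by blast
qed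

end
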